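(* Let $\Omega\subset\mathbb R^n$ ($n\ge1$) be a bounded domain, $d>0$, $a_+>0$, and let $J:\mathbb R^n\to[0,\infty)$ be continuous, compactly supported, with $\int_{\mathbb R^n}J(x)dx=1$. Let $\beta\in AP(\mathbb R,L^\infty_+(0,a_+))$, $\mu\in AP_+(\mathbb R)$, and suppose there is $\varepsilon_0>0$ with $\mu(t)>\varepsilon_0$ and $\beta(t,a)\ge\varepsilon_0$ for all $t\in\mathbb R$ and $a\in(0,a_+)$. Consider the model $$\begin{cases}\left(\frac{\partial}{\partial t}+\frac{\partial}{\partial a}\right)P(t,a,x)=d(J*P-P)(t,a,x)-\mu(t)P(t,a,x),& t\ge t_0,\ a\in(0,a_+),\ x\in\Omega,\\ P(t,0,x)=\int_0^{a_+}\beta(t,a)P(t,a,x)\,da,& t\ge t_0,\ x\in\Omega,\\ P(t_0,a,x)=p_0(a,x)\in L^1_+((0,a_+),L^2(\Omega)),&\\ P(t,a,x)=0,& t\ge t_0,\ a\in(0,a_+),\ x\notin\Omega,\end{cases}$$ where $(J*P-P)(t,a,x)=\int_{\mathbb R^n}J(x-y)P(t,a,y)dy-P(t,a,x)$. Let $\{U(t,s)\}_{t\ge s}$ be its evolution family, $\omega(U)$ the exponential growth bound of this family, and define on $AP(\mathbb R,L^2(\Omega))$ the operator $$(\mathscr L_*\psi)(t)=\int_0^{a_+}\beta(t,a)e^{-\int_0^a\mu(t+s-a)ds}\,\mathbb T(a)\psi(t-a)\,da,$$ with spectral radius $r(\mathscr L_* )$. Then: (i) if $r(\mathscr L_* )<1$,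 then $\omega(U)<0$ and $\lim_{t\to+\infty}\|P(t,\cdot,\cdot)\|=0$; (ii) if $r(\mathscr L_* )=1$, then $\omega(U)=0$; (iii) if $r(\mathscr L_* )>1$, then $\omega(U)>0$.
   Context: $AP(\mathbb R,Y)$ is the Banach space (sup norm) of almost periodic functions $f\in C(\mathbb R,Y)$ into a Banach space $Y$: for every $\epsilon>0$ the set $\{\tau:\|f(t+\tau)-f(t)\|<\epsilon\ \forall t\in\mathbb R\}$ is relatively dense in $\mathbb R$ (meets every interval of some fixed length). $AP_+(\mathbb R)$ denotes the nonnegative real almost periodic functions; $AP(\mathbb R,L^\infty_+(0,a_+))$ denotes almost periodic maps into $L^\infty(0,a_+)$ with nonnegative values. $E=L^2(\Omega)$; $\mathcal X=L^1((0,a_+),E)$ with its usual norm $\|\varphi\|_{\mathcal X}=\int_0^{a_+}\|\varphi(a,\cdot)\|_E\,da$ (the norm in which $\|P(t,\cdot,\cdot)\|$ is taken); $X=E\times\mathcal X$ with the sum norm and $X_0=\{0_E\}\times\mathcal X$. $\{\mathbb T(t)\}_{t\ge0}$ is the positive $C_0$-semigroup on $E$ generated by $u\mapsto d(J*u-u)$, where $u\in L^2(\Omega)$ is extended by zero outside $\Omega$. $A:D(A)\subset X\to X$, $\overline{D(A)}=X_0$, is the closed operator with resolvent, for $\lambda>0$, $$(\lambda I-A)^{-1}\begin{pmatrix}\phi\\\varphi\end{pmatrix}=\begin{pmatrix}0\\\psi\end{pmatrix},\quad\psi(a)=e^{-\lambda a}\mathbb T(a)\phi+\int_0^ae^{-\lambda(a-s)}\mathbb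 T(a-s)\varphi(s)\,ds.$$ Put $F(t)(0,\psi)^T=(\int_0^{a_+}\beta(t,a)\psi(a,\cdot)da,\,0)^T$ and $V(t)(0,\psi)^T=(0,\mu(t)\psi)^T$. With $u(t)=(0,P(t,\cdot,\cdot))^T$ the model reads $u'(t)=Au(t)+F(t)u(t)-V(t)u(t)$, $u(t_0)=u_0\in X_0$; solutions are mild (integrated) solutions, i.e. $u\in C([t_0,\infty),X_0)$, $\int_{t_0}^tu\,ds\in D(A)$, $u(t)=u_0+A\int_{t_0}^tu(s)ds+\int_{t_0}^t(F(s)-V(s))u(s)ds$. The evolution family of the model is $\{U(t,s)\}_{t\ge s}$ on $X_0$ with $u(t)=U(t,t_0)u_0$, and $\omega(U)=\inf\{\hat\omega:\exists M\ge1,\ \forall s\in\mathbb R,\ t\ge s:\|U(t,s)\|\le Me^{\hat\omega(t-s)}\}$. *)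

theory Defs
  imports "HOL-Probability.Essential_Supremum"
begin

text \<open>
  The Lebesgue spaces are built as types of almost-everywhere classes of functions on a whole
  Euclidean space. A space over a subset, such as the square-integrable functions on a domain, is
  rendered below as the closed subspace of classes vanishing almost everywhere outside that subset,
  i.e. its elements are extended by zero.
\<close>

section \<open>The Hilbert space L2\<close>

definition sq_integrable :: "('a::euclidean_space \<Rightarrow> real) \<Rightarrow> bool" where
  "sq_integrable f \<longleftrightarrow> f \<in> borel_measurable lebesgue \<and> integrable lebesgue (\<lambda>x. (f x)\<^sup>2)"

lemma sq_integrable_mult:
  assumes "sq_integrable f" "sq_integrable g"
  shows "integrable lebesgue (\<lambda>x. f x * g x)"
proof (rule Bochner_Integration.integrable_bound)
  show "integrable lebesgue (\<lambda>x. (f x)\<^sup>2 + (g x)\<^sup>2)"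
    using assms by (simp add: sq_integrable_def)
  show "(\<lambda>x. f x * g x) \<in> borel_measurable lebesgue"
    using assms by (auto simp: sq_integrable_def)
  have "\<bar>a * b\<bar> \<le> a\<^sup>2 + b\<^sup>2" for a b :: real
  proof -
    have "2 * (\<bar>a\<bar> * \<bar>b\<bar>) \<le> a\<^sup>2 + b\<^sup>2"
      using sum_squares_bound[of "\<bar>a\<bar>" "\<bar>b\<bar>"] by (simp add: mult.assoc)
    moreover have "0 \<le> \<bar>a\<bar> * \<bar>b\<bar>" by simp
    ultimately show ?thesis unfolding abs_mult by linarith
  qed
  then show "AE x in lebesgue. norm (f x * g x) \<le> norm ((f x)\<^sup>2 + (g x)\<^sup>2)"
    by simp
qed

lemma sq_integrable_add:
  assumes "sq_integrable f" "sq_integrable g"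
  shows "sq_integrable (\<lambda>x. f x + g x)"
proof -
  have "integrable lebesgue (\<lambda>x. (f x)\<^sup>2 + (g x)\<^sup>2 + 2 * (f x * g x))"
    using assms sq_integrable_mult[OF assms]
    by (intro Bochner_Integration.integrable_add integrable_mult_right) (auto simp: sq_integrable_def)
  then have "integrable lebesgue (\<lambda>x. (f x + g x)\<^sup>2)"
    by (simp add: power2_sum mult.assoc)
  then show ?thesis
    using assms by (auto simp: sq_integrable_def)
qed

lemma sq_integrable_scale: "sq_integrable f \<Longrightarrow> sq_integrable (\<lambda>x. c * f x)"
  by (auto simp: sq_integrable_def power_mult_distrib)

quotient_type (overloaded) 'a L2 = "'a::euclidean_space \<Rightarrow> real" / partial:
    "\<lambda>f g. sq_integrable f \<and> sq_integrable g \<and> (AE x in lebesgue. f x = g x)"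
  morphisms rep_L2 abs_L2
proof (rule part_equivpI)
  show "\<exists>f. sq_integrable f \<and> sq_integrable f \<and> (AE x in lebesgue. f x = (f x :: real))"
    by (rule exI[of _ "\<lambda>_. 0"]) (simp add: sq_integrable_def)
qed (auto simp: symp_def transp_def elim: AE_mp)

instantiation L2 :: (euclidean_space) real_inner
begin

lift_definition zero_L2 :: "'a L2" is "\<lambda>_. 0"
  by (simp add: sq_integrable_def)

lift_definition plus_L2 :: "'a L2 \<Rightarrow> 'a L2 \<Rightarrow> 'a L2" is "\<lambda>f g x. f x + g x"
  by (auto simp: sq_integrable_add)

lift_definition scaleR_L2 :: "real \<Rightarrow> 'a L2 \<Rightarrow> 'a L2" is "\<lambda>c f x. c * f x"
  by (auto simp: sq_integrable_scale)

definition uminus_L2 :: "'a L2 \<Rightarrow> 'a L2" where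
  "- (f :: 'a L2) = (-1) *\<^sub>R f"

definition minus_L2 :: "'a L2 \<Rightarrow> 'a L2 \<Rightarrow> 'a L2" where
  "f - g = f + - (g :: 'a L2)"

lift_definition inner_L2 :: "'a L2 \<Rightarrow> 'a L2 \<Rightarrow> real" is "\<lambda>f g. LINT x|lebesgue. f x * g x"
  by (rule integral_cong_AE) (auto simp: sq_integrable_def)

definition norm_L2 :: "'a L2 \<Rightarrow> real" where
  "norm (f :: 'a L2) = sqrt (inner f f)"

definition sgn_L2 :: "'a L2 \<Rightarrow> 'a L2" where
  "sgn (f :: 'a L2) = inverse (norm f) *\<^sub>R f"

definition dist_L2 :: "'a L2 \<Rightarrow> 'a L2 \<Rightarrow> real" where
  "dist f (g :: 'a L2) = norm (f - g)"

definition uniformity_L2 :: "('a L2 \<times> 'a L2) filter" where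
  "(uniformity :: ('a L2 \<times> 'a L2) filter) = (INF e\<in>{0<..}. principal {(f, g). dist f (g :: 'a L2) < e})"

definition open_L2 :: "'a L2 set \<Rightarrow> bool" where
  "open (U :: 'a L2 set) \<longleftrightarrow> (\<forall>f\<in>U. eventually (\<lambda>(f', g). f' = f \<longrightarrow> g \<in> U) uniformity)"

instance
proof
  fix f g h :: "'a L2" and a b :: real and U :: "'a L2 set"
  show "f + g + h = f + (g + h)" "f + g = g + f" "0 + f = f"
    by (transfer; auto simp: sq_integrable_add ac_simps intro: sq_integrable_add)+
  show "- f + f = 0"
    unfolding uminus_L2_def
    by transfer (auto simp: sq_integrable_def)
  show "f - g = f + - g" by (rule minus_L2_def)
  show "a *\<^sub>R (f + g) = a *\<^sub>R f + a *\<^sub>R g"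
    by transfer (auto simp: algebra_simps intro!: sq_integrable_scale sq_integrable_add)
  show "(a + b) *\<^sub>R f = a *\<^sub>R f + b *\<^sub>R f"
    by transfer (auto simp: algebra_simps intro!: sq_integrable_scale sq_integrable_add)
  show "a *\<^sub>R b *\<^sub>R f = (a * b) *\<^sub>R f"
    by transfer (auto simp: algebra_simps intro!: sq_integrable_scale)
  show "1 *\<^sub>R f = f" by transfer auto
  show "sgn f = inverse (norm f) *\<^sub>R f" by (rule sgn_L2_def)
  show "dist f g = norm (f - g)" by (rule dist_L2_def)
  show "uniformity = (INF e\<in>{0<..}. principal {(x, y). dist (x :: 'a L2) y < e})"
    by (rule uniformity_L2_def)
  show "open U \<longleftrightarrow> (\<forall>x\<in>U. eventually (\<lambda>(x', y). x' = x \<longrightarrow> y \<in> U) uniformity)"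
    by (rule open_L2_def)
  show "norm f = sqrt (inner f f)" by (rule norm_L2_def)
  show "inner f g = inner g f" by transfer (simp add: mult.commute)
  show "inner (f + g) h = inner f h + inner g h"
    by transfer (simp add: distrib_right sq_integrable_mult)
  show "inner (a *\<^sub>R f) g = a * inner f g"
    by transfer (simp add: mult.assoc)
  show "0 \<le> inner f f" by transfer simp
  show "inner f f = 0 \<longleftrightarrow> f = 0"
    by transfer (auto simp: integral_nonneg_eq_0_iff_AE sq_integrable_mult sq_integrable_def)
qed

end

lemma sq_integrable_rep [simp]: "sq_integrable (rep_L2 u)"
  using Quotient3_rep_reflp[OF Quotient3_L2, where a = u] by simp

lemma abs_rep_L2 [simp]: "abs_L2 (rep_L2 u) = u"
  by (rule Quotient3_abs_rep[OF Quotient3_L2])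

lemma rep_abs_L2: "sq_integrable f \<Longrightarrow> AE x in lebesgue. rep_L2 (abs_L2 f) x = f x"
  using Quotient3_rep_abs[OF Quotient3_L2, where r = f] by simp

lemma abs_L2_eqI: "sq_integrable f \<Longrightarrow> AE x in lebesgue. f x = g x \<Longrightarrow> sq_integrable g \<Longrightarrow> abs_L2 f = abs_L2 g"
  by (rule Quotient3_rel[OF Quotient3_L2, THEN iffD2, THEN conjunct2, THEN conjunct2]) simp

lemma L2_cases [cases type: L2]: obtains f where "sq_integrable f" "u = abs_L2 f"
  using that[of "rep_L2 u"] by simp

lemma abs_L2_add: "sq_integrable f \<Longrightarrow> sq_integrable g \<Longrightarrow> abs_L2 f + abs_L2 g = abs_L2 (\<lambda>x. f x + g x)"
  by (simp add: plus_L2.abs_eq)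
lemma abs_L2_scaleR: "sq_integrable f \<Longrightarrow> c *\<^sub>R abs_L2 f = abs_L2 (\<lambda>x. c * f x)"
  by (simp add: scaleR_L2.abs_eq)
lemma abs_L2_diff: "sq_integrable f \<Longrightarrow> sq_integrable g \<Longrightarrow> abs_L2 f - abs_L2 g = abs_L2 (\<lambda>x. f x - g x)"
  unfolding minus_L2_def uminus_L2_def
  by (subst abs_L2_scaleR, assumption, subst abs_L2_add, assumption, erule sq_integrable_scale)
     (simp only: mult_minus1 diff_conv_add_uminus)
lemma norm_abs_L2: "sq_integrable f \<Longrightarrow> norm (abs_L2 f) = sqrt (LINT x|lebesgue. (f x)\<^sup>2)"
  by (simp add: norm_L2_def inner_L2.abs_eq power2_eq_square)

section \<open>The Bochner space L1\<close>

quotient_type (overloaded) ('a, 'b) L1 = "'a::euclidean_space \<Rightarrow> 'b::{banach, second_countable_topology}" / partial: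
    "\<lambda>f g. integrable lebesgue f \<and> integrable lebesgue g \<and> (AE x in lebesgue. f x = g x)"
  morphisms rep_L1 abs_L1
proof (rule part_equivpI)
  show "\<exists>f. integrable lebesgue f \<and> integrable lebesgue f \<and> (AE x in lebesgue. f x = (f x :: 'b))"
    by (rule exI[of _ "\<lambda>_. 0"]) simp
qed (auto simp: symp_def transp_def elim: AE_mp)

instantiation L1 :: (euclidean_space, "{banach, second_countable_topology}") real_normed_vector
begin

lift_definition zero_L1 :: "('a, 'b) L1" is "\<lambda>_. 0"
  by simp

lift_definition plus_L1 :: "('a, 'b) L1 \<Rightarrow> ('a, 'b) L1 \<Rightarrow> ('a, 'b) L1" is "\<lambda>f g x. f x + g x"
  by auto

lift_definition scaleR_L1 :: "real \<Rightarrow> ('a, 'b) L1 \<Rightarrow> ('a, 'b) L1" is "\<lambda>c f x. c *\<^sub>R f x"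
  by auto

definition uminus_L1 :: "('a, 'b) L1 \<Rightarrow> ('a, 'b) L1" where
  "- (f :: ('a, 'b) L1) = (-1) *\<^sub>R f"

definition minus_L1 :: "('a, 'b) L1 \<Rightarrow> ('a, 'b) L1 \<Rightarrow> ('a, 'b) L1" where
  "f - g = f + - (g :: ('a, 'b) L1)"

lift_definition norm_L1 :: "('a, 'b) L1 \<Rightarrow> real" is "\<lambda>f. LINT x|lebesgue. norm (f x)"
  by (rule integral_cong_AE) auto

definition sgn_L1 :: "('a, 'b) L1 \<Rightarrow> ('a, 'b) L1" where
  "sgn (f :: ('a, 'b) L1) = inverse (norm f) *\<^sub>R f"

definition dist_L1 :: "('a, 'b) L1 \<Rightarrow> ('a, 'b) L1 \<Rightarrow> real" where
  "dist f (g :: ('a, 'b) L1) = norm (f - g)"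

definition uniformity_L1 :: "(('a, 'b) L1 \<times> ('a, 'b) L1) filter" where
  "(uniformity :: (('a, 'b) L1 \<times> ('a, 'b) L1) filter) = (INF e\<in>{0<..}. principal {(f, g). dist f (g :: ('a, 'b) L1) < e})"

definition open_L1 :: "('a, 'b) L1 set \<Rightarrow> bool" where
  "open (U :: ('a, 'b) L1 set) \<longleftrightarrow> (\<forall>f\<in>U. eventually (\<lambda>(f', g). f' = f \<longrightarrow> g \<in> U) uniformity)"

instance
proof
  fix f g h :: "('a, 'b) L1" and a b :: real and U :: "('a, 'b) L1 set"
  show "f + g + h = f + (g + h)" "f + g = g + f" "0 + f = f"
    by (transfer; auto simp: ac_simps)+
  show "- f + f = 0"
    unfolding uminus_L1_def by transfer auto
  show "f - g = f + - g" by (rule minus_L1_def)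
  show "a *\<^sub>R (f + g) = a *\<^sub>R f + a *\<^sub>R g" "(a + b) *\<^sub>R f = a *\<^sub>R f + b *\<^sub>R f"
    "a *\<^sub>R b *\<^sub>R f = (a * b) *\<^sub>R f" "1 *\<^sub>R f = f"
    by (transfer; auto simp: algebra_simps)+
  show "sgn f = inverse (norm f) *\<^sub>R f" by (rule sgn_L1_def)
  show "dist f g = norm (f - g)" by (rule dist_L1_def)
  show "uniformity = (INF e\<in>{0<..}. principal {(x, y). dist (x :: ('a, 'b) L1) y < e})"
    by (rule uniformity_L1_def)
  show "open U \<longleftrightarrow> (\<forall>x\<in>U. eventually (\<lambda>(x', y). x' = x \<longrightarrow> y \<in> U) uniformity)"
    by (rule open_L1_def)
  show "norm f = 0 \<longleftrightarrow> f = 0"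
    by transfer (auto simp: integral_nonneg_eq_0_iff_AE)
  show "norm (f + g) \<le> norm f + norm g"
  proof transfer
    fix f g :: "'a \<Rightarrow> 'b"
    assume *: "integrable lebesgue f \<and> integrable lebesgue f \<and> (AE x in lebesgue. f x = f x)"
      "integrable lebesgue g \<and> integrable lebesgue g \<and> (AE x in lebesgue. g x = g x)"
    have "(LINT x|lebesgue. norm (f x + g x)) \<le> (LINT x|lebesgue. norm (f x) + norm (g x))"
      using * by (intro integral_mono) (auto simp: norm_triangle_ineq)
    then show "(LINT x|lebesgue. norm (f x + g x)) \<le> (LINT x|lebesgue. norm (f x)) + (LINT x|lebesgue. norm (g x))"
      using * by simp
  qed
  show "norm (a *\<^sub>R f) = \<bar>a\<bar> * norm f"
    by transfer simp
qed

end

section \<open>The space of essentially bounded functions\<close>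

definition ess_bounded :: "('a::euclidean_space \<Rightarrow> real) \<Rightarrow> bool" where
  "ess_bounded f \<longleftrightarrow> f \<in> borel_measurable lebesgue \<and> esssup lebesgue (\<lambda>x. ereal \<bar>f x\<bar>) < \<infinity>"

lemma ess_bounded_iff:
  "ess_bounded f \<longleftrightarrow> f \<in> borel_measurable lebesgue \<and> (\<exists>C. AE x in lebesgue. \<bar>f x\<bar> \<le> C)"
proof (cases "f \<in> borel_measurable lebesgue")
  case True
  note [measurable] = True
  have "\<exists>C. AE x in lebesgue. \<bar>f x\<bar> \<le> C" if "esssup lebesgue (\<lambda>x. ereal \<bar>f x\<bar>) < \<infinity>"
  proof -
    have "esssup lebesgue (\<lambda>x. ereal \<bar>f x\<bar>) \<noteq> \<infinity>" using that by simp
    then obtain n :: nat where "esssup lebesgue (\<lambda>x. ereal \<bar>f x\<bar>) < ereal (real n)"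
      unfolding less_PInf_Ex_of_nat by (rule exE)
    define C where "C = real n"
    have C: "esssup lebesgue (\<lambda>x. ereal \<bar>f x\<bar>) \<le> ereal C"
      unfolding C_def by (rule less_imp_le) fact
    have "AE x in lebesgue. \<bar>f x\<bar> \<le> C"
      using esssup_AE[of "\<lambda>x. ereal \<bar>f x\<bar>" lebesgue]
    proof eventually_elim
      case (elim x)
      then have "ereal \<bar>f x\<bar> \<le> ereal C" using C by (rule order_trans)
      then show ?case by simp
    qed
    then show ?thesis by blast
  qed
  moreover have "esssup lebesgue (\<lambda>x. ereal \<bar>f x\<bar>) < \<infinity>" if "AE x in lebesgue. \<bar>f x\<bar> \<le> C" for C
  proof -
    have "esssup lebesgue (\<lambda>x. ereal \<bar>f x\<bar>) \<le> ereal C"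
      using that by (intro esssup_I) auto
    then show ?thesis by (rule le_less_trans) simp
  qed
  ultimately show ?thesis using True by (auto simp: ess_bounded_def)
qed (simp add: ess_bounded_def)

lemma esssup_abs_nonneg:
  fixes f :: "'a::euclidean_space \<Rightarrow> real"
  shows "0 \<le> esssup lebesgue (\<lambda>x. ereal \<bar>f x\<bar>)"
proof -
  have "(0::ereal) = esssup (lebesgue :: 'a measure) (\<lambda>x. 0)"
    by (rule esssup_const[symmetric]) simp
  also have "\<dots> \<le> esssup lebesgue (\<lambda>x. ereal \<bar>f x\<bar>)"
    by (rule esssup_mono) auto
  finally show ?thesis .
qed

quotient_type (overloaded) 'a Linf = "'a::euclidean_space \<Rightarrow> real" / partial:
    "\<lambda>f g. ess_bounded f \<and> ess_bounded g \<and> (AE x in lebesgue. f x = g x)"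
  morphisms rep_Linf abs_Linf
proof (rule part_equivpI)
  show "\<exists>f. ess_bounded f \<and> ess_bounded f \<and> (AE x in lebesgue. f x = (f x :: real))"
    by (rule exI[of _ "\<lambda>_. 0"]) (auto simp: ess_bounded_iff)
qed (auto simp: symp_def transp_def elim: AE_mp)

lemma ess_bounded_add: "ess_bounded f \<Longrightarrow> ess_bounded g \<Longrightarrow> ess_bounded (\<lambda>x. f x + g x)"
  unfolding ess_bounded_iff
proof safe
  fix C D assume "AE x in lebesgue. \<bar>f x\<bar> \<le> C" "AE x in lebesgue. \<bar>g x\<bar> \<le> D"
  then have "AE x in lebesgue. \<bar>f x + g x\<bar> \<le> C + D" by eventually_elim auto
  then show "\<exists>C. AE x in lebesgue. \<bar>f x + g x\<bar> \<le> C" ..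
qed auto

lemma ess_bounded_scale: "ess_bounded f \<Longrightarrow> ess_bounded (\<lambda>x. c * f x)"
  unfolding ess_bounded_iff
proof safe
  fix C assume "AE x in lebesgue. \<bar>f x\<bar> \<le> C"
  then have "AE x in lebesgue. \<bar>c * f x\<bar> \<le> \<bar>c\<bar> * C"
    by eventually_elim (simp add: abs_mult mult_left_mono)
  then show "\<exists>C. AE x in lebesgue. \<bar>c * f x\<bar> \<le> C" ..
qed auto

lemma esssup_finite:
  assumes "ess_bounded f"
  shows "ereal (real_of_ereal (esssup lebesgue (\<lambda>x. ereal \<bar>f x\<bar>))) = esssup lebesgue (\<lambda>x. ereal \<bar>f x\<bar>)"
  using assms esssup_abs_nonneg[of f] by (intro ereal_real') (auto simp: ess_bounded_def)

instantiation Linf :: (euclidean_space) real_normed_vector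
begin

lift_definition zero_Linf :: "'a Linf" is "\<lambda>_. 0"
  by (auto simp: ess_bounded_iff)

lift_definition plus_Linf :: "'a Linf \<Rightarrow> 'a Linf \<Rightarrow> 'a Linf" is "\<lambda>f g x. f x + g x"
  by (auto simp: ess_bounded_add)

lift_definition scaleR_Linf :: "real \<Rightarrow> 'a Linf \<Rightarrow> 'a Linf" is "\<lambda>c f x. c * f x"
  by (auto simp: ess_bounded_scale)

definition uminus_Linf :: "'a Linf \<Rightarrow> 'a Linf" where
  "- (f :: 'a Linf) = (-1) *\<^sub>R f"

definition minus_Linf :: "'a Linf \<Rightarrow> 'a Linf \<Rightarrow> 'a Linf" where
  "f - g = f + - (g :: 'a Linf)"

lift_definition norm_Linf :: "'a Linf \<Rightarrow> real" is
  "\<lambda>f. real_of_ereal (esssup lebesgue (\<lambda>x. ereal \<bar>f x\<bar>))"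
proof (elim conjE)
  fix f g :: "'a \<Rightarrow> real"
  assume "ess_bounded f" "ess_bounded g" and ae: "AE x in lebesgue. f x = g x"
  then have [measurable]: "f \<in> borel_measurable lebesgue" "g \<in> borel_measurable lebesgue"
    by (auto simp: ess_bounded_def)
  have "esssup lebesgue (\<lambda>x. ereal \<bar>f x\<bar>) = esssup lebesgue (\<lambda>x. ereal \<bar>g x\<bar>)"
    by (rule esssup_AE_cong) (use ae in auto)
  then show "real_of_ereal (esssup lebesgue (\<lambda>x. ereal \<bar>f x\<bar>)) = real_of_ereal (esssup lebesgue (\<lambda>x. ereal \<bar>g x\<bar>))"
    by simp
qed

definition sgn_Linf :: "'a Linf \<Rightarrow> 'a Linf" where
  "sgn (f :: 'a Linf) = inverse (norm f) *\<^sub>R f"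

definition dist_Linf :: "'a Linf \<Rightarrow> 'a Linf \<Rightarrow> real" where
  "dist f (g :: 'a Linf) = norm (f - g)"

definition uniformity_Linf :: "('a Linf \<times> 'a Linf) filter" where
  "(uniformity :: ('a Linf \<times> 'a Linf) filter) = (INF e\<in>{0<..}. principal {(f, g). dist f (g :: 'a Linf) < e})"

definition open_Linf :: "'a Linf set \<Rightarrow> bool" where
  "open (U :: 'a Linf set) \<longleftrightarrow> (\<forall>f\<in>U. eventually (\<lambda>(f', g). f' = f \<longrightarrow> g \<in> U) uniformity)"

instance
proof
  fix f g h :: "'a Linf" and a b :: real and U :: "'a Linf set"
  show "f + g + h = f + (g + h)" "f + g = g + f" "0 + f = f"
    by (transfer; auto simp: ac_simps intro: ess_bounded_add)+
  show "- f + f = 0"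
    unfolding uminus_Linf_def by transfer (auto simp: ess_bounded_iff)
  show "f - g = f + - g" by (rule minus_Linf_def)
  show "a *\<^sub>R (f + g) = a *\<^sub>R f + a *\<^sub>R g" "(a + b) *\<^sub>R f = a *\<^sub>R f + b *\<^sub>R f"
    "a *\<^sub>R b *\<^sub>R f = (a * b) *\<^sub>R f" "1 *\<^sub>R f = f"
    by (transfer; auto simp: algebra_simps intro!: ess_bounded_add ess_bounded_scale)+
  show "sgn f = inverse (norm f) *\<^sub>R f" by (rule sgn_Linf_def)
  show "dist f g = norm (f - g)" by (rule dist_Linf_def)
  show "uniformity = (INF e\<in>{0<..}. principal {(x, y). dist (x :: 'a Linf) y < e})"
    by (rule uniformity_Linf_def)
  show "open U \<longleftrightarrow> (\<forall>x\<in>U. eventually (\<lambda>(x', y). x' = x \<longrightarrow> y \<in> U) uniformity)"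
    by (rule open_Linf_def)
  show "norm f = 0 \<longleftrightarrow> f = 0"
  proof transfer
    fix f :: "'a \<Rightarrow> real"
    assume "ess_bounded f \<and> ess_bounded f \<and> (AE x in lebesgue. f x = f x)"
    then have f: "ess_bounded f" and [measurable]: "f \<in> borel_measurable lebesgue"
      by (auto simp: ess_bounded_def)
    have "AE x in lebesgue. f x = 0" if "real_of_ereal (esssup lebesgue (\<lambda>x. ereal \<bar>f x\<bar>)) = 0"
    proof -
      have "esssup lebesgue (\<lambda>x. ereal \<bar>f x\<bar>) = 0"
        using esssup_finite[OF f] that by (simp add: zero_ereal_def)
      then show ?thesis
        using esssup_AE[of "\<lambda>x. ereal \<bar>f x\<bar>" lebesgue] by (simp add: zero_ereal_def)
    qed
    moreover have "esssup lebesgue (\<lambda>x. ereal \<bar>f x\<bar>) = 0" if "AE x in lebesgue. f x = 0"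
    proof -
      have "esssup lebesgue (\<lambda>x. ereal \<bar>f x\<bar>) \<le> 0" using that by (intro esssup_I) auto
      then show ?thesis using esssup_abs_nonneg[of f] by (rule antisym)
    qed
    ultimately show "(real_of_ereal (esssup lebesgue (\<lambda>x. ereal \<bar>f x\<bar>)) = 0) =
       (ess_bounded f \<and> ess_bounded (\<lambda>_::'a. 0::real) \<and> (AE x in lebesgue. f x = 0))"
      using f by (auto simp: ess_bounded_iff)
  qed
  show "norm (f + g) \<le> norm f + norm g"
  proof transfer
    fix f g :: "'a \<Rightarrow> real"
    let ?N = "\<lambda>f::'a \<Rightarrow> real. esssup lebesgue (\<lambda>x. ereal \<bar>f x\<bar>)"
    assume "ess_bounded f \<and> ess_bounded f \<and> (AE x in lebesgue. f x = f x)"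
      "ess_bounded g \<and> ess_bounded g \<and> (AE x in lebesgue. g x = g x)"
    then have f: "ess_bounded f" "ess_bounded g"
      and [measurable]: "f \<in> borel_measurable lebesgue" "g \<in> borel_measurable lebesgue"
      by (auto simp: ess_bounded_def)
    have "?N (\<lambda>x. f x + g x) \<le> esssup lebesgue (\<lambda>x. ereal \<bar>f x\<bar> + ereal \<bar>g x\<bar>)"
      by (rule esssup_mono) auto
    also have "\<dots> \<le> ?N f + ?N g" by (rule esssup_add)
    finally have "ereal (real_of_ereal (?N (\<lambda>x. f x + g x))) \<le> ereal (real_of_ereal (?N f)) + ereal (real_of_ereal (?N g))"
      using f by (simp add: esssup_finite ess_bounded_add)
    then show "real_of_ereal (?N (\<lambda>x. f x + g x)) \<le> real_of_ereal (?N f) + real_of_ereal (?N g)"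
      by simp
  qed
  show "norm (a *\<^sub>R f) = \<bar>a\<bar> * norm f"
  proof transfer
    fix a and f :: "'a \<Rightarrow> real"
    show "real_of_ereal (esssup lebesgue (\<lambda>x. ereal \<bar>a * f x\<bar>)) = \<bar>a\<bar> * real_of_ereal (esssup lebesgue (\<lambda>x. ereal \<bar>f x\<bar>))"
    proof (cases "a = 0")
      case True
      have "esssup (lebesgue :: 'a measure) (\<lambda>x. (0::ereal)) = 0"
        by (rule esssup_const) simp
      then show ?thesis using True by (simp add: zero_ereal_def)
    next
      case False
      then have "esssup lebesgue (\<lambda>x. ereal \<bar>a\<bar> * ereal \<bar>f x\<bar>) = ereal \<bar>a\<bar> * esssup lebesgue (\<lambda>x. ereal \<bar>f x\<bar>)"
        by (intro esssup_cmult) simp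
      then show ?thesis
        by (simp add: abs_mult)
    qed
  qed
qed

end

section \<open>Completeness of L1 and L2\<close>

lemma fast_Cauchy_limit:
  fixes f :: "nat \<Rightarrow> 'a \<Rightarrow> 'b::{banach, second_countable_topology}"
  assumes p: "p = 1 \<or> p = (2::nat)"
    and meas [measurable]: "\<And>n. f n \<in> borel_measurable M"
    and fast: "\<And>m n. m \<le> n \<Longrightarrow> (\<integral>\<^sup>+x. ennreal (norm (f n x - f m x) ^ p) \<partial>M) \<le> ennreal (((1/4)^m) ^ p)"
  obtains g where "g \<in> borel_measurable M"
    "\<And>m. (\<integral>\<^sup>+x. ennreal (norm (g x - f m x) ^ p) \<partial>M) \<le> ennreal (((1/4)^m) ^ p)"
proof -
  define h where "h n x = 2 ^ n * norm (f (Suc n) x - f n x) ^ p" for n x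
  have [measurable]: "h n \<in> borel_measurable M" for n
    unfolding h_def by measurable
  have h_nonneg: "0 \<le> h n x" for n x
    by (simp add: h_def)
  have I: "(\<integral>\<^sup>+x. ennreal (h n x) \<partial>M) \<le> ennreal ((1/2)^n)" for n
  proof -
    have "(\<integral>\<^sup>+x. ennreal (h n x) \<partial>M) = (\<integral>\<^sup>+x. ennreal (2^n) * ennreal (norm (f (Suc n) x - f n x) ^ p) \<partial>M)"
      by (simp add: h_def ennreal_mult)
    also have "\<dots> = ennreal (2^n) * (\<integral>\<^sup>+x. ennreal (norm (f (Suc n) x - f n x) ^ p) \<partial>M)"
      by (rule nn_integral_cmult) measurable
    also have "\<dots> \<le> ennreal (2^n) * ennreal (((1/4)^n) ^ p)"
      by (intro mult_left_mono fast) auto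
    also have "\<dots> \<le> ennreal (2^n) * ennreal ((1/4)^n)"
    proof (intro mult_left_mono ennreal_leI)
      have "(1/4::real)^n \<le> 1" by (simp add: power_le_one)
      then show "((1/4::real)^n) ^ p \<le> (1/4)^n"
        using p by (auto simp: power2_eq_square mult_left_le)
    qed auto
    also have "\<dots> = ennreal (2^n * (1/4)^n)"
      by (simp add: ennreal_mult)
    also have "2^n * (1/4)^n = (1/2::real)^n"
      by (simp add: power_mult_distrib[symmetric])
    finally show ?thesis .
  qed
  have "(\<integral>\<^sup>+x. (\<Sum>n. ennreal (h n x)) \<partial>M) = (\<Sum>n. \<integral>\<^sup>+x. ennreal (h n x) \<partial>M)"
    by (rule nn_integral_suminf) measurable
  also have "\<dots> \<le> (\<Sum>n. ennreal ((1/2)^n))"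
    by (intro suminf_le I) auto
  also have "\<dots> = ennreal (\<Sum>n. (1/2)^n)"
    by (rule suminf_ennreal2) (auto intro: summable_geometric)
  also have "\<dots> < \<infinity>" by simp
  finally have "AE x in M. (\<Sum>n. ennreal (h n x)) \<noteq> \<infinity>"
    by (intro nn_integral_noteq_infinite) auto
  then have conv: "AE x in M. convergent (\<lambda>n. f n x)"
  proof eventually_elim
    case (elim x)
    have "summable (\<lambda>n. h n x)"
      by (rule summable_suminf_not_top) (use elim h_nonneg in auto)
    then have S: "summable (\<lambda>n. (1/2)^n + h n x)"
      by (intro summable_add summable_geometric) auto
    have "norm (f (Suc n) x - f n x) \<le> (1/2)^n + h n x" for n
    proof -
      define t where "t = norm (f (Suc n) x - f n x)"
      have t: "0 \<le> t" by (simp add: t_def)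
      consider "t \<le> (1/2)^n" | "t > (1/2)^n" "p = 1" | "t > (1/2)^n" "p = 2"
        using p by linarith
      then have "t \<le> (1/2)^n + 2 ^ n * t ^ p"
      proof cases
        case 1
        then show ?thesis using t by (simp add: add_increasing2)
      next
        case 2
        have "1 * t \<le> 2 ^ n * t" by (rule mult_right_mono[OF _ t]) simp
        moreover have "(0::real) \<le> (1/2)^n" by simp
        ultimately show ?thesis using 2 by (simp only: power_one_right)
      next
        case 3
        have "1 = 2 ^ n * (1/2::real)^n" by (simp add: power_mult_distrib[symmetric])
        also have "\<dots> \<le> 2 ^ n * t" using 3 by (intro mult_left_mono) auto
        finally have "1 * t \<le> (2 ^ n * t) * t" by (rule mult_right_mono[OF _ t])
        moreover have "(0::real) \<le> (1/2)^n" by simp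
        ultimately show ?thesis using 3 unfolding \<open>p = 2\<close> power2_eq_square mult.assoc by linarith
      qed
      then show ?thesis by (simp add: t_def h_def)
    qed
    then have "summable (\<lambda>n. f (Suc n) x - f n x)"
      by (intro summable_comparison_test'[OF S, of 0]) auto
    then have "(\<lambda>n. f 0 x + (\<Sum>k<n. f (Suc k) x - f k x)) \<longlonglongrightarrow> f 0 x + (\<Sum>k. f (Suc k) x - f k x)"
      by (intro tendsto_intros summable_LIMSEQ)
    moreover have "f 0 x + (\<Sum>k<n. f (Suc k) x - f k x) = f n x" for n
      using sum_lessThan_telescope[of "\<lambda>k. f k x" n] by simp
    ultimately show ?case
      unfolding convergent_def by auto
  qed
  define g where "g x = lim (\<lambda>n. f n x)" for x
  have g [measurable]: "g \<in> borel_measurable M"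
    unfolding g_def by (rule borel_measurable_lim_metric) measurable
  have "(\<integral>\<^sup>+x. ennreal (norm (g x - f m x) ^ p) \<partial>M) \<le> ennreal (((1/4)^m) ^ p)" for m
  proof -
    have "(\<integral>\<^sup>+x. ennreal (norm (g x - f m x) ^ p) \<partial>M)
        = (\<integral>\<^sup>+x. liminf (\<lambda>n. ennreal (norm (f n x - f m x) ^ p)) \<partial>M)"
    proof (rule nn_integral_cong_AE)
      show "AE x in M. ennreal (norm (g x - f m x) ^ p) = liminf (\<lambda>n. ennreal (norm (f n x - f m x) ^ p))"
        using conv
      proof eventually_elim
        case (elim x)
        then have "(\<lambda>n. f n x) \<longlonglongrightarrow> g x"
          by (simp add: g_def convergent_LIMSEQ_iff)
        then have "(\<lambda>n. ennreal (norm (f n x - f m x) ^ p)) \<longlonglongrightarrow> ennreal (norm (g x - f m x) ^ p)"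
          by (intro tendsto_ennrealI tendsto_intros)
        then show ?case
          by (intro lim_imp_Liminf[symmetric]) auto
      qed
    qed
    also have "\<dots> \<le> liminf (\<lambda>n. \<integral>\<^sup>+x. ennreal (norm (f n x - f m x) ^ p) \<partial>M)"
      by (rule nn_integral_liminf) measurable
    also have "\<dots> \<le> liminf (\<lambda>n. ennreal (((1/4)^m) ^ p))"
      by (rule Liminf_mono) (auto intro!: eventually_sequentiallyI[of m] fast)
    also have "\<dots> = ennreal (((1/4)^m) ^ p)"
      by (simp add: Liminf_const)
    finally show ?thesis .
  qed
  with g show ?thesis by (rule that)
qed

lemma fast_subseq:
  fixes X :: "nat \<Rightarrow> 'a::real_normed_vector"
  assumes "Cauchy X"
  obtains r where "strict_mono r" "\<And>m n. m \<le> n \<Longrightarrow> norm (X (r n) - X (r m)) \<le> (1/4)^m"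
proof -
  have ex: "\<exists>N>k. \<forall>n\<ge>N. norm (X n - X N) < (1/4)^m" for k m
  proof -
    obtain N where N: "\<And>i j. i \<ge> N \<Longrightarrow> j \<ge> N \<Longrightarrow> norm (X i - X j) < (1/4)^m"
      using CauchyD[OF assms, of "(1/4)^m"] by auto
    show ?thesis
      by (rule exI[of _ "max N (Suc k)"]) (auto intro!: N)
  qed
  have "\<exists>r. \<forall>m. (\<forall>n\<ge>r m. norm (X n - X (r m)) < (1/4)^m) \<and> r m < r (Suc m)"
    by (rule dependent_nat_choice) (use ex in blast)+
  then obtain r where r: "\<And>m n. n \<ge> r m \<Longrightarrow> norm (X n - X (r m)) < (1/4)^m" "\<And>m. r m < r (Suc m)"
    by blast
  then have sm: "strict_mono r" by (simp add: strict_mono_Suc_iff)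
  have "norm (X (r n) - X (r m)) \<le> (1/4)^m" if "m \<le> n" for m n
  proof -
    have "r m \<le> r n" using that by (simp add: strict_mono_less_eq[OF sm])
    then show ?thesis using r(1)[of m "r n"] by simp
  qed
  with sm show ?thesis by (rule that)
qed

instance L2 :: (euclidean_space) complete_space
proof
  fix X :: "nat \<Rightarrow> 'a L2"
  assume C: "Cauchy X"
  from fast_subseq[OF C] obtain r where r: "strict_mono r"
    "\<And>m n. m \<le> n \<Longrightarrow> norm (X (r n) - X (r m)) \<le> (1/4)^m" by blast
  define f where "f n = rep_L2 (X (r n))" for n
  have f: "sq_integrable (f n)" "X (r n) = abs_L2 (f n)" for n
    by (simp_all add: f_def)
  have nn: "(\<integral>\<^sup>+x. ennreal (norm (k x) ^ 2) \<partial>lebesgue) = ennreal ((norm (abs_L2 k))\<^sup>2)"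
    if "sq_integrable k" for k :: "'a \<Rightarrow> real"
    using that by (simp add: norm_abs_L2 nn_integral_eq_integral sq_integrable_def)
  have sd: "sq_integrable (\<lambda>x. f n x - f m x)" for n m
    using sq_integrable_add[OF f(1)[of n] sq_integrable_scale[OF f(1)[of m], of "-1"]] by simp
  obtain g where g: "g \<in> borel_measurable lebesgue"
    "\<And>m. (\<integral>\<^sup>+x. ennreal (norm (g x - f m x) ^ 2) \<partial>lebesgue) \<le> ennreal (((1/4)^m) ^ 2)"
  proof (rule fast_Cauchy_limit[of 2 f lebesgue])
    show "f n \<in> borel_measurable lebesgue" for n
      using f(1)[of n] by (simp add: sq_integrable_def)
    show "(\<integral>\<^sup>+x. ennreal (norm (f n x - f m x) ^ 2) \<partial>lebesgue) \<le> ennreal (((1/4)^m) ^ 2)" if "m \<le> n" for m n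
      unfolding nn[OF sd] using r(2)[OF that] f
      by (intro ennreal_leI power_mono) (simp_all add: abs_L2_diff)
  qed auto
  have gd: "sq_integrable (\<lambda>x. g x - f m x)" for m
    unfolding sq_integrable_def
  proof
    show *: "(\<lambda>x. g x - f m x) \<in> borel_measurable lebesgue"
      using g(1) f(1)[of m] by (auto simp: sq_integrable_def intro!: borel_measurable_diff)
    have "(\<integral>\<^sup>+x. ennreal (norm ((g x - f m x)\<^sup>2)) \<partial>lebesgue) < \<infinity>"
      using le_less_trans[OF g(2)[of m], of \<infinity>] by simp
    then show "integrable lebesgue (\<lambda>x. (g x - f m x)\<^sup>2)"
      using * by (intro integrableI_bounded) auto
  qed
  have gs: "sq_integrable g"
    using sq_integrable_add[OF gd[of 0] f(1)[of 0]] by simp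
  have bd: "norm (abs_L2 g - X (r m)) \<le> (1/4)^m" for m
  proof -
    have "abs_L2 g - X (r m) = abs_L2 (\<lambda>x. g x - f m x)"
      using f gs by (simp add: abs_L2_diff)
    moreover have "ennreal ((norm (abs_L2 (\<lambda>x. g x - f m x)))\<^sup>2) \<le> ennreal (((1/4)^m)\<^sup>2)"
      using g(2)[of m] unfolding nn[OF gd] .
    ultimately have "(norm (abs_L2 g - X (r m)))\<^sup>2 \<le> ((1/4)^m)\<^sup>2"
      by (simp add: ennreal_le_iff)
    then show ?thesis by (rule power2_le_imp_le) simp
  qed
  have "(\<lambda>n. X (r n) - abs_L2 g) \<longlonglongrightarrow> 0"
    by (rule Lim_null_comparison[of _ "\<lambda>n. (1/4)^n"])
       (use bd in \<open>auto simp: norm_minus_commute LIMSEQ_power_zero\<close>)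
  then have "(X \<circ> r) \<longlonglongrightarrow> abs_L2 g"
    by (simp add: o_def LIM_zero_iff)
  from Cauchy_converges_subseq[OF C r(1) this] show "convergent X"
    by (auto simp: convergent_def)
qed

instance L2 :: (euclidean_space) banach ..

lemma integrable_rep [simp]: "integrable lebesgue (rep_L1 u)"
  using Quotient3_rep_reflp[OF Quotient3_L1, where a = u] by simp

lemma abs_rep_L1 [simp]: "abs_L1 (rep_L1 u) = u"
  by (rule Quotient3_abs_rep[OF Quotient3_L1])

lemma rep_abs_L1: "integrable lebesgue f \<Longrightarrow> AE x in lebesgue. rep_L1 (abs_L1 f) x = f x"
  using Quotient3_rep_abs[OF Quotient3_L1, where r = f] by simp

lemma norm_abs_L1: "integrable lebesgue f \<Longrightarrow> norm (abs_L1 f) = (LINT x|lebesgue. norm (f x))"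
  by (simp add: norm_L1.abs_eq)

lemma abs_L1_diff: "integrable lebesgue f \<Longrightarrow> integrable lebesgue g \<Longrightarrow> abs_L1 f - abs_L1 g = abs_L1 (\<lambda>x. f x - g x)"
proof -
  assume *: "integrable lebesgue f" "integrable lebesgue g"
  then have "abs_L1 f - abs_L1 g = abs_L1 f + abs_L1 (\<lambda>x. (-1) *\<^sub>R g x)"
    unfolding minus_L1_def uminus_L1_def by (subst scaleR_L1.abs_eq) auto
  also have "\<dots> = abs_L1 (\<lambda>x. f x + (-1) *\<^sub>R g x)"
    using * by (subst plus_L1.abs_eq) auto
  finally show ?thesis by simp
qed

instance L1 :: (euclidean_space, "{banach, second_countable_topology}") complete_space
proof
  fix X :: "nat \<Rightarrow> ('a, 'b) L1"
  assume C: "Cauchy X"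
  from fast_subseq[OF C] obtain r where r: "strict_mono r"
    "\<And>m n. m \<le> n \<Longrightarrow> norm (X (r n) - X (r m)) \<le> (1/4)^m" by blast
  define f where "f n = rep_L1 (X (r n))" for n
  have f: "integrable lebesgue (f n)" "X (r n) = abs_L1 (f n)" for n
    by (simp_all add: f_def)
  have nn: "(\<integral>\<^sup>+x. ennreal (norm (k x) ^ 1) \<partial>lebesgue) = ennreal (norm (abs_L1 k))"
    if "integrable lebesgue k" for k :: "'a \<Rightarrow> 'b"
    using that by (simp add: norm_abs_L1 nn_integral_eq_integral)
  have sd: "integrable lebesgue (\<lambda>x. f n x - f m x)" for n m
    using f by simp
  obtain g where g: "g \<in> borel_measurable lebesgue"
    "\<And>m. (\<integral>\<^sup>+x. ennreal (norm (g x - f m x) ^ 1) \<partial>lebesgue) \<le> ennreal (((1/4)^m) ^ 1)"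
  proof (rule fast_Cauchy_limit[of 1 f lebesgue])
    show "f n \<in> borel_measurable lebesgue" for n
      using f(1)[of n] by simp
    show "(\<integral>\<^sup>+x. ennreal (norm (f n x - f m x) ^ 1) \<partial>lebesgue) \<le> ennreal (((1/4)^m) ^ 1)" if "m \<le> n" for m n
      unfolding nn[OF sd] using r(2)[OF that] f
      by (intro ennreal_leI) (simp_all add: abs_L1_diff)
  qed auto
  have gd: "integrable lebesgue (\<lambda>x. g x - f m x)" for m
  proof -
    have "(\<integral>\<^sup>+x. ennreal (norm (g x - f m x)) \<partial>lebesgue) < \<infinity>"
      using le_less_trans[OF g(2)[of m], of \<infinity>] by simp
    then show ?thesis
      using g(1) f(1)[of m] by (intro integrableI_bounded) (auto intro!: borel_measurable_diff)
  qed
  have gs: "integrable lebesgue g"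
    using Bochner_Integration.integrable_add[OF gd[of 0] f(1)[of 0]] by simp
  have bd: "norm (abs_L1 g - X (r m)) \<le> (1/4)^m" for m
  proof -
    have "abs_L1 g - X (r m) = abs_L1 (\<lambda>x. g x - f m x)"
      using f gs by (simp add: abs_L1_diff)
    moreover have "ennreal (norm (abs_L1 (\<lambda>x. g x - f m x))) \<le> ennreal ((1/4)^m)"
      using g(2)[of m] using nn[OF gd] by simp
    ultimately show ?thesis
      by (simp add: ennreal_le_iff)
  qed
  have "(\<lambda>n. X (r n) - abs_L1 g) \<longlonglongrightarrow> 0"
    by (rule Lim_null_comparison[of _ "\<lambda>n. (1/4)^n"])
       (use bd in \<open>auto simp: norm_minus_commute LIMSEQ_power_zero\<close>)
  then have "(X \<circ> r) \<longlonglongrightarrow> abs_L1 g"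
    by (simp add: o_def LIM_zero_iff)
  from Cauchy_converges_subseq[OF C r(1) this] show "convergent X"
    by (auto simp: convergent_def)
qed

instance L1 :: (euclidean_space, "{banach, second_countable_topology}") banach ..

section \<open>Separability of L2\<close>

text \<open>The Bochner integral of the library requires a second countable range.\<close>

lemma second_countable_of_dense:
  fixes Z :: "'a::metric_space set"
  assumes "countable Z" and dense: "closure Z = UNIV"
  shows "\<exists>B :: 'a set set. countable B \<and> open = generate_topology B"
proof -
  let ?B = "(\<lambda>(z, n). ball z (1 / real (Suc n))) ` (Z \<times> UNIV)"
  have "topological_basis ?B"
  proof (rule topological_basisI)
    fix U :: "'a set" and x assume U: "open U" "x \<in> U"
    then obtain e where e: "e > 0" "ball x e \<subseteq> U" by (auto simp: open_contains_ball)
    obtain n where n: "1 / real (Suc n) < e / 2"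
      using e(1) by (metis half_gt_zero nat_approx_posE)
    have "x \<in> closure Z" using dense by simp
    then obtain z where z: "z \<in> Z" "dist z x < 1 / real (Suc n)"
      unfolding closure_approachable by (meson of_nat_0_less_iff zero_less_Suc zero_less_divide_1_iff)
    have "ball z (1 / real (Suc n)) \<subseteq> ball x e"
    proof
      fix y assume "y \<in> ball z (1 / real (Suc n))"
      then have "dist x y < e"
        using z n dist_triangle[of x y z] by (simp add: dist_commute)
      then show "y \<in> ball x e" by simp
    qed
    then show "\<exists>B'\<in>?B. x \<in> B' \<and> B' \<subseteq> U"
      using z e by (intro bexI[of _ "ball z (1 / real (Suc n))"]) auto
  qed auto
  moreover have "countable ?B" using assms(1) by simp
  ultimately show ?thesis
    by (metis topological_basis_imp_subbasis)
qed

definition rat_span :: "'a::real_vector set \<Rightarrow> 'a set" where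
  "rat_span S = {sum_list (map (\<lambda>(q, x). of_rat q *\<^sub>R x) l) |l. l \<in> lists (UNIV \<times> S)}"

lemma countable_rat_span:
  assumes "countable S" shows "countable (rat_span S)"
proof -
  have "countable (lists ((UNIV :: rat set) \<times> S))"
    by (intro countable_lists countable_SIGMA assms) auto
  moreover have "rat_span S = (\<lambda>l. sum_list (map (\<lambda>(q, x). of_rat q *\<^sub>R x) l)) ` lists (UNIV \<times> S)"
    by (auto simp: rat_span_def)
  ultimately show ?thesis by simp
qed

lemma rat_span_0: "0 \<in> rat_span S"
  unfolding rat_span_def by (auto intro!: exI[of _ "[]"])

lemma rat_span_base:
  assumes "x \<in> S" shows "x \<in> rat_span S"
proof -
  have "x = sum_list (map (\<lambda>(q, x). of_rat q *\<^sub>R x) [(1, x)])" "[(1::rat, x)] \<in> lists (UNIV \<times> S)"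
    using assms by auto
  then show ?thesis unfolding rat_span_def by blast
qed

lemma rat_span_add:
  assumes "x \<in> rat_span S" "y \<in> rat_span S"
  shows "x + y \<in> rat_span S"
proof -
  obtain k l where "k \<in> lists (UNIV \<times> S)" "l \<in> lists (UNIV \<times> S)"
    "x = sum_list (map (\<lambda>(q, x). of_rat q *\<^sub>R x) k)" "y = sum_list (map (\<lambda>(q, x). of_rat q *\<^sub>R x) l)"
    using assms unfolding rat_span_def by blast
  then have "x + y = sum_list (map (\<lambda>(q, x). of_rat q *\<^sub>R x) (k @ l))" "k @ l \<in> lists (UNIV \<times> S)"
    by auto
  then show ?thesis unfolding rat_span_def by blast
qed

lemma rat_span_scale:
  assumes "x \<in> rat_span S"
  shows "of_rat q *\<^sub>R x \<in> rat_span S"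
proof -
  obtain k where k: "k \<in> lists (UNIV \<times> S)" "x = sum_list (map (\<lambda>(q, x). of_rat q *\<^sub>R x) k)"
    using assms unfolding rat_span_def by blast
  have "of_rat q *\<^sub>R sum_list (map (\<lambda>(q, x). of_rat q *\<^sub>R x) k)
      = sum_list (map (\<lambda>(q, x). of_rat q *\<^sub>R x) (map (\<lambda>(p, x). (q * p, x)) k))" for k :: "(rat \<times> 'a) list"
    by (induction k) (auto simp: scaleR_add_right of_rat_mult)
  moreover have "map (\<lambda>(p, x). (q * p, x)) k \<in> lists (UNIV \<times> S)"
    using k(1) by (induction k) auto
  ultimately show ?thesis using k(2) unfolding rat_span_def by blast
qed

lemma closure_rat_span_add:
  fixes S :: "'a::real_normed_vector set"
  assumes "x \<in> closure (rat_span S)" "y \<in> closure (rat_span S)"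
  shows "x + y \<in> closure (rat_span S)"
proof -
  obtain a b where "\<And>n. a n \<in> rat_span S" "a \<longlonglongrightarrow> x" "\<And>n. b n \<in> rat_span S" "b \<longlonglongrightarrow> y"
    using assms unfolding closure_sequential by blast
  then have "\<And>n. a n + b n \<in> rat_span S" "(\<lambda>n. a n + b n) \<longlonglongrightarrow> x + y"
    by (auto intro: rat_span_add tendsto_add)
  then show ?thesis unfolding closure_sequential
    by (intro exI[of _ "\<lambda>n. a n + b n"]) simp
qed

lemma closure_rat_span_scale:
  fixes S :: "'a::real_normed_vector set"
  assumes "x \<in> closure (rat_span S)"
  shows "c *\<^sub>R x \<in> closure (rat_span S)"
proof -
  obtain a where a: "\<And>n. a n \<in> rat_span S" "a \<longlonglongrightarrow> x"
    using assms unfolding closure_sequential by blast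
  have "\<exists>q::rat. \<bar>of_rat q - c\<bar> < 1 / real (Suc n)" for n
  proof -
    obtain q where "c < of_rat q" "of_rat q < c + 1 / real (Suc n)"
      using of_rat_dense[of c "c + 1 / real (Suc n)"] by auto
    then show ?thesis by (intro exI[of _ q]) auto
  qed
  then obtain q where q: "\<And>n. \<bar>of_rat (q n) - c\<bar> < 1 / real (Suc n)" by metis
  have "(\<lambda>n. of_rat (q n) - c) \<longlonglongrightarrow> 0"
  proof (rule Lim_null_comparison)
    show "\<forall>\<^sub>F n in sequentially. norm (of_rat (q n) - c) \<le> 1 / real (Suc n)"
      using q by (intro always_eventually allI less_imp_le) (simp only: real_norm_def)
    show "(\<lambda>n. 1 / real (Suc n)) \<longlonglongrightarrow> 0"
      using LIMSEQ_Suc[OF lim_1_over_n] .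
  qed
  then have "(\<lambda>n. of_rat (q n)) \<longlonglongrightarrow> c" by (simp add: LIM_zero_iff)
  then have "(\<lambda>n. of_rat (q n) *\<^sub>R a n) \<longlonglongrightarrow> c *\<^sub>R x"
    using a(2) by (rule tendsto_scaleR)
  then show ?thesis using a(1) unfolding closure_sequential
    by (intro exI[of _ "\<lambda>n. of_rat (q n) *\<^sub>R a n"]) (simp add: rat_span_scale)
qed

lemma sq_integrable_dominated:
  fixes k :: "'a::euclidean_space \<Rightarrow> real"
  assumes w: "sq_integrable w"
    and k: "k \<in> borel_measurable lebesgue" "AE x in lebesgue. \<bar>k x\<bar> \<le> \<bar>w x\<bar>"
  shows "sq_integrable k"
  unfolding sq_integrable_def
proof
  have w2: "integrable lebesgue (\<lambda>x. (w x)\<^sup>2)" using w by (simp add: sq_integrable_def)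
  show "integrable lebesgue (\<lambda>x. (k x)\<^sup>2)"
  proof (rule Bochner_Integration.integrable_bound[OF w2])
    show "AE x in lebesgue. norm ((k x)\<^sup>2) \<le> norm ((w x)\<^sup>2)"
      using k(2) by eventually_elim (simp add: abs_le_square_iff)
    show "(\<lambda>x. (k x)\<^sup>2) \<in> borel_measurable lebesgue"
      using k(1) by (rule borel_measurable_power)
  qed
qed fact

lemma L2_dominated_convergence:
  fixes f :: "nat \<Rightarrow> 'a::euclidean_space \<Rightarrow> real"
  assumes f: "\<And>n. f n \<in> borel_measurable lebesgue" and g: "g \<in> borel_measurable lebesgue"
    and w: "sq_integrable w"
    and dom: "\<And>n. AE x in lebesgue. \<bar>f n x\<bar> \<le> \<bar>w x\<bar>"
    and lim: "AE x in lebesgue. (\<lambda>n. f n x) \<longlonglongrightarrow> g x"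
  shows "\<And>n. sq_integrable (f n)" "sq_integrable g" "(\<lambda>n. abs_L2 (f n)) \<longlonglongrightarrow> abs_L2 g"
proof -
  note [measurable] = f g
  have w2: "integrable lebesgue (\<lambda>x. (w x)\<^sup>2)" using w by (simp add: sq_integrable_def)
  have domg: "AE x in lebesgue. \<bar>g x\<bar> \<le> \<bar>w x\<bar>"
  proof -
    have "AE x in lebesgue. \<forall>n. \<bar>f n x\<bar> \<le> \<bar>w x\<bar>" using dom by (simp add: AE_all_countable)
    with lim show ?thesis
    proof eventually_elim
      case (elim x)
      then have "(\<lambda>n. \<bar>f n x\<bar>) \<longlonglongrightarrow> \<bar>g x\<bar>" by (intro tendsto_rabs)
      then show ?case by (rule LIMSEQ_le_const2) (use elim in auto)
    qed
  qed
  note sq = sq_integrable_dominated[OF w]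
  show fn: "sq_integrable (f n)" for n by (intro sq f dom)
  show gg: "sq_integrable g" by (intro sq g domg)
  have d: "sq_integrable (\<lambda>x. f n x - g x)" for n
    using sq_integrable_add[OF fn[of n] sq_integrable_scale[OF gg, of "-1"]] by simp
  have "(\<lambda>n. LINT x|lebesgue. (f n x - g x)\<^sup>2) \<longlonglongrightarrow> (LINT x|(lebesgue :: 'a measure). 0)"
  proof (rule integral_dominated_convergence[where w = "\<lambda>x. 4 * (w x)\<^sup>2"])
    show "integrable lebesgue (\<lambda>x. 4 * (w x)\<^sup>2)" using w2 by simp
    show "AE x in lebesgue. (\<lambda>n. (f n x - g x)\<^sup>2) \<longlonglongrightarrow> 0"
      using lim
    proof eventually_elim
      case (elim x)
      then have "(\<lambda>n. (f n x - g x)\<^sup>2) \<longlonglongrightarrow> (g x - g x)\<^sup>2" by (intro tendsto_intros)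
      then show ?case by simp
    qed
    show "AE x in lebesgue. norm ((f n x - g x)\<^sup>2) \<le> 4 * (w x)\<^sup>2" for n
      using dom[of n] domg
    proof eventually_elim
      case (elim x)
      then have "\<bar>f n x - g x\<bar> \<le> \<bar>2 * w x\<bar>" by linarith
      then show ?case by (simp add: abs_le_square_iff power_mult_distrib)
    qed
  qed (measurable)
  then have "(\<lambda>n. sqrt (LINT x|lebesgue. (f n x - g x)\<^sup>2)) \<longlonglongrightarrow> sqrt 0"
    by (intro tendsto_real_sqrt) simp
  then have "(\<lambda>n. norm (abs_L2 (f n) - abs_L2 g)) \<longlonglongrightarrow> 0"
    by (simp add: abs_L2_diff fn gg norm_abs_L2[OF d])
  then show "(\<lambda>n. abs_L2 (f n)) \<longlonglongrightarrow> abs_L2 g"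
    by (simp add: tendsto_norm_zero_iff LIM_zero_iff)
qed

lemma sq_integrable_indicator:
  assumes "A \<in> sets lebesgue" "emeasure lebesgue A < \<infinity>"
  shows "sq_integrable (indicator A :: 'a::euclidean_space \<Rightarrow> real)"
proof -
  have "(\<lambda>x. (indicator A x)\<^sup>2) = (indicator A :: 'a \<Rightarrow> real)"
    by (auto simp: indicator_def)
  with assms show ?thesis
    by (simp add: sq_integrable_def integrable_indicator_iff)
qed

lemma L2_separable:
  "\<exists>Z :: 'a::euclidean_space L2 set. countable Z \<and> closure Z = UNIV"
proof -
  obtain \<B> :: "'a set set" where \<B>: "countable \<B>" "topological_basis \<B>"
    using ex_countable_basis by blast
  define G where "G = (\<lambda>F. \<Inter>F) ` {F. finite F \<and> F \<subseteq> \<B>}"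
  have "countable G"
    unfolding G_def by (intro countable_image countable_Collect_finite_subset \<B>)
  have G_open: "open g" if "g \<in> G" for g
    using that topological_basis_open[OF \<B>(2)] by (auto simp: G_def intro!: open_Inter)
  have "\<B> \<subseteq> G"
    unfolding G_def by (auto intro!: image_eqI[where x = "{_}"])
  have "Int_stable G"
    unfolding Int_stable_def G_def
  proof safe
    fix F F' assume "finite F" "F \<subseteq> \<B>" "finite F'" "F' \<subseteq> \<B>"
    then show "\<Inter>F \<inter> \<Inter>F' \<in> Inter ` {F. finite F \<and> F \<subseteq> \<B>}"
      by (intro image_eqI[of _ _ "F \<union> F'"]) auto
  qed
  have "topological_basis G"
    unfolding topological_basis_def
  proof (intro conjI allI impI)
    show "\<forall>b\<in>G. open b" using G_open by blast
    fix U :: "'a set" assume "open U"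
    then obtain B' where "B' \<subseteq> \<B>" "\<Union>B' = U"
      using \<B>(2) by (auto simp: topological_basis_def)
    then show "\<exists>B'\<subseteq>G. \<Union>B' = U" using \<open>\<B> \<subseteq> G\<close> by blast
  qed
  then have "borel = sigma UNIV G"
    by (rule borel_eq_countable_basis[OF \<open>countable G\<close>])
  then have borel_G: "sets (borel :: 'a measure) = sigma_sets UNIV G"
    by (metis Pow_UNIV sets_measure_of subset_UNIV)

  define S where "S = (\<lambda>(g, k::nat). abs_L2 (indicator (g \<inter> ball 0 (real k)))) ` (G \<times> UNIV)"
  define C where "C = closure (rat_span S)"
  have "countable S" unfolding S_def using \<open>countable G\<close> by simp
  have C_add: "x + y \<in> C" if "x \<in> C" "y \<in> C" for x y
    using that unfolding C_def by (rule closure_rat_span_add)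
  have C_scale: "c *\<^sub>R x \<in> C" if "x \<in> C" for x c
    using that unfolding C_def by (rule closure_rat_span_scale)
  have C_0: "0 \<in> C" unfolding C_def using rat_span_0 closure_subset by blast
  have C_lim: "l \<in> C" if "\<And>n. x n \<in> C" "x \<longlonglongrightarrow> l" for x l
    using closed_sequentially[of C x l] that by (simp add: C_def)
  have ball_fin: "emeasure lebesgue (A \<inter> ball 0 (real k)) < \<infinity>" if "A \<in> sets borel" for A :: "'a set" and k :: nat
  proof -
    have "emeasure lebesgue (A \<inter> ball 0 (real k)) \<le> emeasure lebesgue (ball (0::'a) (real k))"
      by (intro emeasure_mono) auto
    also have "\<dots> < \<infinity>"
      using emeasure_bounded_finite[of "ball (0::'a) (real k)"] by simp
    finally show ?thesis .
  qed
  have ball_sq: "sq_integrable (indicator (A \<inter> ball 0 (real k)) :: 'a \<Rightarrow> real)" if "A \<in> sets borel" for A :: "'a set" and k :: nat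
    using that by (intro sq_integrable_indicator ball_fin) auto
  have ind: "abs_L2 (indicator (A \<inter> ball 0 (real k)) :: 'a \<Rightarrow> real) \<in> C" if A: "A \<in> sets borel" for A :: "'a set" and k :: nat
  proof -
    have "UNIV \<in> G" unfolding G_def by (auto intro!: image_eqI[where x = "{}"])
    have base: "abs_L2 (indicator (g \<inter> ball 0 (real k)) :: 'a \<Rightarrow> real) \<in> C" if "g \<in> G" for g
      unfolding C_def using that
      by (intro subsetD[OF closure_subset] rat_span_base) (auto simp: S_def)
    have "G \<subseteq> Pow UNIV" "A \<in> sigma_sets UNIV G" using A by (simp_all add: borel_G)
    with \<open>Int_stable G\<close> show ?thesis
    proof (induction rule: sigma_sets_induct_disjoint)
      case (basic A)
      then show ?case by (rule base)
    next
      case empty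
      show ?case using C_0 by (simp add: zero_L2_def)
    next
      case (compl A)
      then have A: "A \<in> sets borel" by (simp add: borel_G)
      have "abs_L2 (indicator ((UNIV - A) \<inter> ball 0 (real k)) :: 'a \<Rightarrow> real)
          = abs_L2 (\<lambda>x. indicator (UNIV \<inter> ball 0 (real k)) x + (-1) * indicator (A \<inter> ball 0 (real k)) x)"
        by (rule arg_cong[of _ _ abs_L2]) (auto simp: indicator_def)
      also have "\<dots> = abs_L2 (indicator (UNIV \<inter> ball 0 (real k))) + (-1) *\<^sub>R abs_L2 (indicator (A \<inter> ball 0 (real k)))"
        unfolding abs_L2_scaleR[OF ball_sq[OF A]]
        by (rule abs_L2_add[OF ball_sq sq_integrable_scale[OF ball_sq[OF A]], symmetric]) simp
      also have "\<dots> \<in> C"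
        by (intro C_add C_scale base \<open>UNIV \<in> G\<close> compl.IH)
      finally show ?case .
    next
      case (union A)
      then have A: "A i \<in> sets borel" for i by (auto simp: borel_G)
      have fin: "abs_L2 (indicator ((\<Union>i<n. A i) \<inter> ball 0 (real k)) :: 'a \<Rightarrow> real) \<in> C" for n
      proof (induction n)
        case 0
        show ?case using C_0 by (simp add: zero_L2_def)
      next
        case (Suc n)
        have disj: "A i \<inter> A n = {}" if "i < n" for i
          using union(1) that by (auto simp: disjoint_family_on_def)
        have "abs_L2 (indicator ((\<Union>i<Suc n. A i) \<inter> ball 0 (real k)) :: 'a \<Rightarrow> real)
            = abs_L2 (\<lambda>x. indicator ((\<Union>i<n. A i) \<inter> ball 0 (real k)) x + indicator (A n \<inter> ball 0 (real k)) x)"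
          using disj by (intro arg_cong[of _ _ abs_L2] ext) (force simp: indicator_def less_Suc_eq)
        also have "\<dots> = abs_L2 (indicator ((\<Union>i<n. A i) \<inter> ball 0 (real k))) + abs_L2 (indicator (A n \<inter> ball 0 (real k)))"
          using A by (intro abs_L2_add[symmetric] ball_sq) auto
        also have "\<dots> \<in> C" by (intro C_add Suc union)
        finally show ?case .
      qed
      have "(\<lambda>n. abs_L2 (indicator ((\<Union>i<n. A i) \<inter> ball 0 (real k)) :: 'a \<Rightarrow> real))
          \<longlonglongrightarrow> abs_L2 (indicator ((\<Union>i. A i) \<inter> ball 0 (real k)))"
      proof (rule L2_dominated_convergence(3)[where w = "indicator (UNIV \<inter> ball 0 (real k))"])
        show "sq_integrable (indicator (UNIV \<inter> ball 0 (real k)) :: 'a \<Rightarrow> real)"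
          by (intro ball_sq) auto
        show "(indicator ((\<Union>i<n. A i) \<inter> ball 0 (real k)) :: 'a \<Rightarrow> real) \<in> borel_measurable lebesgue" for n
          using ball_sq[of "\<Union>i<n. A i" k] A unfolding sq_integrable_def by blast
        show "(indicator ((\<Union>i. A i) \<inter> ball 0 (real k)) :: 'a \<Rightarrow> real) \<in> borel_measurable lebesgue"
          using ball_sq[of "\<Union>i. A i" k] A unfolding sq_integrable_def by blast
        show "AE x in lebesgue. (\<lambda>n. indicator ((\<Union>i<n. A i) \<inter> ball 0 (real k)) x :: real)
            \<longlonglongrightarrow> indicator ((\<Union>i. A i) \<inter> ball 0 (real k)) x"
        proof (rule AE_I2)
          fix x
          show "(\<lambda>n. indicator ((\<Union>i<n. A i) \<inter> ball 0 (real k)) x :: real)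
            \<longlonglongrightarrow> indicator ((\<Union>i. A i) \<inter> ball 0 (real k)) x"
            using LIMSEQ_indicator_UN[of A x] by (cases "x \<in> ball 0 (real k)") (simp_all add: indicator_inter_arith)
        qed
      qed (auto simp: indicator_def)
      then show ?case by (rule C_lim[rotated]) (rule fin)
    qed
  qed

  have pos: "abs_L2 (\<lambda>x. indicator (ball 0 (real k)) x * f x) \<in> C"
    if "f \<in> borel_measurable borel" "\<And>x. 0 \<le> f x" "sq_integrable (\<lambda>x. indicator (ball 0 (real k)) x * f x)"
    for f :: "'a \<Rightarrow> real" and k
    using that
  proof (induction rule: borel_measurable_induct_real)
    case (set A)
    have "(\<lambda>x. indicator (ball 0 (real k)) x * indicator A x) = (indicator (A \<inter> ball 0 (real k)) :: 'a \<Rightarrow> real)"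
      by (auto simp: indicator_def)
    with ind[OF set(1), of k] show ?case by simp
  next
    case (mult u c)
    show ?case
    proof (cases "c = 0")
      case True
      then show ?thesis using C_0 by (simp add: zero_L2_def)
    next
      case False
      let ?u = "\<lambda>x. indicator (ball 0 (real k)) x * u x"
      have u: "sq_integrable ?u"
        using sq_integrable_scale[OF mult.prems, of "inverse c"] False by (simp add: field_simps)
      have "(\<lambda>x. indicator (ball 0 (real k)) x * (c * u x)) = (\<lambda>x. c * ?u x)" by (auto simp: ac_simps)
      then have "abs_L2 (\<lambda>x. indicator (ball 0 (real k)) x * (c * u x)) = c *\<^sub>R abs_L2 ?u"
        using u by (simp add: abs_L2_scaleR)
      then show ?thesis using C_scale mult.IH u by simp
    qed
  next
    case (add u v)
    let ?i = "indicator (ball 0 (real k)) :: 'a \<Rightarrow> real"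
    have m: "(\<lambda>x. ?i x * w x) \<in> borel_measurable lebesgue" if "w \<in> borel_measurable borel" for w
      using that by (intro measurable_completion borel_measurable_times borel_measurable_indicator) auto
    have uv: "sq_integrable (\<lambda>x. ?i x * u x)" "sq_integrable (\<lambda>x. ?i x * v x)"
      by (rule sq_integrable_dominated[OF add.prems]; use add.hyps m in \<open>auto simp: indicator_def\<close>)+
    have "abs_L2 (\<lambda>x. ?i x * (v x + u x)) = abs_L2 (\<lambda>x. ?i x * v x) + abs_L2 (\<lambda>x. ?i x * u x)"
      by (simp add: distrib_left abs_L2_add[OF uv(2,1)])
    also have "\<dots> \<in> C"
      using uv add.IH by (intro C_add) auto
    finally show ?case .
  next
    case (seq U)
    let ?i = "indicator (ball 0 (real k)) :: 'a \<Rightarrow> real"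
    have f: "f \<in> borel_measurable borel"
    proof (rule borel_measurable_LIMSEQ_real)
      show "U i \<in> borel_measurable borel" for i by (rule seq.hyps(1))
      show "(\<lambda>i. U i x) \<longlonglongrightarrow> f x" if "x \<in> space borel" for x
        using seq.hyps(4) that by blast
    qed
    have m: "(\<lambda>x. ?i x * w x) \<in> borel_measurable lebesgue" if "w \<in> borel_measurable borel" for w
      using that by (intro measurable_completion borel_measurable_times borel_measurable_indicator) auto
    have le: "U n x \<le> f x" for n x
    proof (rule incseq_le)
      show "incseq (\<lambda>n. U n x)" using seq.hyps(3) by (auto simp: incseq_def le_fun_def)
      show "(\<lambda>n. U n x) \<longlonglongrightarrow> f x" using seq.hyps(4) by simp
    qed
    have dom: "\<bar>?i x * U n x\<bar> \<le> \<bar>?i x * f x\<bar>" for n x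
      using le[of n x] seq.hyps(2)[of n x] by (simp add: abs_mult mult_left_mono)
    have "sq_integrable (\<lambda>x. ?i x * U n x)" for n
      by (rule sq_integrable_dominated[OF seq.prems m[OF seq.hyps(1)] AE_I2[OF dom]])
    then have UC: "abs_L2 (\<lambda>x. ?i x * U n x) \<in> C" for n
      using seq.IH by simp
    have "(\<lambda>n. abs_L2 (\<lambda>x. ?i x * U n x)) \<longlonglongrightarrow> abs_L2 (\<lambda>x. ?i x * f x)"
    proof (rule L2_dominated_convergence(3)[OF m[OF seq.hyps(1)] m[OF f] seq.prems AE_I2[OF dom] AE_I2])
      fix x
      show "(\<lambda>n. ?i x * U n x) \<longlonglongrightarrow> ?i x * f x"
        using seq.hyps(4)[of x] by (intro tendsto_mult_left) simp
    qed
    with UC show ?case by (rule C_lim)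
  qed

  have "u \<in> C" for u :: "'a L2"
  proof -
    obtain f0 where f0: "sq_integrable f0" "u = abs_L2 f0" by (cases u) 
    then obtain f where f: "f \<in> borel_measurable lborel" "AE x in lborel. f0 x = f x"
      using completion_ex_borel_measurable_real[of f0 lborel] by (auto simp: sq_integrable_def)
    have ae: "AE x in lebesgue. f0 x = f x" using f(2) by (rule AE_completion)
    have [measurable]: "f \<in> borel_measurable borel" using f(1) by simp
    have fL: "f \<in> borel_measurable lebesgue" using f(1) by (rule measurable_completion)
    have sf: "sq_integrable f"
      by (rule sq_integrable_dominated[OF f0(1) fL]) (use ae in auto)
    have u: "u = abs_L2 f" unfolding f0(2) by (rule abs_L2_eqI[OF f0(1) ae sf])
    let ?i = "\<lambda>k::nat. indicator (ball 0 (real k)) :: 'a \<Rightarrow> real"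
    have m: "(\<lambda>x. ?i k x * w x) \<in> borel_measurable lebesgue" if "w \<in> borel_measurable borel" for w k
      using that by (intro measurable_completion borel_measurable_times borel_measurable_indicator) auto
    have sp: "sq_integrable (\<lambda>x. ?i k x * max (f x) 0)" for k
      by (rule sq_integrable_dominated[OF sf m]) (auto simp: indicator_def)
    have sn: "sq_integrable (\<lambda>x. ?i k x * max (- f x) 0)" for k
      by (rule sq_integrable_dominated[OF sf m]) (auto simp: indicator_def)
    have fk: "abs_L2 (\<lambda>x. ?i k x * f x) \<in> C" for k
    proof -
      have "(\<lambda>x. ?i k x * f x) = (\<lambda>x. ?i k x * max (f x) 0 - ?i k x * max (- f x) 0)"
        by (auto simp: indicator_def max_def)
      then have "abs_L2 (\<lambda>x. ?i k x * f x)
          = abs_L2 (\<lambda>x. ?i k x * max (f x) 0) + (-1) *\<^sub>R abs_L2 (\<lambda>x. ?i k x * max (- f x) 0)"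
        using abs_L2_diff[OF sp[of k] sn[of k]] by simp
      also have "\<dots> \<in> C"
        by (intro C_add C_scale pos sp sn) auto
      finally show ?thesis .
    qed
    have "(\<lambda>k. abs_L2 (\<lambda>x. ?i k x * f x)) \<longlonglongrightarrow> abs_L2 f"
    proof (rule L2_dominated_convergence(3)[OF m fL sf])
      show "AE x in lebesgue. \<bar>?i k x * f x\<bar> \<le> \<bar>f x\<bar>" for k
        by (auto simp: indicator_def)
      show "AE x in lebesgue. (\<lambda>k. ?i k x * f x) \<longlonglongrightarrow> f x"
      proof (rule AE_I2, rule tendsto_eventually)
        fix x :: 'a
        obtain N :: nat where "norm x < real N" using reals_Archimedean2 by blast
        then show "\<forall>\<^sub>F k in sequentially. ?i k x * f x = f x"
          by (auto intro!: eventually_sequentiallyI[of N] simp: indicator_def)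
      qed
    qed simp
    with fk show ?thesis unfolding u by (rule C_lim)
  qed
  then have "closure (rat_span S) = UNIV" by (auto simp: C_def)
  then show ?thesis using countable_rat_span[OF \<open>countable S\<close>] by blast
qed

instance L2 :: (euclidean_space) second_countable_topology
proof
  obtain Z :: "'a L2 set" where "countable Z" "closure Z = UNIV" using L2_separable by blast
  then show "\<exists>B :: 'a L2 set set. countable B \<and> open = generate_topology B"
    by (rule second_countable_of_dense)
qed

section \<open>Almost periodic functions\<close>

definition relatively_dense :: "real set \<Rightarrow> bool" where
  "relatively_dense S \<longleftrightarrow> (\<exists>l>0. \<forall>a. {a..a + l} \<inter> S \<noteq> {})"

definition almost_periodic :: "(real \<Rightarrow> 'b::real_normed_vector) \<Rightarrow> bool" where
  "almost_periodic f \<longleftrightarrow> continuous_on UNIV f \<and>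
     (\<forall>\<epsilon>>0. relatively_dense {\<tau>. \<forall>t. norm (f (t + \<tau>) - f t) < \<epsilon>})"


section \<open>Function spaces of the model\<close>

definition L2_on :: "'a::euclidean_space set \<Rightarrow> 'a L2 set" where
  "L2_on \<Omega> = {u. AE x in lebesgue. x \<notin> \<Omega> \<longrightarrow> rep_L2 u x = 0}"

definition L2_nonneg :: "'a::euclidean_space L2 \<Rightarrow> bool" where
  "L2_nonneg u \<longleftrightarrow> (AE x in lebesgue. 0 \<le> rep_L2 u x)"

definition Linf_on :: "'a::euclidean_space set \<Rightarrow> 'a Linf set" where
  "Linf_on S = {f. AE a in lebesgue. a \<notin> S \<longrightarrow> rep_Linf f a = 0}"

definition Linf_nonneg :: "'a::euclidean_space Linf \<Rightarrow> bool" where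
  "Linf_nonneg f \<longleftrightarrow> (AE a in lebesgue. 0 \<le> rep_Linf f a)"

text \<open>Integrable functions on the age interval \<open>(0, a\<^sub>+)\<close> with values in the square-integrable
  functions on \<open>\<Omega>\<close>.\<close>

definition age_space :: "real \<Rightarrow> 'a::euclidean_space set \<Rightarrow> (real, 'a L2) L1 set" where
  "age_space ap \<Omega> = {\<phi>. (AE a in lebesgue. a \<notin> {0<..<ap} \<longrightarrow> rep_L1 \<phi> a = 0) \<and>
                        (AE a in lebesgue. rep_L1 \<phi> a \<in> L2_on \<Omega>)}"

definition age_nonneg :: "(real, 'a::euclidean_space L2) L1 \<Rightarrow> bool" where
  "age_nonneg \<phi> \<longleftrightarrow> (AE a in lebesgue. L2_nonneg (rep_L1 \<phi> a))"

text \<open>The library norm on a product type is Euclidean. It is equivalent to the sum norm, and on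
  \<open>state_space0\<close> the two coincide.\<close>

type_synonym 'a state = "'a L2 \<times> (real, 'a L2) L1"

definition state_space :: "real \<Rightarrow> 'a::euclidean_space set \<Rightarrow> 'a state set" where
  "state_space ap \<Omega> = L2_on \<Omega> \<times> age_space ap \<Omega>"

definition state_space0 :: "real \<Rightarrow> 'a::euclidean_space set \<Rightarrow> 'a state set" where
  "state_space0 ap \<Omega> = {0} \<times> age_space ap \<Omega>"


section \<open>Operators and semigroups on a subspace\<close>

definition linear_map_on :: "'b::real_vector set \<Rightarrow> ('b \<Rightarrow> 'c::real_vector) \<Rightarrow> bool" where
  "linear_map_on S f \<longleftrightarrow> (\<forall>x\<in>S. \<forall>y\<in>S. f (x + y) = f x + f y) \<and>
                          (\<forall>c. \<forall>x\<in>S. f (c *\<^sub>R x) = c *\<^sub>R f x)"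

definition C0_semigroup_on :: "'b::real_normed_vector set \<Rightarrow> (real \<Rightarrow> 'b \<Rightarrow> 'b) \<Rightarrow> bool" where
  "C0_semigroup_on S T \<longleftrightarrow>
     (\<forall>t\<ge>0. T t ` S \<subseteq> S \<and> linear_map_on S (T t) \<and> (\<exists>K. \<forall>x\<in>S. norm (T t x) \<le> K * norm x)) \<and>
     (\<forall>x\<in>S. T 0 x = x) \<and>
     (\<forall>s\<ge>0. \<forall>t\<ge>0. \<forall>x\<in>S. T (s + t) x = T s (T t x)) \<and>
     (\<forall>x\<in>S. ((\<lambda>t. T t x) \<longlongrightarrow> x) (at_right 0))"

definition generator_graph_on :: "'b::real_normed_vector set \<Rightarrow> (real \<Rightarrow> 'b \<Rightarrow> 'b) \<Rightarrow> ('b \<times> 'b) set" where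
  "generator_graph_on S T = {(x, y). x \<in> S \<and> y \<in> S \<and> ((\<lambda>h. (T h x - x) /\<^sub>R h) \<longlongrightarrow> y) (at_right 0)}"

text \<open>\<open>A\<close>, with domain \<open>D\<close> dense in \<open>X0\<close>, is a closed linear operator in \<open>X\<close> such that
  \<open>\<lambda>I - A\<close> is a bijection from \<open>D\<close> onto \<open>X\<close> with inverse \<open>R \<lambda>\<close> for every \<open>\<lambda> > 0\<close>.\<close>

definition closed_operator_with_resolvent ::
    "'b::real_normed_vector set \<Rightarrow> 'b set \<Rightarrow> (real \<Rightarrow> 'b \<Rightarrow> 'b) \<Rightarrow> 'b set \<Rightarrow> ('b \<Rightarrow> 'b) \<Rightarrow> bool" where
  "closed_operator_with_resolvent X X0 R D A \<longleftrightarrow>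
     subspace D \<and> D \<subseteq> X \<and> A ` D \<subseteq> X \<and> linear_map_on D A \<and>
     closed {(x, A x) |x. x \<in> D} \<and> closure D = X0 \<and>
     (\<forall>l>0. (\<forall>y\<in>X. R l y \<in> D \<and> l *\<^sub>R R l y - A (R l y) = y) \<and>
             (\<forall>x\<in>D. R l (l *\<^sub>R x - A x) = x))"

text \<open>
  Spectrum of a real operator \<open>L\<close> on a subspace \<open>S\<close>. As usual this is the spectrum of the
  complexification: the pair \<open>(x, y)\<close> stands for \<open>x + iy\<close>, and \<open>complex_shift z L\<close> is \<open>z I - L\<close>
  acting on such pairs. The inverse is required to be bounded.
\<close>

definition complex_shift :: "complex \<Rightarrow> ('b::real_vector \<Rightarrow> 'b) \<Rightarrow> 'b \<times> 'b \<Rightarrow> 'b \<times> 'b" where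
  "complex_shift z L = (\<lambda>(x, y). (Re z *\<^sub>R x - Im z *\<^sub>R y - L x, Re z *\<^sub>R y + Im z *\<^sub>R x - L y))"

definition resolvent_set_on :: "'b::real_normed_vector set \<Rightarrow> ('b \<Rightarrow> 'b) \<Rightarrow> complex set" where
  "resolvent_set_on S L = {z. bij_betw (complex_shift z L) (S \<times> S) (S \<times> S) \<and>
     (\<exists>K. \<forall>p\<in>S \<times> S. norm p \<le> K * norm (complex_shift z L p))}"

definition spectrum_on :: "'b::real_normed_vector set \<Rightarrow> ('b \<Rightarrow> 'b) \<Rightarrow> complex set" where
  "spectrum_on S L = - resolvent_set_on S L"

definition spectral_radius_on :: "'b::real_normed_vector set \<Rightarrow> ('b \<Rightarrow> 'b) \<Rightarrow> real" where
  "spectral_radius_on S L = (SUP z\<in>spectrum_on S L. cmod z)"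


section \<open>The model\<close>

definition nonlocal_diffusion ::
    "real \<Rightarrow> ('a::euclidean_space \<Rightarrow> real) \<Rightarrow> 'a set \<Rightarrow> 'a L2 \<Rightarrow> 'a L2" where
  "nonlocal_diffusion d J \<Omega> u =
     abs_L2 (\<lambda>x. indicator \<Omega> x * (d * ((LINT y|lebesgue. J (x - y) * rep_L2 u y) - rep_L2 u x)))"

definition age_resolvent ::
    "real \<Rightarrow> (real \<Rightarrow> 'a::euclidean_space L2 \<Rightarrow> 'a L2) \<Rightarrow> real \<Rightarrow> 'a state \<Rightarrow> 'a state" where
  "age_resolvent ap T l = (\<lambda>(\<phi>, \<eta>). (0, abs_L1 (\<lambda>a. indicator {0<..<ap} a *\<^sub>R
     (exp (- l * a) *\<^sub>R T a \<phi> +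
      (LINT s:{0..a}|lebesgue. exp (- l * (a - s)) *\<^sub>R T (a - s) (rep_L1 \<eta> s))))))"

definition birth_op :: "real \<Rightarrow> (real \<Rightarrow> real Linf) \<Rightarrow> real \<Rightarrow> 'a::euclidean_space state \<Rightarrow> 'a state" where
  "birth_op ap \<beta> t = (\<lambda>(_, \<psi>). (LINT a:{0<..<ap}|lebesgue. rep_Linf (\<beta> t) a *\<^sub>R rep_L1 \<psi> a, 0))"

definition mortality_op :: "(real \<Rightarrow> real) \<Rightarrow> real \<Rightarrow> 'a::euclidean_space state \<Rightarrow> 'a state" where
  "mortality_op \<mu> t = (\<lambda>(_, \<psi>). (0, \<mu> t *\<^sub>R \<psi>))"

text \<open>Mild solutions on \<open>[t\<^sub>0, \<infinity>)\<close> of \<open>u' = A u + F(t) u - V(t) u\<close>, \<open>u(t\<^sub>0) = u\<^sub>0\<close>,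
  where \<open>A\<close> has domain \<open>D\<close>.\<close>

definition mild_solution ::
    "real \<Rightarrow> 'a::euclidean_space set \<Rightarrow> (real \<Rightarrow> real Linf) \<Rightarrow> (real \<Rightarrow> real) \<Rightarrow>
     'a state set \<Rightarrow> ('a state \<Rightarrow> 'a state) \<Rightarrow> real \<Rightarrow> 'a state \<Rightarrow> (real \<Rightarrow> 'a state) \<Rightarrow> bool" where
  "mild_solution ap \<Omega> \<beta> \<mu> D A t0 u0 u \<longleftrightarrow>
     continuous_on {t0..} u \<and>
     (\<forall>t\<ge>t0. u t \<in> state_space0 ap \<Omega> \<and>
        integral {t0..t} u \<in> D \<and>
        u t = u0 + A (integral {t0..t} u) +
              integral {t0..t} (\<lambda>s. birth_op ap \<beta> s (u s) - mortality_op \<mu> s (u s)))"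

text \<open>The solution operators \<open>U t s\<close> (\<open>t \<ge> s\<close>) of the model. Mild solutions are unique, so this
  determines \<open>U t s\<close> on \<open>state_space0\<close>, and linearity, boundedness and the cocycle identity are
  consequences.\<close>

definition model_evolution_family ::
    "real \<Rightarrow> 'a::euclidean_space set \<Rightarrow> (real \<Rightarrow> real Linf) \<Rightarrow> (real \<Rightarrow> real) \<Rightarrow>
     'a state set \<Rightarrow> ('a state \<Rightarrow> 'a state) \<Rightarrow> (real \<Rightarrow> real \<Rightarrow> 'a state \<Rightarrow> 'a state) \<Rightarrow> bool" where
  "model_evolution_family ap \<Omega> \<beta> \<mu> D A U \<longleftrightarrow>
     (\<forall>s. \<forall>x\<in>state_space0 ap \<Omega>. mild_solution ap \<Omega> \<beta> \<mu> D A s x (\<lambda>t. U t s x))"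

text \<open>Taken in the extended reals, so that the infimum is meaningful without knowing that the set of
  admissible exponents is nonempty and bounded below.\<close>

definition growth_bound_on ::
    "'b::real_normed_vector set \<Rightarrow> (real \<Rightarrow> real \<Rightarrow> 'b \<Rightarrow> 'b) \<Rightarrow> ereal" where
  "growth_bound_on S U = Inf (ereal ` {w. \<exists>M\<ge>1. \<forall>s t. s \<le> t \<longrightarrow>
     (\<forall>x\<in>S. norm (U t s x) \<le> M * exp (w * (t - s)) * norm x)})"

text \<open>Almost periodic functions are bounded, so they form a subspace of the bounded continuous
  functions with the supremum norm.\<close>

definition AP_L2 :: "'a::euclidean_space set \<Rightarrow> (real \<Rightarrow>\<^sub>C 'a L2) set" where
  "AP_L2 \<Omega> = {\<psi>. almost_periodic (apply_bcontfun \<psi>) \<and> (\<forall>t. apply_bcontfun \<psi> t \<in> L2_on \<Omega>)}"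

definition renewal_op ::
    "real \<Rightarrow> (real \<Rightarrow> real Linf) \<Rightarrow> (real \<Rightarrow> real) \<Rightarrow> (real \<Rightarrow> 'a::euclidean_space L2 \<Rightarrow> 'a L2) \<Rightarrow>
     (real \<Rightarrow>\<^sub>C 'a L2) \<Rightarrow> (real \<Rightarrow>\<^sub>C 'a L2)" where
  "renewal_op ap \<beta> \<mu> T \<psi> = Bcontfun (\<lambda>t. LINT a:{0<..<ap}|lebesgue.
     (rep_Linf (\<beta> t) a * exp (- integral {0..a} (\<lambda>s. \<mu> (t + s - a)))) *\<^sub>R
       T a (apply_bcontfun \<psi> (t - a)))"

end

theory Submission
  imports Defs
begin

text \<open>
  Integrating along characteristics reduces the model to the renewal equation \<open>b = L b\<close> for the birth
  rate, where \<open>L\<close> has finite memory \<open>ap\<close>. Solutions grow at most like \<open>exp (l t)\<close> as soon as \<open>L\<close>, acting on functions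
  with weight \<open>exp (l t)\<close>, has iterates decaying geometrically. Finite memory makes such iterate bounds
  independent of the function space: periodic extension transfers them between almost periodic and
  arbitrary continuous functions, so for \<open>l = 0\<close> the best rate is the spectral radius of \<open>L\<close> on almost
  periodic functions. Conversely, positivity lets finitely many solutions with constant initial age
  distribution dominate the iterates of \<open>L\<close>, so a growth bound of the evolution family below \<open>l\<close> yields iterate bounds with
  weight \<open>exp (l t)\<close>. Since the rate is strictly decreasing in \<open>l\<close>, the spectral radius lies below, at
  or above \<open>1\<close> exactly when the growth bound lies below, at or above \<open>0\<close>. Mild solutions are
  identified with solutions along characteristics by letting the resolvent parameter tend to zero.
\<close>

section \<open>Gronwall and uniform boundedness\<close>

text \<open>The spectral radius is a supremum over the spectrum of a complexification, so its link
  to the growth of iterates has to be earned. Positivity replaces the usual analytic argument: on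
  the cone the partial sums of the Neumann series increase in norm, and lower bounds for
  \<open>l I - L\<close> at real \<open>l \<ge> q\<close> already give the rate \<open>q\<close>.

  The harder direction leads from solutions back to \<open>L\<close>. A solution starts from an age
  distribution, whereas \<open>L\<close> acts on arbitrary continuous functions of time, and births
  at different ages involve different operators \<open>T a\<close>, which cannot be compared
  pointwise in space. What helps is that the generator is positive up to the loss term
  \<open>- d\<close>: on nonnegative vectors \<open>T b\<close> dominates
  \<open>exp (- d * (b - a))\<close> times \<open>T a\<close> for \<open>a \<le> b\<close>. All ages
  can thus be pushed to \<open>ap\<close>, and with fertility at least \<epsilon>0 one constant age
  distribution dominates the births of a whole time window.

  The semigroup is given only on a closed subspace. In the abstract setting it is composed with the
  projection onto that subspace, so \<open>T 0\<close> is this projection rather than the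
  identity.\<close>

lemma gronwall_bound:
  fixes \<phi> :: "real \<Rightarrow> real"
  assumes cont: "continuous_on {s..t} \<phi>" and st: "s \<le> t"
    and nn: "\<And>r. r \<in> {s..t} \<Longrightarrow> 0 \<le> \<phi> r" and c: "c > 0" and A: "A \<ge> 0"
    and bd: "\<And>r. r \<in> {s..t} \<Longrightarrow> \<phi> r \<le> A + c * integral {s..r} \<phi>"
  shows "\<phi> t \<le> 2 * A * exp (2 * c * (t - s))"
proof -
  \<comment> \<open>At a maximum point of \<open>y\<close> the integral of the weight
    \<open>exp (2 * c * (r - s))\<close> returns only half of the maximal value, which is absorbed
    on the left. Doubling the rate pays for that half.\<close>
  define y where "y r = exp (-(2 * c * (r - s))) * \<phi> r" for r
  have "continuous_on {s..t} y"
    unfolding y_def by (intro continuous_intros cont)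
  then obtain r0 where r0: "r0 \<in> {s..t}" "\<And>r. r \<in> {s..t} \<Longrightarrow> y r \<le> y r0"
    using continuous_attains_sup[of "{s..t}" y] st by auto
  have \<phi>: "\<phi> r = y r * exp (2 * c * (r - s))" for r
    unfolding y_def by (simp add: mult_exp_exp)
  define Y where "Y = y r0"
  have Y: "Y \<ge> 0" unfolding Y_def y_def using nn[OF r0(1)] by simp
  define e where "e = exp (2 * c * (r0 - s))"
  have e: "e \<ge> 1" unfolding e_def using r0 c by simp
  have hi: "((\<lambda>r. Y * exp (2 * c * (r - s))) has_integral
      (Y / (2*c) * exp (2 * c * (r0 - s)) - Y / (2*c) * exp (2 * c * (s - s)))) {s..r0}"
    by (rule fundamental_theorem_of_calculus)
       (use r0 c in \<open>auto intro!: derivative_eq_intros simp flip: has_real_derivative_iff_has_vector_derivative\<close>)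
  have "integral {s..r0} \<phi> \<le> integral {s..r0} (\<lambda>r. Y * exp (2 * c * (r - s)))"
  proof (rule integral_le)
    show "\<phi> integrable_on {s..r0}"
      by (rule integrable_continuous_interval, rule continuous_on_subset[OF cont]) (use r0 in auto)
    show "\<phi> x \<le> Y * exp (2 * c * (x - s))" if "x \<in> {s..r0}" for x
      unfolding \<phi>[of x] Y_def using that r0 by (intro mult_right_mono) auto
  qed (use hi in auto)
  also have "\<dots> = Y / (2*c) * (e - 1)"
    using integral_unique[OF hi] by (simp add: e_def right_diff_distrib)
  finally have "c * integral {s..r0} \<phi> \<le> Y / 2 * (e - 1)"
    using c by (simp add: field_simps)
  with bd[OF r0(1)] \<phi>[of r0] have "Y * e \<le> A + Y / 2 * (e - 1)"
    by (simp add: Y_def e_def)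
  then have "Y * e \<le> 2 * A" using Y by (simp add: field_simps)
  moreover have "Y * 1 \<le> Y * e" using e Y by (intro mult_left_mono) auto
  ultimately have "Y \<le> 2 * A" by linarith
  then have "y t \<le> 2 * A" using r0(2)[of t] st by (auto simp: Y_def)
  then show ?thesis unfolding \<phi>[of t] by (intro mult_right_mono) auto
qed

text \<open>Banach-Steinhaus for maps that are linear only on a closed subspace. Baire's theorem is
  applied to \<open>S\<close> with the subspace topology, which is completely metrizable because
  \<open>S\<close> is closed.\<close>

lemma uniform_boundedness_on:
  fixes F :: "nat \<Rightarrow> 'a::banach \<Rightarrow> 'b::real_normed_vector"
  assumes S: "closed S" "subspace S"
    and lin: "\<And>i. linear_map_on S (F i)" and bd: "\<And>i. \<exists>K. \<forall>x\<in>S. norm (F i x) \<le> K * norm x"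
    and pt: "\<And>x. x \<in> S \<Longrightarrow> \<exists>K. \<forall>i. norm (F i x) \<le> K"
  shows "\<exists>K. \<forall>i. \<forall>x\<in>S. norm (F i x) \<le> K * norm x"
proof -
  have diff: "F i (x - y) = F i x - F i y" if "x \<in> S" "y \<in> S" for i x y
  proof -
    have "x - y = x + (-1) *\<^sub>R y" by simp
    then have "F i (x - y) = F i x + (-1) *\<^sub>R F i y"
      using lin[of i] that subspace_scale[OF S(2)] unfolding linear_map_on_def by metis
    then show ?thesis by simp
  qed
  have contF: "continuous_on S (F i)" for i
  proof -
    obtain K where K: "\<And>x. x \<in> S \<Longrightarrow> norm (F i x) \<le> K * norm x" using bd by blast
    have "(max K 0)-lipschitz_on S (F i)"
    proof (rule lipschitz_onI)
      fix x y assume xy: "x \<in> S" "y \<in> S"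
      have "dist (F i x) (F i y) \<le> K * norm (x - y)"
        using K[OF subspace_diff[OF S(2) xy]] by (simp add: dist_norm diff xy)
      also have "\<dots> \<le> max K 0 * norm (x - y)" by (intro mult_right_mono) auto
      finally show "dist (F i x) (F i y) \<le> max K 0 * dist x y" by (simp add: dist_norm)
    qed simp
    then show ?thesis by (rule lipschitz_on_continuous_on)
  qed
  define E where "E n = {x \<in> S. \<forall>i. norm (F i x) \<le> real n}" for n :: nat
  have clE: "closedin (top_of_set S) (E n)" for n
  proof -
    have "E n = (\<Inter>i. {x \<in> S. norm (F i x) \<in> {..real n}})" by (auto simp: E_def)
    also have "closedin (top_of_set S) \<dots>"
    proof (rule closedin_INT)
      show "closedin (top_of_set S) {x \<in> S. norm (F i x) \<in> {..real n}}" for i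
        using continuous_closedin_preimage[OF continuous_on_norm[OF contF[of i]], of "{..real n}"]
        by (simp add: vimage_def Int_def)
    qed auto
    finally show ?thesis .
  qed
  have Un: "\<Union> (range E) = S"
  proof (intro equalityI subsetI)
    fix x assume x: "x \<in> S"
    then obtain K where K: "\<And>i. norm (F i x) \<le> K" using pt by blast
    obtain n :: nat where "K \<le> real n" using real_arch_simple by blast
    then have "x \<in> E n" using x K order_trans by (auto simp: E_def)
    then show "x \<in> \<Union> (range E)" by blast
  qed (auto simp: E_def)
  have cm: "completely_metrizable_space (top_of_set S)"
    using completely_metrizable_space_closedin[OF completely_metrizable_space_euclidean, of S] S(1) by simp
  have "\<exists>n. (top_of_set S) interior_of (E n) \<noteq> {}"
  proof (rule ccontr)
    assume "\<not> ?thesis"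
    then have "(top_of_set S) interior_of \<Union> (range E) = {}"
      using clE by (intro Baire_category_alt) (auto simp: cm)
    then have "(top_of_set S) interior_of S = {}" by (simp add: Un)
    moreover have "0 \<in> S" using S(2) by (rule subspace_0)
    ultimately show False using interior_of_topspace[of "top_of_set S"] by auto
  qed
  then obtain n x0 where "x0 \<in> (top_of_set S) interior_of (E n)" by blast
  then obtain U where U: "openin (top_of_set S) U" "x0 \<in> U" "U \<subseteq> E n"
    unfolding interior_of_def by blast
  then obtain r where r: "r > 0" "\<And>x. x \<in> S \<Longrightarrow> dist x x0 < r \<Longrightarrow> x \<in> U"
    unfolding openin_euclidean_subtopology_iff by blast
  have x0: "x0 \<in> S" "\<And>i. norm (F i x0) \<le> real n" using U by (auto simp: E_def)
  have small: "norm (F i y) \<le> 2 * real n" if y: "y \<in> S" "norm y < r" for i y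
  proof -
    have "x0 + y \<in> S" using S(2) x0 y by (auto intro: subspace_add)
    then have "x0 + y \<in> E n" using r(2)[of "x0 + y"] y U by (auto simp: dist_norm)
    then have "norm (F i (x0 + y)) \<le> real n" by (auto simp: E_def)
    moreover have "F i (x0 + y) = F i x0 + F i y"
      using lin x0 y by (auto simp: linear_map_on_def)
    ultimately show ?thesis using x0(2)[of i] norm_triangle_ineq4[of "F i (x0 + y)" "F i x0"] by simp
  qed
  \<comment> \<open>\<open>k *\<^sub>R x\<close> has norm \<open>r / 2\<close>, and values on the
    ball of radius \<open>r\<close> are differences of two values bounded by \<open>n\<close>; hence
    the constant \<open>4 * n / r\<close>.\<close>
  have "norm (F i x) \<le> (4 * real n / r) * norm x" if x: "x \<in> S" for i x
  proof (cases "x = 0")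
    case True
    then show ?thesis using bd[of i] x by fastforce
  next
    case False
    define k where "k = r / (2 * norm x)"
    have k: "k > 0" using False r by (simp add: k_def)
    have "norm (F i (k *\<^sub>R x)) \<le> 2 * real n"
      using False r by (intro small) (auto simp: k_def subspace_scale[OF S(2)] x)
    moreover have "F i (k *\<^sub>R x) = k *\<^sub>R F i x"
      using lin x by (auto simp: linear_map_on_def)
    ultimately have "k * norm (F i x) \<le> 2 * real n" using k by simp
    then have "norm (F i x) \<le> 2 * real n / k" using k by (simp add: field_simps)
    also have "\<dots> = (4 * real n / r) * norm x" using False r by (simp add: k_def)
    finally show ?thesis .
  qed
  then show ?thesis by blast
qed

section \<open>Spectral radius of positive operators\<close>

lemma linear_map_on_diff:
  assumes "subspace S" "linear_map_on S f" "x \<in> S" "y \<in> S"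
  shows "f (x - y) = f x - f y"
proof -
  have "x - y = x + (-1) *\<^sub>R y" by simp
  then have "f (x - y) = f x + (-1) *\<^sub>R f y"
    using assms subspace_scale[OF assms(1)] unfolding linear_map_on_def by metis
  then show ?thesis by simp
qed

lemma linear_map_on_0:
  assumes "subspace S" "linear_map_on S f" shows "f 0 = 0"
  using linear_map_on_diff[OF assms, of 0 0] subspace_0[OF assms(1)] by simp

lemma linear_map_on_sum:
  assumes "subspace S" "linear_map_on S f" "\<And>i. i \<in> I \<Longrightarrow> x i \<in> S"
  shows "f (\<Sum>i\<in>I. x i) = (\<Sum>i\<in>I. f (x i))"
  using assms(3)
proof (induction I rule: infinite_finite_induct)
  case (insert i I)
  have "(\<Sum>i\<in>I. x i) \<in> S" using insert by (intro subspace_sum[OF assms(1)]) auto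
  then show ?case using insert assms(2) by (simp add: linear_map_on_def)
qed (use linear_map_on_0[OF assms(1,2)] in auto)

lemma linear_map_on_funpow:
  assumes "subspace S" "linear_map_on S f" "f ` S \<subseteq> S"
  shows "(f ^^ n) ` S \<subseteq> S \<and> linear_map_on S (f ^^ n)"
proof (induction n)
  case (Suc n)
  then show ?case using assms by (auto simp: linear_map_on_def image_subset_iff)
qed (auto simp: linear_map_on_def)

text \<open>Spectral estimates provide geometric decay of the powers rather than a norm of
  \<open>G\<close> below 1. The bound for \<open>n = 1\<close> supplies the continuity needed to
  pass to the limit in \<open>y - G y\<close>, and summing all bounds gives the estimate for the
  inverse.\<close>

lemma neumann_series_on:
  fixes G :: "'b::banach \<Rightarrow> 'b"
  assumes V: "closed V" "subspace V" and G: "linear_map_on V G" "G ` V \<subseteq> V"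
    and bd: "\<And>n p. p \<in> V \<Longrightarrow> norm ((G ^^ n) p) \<le> A * r ^ n * norm p"
    and r: "0 \<le> r" "r < 1"
  shows "bij_betw (\<lambda>p. p - G p) V V" "\<exists>K. \<forall>p\<in>V. norm p \<le> K * norm (p - G p)"
proof -
  note P = linear_map_on_funpow[OF V(2) G]
  define Y where "Y n e = (\<Sum>k<n. (G ^^ k) e)" for n e
  have YV: "Y n e \<in> V" if "e \<in> V" for n e
    unfolding Y_def using P that by (intro subspace_sum[OF V(2)]) (auto simp: image_subset_iff)
  have GY: "Y n e - G (Y n e) = e - (G ^^ n) e" if "e \<in> V" for n e
  proof -
    have "G (Y n e) = (\<Sum>k<n. (G ^^ Suc k) e)"
      unfolding Y_def using P that
      by (subst linear_map_on_sum[OF V(2) G(1)]) (auto simp: image_subset_iff)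
    then have "Y n e - G (Y n e) = - (\<Sum>k<n. (G ^^ Suc k) e - (G ^^ k) e)"
      by (simp add: Y_def sum_subtractf)
    also have "\<dots> = e - (G ^^ n) e" by (subst sum_lessThan_telescope) simp
    finally show ?thesis .
  qed
  have r0: "(\<lambda>n. A * r ^ n * norm p) \<longlonglongrightarrow> 0" for p :: 'b
    using r by (auto intro!: tendsto_eq_intros LIMSEQ_power_zero)
  have G0: "(\<lambda>n. (G ^^ n) e) \<longlonglongrightarrow> 0" if "e \<in> V" for e
    by (rule Lim_null_comparison[OF _ r0[of e]]) (use bd that in auto)
  have sm: "summable (\<lambda>k. A * r ^ k * norm e)" for e :: 'b
    using r by (intro summable_mult2 summable_mult summable_geometric) auto
  have smG: "summable (\<lambda>k. (G ^^ k) e)" if "e \<in> V" for e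
    by (rule summable_comparison_test'[OF sm[of e]]) (use bd that in auto)
  have Ylim: "(\<lambda>n. Y n e) \<longlonglongrightarrow> (\<Sum>k. (G ^^ k) e)" if "e \<in> V" for e
    unfolding Y_def by (rule summable_LIMSEQ[OF smG[OF that]])
  have limV: "(\<Sum>k. (G ^^ k) e) \<in> V" if "e \<in> V" for e
    by (rule closed_sequentially[OF V(1) _ Ylim[OF that]]) (use YV that in auto)
  have inv1: "(\<Sum>k. (G ^^ k) e) - G (\<Sum>k. (G ^^ k) e) = e" (is "?y - G ?y = e") if e: "e \<in> V" for e
  proof -
    have "(\<lambda>n. norm (Y n e - ?y)) \<longlonglongrightarrow> 0"
      using Ylim[OF e] by (simp add: LIM_zero_iff tendsto_norm_zero_iff)
    then have "(\<lambda>n. A * r * norm (Y n e - ?y)) \<longlonglongrightarrow> 0"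
      by (auto intro: tendsto_eq_intros)
    then have "(\<lambda>n. G (Y n e) - G ?y) \<longlonglongrightarrow> 0"
    proof (rule Lim_null_comparison[rotated], intro always_eventually allI)
      fix n
      show "norm (G (Y n e) - G ?y) \<le> A * r * norm (Y n e - ?y)"
        using bd[of "Y n e - ?y" 1] linear_map_on_diff[OF V(2) G(1) YV[OF e] limV[OF e]]
          subspace_diff[OF V(2) YV[OF e] limV[OF e]] by simp
    qed
    then have "(\<lambda>n. G (Y n e)) \<longlonglongrightarrow> G ?y" by (rule LIM_zero_cancel)
    then have "(\<lambda>n. Y n e - G (Y n e)) \<longlonglongrightarrow> ?y - G ?y" by (intro tendsto_diff Ylim e)
    moreover have "(\<lambda>n. Y n e - G (Y n e)) \<longlonglongrightarrow> e"
      unfolding GY[OF e] using tendsto_diff[OF tendsto_const[of e] G0[OF e]] by simp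
    ultimately show ?thesis by (rule LIMSEQ_unique)
  qed
  have inv2: "(\<Sum>k. (G ^^ k) (p - G p)) = p" if p: "p \<in> V" for p
  proof -
    have pG: "p - G p \<in> V" using p G by (auto intro!: subspace_diff[OF V(2)])
    have "Y n (p - G p) = p - (G ^^ n) p" for n
    proof -
      have "(G ^^ k) (p - G p) = (G ^^ k) p - (G ^^ Suc k) p" for k
        using linear_map_on_diff[OF V(2), of "G ^^ k" p "G p"] P p G
        by (auto simp: funpow_swap1)
      then have "Y n (p - G p) = - (\<Sum>k<n. (G ^^ Suc k) p - (G ^^ k) p)"
        by (simp add: Y_def sum_subtractf)
      also have "\<dots> = p - (G ^^ n) p" by (subst sum_lessThan_telescope) simp
      finally show ?thesis .
    qed
    then have "(\<lambda>n. Y n (p - G p)) \<longlonglongrightarrow> p"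
      using tendsto_diff[OF tendsto_const[of p] G0[OF p]] by simp
    then show ?thesis using Ylim[OF pG] LIMSEQ_unique by blast
  qed
  show "bij_betw (\<lambda>p. p - G p) V V"
    by (rule bij_betw_byWitness[where f' = "\<lambda>e. \<Sum>k. (G ^^ k) e"])
       (use inv1 inv2 limV G in \<open>auto intro!: subspace_diff[OF V(2)]\<close>)
  have "norm p \<le> (A * (1 / (1 - r))) * norm (p - G p)" if p: "p \<in> V" for p
  proof -
    have pG: "p - G p \<in> V" using p G by (auto intro!: subspace_diff[OF V(2)])
    have "norm p \<le> (\<Sum>k. A * r ^ k * norm (p - G p))"
      by (subst inv2[OF p, symmetric], rule norm_suminf_le[OF bd[OF pG] sm])
    also have "\<dots> = A * (1 / (1 - r)) * norm (p - G p)"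
      using r by (simp add: suminf_mult2[symmetric] suminf_mult suminf_geometric summable_geometric)
    finally show ?thesis .
  qed
  then show "\<exists>K. \<forall>p\<in>V. norm p \<le> K * norm (p - G p)" by blast
qed

section \<open>Complex scalars acting on pairs of real vectors\<close>

definition complex_smult :: "complex \<Rightarrow> 'b::real_vector \<times> 'b \<Rightarrow> 'b \<times> 'b" where
  "complex_smult w = (\<lambda>(x, y). (Re w *\<^sub>R x - Im w *\<^sub>R y, Re w *\<^sub>R y + Im w *\<^sub>R x))"

lemma complex_smult_mult: "complex_smult v (complex_smult w p) = complex_smult (v * w) p"
  by (auto simp: complex_smult_def algebra_simps split: prod.splits)

lemma complex_smult_1 [simp]: "complex_smult 1 p = p"
  by (simp add: complex_smult_def split: prod.splits)

lemma complex_smult_diff: "complex_smult w (p - q) = complex_smult w p - complex_smult w q"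
  by (simp add: complex_smult_def algebra_simps split: prod.splits)

text \<open>The factor 4 is crude: over a general normed space the product norm on pairs is not
  homogeneous under complex scalars.\<close>

lemma norm_complex_smult:
  fixes p :: "'b::real_normed_vector \<times> 'b"
  shows "norm (complex_smult w p) \<le> 4 * cmod w * norm p"
proof (cases p)
  case (Pair x y)
  have n: "norm x \<le> norm p" "norm y \<le> norm p" unfolding Pair by (rule norm_fst_le[of x y] norm_snd_le[of y x])+
  have b: "norm (a *\<^sub>R u) \<le> cmod w * norm p" if "\<bar>a\<bar> \<le> cmod w" "norm u \<le> norm p" for a and u :: 'b
    using that by (simp add: mult_mono)
  note r = abs_Re_le_cmod[of w] abs_Im_le_cmod[of w]
  have "norm (complex_smult w p) \<le> norm (Re w *\<^sub>R x - Im w *\<^sub>R y) + norm (Re w *\<^sub>R y + Im w *\<^sub>R x)"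
    unfolding complex_smult_def Pair prod.case by (rule norm_Pair_le)
  also have "\<dots> \<le> (norm (Re w *\<^sub>R x) + norm (Im w *\<^sub>R y)) + (norm (Re w *\<^sub>R y) + norm (Im w *\<^sub>R x))"
    by (intro add_mono norm_triangle_ineq norm_triangle_ineq4)
  also have "\<dots> \<le> 4 * cmod w * norm p"
    using b[OF r(1) n(1)] b[OF r(2) n(2)] b[OF r(1) n(2)] b[OF r(2) n(1)] by linarith
  finally show ?thesis .
qed

text \<open>\<open>z I - L\<close> is multiplication by \<open>z\<close> after \<open>I - G\<close>
  with \<open>G = L / z\<close>, and the powers of \<open>G\<close> decay like
  \<open>(q / cmod z) ^ n\<close>. The factor 8 combines the two components of a pair with the 4 of
  \<open>norm_complex_smult\<close>.\<close>

lemma resolvent_set_on_geometric: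
  fixes L :: "'b::banach \<Rightarrow> 'b"
  assumes S: "closed S" "subspace S" and L: "linear_map_on S L" "L ` S \<subseteq> S"
    and bd: "\<And>n x. x \<in> S \<Longrightarrow> norm ((L ^^ n) x) \<le> A * q ^ n * norm x"
    and q: "0 \<le> q" "q < cmod z"
  shows "z \<in> resolvent_set_on S L"
proof -
  have z: "z \<noteq> 0" using q by auto
  define G where "G p = complex_smult (1 / z) (map_prod L L p)" for p :: "'b \<times> 'b"
  have V: "closed (S \<times> S)" "subspace (S \<times> S)"
    using S by (auto intro: closed_Times subspace_Times)
  have cS: "complex_smult w p \<in> S \<times> S" if "p \<in> S \<times> S" for w p
    using that S(2) by (auto simp: complex_smult_def intro!: subspace_diff subspace_add subspace_scale)
  have GS: "G ` (S \<times> S) \<subseteq> S \<times> S"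
  proof (rule image_subsetI)
    fix p assume "p \<in> S \<times> S"
    then have "map_prod L L p \<in> S \<times> S" using L(2) by (cases p) (auto simp: image_subset_iff)
    then show "G p \<in> S \<times> S" unfolding G_def by (rule cS)
  qed
  have Ls: "L (a *\<^sub>R x) = a *\<^sub>R L x" if "x \<in> S" for a x
    using L that by (auto simp: linear_map_on_def)
  have La: "L (x + y) = L x + L y" if "x \<in> S" "y \<in> S" for x y
    using L that by (auto simp: linear_map_on_def)
  have Ld: "L (x - y) = L x - L y" if "x \<in> S" "y \<in> S" for x y
    using linear_map_on_diff[OF S(2) L(1)] that by auto
  have Glin: "linear_map_on (S \<times> S) G"
    unfolding linear_map_on_def G_def complex_smult_def
    by (auto simp: La Ls algebra_simps)
  have comm: "map_prod L L (complex_smult w p) = complex_smult w (map_prod L L p)" if "p \<in> S \<times> S" for w p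
    using that S(2) by (auto simp: complex_smult_def Ld La Ls subspace_scale)
  note PL = linear_map_on_funpow[OF S(2) L]
  have Gn: "(G ^^ n) p = complex_smult ((1 / z) ^ n) (map_prod (L ^^ n) (L ^^ n) p)" if "p \<in> S \<times> S" for n p
  proof (induction n)
    case (Suc n)
    have "map_prod (L ^^ n) (L ^^ n) p \<in> S \<times> S" using PL[of n] that by (cases p) (auto simp: image_subset_iff)
    then show ?case using Suc by (simp add: G_def comm complex_smult_mult map_prod.compositionality)
        (simp add: map_prod_def comp_def split_beta)
  qed (simp add: map_prod_def split_beta)
  have Gbd: "norm ((G ^^ n) p) \<le> (8 * A) * (q / cmod z) ^ n * norm p" if p: "p \<in> S \<times> S" for n p
  proof (cases p)
    case (Pair x y)
    have n: "norm x \<le> norm p" "norm y \<le> norm p" unfolding Pair by (rule norm_fst_le[of x y] norm_snd_le[of y x])+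
    have xy: "x \<in> S" "y \<in> S" using p Pair by auto
    \<comment> \<open>No sign of \<open>A\<close> is assumed. As soon as \<open>S\<close> contains a
      nonzero vector, the hypothesis itself forces \<open>A * q ^ n\<close> to be nonnegative;
      otherwise all norms vanish.\<close>
    have b: "norm ((L ^^ n) u) \<le> A * q ^ n * norm p" if "u \<in> S" "norm u \<le> norm p" for u
    proof (cases "norm u = 0")
      case True
      then have "norm ((L ^^ n) u) = 0" using bd[OF that(1), of n] by simp
      moreover have "0 \<le> A * q ^ n * norm p"
      proof (cases "p = 0")
        case False
        then obtain v where v: "v \<in> S" "v \<noteq> 0" using xy Pair by (cases "x = 0") (auto simp: zero_prod_def)
        have "0 \<le> A * q ^ n * norm v" using bd[OF v(1), of n] norm_ge_zero order_trans by blast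
        then have "0 \<le> A * q ^ n" using v by (simp add: zero_le_mult_iff)
        then show ?thesis by simp
      qed simp
      ultimately show ?thesis by simp
    next
      case False
      have "0 \<le> A * q ^ n * norm u" using bd[OF that(1), of n] norm_ge_zero order_trans by blast
      then have "0 \<le> A * q ^ n" using False by (simp add: zero_le_mult_iff)
      then have "A * q ^ n * norm u \<le> A * q ^ n * norm p" using that by (intro mult_left_mono)
      then show ?thesis using bd[OF that(1), of n] by linarith
    qed
    have "norm (map_prod (L ^^ n) (L ^^ n) p) \<le> norm ((L ^^ n) x) + norm ((L ^^ n) y)"
      unfolding Pair by (simp add: norm_Pair_le)
    also have "\<dots> \<le> 2 * (A * q ^ n * norm p)" using b[OF xy(1) n(1)] b[OF xy(2) n(2)] by simp
    finally have m: "norm (map_prod (L ^^ n) (L ^^ n) p) \<le> 2 * (A * q ^ n * norm p)" .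
    have "norm ((G ^^ n) p) \<le> 4 * cmod ((1 / z) ^ n) * norm (map_prod (L ^^ n) (L ^^ n) p)"
      unfolding Gn[OF p] by (rule norm_complex_smult)
    also have "\<dots> \<le> 4 * cmod ((1 / z) ^ n) * (2 * (A * q ^ n * norm p))"
      by (intro mult_left_mono m) auto
    also have "\<dots> = (8 * A) * (q / cmod z) ^ n * norm p"
      by (simp add: norm_power norm_divide power_divide)
    finally show ?thesis .
  qed
  have r: "0 \<le> q / cmod z" "q / cmod z < 1" using q z by auto
  note N = neumann_series_on[OF V Glin GS Gbd r]
  have shift: "complex_shift z L p = complex_smult z (p - G p)" for p
  proof -
    have "complex_shift z L p = complex_smult z p - map_prod L L p"
      by (simp add: complex_shift_def complex_smult_def split: prod.splits)
    also have "map_prod L L p = complex_smult z (G p)"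
      using z by (simp add: G_def complex_smult_mult)
    finally show ?thesis by (simp add: complex_smult_diff)
  qed
  have bz: "bij_betw (complex_smult z) (S \<times> S) (S \<times> S)"
    by (rule bij_betw_byWitness[where f' = "complex_smult (1 / z)"])
       (use z cS in \<open>simp_all add: complex_smult_mult image_subset_iff\<close>)
  have "bij_betw (complex_shift z L) (S \<times> S) (S \<times> S)"
    using bij_betw_trans[OF N(1) bz] by (simp add: comp_def shift[abs_def])
  moreover have "\<exists>K. \<forall>p\<in>S \<times> S. norm p \<le> K * norm (complex_shift z L p)"
  proof -
    obtain K where K: "\<And>p. p \<in> S \<times> S \<Longrightarrow> norm p \<le> K * norm (p - G p)" using N(2) by blast
    have "norm p \<le> (\<bar>K\<bar> * (4 * cmod (1 / z))) * norm (complex_shift z L p)" if p: "p \<in> S \<times> S" for p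
    proof -
      have "norm p \<le> K * norm (p - G p)" by (rule K[OF p])
      also have "\<dots> \<le> \<bar>K\<bar> * norm (p - G p)" by (intro mult_right_mono) auto
      also have "p - G p = complex_smult (1 / z) (complex_shift z L p)"
        using z by (simp add: shift complex_smult_mult)
      also have "\<bar>K\<bar> * norm \<dots> \<le> \<bar>K\<bar> * (4 * cmod (1 / z) * norm (complex_shift z L p))"
        by (intro mult_left_mono norm_complex_smult) auto
      finally show ?thesis by (simp add: mult.assoc)
    qed
    then show ?thesis by blast
  qed
  ultimately show ?thesis by (simp add: resolvent_set_on_def)
qed

text \<open>A positive operator for a convex cone \<open>C\<close> on which the norm is monotone and
  such that every vector of \<open>S\<close> is a difference of two cone elements no larger than
  itself. These two properties carry estimates for positive series over to all of
  \<open>S\<close>.\<close>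

locale positive_operator =
  fixes S C :: "'b::banach set" and L :: "'b \<Rightarrow> 'b"
  assumes S: "closed S" "subspace S" and CS: "C \<subseteq> S"
    and C0: "0 \<in> C" and C_add: "\<And>x y. x \<in> C \<Longrightarrow> y \<in> C \<Longrightarrow> x + y \<in> C"
    and C_scale: "\<And>c x. c > 0 \<Longrightarrow> x \<in> C \<Longrightarrow> c *\<^sub>R x \<in> C"
    and lin: "linear_map_on S L" and LS: "L ` S \<subseteq> S"
    and bounded: "\<exists>K. \<forall>x\<in>S. norm (L x) \<le> K * norm x"
    and pos: "\<And>x. x \<in> C \<Longrightarrow> L x \<in> C"
    and norm_mono: "\<And>x y. x \<in> C \<Longrightarrow> y \<in> C \<Longrightarrow> norm x \<le> norm (x + y)"
    and decomp: "\<And>x. x \<in> S \<Longrightarrow> \<exists>u\<in>C. \<exists>v\<in>C. x = u - v \<and> norm u \<le> norm x \<and> norm v \<le> norm x"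
begin

lemma pow_C: "x \<in> C \<Longrightarrow> (L ^^ n) x \<in> C"
  by (induction n) (auto intro: pos)

lemma C_sum: "(\<And>i. i \<in> I \<Longrightarrow> x i \<in> C) \<Longrightarrow> (\<Sum>i\<in>I. x i) \<in> C"
  by (induction I rule: infinite_finite_induct) (auto intro: C0 C_add)

lemma pow_S: "x \<in> S \<Longrightarrow> (L ^^ n) x \<in> S" and pow_lin: "linear_map_on S (L ^^ n)"
  using linear_map_on_funpow[OF S(2) lin LS] by (auto simp: image_subset_iff)

text \<open>Sum the iterates twice: when the operator sum of all \<open>L ^^ j\<close> is applied to
  the sum of all \<open>(L ^^ k) x\<close>, the term \<open>(L ^^ n) x\<close> occurs
  \<open>n + 1\<close> times, once for each \<open>j + k = n\<close>, and everything else lies in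
  the cone. Bounded partial sums therefore force decay at least like
  \<open>1 / (n + 1)\<close>.\<close>

lemma decay_on_cone:
  assumes K: "\<And>n x. x \<in> C \<Longrightarrow> norm (\<Sum>k\<le>n. (L ^^ k) x) \<le> K * norm x" and K0: "K \<ge> 0" and x: "x \<in> C"
  shows "real (n + 1) * norm ((L ^^ n) x) \<le> K\<^sup>2 * norm x"
proof -
  define y where "y = (\<Sum>k\<le>n. (L ^^ k) x)"
  \<comment> \<open>What remains of \<open>y\<close> after removing the summand that
    \<open>L ^^ j\<close> maps to \<open>(L ^^ n) x\<close>.\<close>
  define w where "w j = (\<Sum>k\<in>{..n} - {n - j}. (L ^^ k) x)" for j
  have w: "w j \<in> C" for j unfolding w_def by (intro C_sum pow_C x)
  have y: "y \<in> C" unfolding y_def by (intro C_sum pow_C x)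
  have "(L ^^ j) y = (L ^^ n) x + (L ^^ j) (w j)" if "j \<le> n" for j
  proof -
    have "y = (L ^^ (n - j)) x + w j"
      unfolding y_def w_def by (rule sum.remove) auto
    then have "(L ^^ j) y = (L ^^ j) ((L ^^ (n - j)) x) + (L ^^ j) (w j)"
      using pow_lin[of j] CS w pow_C[OF x] by (auto simp: linear_map_on_def subset_iff)
    also have "(L ^^ j) ((L ^^ (n - j)) x) = (L ^^ (j + (n - j))) x"
      by (simp only: funpow_add comp_apply)
    finally show ?thesis using that by simp
  qed
  then have "(\<Sum>j\<le>n. (L ^^ j) y) = (\<Sum>j\<le>n. (L ^^ n) x) + (\<Sum>j\<le>n. (L ^^ j) (w j))"
    by (simp add: sum.distrib[symmetric])
  also have "(\<Sum>j\<le>n. (L ^^ n) x) = real (n + 1) *\<^sub>R (L ^^ n) x"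
    by (simp add: sum_constant_scaleR)
  finally have e: "(\<Sum>j\<le>n. (L ^^ j) y) = real (n + 1) *\<^sub>R (L ^^ n) x + (\<Sum>j\<le>n. (L ^^ j) (w j))" .
  have "real (n + 1) * norm ((L ^^ n) x) = norm (real (n + 1) *\<^sub>R (L ^^ n) x)" by simp
  also have "\<dots> \<le> norm (\<Sum>j\<le>n. (L ^^ j) y)"
    unfolding e by (intro norm_mono C_scale pow_C x C_sum w) auto
  also have "\<dots> \<le> K * norm y" by (rule K[OF y])
  also have "\<dots> \<le> K * (K * norm x)" unfolding y_def by (intro mult_left_mono K x K0)
  finally show ?thesis by (simp add: power2_eq_square)
qed

text \<open>Decay like \<open>1 / (n + 1)\<close> makes some power \<open>L ^^ N\<close> a
  contraction with factor 1/2, and iterating in blocks of length \<open>N\<close> gives a geometric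
  rate.\<close>

lemma geometric_decay:
  assumes K: "\<And>n x. x \<in> C \<Longrightarrow> norm (\<Sum>k\<le>n. (L ^^ k) x) \<le> K * norm x"
  shows "\<exists>A q. 0 < q \<and> q < 1 \<and> (\<forall>n. \<forall>x\<in>S. norm ((L ^^ n) x) \<le> A * q ^ n * norm x)"
proof -
  define K1 where "K1 = max K 1"
  have K1: "norm (\<Sum>k\<le>n. (L ^^ k) x) \<le> K1 * norm x" if "x \<in> C" for n x
    using K[OF that, of n] mult_right_mono[of K K1 "norm x"] by (simp add: K1_def)
  define A0 where "A0 = 2 * K1\<^sup>2"
  have A0: "A0 > 0" by (auto simp: A0_def K1_def)
  have dec: "real (n + 1) * norm ((L ^^ n) x) \<le> A0 * norm x" if x: "x \<in> S" for n x
  proof -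
    obtain u v where uv: "u \<in> C" "v \<in> C" "x = u - v" "norm u \<le> norm x" "norm v \<le> norm x"
      using decomp[OF x] by blast
    have "(L ^^ n) x = (L ^^ n) u - (L ^^ n) v"
      using linear_map_on_diff[OF S(2) pow_lin] uv CS by auto
    then have "norm ((L ^^ n) x) \<le> norm ((L ^^ n) u) + norm ((L ^^ n) v)"
      by (simp add: norm_triangle_ineq4)
    then have "real (n + 1) * norm ((L ^^ n) x) \<le> real (n + 1) * norm ((L ^^ n) u) + real (n + 1) * norm ((L ^^ n) v)"
      using mult_left_mono[of _ _ "real (n+1)"] by (fastforce simp: distrib_left)
    also have "\<dots> \<le> K1\<^sup>2 * norm u + K1\<^sup>2 * norm v"
      by (intro add_mono decay_on_cone K1 uv) (auto simp: K1_def)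
    also have "\<dots> \<le> K1\<^sup>2 * norm x + K1\<^sup>2 * norm x"
      using uv by (intro add_mono mult_left_mono) auto
    finally show ?thesis by (simp add: A0_def mult_ac)
  qed
  have bd: "norm ((L ^^ n) x) \<le> A0 * norm x" if x: "x \<in> S" for n x
  proof -
    have "1 * norm ((L ^^ n) x) \<le> real (n + 1) * norm ((L ^^ n) x)" by (intro mult_right_mono) auto
    then show ?thesis using dec[OF x, of n] by simp
  qed
  obtain N :: nat where N: "2 * A0 \<le> real N" using real_arch_simple by blast
  then have N0: "N > 0" using A0 by (cases N) auto
  have half: "norm ((L ^^ N) x) \<le> (1/2) * norm x" if x: "x \<in> S" for x
  proof -
    have "2 * A0 * norm ((L ^^ N) x) \<le> real (N + 1) * norm ((L ^^ N) x)"
      using N by (intro mult_right_mono) auto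
    then have "2 * A0 * norm ((L ^^ N) x) \<le> A0 * norm x" using dec[OF x, of N] by linarith
    then show ?thesis using A0 by simp
  qed
  have blocks: "norm ((L ^^ (N * m + r)) x) \<le> A0 * (1/2) ^ m * norm x" if x: "x \<in> S" for m r x
  proof (induction m)
    case (Suc m)
    have "(L ^^ (N * Suc m + r)) x = (L ^^ N) ((L ^^ (N * m + r)) x)"
      by (simp add: funpow_add add.assoc)
    then have "norm ((L ^^ (N * Suc m + r)) x) \<le> (1/2) * norm ((L ^^ (N * m + r)) x)"
      using half[OF pow_S[OF x]] by simp
    then show ?case using Suc by simp
  qed (use bd x in auto)
  \<comment> \<open>One halving per \<open>N\<close> steps. The incomplete last block costs the
    factor 2 in \<open>2 * A0\<close>.\<close>
  define q where "q = (1/2::real) powr (1 / real N)"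
  have q: "0 < q" "q < 1" using N0 powr_less_mono2[of "1 / real N" "1/2" 1] by (auto simp: q_def)
  have "norm ((L ^^ n) x) \<le> (2 * A0) * q ^ n * norm x" if x: "x \<in> S" for n x
  proof -
    have "(1/2::real) ^ (n div N) = (1/2) powr real (n div N)" by (simp add: powr_realpow)
    also have "\<dots> \<le> (1/2) powr (real n / real N - 1)"
    proof (rule powr_mono')
      have "real n = real N * real (n div N) + real (n mod N)"
        by (metis mult_div_mod_eq of_nat_add of_nat_mult)
      also have "\<dots> \<le> real N * real (n div N) + real N" using N0 by (simp add: less_imp_le)
      finally show "real n / real N - 1 \<le> real (n div N)" using N0 by (simp add: field_simps)
    qed auto
    also have "\<dots> = 2 * q ^ n"
      using N0 by (simp add: q_def powr_diff powr_powr powr_realpow[symmetric])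
    finally have *: "(1/2::real) ^ (n div N) \<le> 2 * q ^ n" .
    have "norm ((L ^^ n) x) \<le> A0 * (1/2) ^ (n div N) * norm x"
      using blocks[OF x, of "n div N" "n mod N"] by simp
    also have "\<dots> \<le> A0 * (2 * q ^ n) * norm x"
      using A0 by (intro mult_right_mono mult_left_mono *) auto
    finally show ?thesis by (simp add: mult_ac)
  qed
  then show ?thesis using q by blast
qed

lemma scaled: "c > 0 \<Longrightarrow> positive_operator S C (\<lambda>x. c *\<^sub>R L x)"
proof
  assume c: "c > 0"
  show "linear_map_on S (\<lambda>x. c *\<^sub>R L x)"
    using lin by (auto simp: linear_map_on_def scaleR_add_right)
  show "(\<lambda>x. c *\<^sub>R L x) ` S \<subseteq> S" using LS S by (auto intro: subspace_scale)
  obtain K where "\<And>x. x \<in> S \<Longrightarrow> norm (L x) \<le> K * norm x" using bounded by blast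
  then show "\<exists>K. \<forall>x\<in>S. norm (c *\<^sub>R L x) \<le> K * norm x"
    using c by (intro exI[of _ "c * K"]) (auto simp: mult.assoc)
qed (use S CS C0 C_add C_scale pos norm_mono decomp in auto)

lemma scaled_pow: "x \<in> S \<Longrightarrow> ((\<lambda>x. c *\<^sub>R L x) ^^ n) x = c ^ n *\<^sub>R (L ^^ n) x"
proof (induction n)
  case (Suc n)
  then show ?case using lin pow_S[of x n] by (auto simp: linear_map_on_def)
qed simp

text \<open>Stands in for Gelfand's formula together with the fact that the spectral radius of a
  positive operator is a spectral value. If the rate \<open>q\<close> fails, the infimum
  \<open>s\<close> of the admissible rates is at least \<open>q\<close>. The lower bound at
  \<open>s\<close> persists for \<open>l\<close> slightly above \<open>s\<close> and keeps the
  partial sums of the resolvent series bounded down to \<open>l = s\<close>;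
  \<open>geometric_decay\<close> for \<open>L / s\<close> then yields a rate smaller than
  \<open>s\<close>.\<close>

lemma geometric_bound:
  assumes q: "q > 0" and below: "\<And>l. l \<ge> q \<Longrightarrow> \<exists>K. \<forall>x\<in>S. norm x \<le> K * norm (l *\<^sub>R x - L x)"
  shows "\<exists>A. \<forall>n. \<forall>x\<in>S. norm ((L ^^ n) x) \<le> A * q ^ n * norm x"
proof -
  define \<Gamma> where "\<Gamma> = {l. l > 0 \<and> (\<exists>A. \<forall>n. \<forall>x\<in>S. norm ((L ^^ n) x) \<le> A * l ^ n * norm x)}"
  have up: "l' \<in> \<Gamma>" if "l \<in> \<Gamma>" "l \<le> l'" for l l'
  proof -
    obtain A where A: "\<And>n x. x \<in> S \<Longrightarrow> norm ((L ^^ n) x) \<le> A * l ^ n * norm x" and l: "l > 0"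
      using \<open>l \<in> \<Gamma>\<close> by (auto simp: \<Gamma>_def)
    have "norm ((L ^^ n) x) \<le> \<bar>A\<bar> * l' ^ n * norm x" if "x \<in> S" for n x
    proof -
      have "A * l ^ n * norm x \<le> \<bar>A\<bar> * l' ^ n * norm x"
        using l \<open>l \<le> l'\<close> by (intro mult_right_mono mult_mono power_mono) auto
      then show ?thesis using A[OF that, of n] by linarith
    qed
    then show ?thesis using l \<open>l \<le> l'\<close> by (auto simp: \<Gamma>_def)
  qed
  show ?thesis
  proof (cases "q \<in> \<Gamma>")
    case False
    then have gt: "q < l" if "l \<in> \<Gamma>" for l using up[OF that, of q] by fastforce
    obtain K0 where K0: "\<And>x. x \<in> S \<Longrightarrow> norm (L x) \<le> K0 * norm x" using bounded by blast
    have "norm ((L ^^ n) x) \<le> 1 * (max K0 1) ^ n * norm x" if "x \<in> S" for n x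
    proof (induction n)
      case (Suc n)
      have "norm ((L ^^ Suc n) x) \<le> K0 * norm ((L ^^ n) x)" using K0[OF pow_S[OF that, of n]] by simp
      also have "\<dots> \<le> max K0 1 * norm ((L ^^ n) x)" by (intro mult_right_mono) auto
      also have "\<dots> \<le> max K0 1 * (1 * (max K0 1) ^ n * norm x)" by (intro mult_left_mono Suc) auto
      finally show ?case by (simp add: mult_ac)
    qed simp
    then have ne: "max K0 1 \<in> \<Gamma>" unfolding \<Gamma>_def by (auto intro!: exI[of _ 1])
    define s where "s = Inf \<Gamma>"
    have bb: "bdd_below \<Gamma>" using gt by (meson bdd_belowI less_imp_le)
    have sq: "s \<ge> q" unfolding s_def using ne gt by (intro cInf_greatest) (auto intro: less_imp_le)
    then have s0: "s > 0" using q by simp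
    have above: "l \<in> \<Gamma>" if gs: "l > s" for l
    proof -
      obtain l' where "l' \<in> \<Gamma>" "l' < l" using gs ne cInf_lessD[of \<Gamma> l] unfolding s_def by (metis empty_iff)
      then show ?thesis using up[of l' l] by simp
    qed
    obtain K where "\<And>x. x \<in> S \<Longrightarrow> norm x \<le> K * norm (s *\<^sub>R x - L x)" using below[OF sq] by blast
    define K1 where "K1 = max K 1"
    have K1: "norm x \<le> K1 * norm (s *\<^sub>R x - L x)" if "x \<in> S" for x
      using \<open>\<And>x. x \<in> S \<Longrightarrow> norm x \<le> K * norm (s *\<^sub>R x - L x)\<close>[OF that]
        mult_right_mono[of K K1 "norm (s *\<^sub>R x - L x)"] by (simp add: K1_def)
    have K1p: "K1 \<ge> 1" by (simp add: K1_def)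
    \<comment> \<open>Partial sums of the Neumann series for the inverse of \<open>l I - L\<close>.
      Being finite sums they also make sense, and are continuous in \<open>l\<close>, at
      \<open>l = s\<close>, where convergence is not yet known.\<close>
    define Y where "Y l n x = (\<Sum>k\<le>n. (1 / l) ^ Suc k *\<^sub>R (L ^^ k) x)" for l :: real and n x
    \<comment> \<open>Within distance \<open>1 / (2 * K1)\<close> of \<open>s\<close> the
      perturbation uses up only half of the lower bound, so the constant \<open>2 * K1\<close>
      serves for all these \<open>l\<close>. Each partial sum is bounded by later ones, whose
      remainder tends to 0.\<close>
    have Yb: "norm (Y l m x) \<le> 2 * K1 * norm x" if l: "l > s" "l < s + 1 / (2 * K1)" and x: "x \<in> C" for l m x
    proof -
      have l0: "l > 0" using l s0 by simp
      have xS: "x \<in> S" using x CS by auto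
      have bl: "norm y \<le> 2 * K1 * norm (l *\<^sub>R y - L y)" if "y \<in> S" for y
      proof -
        have "s *\<^sub>R y - L y = (l *\<^sub>R y - L y) - (l - s) *\<^sub>R y" by (simp add: algebra_simps)
        then have "norm (s *\<^sub>R y - L y) \<le> norm (l *\<^sub>R y - L y) + (l - s) * norm y"
          using norm_triangle_ineq4[of "l *\<^sub>R y - L y" "(l - s) *\<^sub>R y"] l
          by (simp only: norm_scaleR abs_of_pos diff_gt_0_iff_gt)
        moreover have "(l - s) * norm y \<le> 1 / (2 * K1) * norm y" using l by (intro mult_right_mono) auto
        ultimately have "norm (s *\<^sub>R y - L y) \<le> norm (l *\<^sub>R y - L y) + 1 / (2 * K1) * norm y" by linarith
        then have "K1 * norm (s *\<^sub>R y - L y) \<le> K1 * (norm (l *\<^sub>R y - L y) + 1 / (2 * K1) * norm y)"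
          using K1p by (intro mult_left_mono) auto
        also have "\<dots> = K1 * norm (l *\<^sub>R y - L y) + norm y / 2" using K1p by (simp add: field_simps)
        finally show ?thesis using K1[OF that] by linarith
      qed
      have YS: "Y l n x \<in> S" for n
        unfolding Y_def by (intro subspace_sum[OF S(2)] subspace_scale[OF S(2)] pow_S xS)
      have tele: "l *\<^sub>R Y l n x - L (Y l n x) = x - (1 / l) ^ Suc n *\<^sub>R (L ^^ Suc n) x" for n
      proof -
        have "L (Y l n x) = (\<Sum>k\<le>n. (1 / l) ^ Suc k *\<^sub>R (L ^^ Suc k) x)"
          unfolding Y_def
          by (subst linear_map_on_sum[OF S(2) lin])
             (use lin pow_S[OF xS] subspace_scale[OF S(2)] in \<open>auto simp: linear_map_on_def\<close>)
        moreover have "l *\<^sub>R Y l n x = (\<Sum>k\<le>n. (1 / l) ^ k *\<^sub>R (L ^^ k) x)"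
          unfolding Y_def scaleR_sum_right using l0 by simp
        ultimately have "l *\<^sub>R Y l n x - L (Y l n x)
            = (\<Sum>k\<le>n. (1 / l) ^ k *\<^sub>R (L ^^ k) x - (1 / l) ^ Suc k *\<^sub>R (L ^^ Suc k) x)"
          by (simp add: sum_subtractf)
        also have "\<dots> = x - (1 / l) ^ Suc n *\<^sub>R (L ^^ Suc n) x"
          using sum_telescope[of "\<lambda>k. (1 / l) ^ k *\<^sub>R (L ^^ k) x" n] by simp
        finally show ?thesis .
      qed
      \<comment> \<open>An admissible rate strictly below \<open>l\<close>, which makes the
        remainder of the telescoping sum vanish as \<open>n\<close> grows.\<close>
      define l1 where "l1 = (s + l) / 2"
      have l1: "s < l1" "l1 < l" "l1 > 0" using l s0 by (auto simp: l1_def)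
      obtain A where A: "\<And>n x. x \<in> S \<Longrightarrow> norm ((L ^^ n) x) \<le> A * l1 ^ n * norm x"
        using above[OF l1(1)] by (auto simp: \<Gamma>_def)
      have mono: "norm (Y l m x) \<le> norm (Y l n x)" if "m \<le> n" for n
      proof -
        have "Y l n x = Y l m x + (\<Sum>k\<in>{..n} - {..m}. (1 / l) ^ Suc k *\<^sub>R (L ^^ k) x)"
          unfolding Y_def using that by (subst sum.subset_diff[of "{..m}" "{..n}"]) auto
        moreover have "Y l m x \<in> C" "(\<Sum>k\<in>{..n} - {..m}. (1 / l) ^ Suc k *\<^sub>R (L ^^ k) x) \<in> C"
          unfolding Y_def using l0 by (auto intro!: C_sum C_scale pow_C x)
        ultimately show ?thesis using norm_mono by metis
      qed
      have "norm (Y l m x) \<le> 2 * K1 * (norm x + A * (l1 / l) ^ Suc n * norm x)" if "m \<le> n" for n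
      proof -
        have "norm ((1 / l) ^ Suc n *\<^sub>R (L ^^ Suc n) x) \<le> (1 / l) ^ Suc n * (A * l1 ^ Suc n * norm x)"
          unfolding norm_scaleR using l0 A[OF xS, of "Suc n"] by (intro mult_mono) auto
        also have "\<dots> = A * (l1 / l) ^ Suc n * norm x" by (simp add: power_divide)
        finally have "norm (l *\<^sub>R Y l n x - L (Y l n x)) \<le> norm x + A * (l1 / l) ^ Suc n * norm x"
          unfolding tele by (intro order_trans[OF norm_triangle_ineq4]) simp
        then have "norm (Y l n x) \<le> 2 * K1 * (norm x + A * (l1 / l) ^ Suc n * norm x)"
          using bl[OF YS, of n] K1p by (meson mult_left_mono order_trans zero_le_mult_iff zero_le_numeral zero_le_one)
        then show ?thesis using mono[OF that] by linarith
      qed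
      moreover have "(\<lambda>n. 2 * K1 * (norm x + A * (l1 / l) ^ Suc n * norm x)) \<longlonglongrightarrow> 2 * K1 * (norm x + A * 0 * norm x)"
        using l1 by (intro tendsto_intros LIMSEQ_Suc LIMSEQ_power_zero) auto
      ultimately have "norm (Y l m x) \<le> 2 * K1 * (norm x + A * 0 * norm x)"
        by (intro LIMSEQ_le_const[of _ _ "norm (Y l m x)"]) auto
      then show ?thesis by simp
    qed
    have Ys: "norm (Y s m x) \<le> 2 * K1 * norm x" if x: "x \<in> C" for m x
    proof (rule tendsto_upperbound)
      show "((\<lambda>l. norm (Y l m x)) \<longlongrightarrow> norm (Y s m x)) (at_right s)"
        unfolding Y_def using s0 by (intro tendsto_intros) auto
      have "s < s + 1 / (2 * K1)" using K1p by simp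
      then show "\<forall>\<^sub>F l in at_right s. norm (Y l m x) \<le> 2 * K1 * norm x"
        by (subst eventually_at_right[OF \<open>s < s + 1 / (2 * K1)\<close>]) (use Yb x in blast)
    qed simp
    interpret sc: positive_operator S C "\<lambda>x. (1 / s) *\<^sub>R L x" using s0 by (intro scaled) simp
    have "\<exists>A q. 0 < q \<and> q < 1 \<and> (\<forall>n. \<forall>x\<in>S. norm (((\<lambda>x. (1 / s) *\<^sub>R L x) ^^ n) x) \<le> A * q ^ n * norm x)"
    proof (rule sc.geometric_decay)
      fix n x assume x: "x \<in> C"
      then have xS: "x \<in> S" using CS by auto
      have "(\<Sum>k\<le>n. ((\<lambda>x. (1 / s) *\<^sub>R L x) ^^ k) x) = s *\<^sub>R Y s n x"
        unfolding Y_def scaleR_sum_right using s0 by (simp add: scaled_pow[OF xS])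
      then show "norm (\<Sum>k\<le>n. ((\<lambda>x. (1 / s) *\<^sub>R L x) ^^ k) x) \<le> (s * (2 * K1)) * norm x"
        using Ys[OF x, of n] s0 by (simp add: mult.assoc)
    qed
    then obtain A r where r: "0 < r" "r < 1"
      and Ar: "\<And>n x. x \<in> S \<Longrightarrow> norm (((\<lambda>x. (1 / s) *\<^sub>R L x) ^^ n) x) \<le> A * r ^ n * norm x" by blast
    have "norm ((L ^^ n) x) \<le> A * (r * s) ^ n * norm x" if x: "x \<in> S" for n x
    proof -
      have "(1 / s) ^ n * norm ((L ^^ n) x) \<le> A * r ^ n * norm x"
        using Ar[OF x, of n] s0 by (simp add: scaled_pow[OF x])
      then have "s ^ n * ((1 / s) ^ n * norm ((L ^^ n) x)) \<le> s ^ n * (A * r ^ n * norm x)"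
        using s0 by (intro mult_left_mono) auto
      then show ?thesis using s0 by (simp add: power_divide power_mult_distrib mult_ac)
    qed
    then have "r * s \<in> \<Gamma>" using r s0 by (auto simp: \<Gamma>_def)
    then have "s \<le> r * s" unfolding s_def using bb by (intro cInf_lower)
    then show ?thesis using r s0 by simp
  qed (auto simp: \<Gamma>_def)
qed

text \<open>A real supremum says nothing about an unbounded set, so the spectral radius dominates
  spectral values only after this bound.\<close>

lemma bdd_above_spectrum: "bdd_above (cmod ` spectrum_on S L)"
  and spectrum_bound: "\<lbrakk>q \<ge> 0; \<And>n x. x \<in> S \<Longrightarrow> norm ((L ^^ n) x) \<le> A * q ^ n * norm x; z \<in> spectrum_on S L\<rbrakk> \<Longrightarrow> cmod z \<le> q"
proof -
  show *: "cmod z \<le> q" if "q \<ge> 0" "\<And>n x. x \<in> S \<Longrightarrow> norm ((L ^^ n) x) \<le> A * q ^ n * norm x" "z \<in> spectrum_on S L" for z q A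
    using resolvent_set_on_geometric[OF S lin LS that(2,1)] that(3) by (force simp: spectrum_on_def)
  obtain K0 where K0: "\<And>x. x \<in> S \<Longrightarrow> norm (L x) \<le> K0 * norm x" using bounded by blast
  have "norm ((L ^^ n) x) \<le> 1 * (max K0 0) ^ n * norm x" if "x \<in> S" for n x
  proof (induction n)
    case (Suc n)
    have "norm ((L ^^ Suc n) x) \<le> K0 * norm ((L ^^ n) x)" using K0[OF pow_S[OF that, of n]] by simp
    also have "\<dots> \<le> max K0 0 * norm ((L ^^ n) x)" by (intro mult_right_mono) auto
    also have "\<dots> \<le> max K0 0 * (1 * (max K0 0) ^ n * norm x)" by (intro mult_left_mono Suc) auto
    finally show ?case by (simp add: mult_ac)
  qed simp
  then have "cmod z \<le> max K0 0" if "z \<in> spectrum_on S L" for z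
    using *[of "max K0 0" 1 z] that by auto
  then show "bdd_above (cmod ` spectrum_on S L)" by (intro bdd_aboveI[of _ "max K0 0"]) auto
qed

lemma resolvent_bounded_below:
  assumes "complex_of_real l \<in> resolvent_set_on S L"
  shows "\<exists>K. \<forall>x\<in>S. norm x \<le> K * norm (l *\<^sub>R x - L x)"
proof -
  obtain K where K: "\<And>p. p \<in> S \<times> S \<Longrightarrow> norm p \<le> K * norm (complex_shift l L p)"
    using assms by (auto simp: resolvent_set_on_def)
  have "norm x \<le> K * norm (l *\<^sub>R x - L x)" if "x \<in> S" for x
    using K[of "(x, 0)"] that subspace_0[OF S(2)] linear_map_on_0[OF S(2) lin]
    by (simp add: complex_shift_def norm_Pair)
  then show ?thesis by blast
qed

lemma spectral_radius_less:
  assumes "spectral_radius_on S L < q" "q > 0"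
  shows "\<exists>A. \<forall>n. \<forall>x\<in>S. norm ((L ^^ n) x) \<le> A * q ^ n * norm x"
proof (rule geometric_bound[OF assms(2)])
  fix l assume l: "q \<le> l"
  have "complex_of_real l \<notin> spectrum_on S L"
  proof
    assume "complex_of_real l \<in> spectrum_on S L"
    then have "cmod l \<le> spectral_radius_on S L"
      unfolding spectral_radius_on_def by (intro cSUP_upper bdd_above_spectrum)
    then show False using l assms by simp
  qed
  then show "\<exists>K. \<forall>x\<in>S. norm x \<le> K * norm (l *\<^sub>R x - L x)"
    by (intro resolvent_bounded_below) (simp add: spectrum_on_def)
qed

text \<open>The lower bound along the orbit of \<open>x0\<close> shows that the spectrum is
  nonempty, without which the real supremum is unspecified: for an empty spectrum
  \<open>geometric_bound\<close> would apply with the rate \<open>c / 2\<close>, which the orbit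
  exceeds.\<close>

lemma spectral_radius_le:
  assumes c: "c > 0" and x0: "x0 \<in> S" "x0 \<noteq> 0" "\<And>n. c ^ n * norm x0 \<le> norm ((L ^^ n) x0)"
    and q: "q \<ge> 0" "\<And>n x. x \<in> S \<Longrightarrow> norm ((L ^^ n) x) \<le> A * q ^ n * norm x"
  shows "spectral_radius_on S L \<le> q"
  unfolding spectral_radius_on_def
proof (rule cSUP_least)
  show "spectrum_on S L \<noteq> {}"
  proof
    assume "spectrum_on S L = {}"
    then have "complex_of_real l \<in> resolvent_set_on S L" for l by (auto simp: spectrum_on_def)
    then have "\<exists>A. \<forall>n. \<forall>x\<in>S. norm ((L ^^ n) x) \<le> A * (c/2) ^ n * norm x"
      using c by (intro geometric_bound resolvent_bounded_below) auto
    then obtain A where "\<And>n. norm ((L ^^ n) x0) \<le> A * (c/2) ^ n * norm x0" using x0 by blast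
    then have "c ^ n * norm x0 \<le> A * (c/2) ^ n * norm x0" for n using x0(3)[of n] order_trans by blast
    then have "2 ^ n \<le> A" for n :: nat using c x0(2) by (simp add: power_divide field_simps)
    moreover obtain n :: nat where "A < 2 ^ n" using real_arch_pow[of 2 A] by auto
    ultimately show False using not_le by blast
  qed
qed (use spectrum_bound q in blast)

end

section \<open>Almost periodic functions\<close>

lemma relatively_dense_mono: "relatively_dense S \<Longrightarrow> S \<subseteq> S' \<Longrightarrow> relatively_dense S'"
  unfolding relatively_dense_def by (elim exE, rule exI, elim conjE, intro conjI allI, assumption) (drule spec, blast)

text \<open>An almost period moves any given point into one fixed compact interval. Boundedness and
  uniform continuity on the whole line are inherited from that interval.\<close>

lemma almost_periodic_reduce:
  fixes f :: "real \<Rightarrow> 'b::real_normed_vector"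
  assumes "almost_periodic f" "\<epsilon> > 0"
  obtains l where "l > 0" "\<And>t. \<exists>\<tau>. t + \<tau> \<in> {0..l} \<and> (\<forall>r. norm (f (r + \<tau>) - f r) < \<epsilon>)"
proof -
  obtain l where l: "l > 0" "\<And>a. {a..a + l} \<inter> {\<tau>. \<forall>t. norm (f (t + \<tau>) - f t) < \<epsilon>} \<noteq> {}"
    using assms unfolding almost_periodic_def relatively_dense_def by blast
  have "\<exists>\<tau>. t + \<tau> \<in> {0..l} \<and> (\<forall>r. norm (f (r + \<tau>) - f r) < \<epsilon>)" for t
  proof -
    obtain \<tau> where "\<tau> \<in> {- t..- t + l}" "\<forall>r. norm (f (r + \<tau>) - f r) < \<epsilon>" using l(2)[of "-t"] by blast
    then show ?thesis by (intro exI[of _ \<tau>]) auto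
  qed
  with l(1) show ?thesis by (rule that)
qed

lemma almost_periodic_bounded:
  fixes f :: "real \<Rightarrow> 'b::real_normed_vector"
  assumes f: "almost_periodic f"
  obtains M where "M > 0" "\<And>t. norm (f t) \<le> M"
proof -
  obtain l where l: "l > 0" "\<And>t. \<exists>\<tau>. t + \<tau> \<in> {0..l} \<and> (\<forall>r. norm (f (r + \<tau>) - f r) < 1)"
    using almost_periodic_reduce[OF f, of 1] by auto
  have "continuous_on {0..l} f"
    using f by (auto simp: almost_periodic_def intro: continuous_on_subset)
  then have "compact (f ` {0..l})" by (rule compact_continuous_image) simp
  then obtain M where M: "M > 0" "\<And>t. t \<in> {0..l} \<Longrightarrow> norm (f t) \<le> M"
    using compact_imp_bounded bounded_pos by (metis imageI)
  have "norm (f t) \<le> M + 1" for t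
  proof -
    obtain \<tau> where "t + \<tau> \<in> {0..l}" "norm (f (t + \<tau>) - f t) < 1" using l(2)[of t] by blast
    then show ?thesis using M(2)[of "t + \<tau>"] norm_triangle_ineq2[of "f t" "f (t + \<tau>)"]
      by (simp add: norm_minus_commute)
  qed
  then show ?thesis using M(1) by (intro that[of "M + 1"]) auto
qed

lemma almost_periodic_uniformly_continuous:
  fixes f :: "real \<Rightarrow> 'b::real_normed_vector"
  assumes f: "almost_periodic f" and \<epsilon>: "\<epsilon> > 0"
  obtains \<delta> where "\<delta> > 0" "\<And>s t. \<bar>s - t\<bar> < \<delta> \<Longrightarrow> norm (f s - f t) < \<epsilon>"
proof -
  have \<epsilon>3: "\<epsilon> / 3 > 0" using \<epsilon> by simp
  obtain l where l: "l > 0" "\<And>t. \<exists>\<tau>. t + \<tau> \<in> {0..l} \<and> (\<forall>r. norm (f (r + \<tau>) - f r) < \<epsilon> / 3)"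
    using almost_periodic_reduce[OF f \<epsilon>3] by auto
  have "uniformly_continuous_on {-1..l+1} f"
    using f by (intro compact_uniformly_continuous) (auto simp: almost_periodic_def intro: continuous_on_subset)
  then obtain d where d: "d > 0" "\<And>s t. s \<in> {-1..l+1} \<Longrightarrow> t \<in> {-1..l+1} \<Longrightarrow> dist s t < d \<Longrightarrow> dist (f s) (f t) < \<epsilon> / 3"
    unfolding uniformly_continuous_on_def using \<epsilon>3 by metis
  show ?thesis
  proof (rule that[of "min d 1"])
    fix s t :: real assume st: "\<bar>s - t\<bar> < min d 1"
    obtain \<tau> where \<tau>: "t + \<tau> \<in> {0..l}" "\<And>r. norm (f (r + \<tau>) - f r) < \<epsilon> / 3" using l(2)[of t] by blast
    have "norm (f (s + \<tau>) - f (t + \<tau>)) < \<epsilon> / 3"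
      using \<tau>(1) st by (intro d(2)[of "s + \<tau>" "t + \<tau>", unfolded dist_norm]) auto
    moreover have "norm (f s - f t) \<le> norm (f s - f (s + \<tau>)) + norm (f (s + \<tau>) - f (t + \<tau>)) + norm (f (t + \<tau>) - f t)"
      using norm_triangle_ineq[of "f s - f (s + \<tau>)" "f (s + \<tau>) - f t"]
        norm_triangle_ineq[of "f (s + \<tau>) - f (t + \<tau>)" "f (t + \<tau>) - f t"] by simp
    ultimately show "norm (f s - f t) < \<epsilon>" using \<tau>(2)[of s] \<tau>(2)[of t] by (simp add: norm_minus_commute)
  qed (use d in auto)
qed

lemma almost_period_diff:
  fixes f :: "real \<Rightarrow> 'b::real_normed_vector"
  assumes "\<And>t. norm (f (t + \<tau>) - f t) < \<epsilon>" "\<And>t. norm (f (t + \<sigma>) - f t) < \<epsilon>"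
  shows "norm (f (t + (\<tau> - \<sigma>)) - f t) < 2 * \<epsilon>"
proof -
  have "norm (f (t - \<sigma> + \<tau>) - f (t - \<sigma>)) < \<epsilon>" "norm (f (t - \<sigma>) - f t) < \<epsilon>"
    using assms(1)[of "t - \<sigma>"] assms(2)[of "t - \<sigma>"] by (simp_all add: norm_minus_commute)
  moreover have "norm (f (t + (\<tau> - \<sigma>)) - f t) \<le> norm (f (t - \<sigma> + \<tau>) - f (t - \<sigma>)) + norm (f (t - \<sigma>) - f t)"
    using norm_triangle_ineq[of "f (t - \<sigma> + \<tau>) - f (t - \<sigma>)" "f (t - \<sigma>) - f t"] by (simp add: algebra_simps)
  ultimately show ?thesis by linarith
qed

text \<open>Choose an almost period of \<open>f\<close> and one of \<open>g\<close> in every interval of a fixed length. Their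
  differences fall into finitely many small cells, and two choices from the same cell
  differ by an almost period common to \<open>f\<close> and \<open>g\<close>.\<close>

lemma common_almost_periods:
  fixes f :: "real \<Rightarrow> 'b::real_normed_vector" and g :: "real \<Rightarrow> 'c::real_normed_vector"
  assumes f: "almost_periodic f" and g: "almost_periodic g" and \<epsilon>: "\<epsilon> > 0"
  shows "relatively_dense {\<tau>. (\<forall>t. norm (f (t + \<tau>) - f t) < \<epsilon>) \<and> (\<forall>t. norm (g (t + \<tau>) - g t) < \<epsilon>)}"
proof -
  have \<epsilon>4: "\<epsilon> / 4 > 0" "\<epsilon> / 2 > 0" using \<epsilon> by auto
  obtain lf where lf: "lf > 0" "\<And>a. {a..a + lf} \<inter> {\<tau>. \<forall>t. norm (f (t + \<tau>) - f t) < \<epsilon> / 4} \<noteq> {}"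
    using f \<epsilon>4 unfolding almost_periodic_def relatively_dense_def by blast
  obtain lg where lg: "lg > 0" "\<And>a. {a..a + lg} \<inter> {\<tau>. \<forall>t. norm (g (t + \<tau>) - g t) < \<epsilon> / 4} \<noteq> {}"
    using g \<epsilon>4 unfolding almost_periodic_def relatively_dense_def by blast
  obtain \<delta> where \<delta>: "\<delta> > 0" "\<And>s t. \<bar>s - t\<bar> < \<delta> \<Longrightarrow> norm (g s - g t) < \<epsilon> / 2"
    using almost_periodic_uniformly_continuous[OF g \<epsilon>4(2)] by blast
  define l where "l = max lf lg"
  have "\<forall>a. \<exists>\<tau>. \<tau> \<in> {a..a + l} \<and> (\<forall>t. norm (f (t + \<tau>) - f t) < \<epsilon> / 4)"
  proof
    fix a
    obtain \<tau> where "\<tau> \<in> {a..a + lf}" "\<forall>t. norm (f (t + \<tau>) - f t) < \<epsilon> / 4" using lf(2)[of a] by blast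
    then show "\<exists>\<tau>. \<tau> \<in> {a..a + l} \<and> (\<forall>t. norm (f (t + \<tau>) - f t) < \<epsilon> / 4)"
      by (intro exI[of _ \<tau>]) (auto simp: l_def)
  qed
  then obtain p where p: "\<And>a. p a \<in> {a..a + l}" "\<And>a t. norm (f (t + p a) - f t) < \<epsilon> / 4" by metis
  have "\<forall>a. \<exists>\<tau>. \<tau> \<in> {a..a + l} \<and> (\<forall>t. norm (g (t + \<tau>) - g t) < \<epsilon> / 4)"
  proof
    fix a
    obtain \<tau> where "\<tau> \<in> {a..a + lg}" "\<forall>t. norm (g (t + \<tau>) - g t) < \<epsilon> / 4" using lg(2)[of a] by blast
    then show "\<exists>\<tau>. \<tau> \<in> {a..a + l} \<and> (\<forall>t. norm (g (t + \<tau>) - g t) < \<epsilon> / 4)"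
      by (intro exI[of _ \<tau>]) (auto simp: l_def)
  qed
  then obtain q where q: "\<And>a. q a \<in> {a..a + l}" "\<And>a t. norm (g (t + q a) - g t) < \<epsilon> / 4" by metis
  define k where "k a = \<lfloor>(p a - q a) / \<delta>\<rfloor>" for a
  have "range k \<subseteq> {\<lfloor>- l / \<delta>\<rfloor>..\<lfloor>l / \<delta>\<rfloor>}"
  proof safe
    fix a
    have "- l \<le> p a - q a" "p a - q a \<le> l" using p(1)[of a] q(1)[of a] by auto
    then have "- l / \<delta> \<le> (p a - q a) / \<delta>" "(p a - q a) / \<delta> \<le> l / \<delta>"
      using \<delta>(1) by (intro divide_right_mono; simp)+
    then show "k a \<in> {\<lfloor>- l / \<delta>\<rfloor>..\<lfloor>l / \<delta>\<rfloor>}"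
      unfolding k_def by (simp only: atLeastAtMost_iff floor_mono)
  qed
  then have fin: "finite (range k)" by (rule finite_subset) simp
  define rep where "rep i = (SOME a. k a = i)" for i
  have rep: "k (rep (k a)) = k a" for a unfolding rep_def by (rule someI[of _ a]) simp
  define R where "R = Max ((\<lambda>i. \<bar>p (rep i)\<bar>) ` range k)"
  have R: "\<bar>p (rep (k a))\<bar> \<le> R" for a unfolding R_def using fin by (intro Max_ge) auto
  have R0: "R \<ge> 0" using R[of 0] by linarith
  have l0: "l > 0" using lf by (auto simp: l_def)
  show ?thesis
    unfolding relatively_dense_def
  proof (intro exI[of _ "l + 2 * R"] conjI allI)
    show "0 < l + 2 * R" using l0 R0 by simp
    fix b :: real
    \<comment> \<open>Starting at \<open>b + R\<close> compensates for the representative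
      \<open>p a'\<close>, whose absolute value is at most \<open>R\<close>, so that the difference
      lands in the interval beginning at \<open>b\<close>.\<close>
    define a where "a = b + R"
    define a' where "a' = rep (k a)"
    define \<tau> where "\<tau> = p a - p a'"
    have "\<tau> \<in> {b..b + (l + 2 * R)}"
      using p(1)[of a] R[of a] by (auto simp: \<tau>_def a'_def a_def)
    moreover have "norm (f (t + \<tau>) - f t) < \<epsilon>" for t
    proof -
      have "norm (f (t + \<tau>) - f t) < 2 * (\<epsilon> / 4)"
        unfolding \<tau>_def by (rule almost_period_diff) (rule p(2))+
      then show ?thesis using \<epsilon> by simp
    qed
    moreover have "norm (g (t + \<tau>) - g t) < \<epsilon>" for t
    proof -
      have 1: "norm (g (t + (q a - q a')) - g t) < 2 * (\<epsilon> / 4)"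
        by (rule almost_period_diff) (use q(2) in auto)
      have "\<lfloor>(p a - q a) / \<delta>\<rfloor> = \<lfloor>(p a' - q a') / \<delta>\<rfloor>" using rep[of a] by (simp add: k_def a'_def)
      then have "\<bar>(p a - q a) / \<delta> - (p a' - q a') / \<delta>\<bar> < 1" by linarith
      then have "\<bar>(p a - q a) - (p a' - q a')\<bar> < \<delta>"
        using \<delta>(1) by (simp add: diff_divide_distrib[symmetric] abs_less_iff field_simps)
      then have 2: "norm (g (t + \<tau>) - g (t + (q a - q a'))) < \<epsilon> / 2"
        by (intro \<delta>(2)) (simp add: \<tau>_def algebra_simps)
      have "norm (g (t + \<tau>) - g t) \<le> norm (g (t + \<tau>) - g (t + (q a - q a'))) + norm (g (t + (q a - q a')) - g t)"
        using norm_triangle_ineq[of "g (t + \<tau>) - g (t + (q a - q a'))" "g (t + (q a - q a')) - g t"] by simp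
      then show ?thesis using 1 2 by linarith
    qed
    ultimately show "{b..b + (l + 2 * R)} \<inter> {\<tau>. (\<forall>t. norm (f (t + \<tau>) - f t) < \<epsilon>) \<and> (\<forall>t. norm (g (t + \<tau>) - g t) < \<epsilon>)} \<noteq> {}"
      by blast
  qed
qed

lemma almost_periodic_Pair:
  fixes f :: "real \<Rightarrow> 'b::real_normed_vector" and g :: "real \<Rightarrow> 'c::real_normed_vector"
  assumes f: "almost_periodic f" and g: "almost_periodic g"
  shows "almost_periodic (\<lambda>t. (f t, g t))"
  unfolding almost_periodic_def
proof (intro conjI allI impI)
  show "continuous_on UNIV (\<lambda>t. (f t, g t))"
    using f g by (auto simp: almost_periodic_def intro: continuous_intros)
  fix \<epsilon> :: real assume "\<epsilon> > 0"
  then have "\<epsilon> / 2 > 0" by simp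
  from common_almost_periods[OF f g this] show "relatively_dense {\<tau>. \<forall>t. norm ((f (t + \<tau>), g (t + \<tau>)) - (f t, g t)) < \<epsilon>}"
  proof (rule relatively_dense_mono, safe)
    fix \<tau> t assume "\<forall>t. norm (f (t + \<tau>) - f t) < \<epsilon> / 2" "\<forall>t. norm (g (t + \<tau>) - g t) < \<epsilon> / 2"
    then have "norm (f (t + \<tau>) - f t) < \<epsilon> / 2" "norm (g (t + \<tau>) - g t) < \<epsilon> / 2" by auto
    moreover have "norm ((f (t + \<tau>), g (t + \<tau>)) - (f t, g t)) \<le> norm (f (t + \<tau>) - f t) + norm (g (t + \<tau>) - g t)"
      by (simp add: norm_Pair_le)
    ultimately show "norm ((f (t + \<tau>), g (t + \<tau>)) - (f t, g t)) < \<epsilon>" by linarith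
  qed
qed

text \<open>The hypothesis on translations yields continuity as well: by uniform continuity of
  \<open>f\<close> every sufficiently small translation is an almost period of \<open>f\<close> for
  the tolerance \<delta>, hence one of \<open>h\<close>.\<close>

lemma almost_periodic_transfer:
  fixes f :: "real \<Rightarrow> 'b::real_normed_vector" and h :: "real \<Rightarrow> 'c::real_normed_vector"
  assumes f: "almost_periodic f"
    and h: "\<And>\<epsilon>. \<epsilon> > 0 \<Longrightarrow> \<exists>\<delta>>0. \<forall>\<tau>. (\<forall>t. norm (f (t + \<tau>) - f t) < \<delta>) \<longrightarrow> (\<forall>t. norm (h (t + \<tau>) - h t) < \<epsilon>)"
  shows "almost_periodic h"
  unfolding almost_periodic_def
proof (intro conjI allI impI)
  show "continuous_on UNIV h"
    unfolding continuous_on_iff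
  proof (intro ballI allI impI)
    fix x \<epsilon> :: real assume "\<epsilon> > 0"
    from h[OF this] obtain \<delta> where \<delta>: "\<delta> > 0"
      "\<And>\<tau>. (\<forall>t. norm (f (t + \<tau>) - f t) < \<delta>) \<Longrightarrow> (\<forall>t. norm (h (t + \<tau>) - h t) < \<epsilon>)" by blast
    obtain d where d: "d > 0" "\<And>s t. \<bar>s - t\<bar> < d \<Longrightarrow> norm (f s - f t) < \<delta>"
      using almost_periodic_uniformly_continuous[OF f \<delta>(1)] by blast
    have "dist (h y) (h x) < \<epsilon>" if "dist y x < d" for y
      using \<delta>(2)[of "y - x"] d(2) that by (auto simp: dist_norm dest: spec[of _ x])
    then show "\<exists>d>0. \<forall>x'\<in>UNIV. dist x' x < d \<longrightarrow> dist (h x') (h x) < \<epsilon>" using d(1) by blast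
  qed
  fix \<epsilon> :: real assume "\<epsilon> > 0"
  from h[OF this] obtain \<delta> where \<delta>: "\<delta> > 0"
    "\<And>\<tau>. (\<forall>t. norm (f (t + \<tau>) - f t) < \<delta>) \<Longrightarrow> (\<forall>t. norm (h (t + \<tau>) - h t) < \<epsilon>)" by blast
  show "relatively_dense {\<tau>. \<forall>t. norm (h (t + \<tau>) - h t) < \<epsilon>}"
    by (rule relatively_dense_mono[of "{\<tau>. \<forall>t. norm (f (t + \<tau>) - f t) < \<delta>}"])
       (use f \<delta> in \<open>auto simp: almost_periodic_def\<close>)
qed

lemma almost_periodic_lipschitz:
  fixes f :: "real \<Rightarrow> 'b::real_normed_vector" and F :: "'b \<Rightarrow> 'c::real_normed_vector"
  assumes f: "almost_periodic f" and F: "\<And>x y. norm (F x - F y) \<le> K * norm (x - y)"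
  shows "almost_periodic (\<lambda>t. F (f t))"
proof (rule almost_periodic_transfer[OF f])
  fix \<epsilon> :: real assume \<epsilon>: "\<epsilon> > 0"
  show "\<exists>\<delta>>0. \<forall>\<tau>. (\<forall>t. norm (f (t + \<tau>) - f t) < \<delta>) \<longrightarrow> (\<forall>t. norm (F (f (t + \<tau>)) - F (f t)) < \<epsilon>)"
  proof (intro exI[of _ "\<epsilon> / (\<bar>K\<bar> + 1)"] conjI allI impI)
    show "0 < \<epsilon> / (\<bar>K\<bar> + 1)" using \<epsilon> by simp
    fix \<tau> t assume "\<forall>t. norm (f (t + \<tau>) - f t) < \<epsilon> / (\<bar>K\<bar> + 1)"
    then have "norm (f (t + \<tau>) - f t) < \<epsilon> / (\<bar>K\<bar> + 1)" by blast
    moreover have "\<bar>K\<bar> + 1 > 0" by simp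
    ultimately have "(\<bar>K\<bar> + 1) * norm (f (t + \<tau>) - f t) < \<epsilon>"
      by (simp only: pos_less_divide_eq mult.commute)
    moreover have "K * norm (f (t + \<tau>) - f t) \<le> (\<bar>K\<bar> + 1) * norm (f (t + \<tau>) - f t)"
      by (intro mult_right_mono) auto
    ultimately show "norm (F (f (t + \<tau>)) - F (f t)) < \<epsilon>" using F[of "f (t + \<tau>)" "f t"] by linarith
  qed
qed

lemma almost_periodic_add:
  fixes f g :: "real \<Rightarrow> 'b::real_normed_vector"
  assumes "almost_periodic f" "almost_periodic g"
  shows "almost_periodic (\<lambda>t. f t + g t)"
proof -
  have "almost_periodic (\<lambda>t. (\<lambda>p. fst p + snd p) (f t, g t))"
  proof (rule almost_periodic_lipschitz[OF almost_periodic_Pair[OF assms]])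
    fix x y :: "'b \<times> 'b"
    have e: "fst x + snd x - (fst y + snd y) = fst (x - y) + snd (x - y)" by simp
    show "norm (fst x + snd x - (fst y + snd y)) \<le> 2 * norm (x - y)"
      using norm_triangle_ineq[of "fst (x - y)" "snd (x - y)"]
        norm_fst_le[of "fst (x - y)" "snd (x - y)"] norm_snd_le[of "snd (x - y)" "fst (x - y)"]
      unfolding prod.collapse e by linarith
  qed
  then show ?thesis by simp
qed

lemma periodic_imp_almost_periodic:
  fixes f :: "real \<Rightarrow> 'b::real_normed_vector"
  assumes f: "continuous_on UNIV f" and p: "p > 0" "\<And>t. f (t + p) = f t"
  shows "almost_periodic f"
  unfolding almost_periodic_def
proof (intro conjI allI impI f)
  have n: "f (t + real n * p) = f t" for n t
  proof (induction n)
    case (Suc n)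
    have "t + real (Suc n) * p = (t + real n * p) + p" by (simp add: algebra_simps)
    then show ?case using p(2) Suc by metis
  qed simp
  have i: "f (t + of_int k * p) = f t" for k t
  proof (cases "k \<ge> 0")
    case True
    then show ?thesis using n[of t "nat k"] by simp
  next
    case False
    then show ?thesis using n[of "t + of_int k * p" "nat (- k)"] by (simp add: algebra_simps)
  qed
  fix \<epsilon> :: real assume "\<epsilon> > 0"
  show "relatively_dense {\<tau>. \<forall>t. norm (f (t + \<tau>) - f t) < \<epsilon>}"
    unfolding relatively_dense_def
  proof (intro exI[of _ p] conjI allI p(1))
    fix a
    have "a / p \<le> of_int \<lceil>a / p\<rceil>" "of_int \<lceil>a / p\<rceil> \<le> a / p + 1" by linarith+
    then have "a / p * p \<le> of_int \<lceil>a / p\<rceil> * p" "of_int \<lceil>a / p\<rceil> * p \<le> (a / p + 1) * p"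
      using p(1) by (intro mult_right_mono; simp)+
    then have "of_int \<lceil>a / p\<rceil> * p \<in> {a..a + p}" using p(1) by (simp add: distrib_right)
    then show "{a..a + p} \<inter> {\<tau>. \<forall>t. norm (f (t + \<tau>) - f t) < \<epsilon>} \<noteq> {}"
      using i \<open>\<epsilon> > 0\<close> by auto
  qed
qed

lemma closed_almost_periodic: "closed {\<psi> :: real \<Rightarrow>\<^sub>C 'b::real_normed_vector. almost_periodic (apply_bcontfun \<psi>)}"
  unfolding closed_sequential_limits
proof safe
  fix x :: "nat \<Rightarrow> real \<Rightarrow>\<^sub>C 'b" and \<psi>
  assume x: "\<forall>n. x n \<in> {\<psi>. almost_periodic (apply_bcontfun \<psi>)}" and lim: "x \<longlonglongrightarrow> \<psi>"
  show "almost_periodic (apply_bcontfun \<psi>)"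
    unfolding almost_periodic_def
  proof (intro conjI allI impI)
    fix \<epsilon> :: real assume \<epsilon>: "\<epsilon> > 0"
    then have "\<epsilon> / 3 > 0" by simp
    then obtain n where n: "dist (x n) \<psi> < \<epsilon> / 3" using metric_LIMSEQ_D[OF lim] by blast
    have d: "norm (\<psi> t - x n t) < \<epsilon> / 3" for t
      using dist_fun_lt_imp_dist_val_lt[OF n, of t] by (simp add: dist_norm norm_minus_commute)
    have "relatively_dense {\<tau>. \<forall>t. norm (x n (t + \<tau>) - x n t) < \<epsilon> / 3}"
      using x \<open>\<epsilon> / 3 > 0\<close> unfolding almost_periodic_def by blast
    then show "relatively_dense {\<tau>. \<forall>t. norm (\<psi> (t + \<tau>) - \<psi> t) < \<epsilon>}"
    proof (rule relatively_dense_mono, safe)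
      fix \<tau> t assume "\<forall>t. norm (x n (t + \<tau>) - x n t) < \<epsilon> / 3"
      then have "norm (x n (t + \<tau>) - x n t) < \<epsilon> / 3" by blast
      moreover have "norm (\<psi> (t + \<tau>) - \<psi> t) \<le> norm (\<psi> (t + \<tau>) - x n (t + \<tau>)) + norm (x n (t + \<tau>) - x n t) + norm (x n t - \<psi> t)"
        using norm_triangle_ineq[of "\<psi> (t + \<tau>) - x n (t + \<tau>)" "x n (t + \<tau>) - \<psi> t"]
          norm_triangle_ineq[of "x n (t + \<tau>) - x n t" "x n t - \<psi> t"] by simp
      ultimately show "norm (\<psi> (t + \<tau>) - \<psi> t) < \<epsilon>" using d[of "t + \<tau>"] d[of t] by (simp add: norm_minus_commute)
    qed
  qed simp
qed

section \<open>The renewal operator\<close>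

lemma rep_Linf_bounded [simp]: "ess_bounded (rep_Linf u)"
  using Quotient3_rep_reflp[OF Quotient3_Linf, where a = u] by simp

lemma abs_rep_Linf [simp]: "abs_Linf (rep_Linf u) = u"
  by (rule Quotient3_abs_rep[OF Quotient3_Linf])

lemma rep_abs_Linf: "ess_bounded f \<Longrightarrow> AE x in lebesgue. rep_Linf (abs_Linf f) x = f x"
  using Quotient3_rep_abs[OF Quotient3_Linf, where r = f] by simp

lemma rep_Linf_measurable [measurable]: "rep_Linf u \<in> borel_measurable lebesgue"
  using rep_Linf_bounded[of u] by (simp add: ess_bounded_def)

lemma rep_Linf_norm: "AE x in lebesgue. \<bar>rep_Linf u x\<bar> \<le> norm u"
proof -
  have "norm u = real_of_ereal (esssup lebesgue (\<lambda>x. ereal \<bar>rep_Linf u x\<bar>))"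
    using norm_Linf.abs_eq[of "rep_Linf u"] by simp
  then have "ereal (norm u) = esssup lebesgue (\<lambda>x. ereal \<bar>rep_Linf u x\<bar>)"
    using esssup_finite[of "rep_Linf u"] by simp
  then have "AE x in lebesgue. ereal \<bar>rep_Linf u x\<bar> \<le> ereal (norm u)"
    using esssup_AE[of "\<lambda>x. ereal \<bar>rep_Linf u x\<bar>" lebesgue] by simp
  then show ?thesis by simp
qed

lemma rep_Linf_diff: "AE x in lebesgue. rep_Linf (u - v) x = rep_Linf u x - rep_Linf v x"
proof -
  have b: "ess_bounded (\<lambda>x. (-1) * rep_Linf v x)" by (rule ess_bounded_scale) simp
  have "u - v = abs_Linf (rep_Linf u) + (-1) *\<^sub>R abs_Linf (rep_Linf v)"
    by (simp only: minus_Linf_def uminus_Linf_def abs_rep_Linf)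
  also have "(-1) *\<^sub>R abs_Linf (rep_Linf v) = abs_Linf (\<lambda>x. (-1) * rep_Linf v x)"
    by (rule scaleR_Linf.abs_eq) simp
  also have "abs_Linf (rep_Linf u) + \<dots> = abs_Linf (\<lambda>x. rep_Linf u x + (-1) * rep_Linf v x)"
    by (rule plus_Linf.abs_eq) (use b in auto)
  finally show ?thesis
    using rep_abs_Linf[OF ess_bounded_add[OF rep_Linf_bounded[of u] b]] by simp
qed

lemma compact_continuous_norm_bound:
  fixes f :: "'a::topological_space \<Rightarrow> 'b::real_normed_vector"
  assumes "compact S" "continuous_on S f"
  obtains B where "B > 0" "\<And>x. x \<in> S \<Longrightarrow> norm (f x) \<le> B"
proof -
  have "bounded (f ` S)" by (intro compact_imp_bounded compact_continuous_image assms)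
  then obtain B where "B > 0" "\<forall>y\<in>f ` S. norm y \<le> B" unfolding bounded_pos by blast
  then show ?thesis by (intro that[of B]) auto
qed

text \<open>Abstracts the nonnegative functions in a space of square-integrable functions, with
  \<open>pp\<close> the positive part. Self-duality allows an order relation to be tested by inner
  products, which pass through Bochner integrals; \<open>pp_split\<close> and \<open>pp_orth\<close>
  are the orthogonal decomposition of Moreau.\<close>

locale self_dual_cone =
  fixes nn :: "'e::{real_inner, banach, second_countable_topology} \<Rightarrow> bool" and pp :: "'e \<Rightarrow> 'e"
  assumes self_dual: "nn x \<longleftrightarrow> (\<forall>z. nn z \<longrightarrow> 0 \<le> inner x z)"
    and pp_nn: "nn (pp x)" and pp_split: "pp x - pp (- x) = x"
    and pp_orth: "inner (pp x) (pp (- x)) = 0"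
begin

abbreviation le (infix "\<preceq>" 50) where "x \<preceq> y \<equiv> nn (y - x)"

lemma nn_inner: "nn x \<Longrightarrow> nn z \<Longrightarrow> 0 \<le> inner x z"
  using self_dual by blast

lemma nn_0: "nn 0" by (subst self_dual) simp

lemma nn_add: "nn x \<Longrightarrow> nn y \<Longrightarrow> nn (x + y)"
  by (subst self_dual) (simp add: inner_add_left nn_inner)

lemma nn_scale: "c \<ge> 0 \<Longrightarrow> nn x \<Longrightarrow> nn (c *\<^sub>R x)"
  by (subst self_dual) (simp add: nn_inner)

lemma nn_sum: "(\<And>i. i \<in> I \<Longrightarrow> nn (x i)) \<Longrightarrow> nn (\<Sum>i\<in>I. x i)"
  by (induction I rule: infinite_finite_induct) (auto intro: nn_0 nn_add)

lemma le_trans: "x \<preceq> y \<Longrightarrow> y \<preceq> z \<Longrightarrow> x \<preceq> z"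
  using nn_add[of "y - x" "z - y"] by simp

lemma le_scale: "c \<ge> 0 \<Longrightarrow> x \<preceq> y \<Longrightarrow> c *\<^sub>R x \<preceq> c *\<^sub>R y"
  using nn_scale[of c "y - x"] by (simp add: scaleR_diff_right)

lemma le_scale_left: "b \<le> c \<Longrightarrow> nn x \<Longrightarrow> b *\<^sub>R x \<preceq> c *\<^sub>R x"
  using nn_scale[of "c - b" x] by (simp add: scaleR_diff_left)

lemma nn_mono_norm:
  assumes "nn x" "x \<preceq> y" shows "norm x \<le> norm y"
proof -
  have "inner y y = inner x x + 2 * inner x (y - x) + inner (y - x) (y - x)"
    by (simp add: inner_diff_left inner_diff_right inner_commute)
  then have "inner x x \<le> inner y y" using nn_inner[OF assms] by (simp add: inner_ge_zero)
  then show ?thesis by (simp add: norm_le)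
qed

text \<open>Testing \<open>y - x\<close> with \<open>pp x\<close> shows that the positive part is
  the norm-smallest nonnegative majorant. This turns an order inequality for a negative part into a
  norm inequality, to which Gronwall arguments apply when positivity is to be proved.\<close>

lemma nn_pp_minimal:
  assumes "nn y" "x \<preceq> y" shows "norm (pp x) \<le> norm y"
proof -
  have "inner x (pp x) = inner (pp x) (pp x)"
    using pp_orth[of x] pp_split[of x] by (metis diff_zero inner_commute inner_diff_left)
  moreover have "0 \<le> inner (y - x) (pp x)" by (intro nn_inner assms pp_nn)
  ultimately have "inner (pp x) (pp x) \<le> inner y (pp x)" by (simp add: inner_diff_left)
  also have "\<dots> \<le> norm y * norm (pp x)" by (rule norm_cauchy_schwarz)
  finally have "norm (pp x) * norm (pp x) \<le> norm y * norm (pp x)" by (simp add: dot_square_norm power2_eq_square)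
  then show ?thesis by (cases "norm (pp x) = 0") auto
qed

text \<open>\<open>pp\<close> is the metric projection onto the cone, hence nonexpansive; the mixed
  terms dropped in the estimate, such as \<open>inner (pp (- x)) (pp y)\<close>, are
  nonnegative.\<close>

lemma pp_lipschitz: "norm (pp x - pp y) \<le> norm (x - y)"
proof -
  let ?u = "pp x" and ?v = "pp y" and ?u' = "pp (- x)" and ?v' = "pp (- y)"
  have "inner (x - y) (?u - ?v) = inner ((?u - ?u') - (?v - ?v')) (?u - ?v)"
    by (simp add: pp_split)
  also have "\<dots> = inner (?u - ?v) (?u - ?v) + inner ?u' ?v + inner ?v' ?u - inner ?u ?u' - inner ?v ?v'"
    by (simp add: inner_diff_left inner_diff_right inner_commute)
  finally have "inner (?u - ?v) (?u - ?v) \<le> inner (x - y) (?u - ?v)"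
    using nn_inner[OF pp_nn pp_nn, of "-x" y] nn_inner[OF pp_nn pp_nn, of "-y" x] pp_orth by simp
  also have "\<dots> \<le> norm (x - y) * norm (?u - ?v)" by (rule norm_cauchy_schwarz)
  finally have "norm (?u - ?v) * norm (?u - ?v) \<le> norm (x - y) * norm (?u - ?v)"
    by (simp add: dot_square_norm power2_eq_square)
  then show ?thesis by (cases "norm (?u - ?v) = 0") auto
qed

lemma pp_0: "pp 0 = 0"
  using pp_orth[of 0] by simp

lemma pp_norm: "norm (pp x) \<le> norm x"
  using pp_lipschitz[of x 0] by (simp add: pp_0)

lemma continuous_on_pp [continuous_intros]: "continuous_on S f \<Longrightarrow> continuous_on S (\<lambda>x. pp (f x))"
proof -
  have "1-lipschitz_on UNIV pp" by (rule lipschitz_onI) (auto simp: dist_norm pp_lipschitz)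
  then have "continuous_on UNIV pp" by (rule lipschitz_on_continuous_on)
  then show "continuous_on S f \<Longrightarrow> continuous_on S (\<lambda>x. pp (f x))"
    by (rule continuous_on_compose2) auto
qed

lemma nn_iff_pp: "nn x \<longleftrightarrow> pp (- x) = 0"
  using nn_pp_minimal[OF nn_0, of "-x"] pp_nn[of x] pp_split[of x] by auto

lemma nn_integral:
  assumes "integrable M f" "AE a in M. nn (f a)" shows "nn (LINT a|M. f a)"
proof (subst self_dual, intro allI impI)
  fix z assume z: "nn z"
  have "0 \<le> (LINT a|M. inner (f a) z)"
    by (rule integral_nonneg_AE) (use assms(2) z in \<open>auto elim!: eventually_mono intro: nn_inner\<close>)
  then show "0 \<le> inner (LINT a|M. f a) z" using assms(1) by simp
qed

lemma le_integral:
  assumes "integrable M f" "integrable M g" "AE a in M. f a \<preceq> g a"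
  shows "(LINT a|M. f a) \<preceq> (LINT a|M. g a)"
  using nn_integral[of M "\<lambda>a. g a - f a"] assms by simp

end

text \<open>\<open>T\<close> is a semigroup composed with a projection; the fixed vectors of
  \<open>T 0\<close> form the actual state space. \<open>T_ge\<close> expresses that the generator
  is positive up to the loss term \<open>- d\<close>, \<open>H\<close> is an antiderivative of the
  mortality, and \<open>x0\<close> is a positive vector on which iterates of the renewal operator
  can be bounded from below.\<close>

locale renewal = self_dual_cone nn pp
  for nn :: "'e::{real_inner, banach, second_countable_topology} \<Rightarrow> bool" and pp +
  fixes T :: "real \<Rightarrow> 'e \<Rightarrow> 'e" and \<beta> :: "real \<Rightarrow> real Linf" and \<mu> H :: "real \<Rightarrow> real"
    and ap d \<kappa> \<epsilon>0 \<beta>m \<mu>m :: real and x0 :: 'e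
  assumes ap: "ap > 0" and \<kappa>: "\<kappa> \<ge> 0" and d: "d \<ge> 0"
    and T_lin: "\<And>a. a \<ge> 0 \<Longrightarrow> bounded_linear (T a)"
    and T_norm: "\<And>a x. a \<ge> 0 \<Longrightarrow> norm (T a x) \<le> exp (\<kappa> * a) * norm x"
    and T_cont: "\<And>x. continuous_on {0..} (\<lambda>a. T a x)"
    and T_add: "\<And>s t x. s \<ge> 0 \<Longrightarrow> t \<ge> 0 \<Longrightarrow> T (s + t) x = T s (T t x)"
    and T_nn: "\<And>a x. a \<ge> 0 \<Longrightarrow> nn x \<Longrightarrow> nn (T a x)"
    and T_ge: "\<And>a x. a \<ge> 0 \<Longrightarrow> nn x \<Longrightarrow> exp (- d * a) *\<^sub>R T 0 x \<preceq> T a x"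
    and T0_pp: "\<And>x. T 0 x = x \<Longrightarrow> T 0 (pp x) = pp x"
    and \<beta>_AP: "almost_periodic \<beta>" and \<beta>_nn: "\<And>t. AE a in lebesgue. 0 \<le> rep_Linf (\<beta> t) a"
    and \<beta>_ge: "\<And>t. AE a in lebesgue. a \<in> {0<..<ap} \<longrightarrow> \<epsilon>0 \<le> rep_Linf (\<beta> t) a"
    and \<epsilon>0: "\<epsilon>0 > 0" and \<beta>m: "\<And>t. norm (\<beta> t) \<le> \<beta>m" "\<beta>m > 0"
    and \<mu>_AP: "almost_periodic \<mu>" and \<mu>: "\<And>t. 0 \<le> \<mu> t" "\<And>t. \<mu> t \<le> \<mu>m"
    and H: "\<And>t. (H has_real_derivative \<mu> t) (at t)"
    and x0: "T 0 x0 = x0" "nn x0" "x0 \<noteq> 0"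
begin

abbreviation M :: "real measure" where "M \<equiv> lebesgue_on {0<..<ap}"

definition K where "K = exp (\<kappa> * ap)"

lemma K1: "K \<ge> 1" using \<kappa> ap by (simp add: K_def)

lemma T_K: "0 \<le> a \<Longrightarrow> a \<le> ap \<Longrightarrow> norm (T a x) \<le> K * norm x"
  using T_norm[of a x] mult_right_mono[of "exp (\<kappa> * a)" K "norm x"] \<kappa>
  by (simp add: K_def mult_left_mono)

lemma T_diff: "a \<ge> 0 \<Longrightarrow> T a (x - y) = T a x - T a y"
  by (rule linear_diff[OF bounded_linear.linear[OF T_lin]])
lemma T_plus: "a \<ge> 0 \<Longrightarrow> T a (x + y) = T a x + T a y"
  by (rule linear_add[OF bounded_linear.linear[OF T_lin]])
lemma T_scaleR: "a \<ge> 0 \<Longrightarrow> T a (c *\<^sub>R x) = c *\<^sub>R T a x"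
  by (rule linear_scale[OF bounded_linear.linear[OF T_lin]])
lemma T_zero: "a \<ge> 0 \<Longrightarrow> T a 0 = 0"
  by (rule linear_0[OF bounded_linear.linear[OF T_lin]])
lemma T_T0: "a \<ge> 0 \<Longrightarrow> T a (T 0 x) = T a x"
  using T_add[of a 0 x] by simp
lemma T0_T: "a \<ge> 0 \<Longrightarrow> T 0 (T a x) = T a x"
  using T_add[of 0 a x] by simp
lemma T0_norm: "norm (T 0 x) \<le> norm x"
  using T_norm[of 0 x] by simp

lemma T_mono: "a \<ge> 0 \<Longrightarrow> x \<preceq> y \<Longrightarrow> T a x \<preceq> T a y"
  using T_nn[of a "y - x"] by (simp add: T_diff)

text \<open>Clamping the age at 0 gives a map that is jointly continuous everywhere, so continuity
  and measurability of later integrands follow by composition.\<close>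

lemma continuous_on_T_pair: "continuous_on UNIV (\<lambda>p. T (max 0 (fst p)) (snd p))"
proof (subst continuous_on_eq_continuous_within, intro ballI)
  fix p0 :: "real \<times> 'e"
  define a where "a = max 0 (fst p0)"
  let ?f = "\<lambda>p. T (max 0 (fst p)) (snd p)"
  have c1: "((\<lambda>p. T (max 0 (fst p)) (snd p0)) \<longlongrightarrow> T (max 0 (fst p0)) (snd p0)) (at p0)"
  proof -
    have "continuous_on UNIV (\<lambda>p::real \<times> 'e. T (max 0 (fst p)) (snd p0))"
      by (rule continuous_on_compose2[OF T_cont]) (auto intro!: continuous_intros)
    then have "continuous (at p0) (\<lambda>p. T (max 0 (fst p)) (snd p0))"
      unfolding continuous_on_eq_continuous_within by blast
    then show ?thesis by (simp only: continuous_within)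
  qed
  have "((\<lambda>p. ?f p - ?f p0) \<longlongrightarrow> 0) (at p0)"
  proof (rule Lim_null_comparison)
    show "\<forall>\<^sub>F p in at p0. norm (?f p - ?f p0) \<le> exp (\<kappa> * max 0 (fst p)) * norm (snd p - snd p0)
        + norm (T (max 0 (fst p)) (snd p0) - T (max 0 (fst p0)) (snd p0))"
    proof (rule always_eventually, intro allI)
      fix p
      have "?f p - ?f p0 = T (max 0 (fst p)) (snd p - snd p0) + (T (max 0 (fst p)) (snd p0) - T (max 0 (fst p0)) (snd p0))"
        by (simp add: T_diff)
      then have "norm (?f p - ?f p0) \<le> norm (T (max 0 (fst p)) (snd p - snd p0)) + norm (T (max 0 (fst p)) (snd p0) - T (max 0 (fst p0)) (snd p0))"
        by (simp only: norm_triangle_ineq)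
      then show "norm (?f p - ?f p0) \<le> exp (\<kappa> * max 0 (fst p)) * norm (snd p - snd p0)
        + norm (T (max 0 (fst p)) (snd p0) - T (max 0 (fst p0)) (snd p0))"
        using T_norm[of "max 0 (fst p)" "snd p - snd p0"] by simp
    qed
    have "((\<lambda>p. exp (\<kappa> * max 0 (fst p)) * norm (snd p - snd p0)
        + norm (T (max 0 (fst p)) (snd p0) - T (max 0 (fst p0)) (snd p0))) \<longlongrightarrow>
        exp (\<kappa> * max 0 (fst p0)) * norm (snd p0 - snd p0) + norm (T (max 0 (fst p0)) (snd p0) - T (max 0 (fst p0)) (snd p0))) (at p0)"
      by (intro tendsto_intros c1 tendsto_max)
    then show "((\<lambda>p. exp (\<kappa> * max 0 (fst p)) * norm (snd p - snd p0)
        + norm (T (max 0 (fst p)) (snd p0) - T (max 0 (fst p0)) (snd p0))) \<longlongrightarrow> 0) (at p0)" by simp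
  qed
  then show "continuous (at p0) ?f" by (simp add: continuous_within LIM_zero_iff)
qed

lemma continuous_on_Tmax:
  assumes "continuous_on S g" "continuous_on S f"
  shows "continuous_on S (\<lambda>s. T (max 0 (g s)) (f s))"
proof -
  have "continuous_on S (\<lambda>s. (\<lambda>p. T (max 0 (fst p)) (snd p)) (g s, f s))"
    by (rule continuous_on_compose2[OF continuous_on_T_pair]) (auto intro!: continuous_intros assms)
  then show ?thesis by simp
qed

lemma continuous_on_T:
  assumes "continuous_on S g" "continuous_on S f" "\<And>s. s \<in> S \<Longrightarrow> g s \<ge> 0"
  shows "continuous_on S (\<lambda>s. T (g s) (f s))"
  using continuous_on_Tmax[OF assms(1,2)] assms(3) by (simp add: max_absorb2 cong: continuous_on_cong)

lemma measurable_Tmax: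
  assumes "g \<in> borel_measurable N" "f \<in> borel_measurable N"
  shows "(\<lambda>s. T (max 0 (g s)) (f s)) \<in> borel_measurable N"
proof -
  have "(\<lambda>p. T (max 0 (fst p)) (snd p)) \<in> borel_measurable borel"
    by (rule borel_measurable_continuous_onI[OF continuous_on_T_pair])
  moreover have "(\<lambda>s. (g s, f s)) \<in> borel_measurable N"
    using assms by (rule borel_measurable_Pair)
  ultimately have "(\<lambda>s. (\<lambda>p. T (max 0 (fst p)) (snd p)) (g s, f s)) \<in> borel_measurable N"
    by (rule measurable_compose[rotated])
  then show ?thesis by simp
qed

lemma continuous_on_H: "continuous_on S H"
  using H by (meson DERIV_isCont continuous_at_imp_continuous_on)

lemma H_diff: "s \<le> t \<Longrightarrow> 0 \<le> H t - H s \<and> H t - H s \<le> \<mu>m * (t - s)"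
proof (cases "s = t")
  case False
  assume "s \<le> t"
  then have "s < t" using False by simp
  then obtain z where "H t - H s = (t - s) * \<mu> z" using MVT2[of s t H \<mu>] H by blast
  then show ?thesis using \<open>s < t\<close> \<mu>[of z] by (simp add: mult.commute mult_left_mono)
qed simp

lemma \<mu>m0: "\<mu>m \<ge> 0" using \<mu>[of 0] by linarith

lemma finite_M: "finite_measure M"
  by (rule finite_measureI) (use ap in \<open>simp add: emeasure_restrict_space\<close>)

sublocale M: finite_measure M by (rule finite_M)

lemma measure_M: "measure M (space M) = ap"
  using ap by (simp add: measure_restrict_space)

lemma AE_M: "(AE a in lebesgue. a \<in> {0<..<ap} \<longrightarrow> P a) \<Longrightarrow> AE a in M. P a"
  by (subst AE_restrict_space_iff) auto

lemma AE_M': "(AE a in lebesgue. P a) \<Longrightarrow> AE a in M. P a"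
  by (rule AE_M) auto

lemma AE_M_I: "(\<And>a. 0 < a \<Longrightarrow> a < ap \<Longrightarrow> P a) \<Longrightarrow> AE a in M. P a"
  by (rule AE_I2) (auto simp: space_restrict_space)

lemma borel_M: "f \<in> borel_measurable lebesgue \<Longrightarrow> f \<in> borel_measurable M"
  by (rule measurable_restrict_space1)

lemma borel_M': "f \<in> borel_measurable borel \<Longrightarrow> f \<in> borel_measurable M"
  by (rule borel_M, rule measurable_completion) simp

lemma integrable_M_continuous:
  fixes g :: "real \<Rightarrow> 'b::{banach, second_countable_topology}"
  assumes "continuous_on UNIV g" shows "integrable M g"
proof -
  have m: "g \<in> borel_measurable M" using assms by (intro borel_M' borel_measurable_continuous_onI)
  obtain B where B: "\<And>a. a \<in> {0..ap} \<Longrightarrow> norm (g a) \<le> B"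
    using compact_continuous_norm_bound[of "{0..ap}" g] continuous_on_subset[OF assms] by (metis compact_Icc top_greatest)
  show ?thesis
    by (rule M.integrable_const_bound[where B = B]) (auto intro!: AE_M_I B m)
qed

lemma integral_M_const: "(LINT a|M. c) = ap *\<^sub>R (c :: 'b::{banach, second_countable_topology})"
  using measure_M by (subst lebesgue_integral_const) simp

section \<open>Births produced by an age distribution\<close>

definition birth :: "real \<Rightarrow> (real \<Rightarrow> 'e) \<Rightarrow> 'e" where
  "birth t g = (LINT a|M. rep_Linf (\<beta> t) a *\<^sub>R g a)"

lemma \<beta>_M: "AE a in M. 0 \<le> rep_Linf (\<beta> t) a \<and> \<epsilon>0 \<le> rep_Linf (\<beta> t) a \<and> rep_Linf (\<beta> t) a \<le> \<beta>m"
proof -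
  have "AE a in lebesgue. a \<in> {0<..<ap} \<longrightarrow> 0 \<le> rep_Linf (\<beta> t) a \<and> \<epsilon>0 \<le> rep_Linf (\<beta> t) a \<and> rep_Linf (\<beta> t) a \<le> \<beta>m"
    using \<beta>_nn[of t] \<beta>_ge[of t] rep_Linf_norm[of "\<beta> t"] by eventually_elim (use \<beta>m(1)[of t] in auto)
  then show ?thesis by (rule AE_M)
qed

lemma integrable_Linf:
  fixes g :: "real \<Rightarrow> 'e"
  assumes g: "integrable M g" shows "integrable M (\<lambda>a. rep_Linf u a *\<^sub>R g a)"
proof (rule Bochner_Integration.integrable_bound)
  show "integrable M (\<lambda>a. norm u * norm (g a))" using g by simp
  show "(\<lambda>a. rep_Linf u a *\<^sub>R g a) \<in> borel_measurable M"
    using borel_M[OF rep_Linf_measurable[of u]] borel_measurable_integrable[OF g]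
    by (rule borel_measurable_scaleR)
  show "AE a in M. norm (rep_Linf u a *\<^sub>R g a) \<le> norm (norm u * norm (g a))"
    using AE_M'[OF rep_Linf_norm[of u]] by eventually_elim (simp add: mult_right_mono)
qed

lemma norm_integral_Linf:
  fixes g :: "real \<Rightarrow> 'e"
  assumes g: "integrable M g"
  shows "norm (LINT a|M. rep_Linf u a *\<^sub>R g a) \<le> norm u * (LINT a|M. norm (g a))"
proof -
  have "norm (LINT a|M. rep_Linf u a *\<^sub>R g a) \<le> (LINT a|M. norm (rep_Linf u a *\<^sub>R g a))"
    by (rule integral_norm_bound)
  also have "\<dots> \<le> (LINT a|M. norm u * norm (g a))"
  proof (rule integral_mono_AE)
    show "AE a in M. norm (rep_Linf u a *\<^sub>R g a) \<le> norm u * norm (g a)"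
      using AE_M'[OF rep_Linf_norm[of u]] by eventually_elim (simp add: mult_right_mono)
    show "integrable M (\<lambda>a. norm (rep_Linf u a *\<^sub>R g a))"
      by (rule integrable_norm[OF integrable_Linf[OF g]])
    show "integrable M (\<lambda>a. norm u * norm (g a))"
      by (intro integrable_mult_right integrable_norm g)
  qed
  finally show ?thesis by simp
qed

lemma birth_norm: "integrable M g \<Longrightarrow> norm (birth t g) \<le> \<beta>m * (LINT a|M. norm (g a))"
  unfolding birth_def
  using norm_integral_Linf[of g "\<beta> t"] \<beta>m(1)[of t] mult_right_mono[of "norm (\<beta> t)" \<beta>m "LINT a|M. norm (g a)"]
  by fastforce

lemma birth_diff_time:
  assumes g: "integrable M g"
  shows "norm (birth t g - birth s g) \<le> norm (\<beta> t - \<beta> s) * (LINT a|M. norm (g a))"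
proof -
  have "birth t g - birth s g = (LINT a|M. rep_Linf (\<beta> t) a *\<^sub>R g a - rep_Linf (\<beta> s) a *\<^sub>R g a)"
    unfolding birth_def using integrable_Linf[OF g] by simp
  also have "\<dots> = (LINT a|M. rep_Linf (\<beta> t - \<beta> s) a *\<^sub>R g a)"
  proof (rule integral_cong_AE)
    show "AE a in M. rep_Linf (\<beta> t) a *\<^sub>R g a - rep_Linf (\<beta> s) a *\<^sub>R g a = rep_Linf (\<beta> t - \<beta> s) a *\<^sub>R g a"
      using AE_M'[OF rep_Linf_diff[of "\<beta> t" "\<beta> s"]] by eventually_elim (simp add: scaleR_diff_left)
  qed (use integrable_Linf[OF g] in \<open>auto intro!: borel_measurable_diff borel_measurable_integrable\<close>)
  also have "norm \<dots> \<le> norm (\<beta> t - \<beta> s) * (LINT a|M. norm (g a))" by (rule norm_integral_Linf[OF g])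
  finally show ?thesis .
qed

lemma birth_add: "integrable M g \<Longrightarrow> integrable M h \<Longrightarrow> birth t (\<lambda>a. g a + h a) = birth t g + birth t h"
  unfolding birth_def using integrable_Linf[of g "\<beta> t"] integrable_Linf[of h "\<beta> t"] by (simp add: scaleR_add_right)

lemma birth_diff: "integrable M g \<Longrightarrow> integrable M h \<Longrightarrow> birth t (\<lambda>a. g a - h a) = birth t g - birth t h"
  unfolding birth_def using integrable_Linf[of g "\<beta> t"] integrable_Linf[of h "\<beta> t"] by (simp add: scaleR_diff_right)

lemma birth_scale: "birth t (\<lambda>a. c *\<^sub>R g a) = c *\<^sub>R birth t g"
  using integral_scaleR_right[of M c "\<lambda>a. rep_Linf (\<beta> t) a *\<^sub>R g a"]
  by (simp only: birth_def scaleR_left_commute)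

lemma birth_mono:
  assumes g: "integrable M g" and h: "integrable M h" and le: "AE a in M. g a \<preceq> h a"
  shows "birth t g \<preceq> birth t h"
  unfolding birth_def
proof (rule le_integral[OF integrable_Linf[OF g] integrable_Linf[OF h]])
  show "AE a in M. rep_Linf (\<beta> t) a *\<^sub>R g a \<preceq> rep_Linf (\<beta> t) a *\<^sub>R h a"
    using le \<beta>_M[of t] by eventually_elim (rule le_scale, simp_all)
qed

lemma birth_nn: "integrable M g \<Longrightarrow> AE a in M. nn (g a) \<Longrightarrow> nn (birth t g)"
  using birth_mono[of "\<lambda>_. 0" g t] by (simp add: birth_def)

lemma birth_cong_AE: "integrable M g \<Longrightarrow> integrable M h \<Longrightarrow> AE a in M. g a = h a \<Longrightarrow> birth t g = birth t h"
  unfolding birth_def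
  by (rule integral_cong_AE)
     (auto intro!: borel_measurable_integrable integrable_Linf elim!: eventually_mono)

text \<open>The lower bound \<epsilon>0 for the fertility enters through this estimate: it yields
  both the growth of a constant function under \<open>L\<close> and the births of a population
  started from a constant profile.\<close>

lemma birth_indicator_ge:
  assumes x: "nn x" and A: "A \<in> sets M"
  shows "(\<epsilon>0 * measure M A) *\<^sub>R x \<preceq> birth t (\<lambda>a. indicator A a *\<^sub>R x)"
proof -
  have hb: "has_bochner_integral M (\<lambda>a. indicator A a *\<^sub>R x) (measure M A *\<^sub>R x)"
    using M.emeasure_finite[of A] by (intro has_bochner_integral_indicator[OF A]) (simp only: top.not_eq_extremum infinity_ennreal_def)
  have i: "integrable M (\<lambda>a. indicator A a *\<^sub>R x)"
    using hb by (rule integrable.intros)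
  have "(LINT a|M. \<epsilon>0 *\<^sub>R (indicator A a *\<^sub>R x)) \<preceq> birth t (\<lambda>a. indicator A a *\<^sub>R x)"
    unfolding birth_def
  proof (rule le_integral[OF integrable_scaleR_right[OF i] integrable_Linf[OF i]])
    show "AE a in M. \<epsilon>0 *\<^sub>R (indicator A a *\<^sub>R x) \<preceq> rep_Linf (\<beta> t) a *\<^sub>R (indicator A a *\<^sub>R x)"
      using \<beta>_M[of t] by eventually_elim (rule le_scale_left, simp, rule nn_scale, simp, rule x)
  qed
  moreover have "(LINT a|M. \<epsilon>0 *\<^sub>R (indicator A a *\<^sub>R x)) = (\<epsilon>0 * measure M A) *\<^sub>R x"
    using has_bochner_integral_integral_eq[OF hb] by (subst integral_scaleR_right) simp
  ultimately show ?thesis by simp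
qed

text \<open>The probability of surviving from birth at \<open>t - a\<close> until \<open>t\<close>.
  The antiderivative \<open>H\<close> makes it a quotient of exponentials;
  \<open>srv_eq_integral\<close> identifies it with the integral in the model.\<close>

definition srv :: "real \<Rightarrow> real \<Rightarrow> real" where "srv t a = exp (H (t - a) - H t)"

lemma srv_pos: "srv t a > 0" by (simp add: srv_def)

lemma srv_le_1: "a \<ge> 0 \<Longrightarrow> srv t a \<le> 1"
  using H_diff[of "t - a" t] by (simp add: srv_def)

lemma srv_ge: "0 \<le> a \<Longrightarrow> a \<le> ap \<Longrightarrow> srv t a \<ge> exp (- \<mu>m * ap)"
  using H_diff[of "t - a" t] mult_left_mono[of a ap \<mu>m] \<mu>m0 by (simp add: srv_def)

definition kern :: "(real \<Rightarrow> 'e) \<Rightarrow> real \<Rightarrow> real \<Rightarrow> 'e" where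
  "kern f t a = srv t a *\<^sub>R T (max 0 a) (f (t - a))"

definition L :: "(real \<Rightarrow> 'e) \<Rightarrow> real \<Rightarrow> 'e" where "L f t = birth t (kern f t)"

lemma continuous_on_H': "continuous_on S g \<Longrightarrow> continuous_on S (\<lambda>x. H (g x))"
  by (rule continuous_on_compose2[OF continuous_on_H[of UNIV]]) auto

lemma continuous_on_kern:
  assumes f: "continuous_on UNIV f" shows "continuous_on UNIV (\<lambda>p. kern f (fst p) (snd p))"
proof -
  have c: "continuous_on UNIV (\<lambda>p::real \<times> real. f (fst p - snd p))"
    by (rule continuous_on_compose2[OF f]) (auto intro!: continuous_intros)
  show ?thesis
    unfolding kern_def srv_def
    by (intro continuous_on_scaleR continuous_on_Tmax c continuous_on_exp continuous_on_diff
        continuous_on_H' continuous_on_fst continuous_on_snd continuous_on_id)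
qed

lemma continuous_on_kern_age:
  assumes f: "continuous_on UNIV f" shows "continuous_on UNIV (kern f t)"
proof -
  have "continuous_on UNIV (\<lambda>a. (\<lambda>p. kern f (fst p) (snd p)) (t, a))"
    by (rule continuous_on_compose2[OF continuous_on_kern[OF f]]) (auto intro!: continuous_intros)
  then show ?thesis by simp
qed

lemma integrable_kern: "continuous_on UNIV f \<Longrightarrow> integrable M (kern f t)"
  by (intro integrable_M_continuous continuous_on_kern_age)

lemma kern_norm: "0 \<le> a \<Longrightarrow> a \<le> ap \<Longrightarrow> norm (kern f t a) \<le> K * norm (f (t - a))"
  using T_K[of a "f (t - a)"] srv_le_1[of a t] srv_pos[of t a]
    mult_mono[of "srv t a" 1 "norm (T a (f (t - a)))" "K * norm (f (t - a))"]
  by (simp add: kern_def)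

text \<open>One estimate for continuity and almost periodicity of \<open>L f\<close> alike: the
  change of the fertility and the change of the kernel are separated.\<close>

lemma L_time_diff:
  assumes f: "continuous_on UNIV f" and g: "continuous_on UNIV g"
    and b: "\<And>a. 0 \<le> a \<Longrightarrow> a \<le> ap \<Longrightarrow> norm (kern f t a) \<le> B"
    and e: "\<And>a. 0 \<le> a \<Longrightarrow> a \<le> ap \<Longrightarrow> norm (kern f t a - kern g s a) \<le> e"
  shows "norm (L f t - L g s) \<le> norm (\<beta> t - \<beta> s) * (ap * B) + \<beta>m * (ap * e)"
proof -
  note i = integrable_kern[OF f, of t] integrable_kern[OF g, of s]
  have I: "(LINT a|M. norm (h a)) \<le> ap * C" if "integrable M h" "\<And>a. 0 < a \<Longrightarrow> a < ap \<Longrightarrow> norm (h a) \<le> C"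
    for h :: "real \<Rightarrow> 'e" and C
  proof -
    have "(LINT a|M. norm (h a)) \<le> (LINT a|M. C)"
      using that by (intro integral_mono_AE AE_M_I) auto
    then show ?thesis by (simp only: integral_M_const real_scaleR_def)
  qed
  have "L f t - L g s = (birth t (kern f t) - birth s (kern f t)) + birth s (\<lambda>a. kern f t a - kern g s a)"
    using i by (simp add: L_def birth_diff)
  then have "norm (L f t - L g s) \<le> norm (birth t (kern f t) - birth s (kern f t)) + norm (birth s (\<lambda>a. kern f t a - kern g s a))"
    by (simp add: norm_triangle_ineq)
  also have "\<dots> \<le> norm (\<beta> t - \<beta> s) * (LINT a|M. norm (kern f t a)) + \<beta>m * (LINT a|M. norm (kern f t a - kern g s a))"
    using i by (intro add_mono birth_diff_time birth_norm) auto
  also have "\<dots> \<le> norm (\<beta> t - \<beta> s) * (ap * B) + \<beta>m * (ap * e)"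
    using i b e \<beta>m by (intro add_mono mult_left_mono I) auto
  finally show ?thesis .
qed

lemma continuous_on_\<beta>: "continuous_on UNIV \<beta>" using \<beta>_AP by (simp add: almost_periodic_def)

lemma L_cont:
  assumes f: "continuous_on UNIV f" shows "continuous_on UNIV (L f)"
  unfolding continuous_on_iff
proof (intro ballI allI impI)
  fix t \<epsilon> :: real assume \<epsilon>: "\<epsilon> > 0"
  let ?S = "{t-1..t+1} \<times> {0..ap}"
  have cS: "compact ?S" by (intro compact_Times) auto
  have ck: "continuous_on ?S (\<lambda>p. kern f (fst p) (snd p))"
    by (rule continuous_on_subset[OF continuous_on_kern[OF f]]) auto
  obtain B where B: "B > 0" "\<And>p. p \<in> ?S \<Longrightarrow> norm (kern f (fst p) (snd p)) \<le> B"
    using compact_continuous_norm_bound[OF cS ck] by blast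
  have uc: "uniformly_continuous_on ?S (\<lambda>p. kern f (fst p) (snd p))"
    by (rule compact_uniformly_continuous[OF ck cS])
  define \<epsilon>' where "\<epsilon>' = \<epsilon> / (4 * \<beta>m * ap)"
  have \<epsilon>': "\<epsilon>' > 0" using \<epsilon> \<beta>m ap by (simp add: \<epsilon>'_def)
  from uc[unfolded uniformly_continuous_on_def, rule_format, OF \<epsilon>']
  obtain d1 where d1: "d1 > 0" "\<And>p q. p \<in> ?S \<Longrightarrow> q \<in> ?S \<Longrightarrow> dist q p < d1 \<Longrightarrow> dist (kern f (fst q) (snd q)) (kern f (fst p) (snd p)) < \<epsilon>'"
    by blast
  have e4: "\<epsilon> / (4 * ap * B) > 0" using \<epsilon> ap B by simp
  from continuous_on_\<beta>[unfolded continuous_on_iff, rule_format, OF UNIV_I e4]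
  obtain d2 where d2: "d2 > 0" "\<And>s. dist s t < d2 \<Longrightarrow> dist (\<beta> s) (\<beta> t) < \<epsilon> / (4 * ap * B)"
    by blast
  have "dist (L f s) (L f t) < \<epsilon>" if s: "dist s t < min 1 (min d1 d2)" for s
  proof -
    have sS: "s \<in> {t-1..t+1}" using s by (auto simp: dist_real_def)
    have "norm (L f s - L f t) \<le> norm (\<beta> s - \<beta> t) * (ap * B) + \<beta>m * (ap * \<epsilon>')"
    proof (rule L_time_diff[OF f f])
      fix a assume a: "0 \<le> a" "a \<le> ap"
      show "norm (kern f s a) \<le> B" using B(2)[of "(s, a)"] sS a by simp
      have "dist (s, a) (t, a) < d1" using s by (simp add: dist_Pair_Pair)
      then show "norm (kern f s a - kern f t a) \<le> \<epsilon>'"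
        using d1(2)[of "(t, a)" "(s, a)"] sS a by (simp add: dist_norm less_imp_le)
    qed
    also have "\<dots> \<le> \<epsilon> / (4 * ap * B) * (ap * B) + \<beta>m * (ap * \<epsilon>')"
      using d2(2)[of s] s ap B by (intro add_mono mult_right_mono order_refl) (auto simp: dist_norm)
    also have "\<dots> = \<epsilon> / 2" using ap B \<beta>m by (simp add: \<epsilon>'_def field_simps)
    finally show ?thesis using \<epsilon> by (simp add: dist_norm)
  qed
  then show "\<exists>d>0. \<forall>x'\<in>UNIV. dist x' t < d \<longrightarrow> dist (L f x') (L f t) < \<epsilon>"
    using d1 d2 by (intro exI[of _ "min 1 (min d1 d2)"]) auto
qed

lemma L_add: "continuous_on UNIV f \<Longrightarrow> continuous_on UNIV g \<Longrightarrow> L (\<lambda>s. f s + g s) t = L f t + L g t"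
  unfolding L_def
  by (subst birth_add[symmetric], auto intro: integrable_kern) (simp add: kern_def[abs_def] T_plus scaleR_add_right)

lemma L_diff: "continuous_on UNIV f \<Longrightarrow> continuous_on UNIV g \<Longrightarrow> L (\<lambda>s. f s - g s) t = L f t - L g t"
  unfolding L_def
  by (subst birth_diff[symmetric], auto intro: integrable_kern) (simp add: kern_def[abs_def] T_diff scaleR_diff_right)

lemma L_scale: "L (\<lambda>s. c *\<^sub>R f s) t = c *\<^sub>R L f t"
  unfolding L_def
  by (subst birth_scale[symmetric]) (simp add: kern_def[abs_def] T_scaleR mult.commute)

lemma kern_mono: "a \<ge> 0 \<Longrightarrow> f (t - a) \<preceq> g (t - a) \<Longrightarrow> kern f t a \<preceq> kern g t a"
  unfolding kern_def by (intro le_scale T_mono) (auto simp: srv_pos less_imp_le)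

lemma L_mono:
  assumes "continuous_on UNIV f" "continuous_on UNIV g" "\<And>s. s \<in> {t - ap..t} \<Longrightarrow> f s \<preceq> g s"
  shows "L f t \<preceq> L g t"
  unfolding L_def by (intro birth_mono integrable_kern AE_M_I kern_mono assms) auto

lemma L_T0: "L (\<lambda>s. T 0 (f s)) t = L f t"
  by (simp add: L_def kern_def[abs_def] T_T0)

lemma Lpow_cont: "continuous_on UNIV f \<Longrightarrow> continuous_on UNIV ((L ^^ n) f)"
  by (induction n) (auto intro: L_cont)

lemma Lpow_diff:
  assumes "continuous_on UNIV f" "continuous_on UNIV g"
  shows "(L ^^ n) (\<lambda>s. f s - g s) = (\<lambda>s. (L ^^ n) f s - (L ^^ n) g s)"
proof (induction n)
  case (Suc n)
  then show ?case using L_diff[OF Lpow_cont Lpow_cont, OF assms] by auto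
qed simp

lemma Lpow_add:
  assumes "continuous_on UNIV f" "continuous_on UNIV g"
  shows "(L ^^ n) (\<lambda>s. f s + g s) = (\<lambda>s. (L ^^ n) f s + (L ^^ n) g s)"
proof (induction n)
  case (Suc n)
  then show ?case using L_add[OF Lpow_cont Lpow_cont, OF assms] by auto
qed simp

lemma Lpow_scale: "(L ^^ n) (\<lambda>s. c *\<^sub>R f s) = (\<lambda>s. c *\<^sub>R (L ^^ n) f s)"
  by (induction n) (auto simp: L_scale)

lemma Lpow_mono:
  assumes f: "continuous_on UNIV f" and g: "continuous_on UNIV g"
    and le: "\<And>s. s \<in> {t - real n * ap..t} \<Longrightarrow> f s \<preceq> g s"
  shows "(L ^^ n) f t \<preceq> (L ^^ n) g t"
  using le
proof (induction n arbitrary: t)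
  case (Suc n)
  have "L ((L ^^ n) f) t \<preceq> L ((L ^^ n) g) t"
  proof (rule L_mono)
    fix s assume s: "s \<in> {t - ap..t}"
    show "(L ^^ n) f s \<preceq> (L ^^ n) g s"
    proof (rule Suc.IH)
      fix r assume "r \<in> {s - real n * ap..s}"
      then have "r \<in> {t - real (Suc n) * ap..t}" using s by (auto simp: algebra_simps)
      then show "f r \<preceq> g r" by (rule Suc.prems)
    qed
  qed (intro Lpow_cont f g)+
  then show ?case by simp
qed auto

lemma nn_antisym: "x \<preceq> y \<Longrightarrow> y \<preceq> x \<Longrightarrow> x = y"
  using nn_mono_norm[of "y - x" 0] by simp

text \<open>Locality in time comes from the order: equality on the window is two inequalities, and
  both pass through \<open>Lpow_mono\<close>.\<close>

lemma Lpow_local: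
  assumes f: "continuous_on UNIV f" and g: "continuous_on UNIV g"
    and eq: "\<And>s. s \<in> {t - real n * ap..t} \<Longrightarrow> f s = g s"
  shows "(L ^^ n) f t = (L ^^ n) g t"
  by (rule nn_antisym; rule Lpow_mono[OF _ _ ]) (use f g eq nn_0 in auto)

lemma Lpow_nn:
  assumes f: "continuous_on UNIV f" and "\<And>s. s \<in> {t - real n * ap..t} \<Longrightarrow> nn (f s)"
  shows "nn ((L ^^ n) f t)"
proof -
  have "(L ^^ n) (\<lambda>s. 0 *\<^sub>R f s) t \<preceq> (L ^^ n) f t"
    by (rule Lpow_mono) (use assms in \<open>auto intro!: continuous_intros\<close>)
  then show ?thesis by (simp only: Lpow_scale) simp
qed

end

section \<open>Weighted bounds for the iterates of the renewal operator\<close>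

instance bcontfun :: (metric_space, banach) banach ..

context renewal
begin

text \<open>The iterates of \<open>L\<close> on functions with weight \<open>exp (l s)\<close> are bounded by a multiple of \<open>c ^ n\<close>. As
  \<open>(L ^^ n) f t\<close> involves only the values of \<open>f\<close> on \<open>{t - n ap..t}\<close>, the bound is required to be local in time.\<close>

definition iterate_bound :: "real \<Rightarrow> real \<Rightarrow> bool" where
  "iterate_bound l c \<longleftrightarrow> (\<exists>C. \<forall>n f t B. continuous_on UNIV f \<longrightarrow>
     (\<forall>s\<in>{t - real n * ap..t}. norm (f s) \<le> B * exp (l * (s - t))) \<longrightarrow>
     norm ((L ^^ n) f t) \<le> C * c ^ n * B)"

text \<open>Splitting \<open>f\<close> into positive and negative parts costs only a factor 2 in
  \<open>C\<close> and makes order arguments available.\<close>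

lemma iterate_boundI_nn:
  assumes "\<And>n f t B. continuous_on UNIV f \<Longrightarrow> (\<And>s. nn (f s)) \<Longrightarrow> B \<ge> 0 \<Longrightarrow>
     (\<And>s. s \<in> {t - real n * ap..t} \<Longrightarrow> norm (f s) \<le> B * exp (l * (s - t))) \<Longrightarrow>
     norm ((L ^^ n) f t) \<le> C * c ^ n * B"
  shows "iterate_bound l c"
  unfolding iterate_bound_def
proof (intro exI[of _ "2 * C"] allI impI)
  fix n t B and f :: "real \<Rightarrow> 'e"
  assume f: "continuous_on UNIV f"
    and b: "\<forall>s\<in>{t - real n * ap..t}. norm (f s) \<le> B * exp (l * (s - t))"
  \<comment> \<open>The window contains \<open>t\<close> itself, also for \<open>n = 0\<close>, so
    the bound on \<open>f\<close> forces \<open>B\<close> to be nonnegative.\<close>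
  have B: "B \<ge> 0" using b[rule_format, of t] ap norm_ge_zero[of "f t"] by (simp del: norm_ge_zero)
  have 1: "norm ((L ^^ n) (\<lambda>s. pp (f s)) t) \<le> C * c ^ n * B"
  proof (rule assms)
    fix s assume "s \<in> {t - real n * ap..t}"
    then show "norm (pp (f s)) \<le> B * exp (l * (s - t))"
      using b pp_norm[of "f s"] by fastforce
  qed (use f B pp_nn in \<open>auto intro!: continuous_intros\<close>)
  have 2: "norm ((L ^^ n) (\<lambda>s. pp (- f s)) t) \<le> C * c ^ n * B"
  proof (rule assms)
    fix s assume "s \<in> {t - real n * ap..t}"
    then show "norm (pp (- f s)) \<le> B * exp (l * (s - t))"
      using b pp_norm[of "- f s"] by fastforce
  qed (use f B pp_nn in \<open>auto intro!: continuous_intros\<close>)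
  have "(L ^^ n) f t = (L ^^ n) (\<lambda>s. pp (f s) - pp (- f s)) t" by (simp add: pp_split)
  also have "\<dots> = (L ^^ n) (\<lambda>s. pp (f s)) t - (L ^^ n) (\<lambda>s. pp (- f s)) t"
    by (subst Lpow_diff) (auto intro!: continuous_intros f)
  finally have e: "(L ^^ n) f t = (L ^^ n) (\<lambda>s. pp (f s)) t - (L ^^ n) (\<lambda>s. pp (- f s)) t" .
  have "norm ((L ^^ n) f t) \<le> norm ((L ^^ n) (\<lambda>s. pp (f s)) t) + norm ((L ^^ n) (\<lambda>s. pp (- f s)) t)"
    unfolding e by (rule norm_triangle_ineq4)
  with 1 2 show "norm ((L ^^ n) f t) \<le> 2 * C * c ^ n * B" by linarith
qed

text \<open>Only a window of length \<open>n * ap\<close> matters, and there the quotient of the two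
  weights is at most \<open>exp (max 0 (l - l') * ap) ^ n\<close>. A change of weight is therefore
  paid by the rate, while the constant stays the same.\<close>

lemma iterate_bound_weaken:
  assumes "iterate_bound l c" shows "iterate_bound l' (c * exp (max 0 (l - l') * ap))"
proof -
  obtain C where C: "\<And>n f t B. continuous_on UNIV f \<Longrightarrow>
     (\<And>s. s \<in> {t - real n * ap..t} \<Longrightarrow> norm (f s) \<le> B * exp (l * (s - t))) \<Longrightarrow>
     norm ((L ^^ n) f t) \<le> C * c ^ n * B"
    using assms unfolding iterate_bound_def by blast
  show ?thesis
    unfolding iterate_bound_def
  proof (intro exI[of _ C] allI impI)
    fix n t B and f :: "real \<Rightarrow> 'e"
    assume f: "continuous_on UNIV f"
      and b: "\<forall>s\<in>{t - real n * ap..t}. norm (f s) \<le> B * exp (l' * (s - t))"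
    define E where "E = exp (max 0 (l - l') * ap)"
    have B: "B \<ge> 0" using b[rule_format, of t] ap norm_ge_zero[of "f t"] by (simp del: norm_ge_zero)
    have "norm ((L ^^ n) f t) \<le> C * c ^ n * (B * E ^ n)"
    proof (rule C[OF f])
      fix s assume s: "s \<in> {t - real n * ap..t}"
      have "(l - l') * (t - s) \<le> max 0 (l - l') * (t - s)" using s by (intro mult_right_mono) auto
      also have "\<dots> \<le> max 0 (l - l') * (real n * ap)" using s by (intro mult_left_mono) auto
      finally have "l' * (s - t) \<le> real n * (max 0 (l - l') * ap) + l * (s - t)" by (simp add: algebra_simps)
      then have "exp (l' * (s - t)) \<le> E ^ n * exp (l * (s - t))"
        by (simp add: E_def exp_of_nat_mult[symmetric] exp_add[symmetric])
      then have "B * exp (l' * (s - t)) \<le> B * (E ^ n * exp (l * (s - t)))" using B by (rule mult_left_mono)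
      then show "norm (f s) \<le> B * E ^ n * exp (l * (s - t))" using b s by (fastforce simp: mult.assoc)
    qed
    then show "norm ((L ^^ n) f t) \<le> C * (c * exp (max 0 (l - l') * ap)) ^ n * B"
      by (simp add: E_def power_mult_distrib mult_ac)
  qed
qed

lemma integral_M_exp:
  assumes "l > 0" shows "(LINT a|M. exp (- l * a)) \<le> 1 / l"
proof -
  have i: "integrable M (\<lambda>a. exp (- l * a))"
    by (intro integrable_M_continuous continuous_intros)
  have "((\<lambda>a. exp (- l * a)) has_integral (- exp (- l * ap) / l - (- exp (- l * 0) / l))) {0..ap}"
    by (rule fundamental_theorem_of_calculus)
       (use assms ap in \<open>auto intro!: derivative_eq_intros simp flip: has_real_derivative_iff_has_vector_derivative\<close>)
  then have "integral {0<..<ap} (\<lambda>a. exp (- l * a)) = - exp (- l * ap) / l + 1 / l"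
    using integral_open_interval_real[of 0 ap "\<lambda>a. exp (- l * a)"] by (simp add: integral_unique)
  also have "\<dots> \<le> 1 / l" using assms by simp
  finally show ?thesis using lebesgue_integral_eq_integral[OF i] by simp
qed

text \<open>Against the weight \<open>exp (l * s)\<close> the age integral contributes at most
  \<open>1 / l\<close>, so \<open>L\<close> becomes a strict contraction once
  \<open>l > \<beta>m * K\<close>. The reference time \<open>r\<close> is kept apart from
  \<open>t\<close> so that the estimate can be iterated.\<close>

lemma L_weighted:
  assumes f: "continuous_on UNIV f" and l: "l > 0" and B: "B \<ge> 0"
    and b: "\<And>s. s \<in> {t - ap..t} \<Longrightarrow> norm (f s) \<le> B * exp (l * (s - r))"
  shows "norm (L f t) \<le> (\<beta>m * K / l) * B * exp (l * (t - r))"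
proof -
  have "(LINT a|M. norm (kern f t a)) \<le> (LINT a|M. (K * B * exp (l * (t - r))) * exp (- l * a))"
  proof (rule integral_mono_AE)
    show "AE a in M. norm (kern f t a) \<le> K * B * exp (l * (t - r)) * exp (- l * a)"
    proof (rule AE_M_I)
      fix a assume a: "0 < a" "a < ap"
      have "norm (kern f t a) \<le> K * norm (f (t - a))" using a by (intro kern_norm) auto
      also have "\<dots> \<le> K * (B * exp (l * (t - a - r)))" using a K1 by (intro mult_left_mono b) auto
      also have "exp (l * (t - a - r)) = exp (l * (t - r)) * exp (- l * a)"
        by (simp add: exp_add[symmetric] algebra_simps)
      finally show "norm (kern f t a) \<le> K * B * exp (l * (t - r)) * exp (- l * a)" by (simp add: mult_ac)
    qed
    show "integrable M (\<lambda>a. (K * B * exp (l * (t - r))) * exp (- l * a))"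
      by (intro integrable_M_continuous continuous_intros)
  qed (intro integrable_norm integrable_kern f)
  also have "\<dots> = (K * B * exp (l * (t - r))) * (LINT a|M. exp (- l * a))" by simp
  also have "\<dots> \<le> (K * B * exp (l * (t - r))) * (1 / l)"
    using K1 B by (intro mult_left_mono integral_M_exp l) auto
  finally have "\<beta>m * (LINT a|M. norm (kern f t a)) \<le> \<beta>m * ((K * B * exp (l * (t - r))) * (1 / l))"
    using \<beta>m by (intro mult_left_mono) auto
  then show ?thesis using birth_norm[OF integrable_kern[OF f], of t t] by (simp add: L_def mult_ac)
qed

lemma Lpow_weighted:
  assumes f: "continuous_on UNIV f" and l: "l > 0" and B: "B \<ge> 0"
    and b: "\<And>s. s \<in> {t - real n * ap..t} \<Longrightarrow> norm (f s) \<le> B * exp (l * (s - r))"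
  shows "norm ((L ^^ n) f t) \<le> (\<beta>m * K / l) ^ n * B * exp (l * (t - r))"
  using b
proof (induction n arbitrary: t)
  case (Suc n)
  have "norm (L ((L ^^ n) f) t) \<le> (\<beta>m * K / l) * ((\<beta>m * K / l) ^ n * B) * exp (l * (t - r))"
  proof (rule L_weighted[OF Lpow_cont[OF f] l])
    show "0 \<le> (\<beta>m * K / l) ^ n * B" using \<beta>m K1 l B by simp
    fix s assume s: "s \<in> {t - ap..t}"
    show "norm ((L ^^ n) f s) \<le> (\<beta>m * K / l) ^ n * B * exp (l * (s - r))"
    proof (rule Suc.IH)
      fix x assume "x \<in> {s - real n * ap..s}"
      then have "x \<in> {t - real (Suc n) * ap..t}" using s by (auto simp: algebra_simps)
      then show "norm (f x) \<le> B * exp (l * (x - r))" by (rule Suc.prems)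
    qed
  qed
  then show ?case by (simp add: mult_ac)
qed auto

text \<open>The weight \<open>exp (l (s - t))\<close> with \<open>l\<close> strictly between \<open>l0\<close> and a large \<open>\<Lambda>\<close> is a geometric mean of
  the weights for \<open>l0\<close> and \<open>\<Lambda>\<close>. It is bounded by the sum of these two weights with suitable
  constant factors, of which the one for \<open>\<Lambda>\<close> is absorbed by the decay of the iterates for \<open>\<Lambda>\<close>.\<close>

lemma iterate_bound_strict:
  assumes iterate_bound: "\<And>c. c > 1 \<Longrightarrow> iterate_bound l0 c" and l: "l0 < l"
  shows "\<exists>q. 0 < q \<and> q < 1 \<and> iterate_bound l q"
proof -
  \<comment> \<open>Large enough for \<open>L\<close> to contract by 1/2 in the weight with exponent
    \<Lambda>, and above \<open>l\<close> so that \<open>l\<close> lies strictly between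
    \<open>l0\<close> and \<Lambda>.\<close>
  define \<Lambda> where "\<Lambda> = max (2 * \<beta>m * K) (l + 1)"
  have \<beta>K: "\<beta>m * K > 0" using \<beta>m K1 by simp
  have \<Lambda>: "\<Lambda> > 0" "\<Lambda> > l" using \<beta>K by (auto simp: \<Lambda>_def)
  have half: "\<beta>m * K / \<Lambda> \<le> 1 / 2" using \<Lambda> by (simp add: \<Lambda>_def field_simps)
  define \<Delta> where "\<Delta> = \<Lambda> - l0"
  have \<Delta>: "\<Delta> > 0" using \<Lambda> l by (simp add: \<Delta>_def)
  define \<theta> where "\<theta> = (l - l0) / \<Delta>"
  have \<theta>: "0 < \<theta>" "\<theta> < 1" "\<theta> * \<Delta> = l - l0" using l \<Lambda> \<Delta> by (auto simp: \<theta>_def \<Delta>_def)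
  \<comment> \<open>The contraction 1/2 per step, written as \<open>exp (- k)\<close>. The share
    \<theta> of it survives the interpolation: half of this share, \<open>c\<close>, is spent on the
    rate allowed at \<open>l0\<close>, and the other half is the gain \<open>q\<close>.\<close>
  define k where "k = ln (2::real)"
  have k: "k > 0" "exp (- k) = 1 / 2" by (auto simp: k_def exp_minus inverse_eq_divide)
  define c where "c = exp (\<theta> * k / 2)"
  have "c > 1" using \<theta> k by (simp add: c_def)
  then obtain C where C: "\<And>n f t B. continuous_on UNIV f \<Longrightarrow>
     (\<And>s. s \<in> {t - real n * ap..t} \<Longrightarrow> norm (f s) \<le> B * exp (l0 * (s - t))) \<Longrightarrow>
     norm ((L ^^ n) f t) \<le> C * c ^ n * B"
    using iterate_bound[of c] unfolding iterate_bound_def by blast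
  define q where "q = exp (- (\<theta> * k / 2))"
  have q: "0 < q" "q < 1" using \<theta> k by (auto simp: q_def)
  have "iterate_bound l q"
  proof (rule iterate_boundI_nn)
    fix n t B and f :: "real \<Rightarrow> 'e"
    assume f: "continuous_on UNIV f" and fn: "\<And>s. nn (f s)" and B: "B \<ge> 0"
      and b: "\<And>s. s \<in> {t - real n * ap..t} \<Longrightarrow> norm (f s) \<le> B * exp (l * (s - t))"
    define f0 where "f0 s = exp (- \<theta> * \<Delta> * (s - t)) *\<^sub>R f s" for s
    define f1 where "f1 s = exp ((1 - \<theta>) * \<Delta> * (s - t)) *\<^sub>R f s" for s
    define p0 where "p0 = exp (- real n * \<theta> * k)"
    define p1 where "p1 = exp (real n * (1 - \<theta>) * k)"
    have c0: "continuous_on UNIV f0" and c1: "continuous_on UNIV f1"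
      unfolding f0_def f1_def by (intro continuous_intros f)+
    have nf: "norm (exp a *\<^sub>R f s) \<le> B * exp (l * (s - t) + a)" if "s \<in> {t - real n * ap..t}" for s a
    proof -
      have "norm (exp a *\<^sub>R f s) \<le> exp a * (B * exp (l * (s - t)))" using b[OF that] by simp
      then show ?thesis by (simp add: exp_add mult_ac)
    qed
    have n0: "norm ((L ^^ n) f0 t) \<le> C * c ^ n * B"
    proof (rule C[OF c0])
      fix s assume s: "s \<in> {t - real n * ap..t}"
      have "l * (s - t) + - \<theta> * \<Delta> * (s - t) = (l - \<theta> * \<Delta>) * (s - t)"
        by (simp add: algebra_simps)
      then have "l * (s - t) + - \<theta> * \<Delta> * (s - t) = l0 * (s - t)"
        unfolding \<theta>(3) by simp
      then show "norm (f0 s) \<le> B * exp (l0 * (s - t))"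
        using nf[OF s, of "- \<theta> * \<Delta> * (s - t)"] by (simp only: f0_def)
    qed
    have n1: "norm ((L ^^ n) f1 t) \<le> (\<beta>m * K / \<Lambda>) ^ n * B * exp (\<Lambda> * (t - t))"
    proof (rule Lpow_weighted[OF c1 \<Lambda>(1) B])
      fix s assume s: "s \<in> {t - real n * ap..t}"
      have "l * (s - t) + (1 - \<theta>) * \<Delta> * (s - t) = (l + \<Delta> - \<theta> * \<Delta>) * (s - t)"
        by (simp add: algebra_simps)
      also have "\<dots> = \<Lambda> * (s - t)" unfolding \<theta>(3) by (simp add: \<Delta>_def)
      finally show "norm (f1 s) \<le> B * exp (\<Lambda> * (s - t))"
        using nf[OF s, of "(1 - \<theta>) * \<Delta> * (s - t)"] by (simp only: f1_def)
    qed
    have "(L ^^ n) f t \<preceq> (L ^^ n) (\<lambda>s. p0 *\<^sub>R f0 s + p1 *\<^sub>R f1 s) t"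
    proof (rule Lpow_mono[OF f])
      show "continuous_on UNIV (\<lambda>s. p0 *\<^sub>R f0 s + p1 *\<^sub>R f1 s)" by (intro continuous_intros c0 c1)
      fix s
      \<comment> \<open>The two scaled weights cross at \<open>t - s = n * k / \<Delta>\<close>,
        which is \<open>x = 0\<close>; on either side of it one of the two exponentials is at least
        1.\<close>
      define x where "x = - real n * k - \<Delta> * (s - t)"
      have "p0 * exp (- \<theta> * \<Delta> * (s - t)) = exp (\<theta> * x)"
        unfolding p0_def mult_exp_exp by (rule arg_cong[where f = exp]) (simp add: x_def algebra_simps)
      moreover have "p1 * exp ((1 - \<theta>) * \<Delta> * (s - t)) = exp ((\<theta> - 1) * x)"
        unfolding p1_def mult_exp_exp by (rule arg_cong[where f = exp]) (simp add: x_def algebra_simps)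
      ultimately have "p0 *\<^sub>R f0 s + p1 *\<^sub>R f1 s = (exp (\<theta> * x) + exp ((\<theta> - 1) * x)) *\<^sub>R f s"
        by (simp only: f0_def f1_def scaleR_scaleR scaleR_add_left)
      moreover have "1 \<le> exp (\<theta> * x) + exp ((\<theta> - 1) * x)"
      proof (cases "x \<ge> 0")
        case True
        then have "1 \<le> exp (\<theta> * x)" using \<theta> by simp
        then show ?thesis using exp_ge_zero[of "(\<theta> - 1) * x"] by linarith
      next
        case False
        then have "1 \<le> exp ((\<theta> - 1) * x)" using \<theta> by (simp add: mult_nonpos_nonpos)
        then show ?thesis using exp_ge_zero[of "\<theta> * x"] by linarith
      qed
      ultimately show "f s \<preceq> p0 *\<^sub>R f0 s + p1 *\<^sub>R f1 s"
        using le_scale_left[OF _ fn[of s], of 1] by simp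
    qed
    moreover have "nn ((L ^^ n) f t)" by (intro Lpow_nn f fn)
    moreover have e: "(L ^^ n) (\<lambda>s. p0 *\<^sub>R f0 s + p1 *\<^sub>R f1 s) t = p0 *\<^sub>R (L ^^ n) f0 t + p1 *\<^sub>R (L ^^ n) f1 t"
      by (subst Lpow_add) (auto intro!: continuous_intros c0 c1 simp: Lpow_scale)
    ultimately have "norm ((L ^^ n) f t) \<le> norm (p0 *\<^sub>R (L ^^ n) f0 t + p1 *\<^sub>R (L ^^ n) f1 t)"
      using nn_mono_norm by simp
    also have "\<dots> \<le> norm (p0 *\<^sub>R (L ^^ n) f0 t) + norm (p1 *\<^sub>R (L ^^ n) f1 t)"
      by (rule norm_triangle_ineq)
    also have "\<dots> = p0 * norm ((L ^^ n) f0 t) + p1 * norm ((L ^^ n) f1 t)"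
      by (simp add: p0_def p1_def)
    also have "\<dots> \<le> p0 * (\<bar>C\<bar> * c ^ n * B) + p1 * ((1 / 2) ^ n * B)"
    proof (intro add_mono mult_left_mono)
      have "C * c ^ n * B \<le> \<bar>C\<bar> * c ^ n * B" using B \<open>c > 1\<close> by (intro mult_right_mono) auto
      then show "norm ((L ^^ n) f0 t) \<le> \<bar>C\<bar> * c ^ n * B" using n0 by simp
      have "(\<beta>m * K / \<Lambda>) ^ n * B \<le> (1 / 2) ^ n * B"
        using half \<beta>K \<Lambda> B by (intro mult_right_mono power_mono) auto
      then show "norm ((L ^^ n) f1 t) \<le> (1 / 2) ^ n * B" using n1 by simp
    qed (auto simp: p0_def p1_def)
    also have "p0 * (\<bar>C\<bar> * c ^ n * B) = \<bar>C\<bar> * q ^ n * B"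
    proof -
      have "p0 * c ^ n = q ^ n"
        unfolding p0_def c_def q_def exp_of_nat_mult[symmetric] mult_exp_exp
        by (rule arg_cong[where f = exp]) (simp add: algebra_simps)
      then show ?thesis by (metis mult.assoc mult.left_commute)
    qed
    also have "p1 * ((1 / 2) ^ n * B) \<le> q ^ n * B"
    proof -
      have "p1 * (1 / 2) ^ n = exp (- real n * \<theta> * k)"
        unfolding k(2)[symmetric] p1_def exp_of_nat_mult[symmetric] mult_exp_exp
        by (rule arg_cong[where f = exp]) (simp add: algebra_simps)
      also have "\<dots> \<le> q ^ n" using \<theta> k by (simp add: q_def exp_of_nat_mult[symmetric] mult_left_mono)
      finally show ?thesis using B by (simp add: mult.assoc[symmetric] mult_right_mono)
    qed
    finally show "norm ((L ^^ n) f t) \<le> (\<bar>C\<bar> + 1) * q ^ n * B" by (simp add: algebra_simps)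
  qed
  then show ?thesis using q by blast
qed

section \<open>The renewal operator on almost periodic functions\<close>

definition AP_space :: "(real \<Rightarrow>\<^sub>C 'e) set" where
  "AP_space = {\<psi>. almost_periodic (apply_bcontfun \<psi>) \<and> (\<forall>t. T 0 (apply_bcontfun \<psi> t) = apply_bcontfun \<psi> t)}"

definition L_bcontfun :: "(real \<Rightarrow>\<^sub>C 'e) \<Rightarrow> (real \<Rightarrow>\<^sub>C 'e)" where
  "L_bcontfun \<psi> = Bcontfun (L (apply_bcontfun \<psi>))"

lemma L_norm:
  assumes f: "continuous_on UNIV f" and b: "\<And>s. s \<in> {t - ap..t} \<Longrightarrow> norm (f s) \<le> B"
  shows "norm (L f t) \<le> \<beta>m * ap * K * B"
proof -
  have "(LINT a|M. norm (kern f t a)) \<le> (LINT a|M. K * B)"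
  proof (rule integral_mono_AE)
    show "AE a in M. norm (kern f t a) \<le> K * B"
    proof (rule AE_M_I)
      fix a assume a: "0 < a" "a < ap"
      have "norm (kern f t a) \<le> K * norm (f (t - a))" using a by (intro kern_norm) auto
      also have "\<dots> \<le> K * B" using a K1 by (intro mult_left_mono b) auto
      finally show "norm (kern f t a) \<le> K * B" .
    qed
  qed (auto intro!: integrable_norm integrable_kern f)
  also have "\<dots> = ap * (K * B)" by (simp only: integral_M_const real_scaleR_def)
  finally have "\<beta>m * (LINT a|M. norm (kern f t a)) \<le> \<beta>m * (ap * (K * B))"
    using \<beta>m by (intro mult_left_mono) auto
  then show ?thesis using birth_norm[OF integrable_kern[OF f], of t t] by (simp add: L_def mult_ac)
qed

lemma apply_L_bcontfun: "apply_bcontfun (L_bcontfun \<psi>) = L (apply_bcontfun \<psi>)"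
  unfolding L_bcontfun_def
  by (rule Bcontfun_inverse, rule bcontfun_normI[where b = "\<beta>m * ap * K * norm \<psi>"])
     (auto intro!: L_cont L_norm norm_bounded)

lemma apply_L_bcontfun_pow: "apply_bcontfun ((L_bcontfun ^^ n) \<psi>) = (L ^^ n) (apply_bcontfun \<psi>)"
  by (induction n) (auto simp: apply_L_bcontfun)

lemma T0_bounded_linear: "bounded_linear (T 0)" by (rule T_lin) simp

lemma T0_L: assumes f: "continuous_on UNIV f" shows "T 0 (L f t) = L f t"
proof -
  have i: "integrable M (\<lambda>a. rep_Linf (\<beta> t) a *\<^sub>R kern f t a)" by (intro integrable_Linf integrable_kern f)
  have "T 0 (L f t) = (LINT a|M. T 0 (rep_Linf (\<beta> t) a *\<^sub>R kern f t a))"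
    unfolding L_def birth_def by (rule integral_bounded_linear[OF T0_bounded_linear i, symmetric])
  also have "\<dots> = L f t"
    unfolding L_def birth_def kern_def by (simp add: T_scaleR T0_T)
  finally show ?thesis .
qed

text \<open>\<open>exp (- x)\<close> is 1-Lipschitz for nonnegative \<open>x\<close>, and the mean
  value theorem for \<open>H (r + \<tau>) - H r\<close> bounds the difference of the exponents by
  \<open>ap\<close> times the translation error of the mortality.\<close>

lemma srv_time_diff:
  assumes a: "0 \<le> a" "a \<le> ap" and \<delta>: "\<And>r. \<bar>\<mu> (r + \<tau>) - \<mu> r\<bar> \<le> \<delta>"
  shows "\<bar>srv (t + \<tau>) a - srv t a\<bar> \<le> ap * \<delta>"
proof -
  have e: "\<bar>exp (- x) - exp (- y)\<bar> \<le> \<bar>x - y\<bar>" if "x \<ge> 0" "y \<ge> 0" for x y :: real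
  proof -
    have *: "exp (- u) - exp (- v) \<le> v - u" if "0 \<le> u" "u \<le> v" for u v :: real
    proof -
      define h where "h = v - u"
      have h: "v = u + h" "h \<ge> 0" using that by (auto simp: h_def)
      have "exp (- u) - exp (- v) = exp (- u) * (1 - exp (- h))"
        by (simp add: h(1) right_diff_distrib mult_exp_exp)
      also have "\<dots> \<le> 1 * (1 - exp (- h))"
        using that h(2) by (intro mult_right_mono) auto
      also have "\<dots> \<le> h" using exp_ge_add_one_self[of "- h"] by simp
      finally show ?thesis by (simp add: h_def)
    qed
    show ?thesis
    proof (cases "x \<le> y")
      case True
      then have "exp (- y) \<le> exp (- x)" by simp
      then show ?thesis using *[of x y] True that by linarith
    next
      case False
      then have "exp (- x) \<le> exp (- y)" by simp
      then show ?thesis using *[of y x] False that by linarith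
    qed
  qed
  have "\<bar>(H (t + \<tau>) - H t) - (H (t + \<tau> - a) - H (t - a))\<bar> \<le> ap * \<delta>"
  proof (cases "a = 0")
    case True
    then show ?thesis using \<delta>[of 0] ap by (simp add: mult_nonneg_nonneg[OF less_imp_le] order_trans[OF abs_ge_zero])
  next
    case False
    have der: "((\<lambda>r. H (r + \<tau>) - H r) has_real_derivative (\<mu> (r + \<tau>) - \<mu> r)) (at r)" for r
      by (auto intro!: derivative_eq_intros H DERIV_chain2[OF H])
    have "t - a < t" using False a by simp
    then obtain z where "(H (t + \<tau>) - H t) - (H (t - a + \<tau>) - H (t - a)) = (t - (t - a)) * (\<mu> (z + \<tau>) - \<mu> z)"
      using MVT2[of "t - a" t "\<lambda>r. H (r + \<tau>) - H r" "\<lambda>r. \<mu> (r + \<tau>) - \<mu> r"] der by blast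
    then have "(H (t + \<tau>) - H t) - (H (t + \<tau> - a) - H (t - a)) = a * (\<mu> (z + \<tau>) - \<mu> z)"
      by (simp add: algebra_simps)
    then have "\<bar>(H (t + \<tau>) - H t) - (H (t + \<tau> - a) - H (t - a))\<bar> = a * \<bar>\<mu> (z + \<tau>) - \<mu> z\<bar>"
      using a by (simp add: abs_mult)
    also have "\<dots> \<le> ap * \<delta>" using a \<delta>[of z] by (intro mult_mono) auto
    finally show ?thesis .
  qed
  then show ?thesis
    using e[of "H (t + \<tau>) - H (t + \<tau> - a)" "H t - H (t - a)"] H_diff[of "t + \<tau> - a" "t + \<tau>"] H_diff[of "t - a" t] a
    unfolding srv_def by (simp add: algebra_simps)
qed

text \<open>Fertility, mortality and \<psi> are treated as one almost periodic function with values
  in a product space; its almost periods serve for the image.\<close>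

lemma L_AP:
  assumes \<psi>: "almost_periodic \<psi>" shows "almost_periodic (L \<psi>)"
proof -
  obtain B where B: "B > 0" "\<And>t. norm (\<psi> t) \<le> B" using almost_periodic_bounded[OF \<psi>] by blast
  have c: "continuous_on UNIV \<psi>" using \<psi> by (simp add: almost_periodic_def)
  define C where "C = ap * (K * B) + \<beta>m * (ap * (ap * (K * B) + K))"
  have C: "C > 0" unfolding C_def using B ap K1 \<beta>m by (intro add_pos_pos mult_pos_pos) auto
  show ?thesis
  proof (rule almost_periodic_transfer[OF almost_periodic_Pair[OF \<beta>_AP almost_periodic_Pair[OF \<mu>_AP \<psi>]]])
    fix \<epsilon> :: real assume \<epsilon>: "\<epsilon> > 0"
    define \<delta> where "\<delta> = \<epsilon> / (2 * C)"
    have \<delta>: "\<delta> > 0" using \<epsilon> C by (simp add: \<delta>_def)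
    show "\<exists>\<delta>>0. \<forall>\<tau>. (\<forall>t. norm ((\<beta> (t + \<tau>), \<mu> (t + \<tau>), \<psi> (t + \<tau>)) - (\<beta> t, \<mu> t, \<psi> t)) < \<delta>) \<longrightarrow>
        (\<forall>t. norm (L \<psi> (t + \<tau>) - L \<psi> t) < \<epsilon>)"
    proof (intro exI[of _ \<delta>] conjI \<delta> allI impI)
      fix \<tau> t
      assume *: "\<forall>t. norm ((\<beta> (t + \<tau>), \<mu> (t + \<tau>), \<psi> (t + \<tau>)) - (\<beta> t, \<mu> t, \<psi> t)) < \<delta>"
      have p: "norm (\<beta> (t + \<tau>) - \<beta> t) \<le> \<delta>" "\<bar>\<mu> (t + \<tau>) - \<mu> t\<bar> \<le> \<delta>" "norm (\<psi> (t + \<tau>) - \<psi> t) \<le> \<delta>" for t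
        using *[rule_format, of t] norm_fst_le[of "\<beta> (t + \<tau>) - \<beta> t" "(\<mu> (t + \<tau>) - \<mu> t, \<psi> (t + \<tau>) - \<psi> t)"]
          norm_snd_le[of "(\<mu> (t + \<tau>) - \<mu> t, \<psi> (t + \<tau>) - \<psi> t)" "\<beta> (t + \<tau>) - \<beta> t"]
          norm_fst_le[of "\<mu> (t + \<tau>) - \<mu> t" "\<psi> (t + \<tau>) - \<psi> t"]
          norm_snd_le[of "\<psi> (t + \<tau>) - \<psi> t" "\<mu> (t + \<tau>) - \<mu> t"] by simp_all
      have "norm (L \<psi> (t + \<tau>) - L \<psi> t) \<le> norm (\<beta> (t + \<tau>) - \<beta> t) * (ap * (K * B)) + \<beta>m * (ap * (ap * \<delta> * (K * B) + K * \<delta>))"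
      proof (rule L_time_diff[OF c c])
        fix a assume a: "0 \<le> a" "a \<le> ap"
        show "norm (kern \<psi> (t + \<tau>) a) \<le> K * B"
          using kern_norm[OF a, of \<psi> "t + \<tau>"] B(2)[of "t + \<tau> - a"] K1
          by (meson mult_left_mono order_trans zero_le_one)
        have e: "kern \<psi> (t + \<tau>) a - kern \<psi> t a = (srv (t + \<tau>) a - srv t a) *\<^sub>R T a (\<psi> (t + \<tau> - a))
            + srv t a *\<^sub>R T a (\<psi> (t - a + \<tau>) - \<psi> (t - a))"
          using a by (simp add: kern_def T_diff algebra_simps)
        have "norm (kern \<psi> (t + \<tau>) a - kern \<psi> t a) \<le> \<bar>srv (t + \<tau>) a - srv t a\<bar> * norm (T a (\<psi> (t + \<tau> - a)))
            + \<bar>srv t a\<bar> * norm (T a (\<psi> (t - a + \<tau>) - \<psi> (t - a)))"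
          unfolding e by (rule order_trans[OF norm_triangle_ineq]) simp
        also have "\<dots> \<le> (ap * \<delta>) * (K * B) + 1 * (K * \<delta>)"
        proof (intro add_mono mult_mono)
          show "\<bar>srv (t + \<tau>) a - srv t a\<bar> \<le> ap * \<delta>" by (rule srv_time_diff[OF a p(2)])
          show "norm (T a (\<psi> (t + \<tau> - a))) \<le> K * B"
            using T_K[OF a, of "\<psi> (t + \<tau> - a)"] B(2)[of "t + \<tau> - a"] K1 by (meson mult_left_mono order_trans zero_le_one)
          show "norm (T a (\<psi> (t - a + \<tau>) - \<psi> (t - a))) \<le> K * \<delta>"
            using T_K[OF a, of "\<psi> (t - a + \<tau>) - \<psi> (t - a)"] p(3)[of "t - a"] K1 by (meson mult_left_mono order_trans zero_le_one)
          show "\<bar>srv t a\<bar> \<le> 1" using srv_pos[of t a] srv_le_1[OF a(1), of t] by simp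
        qed (use ap \<delta> in auto)
        finally show "norm (kern \<psi> (t + \<tau>) a - kern \<psi> t a) \<le> ap * \<delta> * (K * B) + K * \<delta>" by simp
      qed
      also have "\<dots> \<le> \<delta> * (ap * (K * B)) + \<beta>m * (ap * (ap * \<delta> * (K * B) + K * \<delta>))"
        using p(1)[of t] ap K1 B by (intro add_mono mult_right_mono order_refl) auto
      also have "\<dots> = \<delta> * C" by (simp add: C_def algebra_simps)
      also have "\<dots> < \<epsilon>" using C \<epsilon> by (simp add: \<delta>_def)
      finally show "norm (L \<psi> (t + \<tau>) - L \<psi> t) < \<epsilon>" .
    qed
  qed
qed

lemma const_AP: "almost_periodic (\<lambda>_. x)"
  by (rule periodic_imp_almost_periodic[of _ 1]) auto

lemma AP_space_D: "\<psi> \<in> AP_space \<Longrightarrow> almost_periodic (apply_bcontfun \<psi>)"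
  by (simp add: AP_space_def)

lemma closed_AP_space: "closed AP_space"
proof -
  have "AP_space = {\<psi>. almost_periodic (apply_bcontfun \<psi>)} \<inter> PiC UNIV (\<lambda>_. {x. T 0 x = x})"
    by (auto simp: AP_space_def mem_PiC_iff Pi_iff)
  moreover have "closed {x. T 0 x = x}"
    by (intro closed_Collect_eq bounded_linear.continuous_on[OF T0_bounded_linear] continuous_intros)
  ultimately show ?thesis using closed_almost_periodic by (auto intro!: closed_Int closed_PiC)
qed

lemma subspace_AP_space: "subspace AP_space"
  unfolding subspace_def
proof (intro conjI ballI allI)
  show "0 \<in> AP_space" by (simp add: AP_space_def T_zero const_AP)
  fix x y assume "x \<in> AP_space" "y \<in> AP_space"
  then show "x + y \<in> AP_space" by (simp add: AP_space_def T_plus almost_periodic_add)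
next
  fix c x assume x: "x \<in> AP_space"
  have "almost_periodic (\<lambda>t. c *\<^sub>R apply_bcontfun x t)"
    by (rule almost_periodic_lipschitz[OF AP_space_D[OF x], where K = "\<bar>c\<bar>"])
       (simp add: scaleR_diff_right[symmetric])
  then show "c *\<^sub>R x \<in> AP_space" using x by (simp add: AP_space_def T_scaleR)
qed

lemma L_bcontfun_AP_space: "\<psi> \<in> AP_space \<Longrightarrow> L_bcontfun \<psi> \<in> AP_space"
  by (simp add: AP_space_def apply_L_bcontfun L_AP T0_L)

lemma norm_L_bcontfun: "norm (L_bcontfun \<psi>) \<le> \<beta>m * ap * K * norm \<psi>"
  by (rule norm_bound) (auto simp: apply_L_bcontfun intro!: L_norm norm_bounded)

text \<open>The pointwise positive part is Lipschitz and keeps fixed vectors of \<open>T 0\<close>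
  fixed, so it preserves \<open>AP_space\<close> and provides the decomposition demanded of the
  cone.\<close>

sublocale renewal_operator: positive_operator AP_space "{\<psi> \<in> AP_space. \<forall>t. nn (apply_bcontfun \<psi> t)}" L_bcontfun
proof
  show "linear_map_on AP_space L_bcontfun"
    unfolding linear_map_on_def
    by (auto intro!: bcontfun_eqI simp: apply_L_bcontfun L_add L_scale)
  show "L_bcontfun ` AP_space \<subseteq> AP_space" using L_bcontfun_AP_space by auto
  show "\<exists>K. \<forall>x\<in>AP_space. norm (L_bcontfun x) \<le> K * norm x" using norm_L_bcontfun by blast
next
  fix x assume "x \<in> {\<psi> \<in> AP_space. \<forall>t. nn (apply_bcontfun \<psi> t)}"
  then show "L_bcontfun x \<in> {\<psi> \<in> AP_space. \<forall>t. nn (apply_bcontfun \<psi> t)}"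
    using L_bcontfun_AP_space Lpow_nn[of "apply_bcontfun x" _ 1] by (auto simp: apply_L_bcontfun)
next
  fix x y assume "x \<in> {\<psi> \<in> AP_space. \<forall>t. nn (apply_bcontfun \<psi> t)}" "y \<in> {\<psi> \<in> AP_space. \<forall>t. nn (apply_bcontfun \<psi> t)}"
  then have "norm (apply_bcontfun x t) \<le> norm (apply_bcontfun (x + y) t)" for t
    by (intro nn_mono_norm) auto
  then show "norm x \<le> norm (x + y)"
    by (intro norm_bound) (rule order_trans[OF _ norm_bounded])
next
  fix x assume x: "x \<in> AP_space"
  define u where "u f = Bcontfun (\<lambda>t. pp (apply_bcontfun f t))" for f :: "real \<Rightarrow>\<^sub>C 'e"
  have u: "apply_bcontfun (u f) t = pp (apply_bcontfun f t)" for f t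
    unfolding u_def
    by (subst Bcontfun_inverse, rule bcontfun_normI[where b = "norm f"])
       (auto intro!: continuous_intros order_trans[OF pp_norm norm_bounded])
  have uA: "u f \<in> AP_space" if "f \<in> AP_space" for f
  proof -
    have "almost_periodic (\<lambda>t. pp (apply_bcontfun f t))"
      by (rule almost_periodic_lipschitz[OF AP_space_D[OF that], where K = 1]) (simp add: pp_lipschitz)
    moreover have "apply_bcontfun (u f) = (\<lambda>t. pp (apply_bcontfun f t))"
      by (rule ext) (rule u)
    ultimately show ?thesis using that by (simp add: AP_space_def u T0_pp)
  qed
  have mx: "- x \<in> AP_space" using x by (rule subspace_neg[OF subspace_AP_space])
  have "x = u x - u (- x)" by (rule bcontfun_eqI) (simp add: u pp_split)
  moreover have nu: "norm (u f) \<le> norm f" for f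
    by (rule norm_bound) (simp add: u order_trans[OF pp_norm norm_bounded])
  moreover have "norm (u (- x)) \<le> norm x" using nu[of "- x"] by simp
  ultimately show "\<exists>u\<in>{\<psi> \<in> AP_space. \<forall>t. nn (apply_bcontfun \<psi> t)}. \<exists>v\<in>{\<psi> \<in> AP_space. \<forall>t. nn (apply_bcontfun \<psi> t)}.
      x = u - v \<and> norm u \<le> norm x \<and> norm v \<le> norm x"
    using uA[OF x] uA[OF mx] by (intro bexI[of _ "u x"] bexI[of _ "u (- x)"]) (auto simp: u pp_nn)
qed (use closed_AP_space subspace_AP_space in \<open>auto simp: subspace_0 subspace_add subspace_scale nn_0 nn_add nn_scale\<close>)

text \<open>The worst case over one generation: mortality and diffusive loss over the full age span,
  then fertility \<epsilon>0 at every age.\<close>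

definition growth_const where "growth_const = exp (- (\<mu>m + d) * ap) * (\<epsilon>0 * ap)"

lemma Lpow_const_ge: "growth_const ^ n *\<^sub>R x0 \<preceq> (L ^^ n) (\<lambda>_. x0) t"
proof (induction n arbitrary: t)
  case (Suc n)
  have 1: "growth_const *\<^sub>R x0 \<preceq> L (\<lambda>_. x0) t" for t
  proof -
    define y where "y = exp (- (\<mu>m + d) * ap) *\<^sub>R x0"
    have y: "nn y" by (simp add: y_def nn_scale x0)
    have iy: "integrable M (\<lambda>a. y)" by (intro integrable_M_continuous continuous_intros)
    have sp: "space M \<in> sets M" by (rule sets.top)
    have "(\<epsilon>0 * measure M (space M)) *\<^sub>R y \<preceq> birth t (\<lambda>a. indicator (space M) a *\<^sub>R y)"
      by (rule birth_indicator_ge[OF y sp])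
    also have "birth t (\<lambda>a. indicator (space M) a *\<^sub>R y) = birth t (\<lambda>a. y)"
      unfolding birth_def by (rule Bochner_Integration.integral_cong) auto
    finally have "(\<epsilon>0 * ap) *\<^sub>R y \<preceq> birth t (\<lambda>a. y)" unfolding measure_M .
    also have "(\<epsilon>0 * ap) *\<^sub>R y = growth_const *\<^sub>R x0" by (simp add: y_def growth_const_def mult.commute)
    finally have "growth_const *\<^sub>R x0 \<preceq> birth t (\<lambda>a. y)" .
    moreover have "birth t (\<lambda>a. y) \<preceq> birth t (kern (\<lambda>_. x0) t)"
    proof (intro birth_mono iy integrable_kern continuous_intros AE_M_I)
      fix a assume a: "0 < a" "a < ap"
      have "exp (- (\<mu>m + d) * ap) \<le> srv t a * exp (- d * a)"
      proof -
        have "exp (- (\<mu>m + d) * ap) = exp (- \<mu>m * ap) * exp (- d * ap)"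
          by (simp add: exp_add[symmetric] algebra_simps)
        also have "\<dots> \<le> srv t a * exp (- d * a)"
          using a d srv_ge[of a t] by (intro mult_mono) (auto simp: srv_pos less_imp_le mult_left_mono)
        finally show ?thesis .
      qed
      then have "y \<preceq> (srv t a * exp (- d * a)) *\<^sub>R x0" unfolding y_def by (intro le_scale_left x0)
      also have "(srv t a * exp (- d * a)) *\<^sub>R x0 = srv t a *\<^sub>R (exp (- d * a) *\<^sub>R T 0 x0)" by (simp add: x0)
      finally have "y \<preceq> srv t a *\<^sub>R (exp (- d * a) *\<^sub>R T 0 x0)" .
      moreover have "srv t a *\<^sub>R (exp (- d * a) *\<^sub>R T 0 x0) \<preceq> kern (\<lambda>_. x0) t a"
        using a T_ge[OF less_imp_le[OF a(1)] x0(2)] unfolding kern_def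
        by (intro le_scale) (simp_all only: srv_pos less_imp_le max_absorb2)
      ultimately show "y \<preceq> kern (\<lambda>_. x0) t a" by (rule le_trans)
    qed
    ultimately show ?thesis unfolding L_def by (rule le_trans)
  qed
  have "L (\<lambda>_. growth_const ^ n *\<^sub>R x0) t \<preceq> L ((L ^^ n) (\<lambda>_. x0)) t"
    by (intro L_mono Lpow_cont continuous_intros Suc)
  then have "growth_const ^ n *\<^sub>R L (\<lambda>_. x0) t \<preceq> (L ^^ Suc n) (\<lambda>_. x0) t" by (simp add: L_scale)
  moreover have "growth_const ^ n *\<^sub>R (growth_const *\<^sub>R x0) \<preceq> growth_const ^ n *\<^sub>R L (\<lambda>_. x0) t"
    using ap \<epsilon>0 by (intro le_scale 1) (simp add: growth_const_def)
  ultimately show ?case using le_trans by (simp add: mult.commute)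
qed (simp add: nn_0)

text \<open>The constant function \<open>x0\<close> provides the orbit that certifies a nonempty
  spectrum.\<close>

lemma iterate_bound_imp_spectral_radius:
  assumes "iterate_bound 0 c" "c \<ge> 0" shows "spectral_radius_on AP_space L_bcontfun \<le> c"
proof -
  obtain C where C0: "\<forall>n f t B. continuous_on UNIV f \<longrightarrow>
     (\<forall>s\<in>{t - real n * ap..t}. norm (f s) \<le> B * exp (0 * (s - t))) \<longrightarrow> norm ((L ^^ n) f t) \<le> C * c ^ n * B"
    using assms(1) unfolding iterate_bound_def by blast
  have C: "norm ((L ^^ n) f t) \<le> C * c ^ n * B"
    if "continuous_on UNIV f" "\<And>s. s \<in> {t - real n * ap..t} \<Longrightarrow> norm (f s) \<le> B" for n f t B
    using C0 that by simp
  define X where "X = (const_bcontfun x0 :: real \<Rightarrow>\<^sub>C 'e)"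
  have aX: "apply_bcontfun X = (\<lambda>_. x0)" by (simp add: X_def const_bcontfun.rep_eq)
  have g0: "growth_const > 0" using ap \<epsilon>0 by (simp add: growth_const_def)
  show ?thesis
  proof (rule renewal_operator.spectral_radius_le[of growth_const X, OF g0 _ _ _ assms(2)])
    show "X \<in> AP_space" by (simp add: AP_space_def aX x0 const_AP)
    show "X \<noteq> 0" using x0(3) aX by (metis zero_bcontfun.rep_eq)
    have "norm X \<le> norm x0" by (rule norm_bound) (simp add: aX)
    show "growth_const ^ n * norm X \<le> norm ((L_bcontfun ^^ n) X)" for n
    proof -
      have "growth_const ^ n * norm X \<le> norm (growth_const ^ n *\<^sub>R x0)"
        using g0 \<open>norm X \<le> norm x0\<close> by (simp add: mult_left_mono)
      also have "\<dots> \<le> norm ((L ^^ n) (\<lambda>_. x0) 0)"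
        by (rule nn_mono_norm[OF _ Lpow_const_ge]) (use g0 x0 in \<open>auto intro!: nn_scale\<close>)
      also have "\<dots> \<le> norm ((L_bcontfun ^^ n) X)"
        using norm_bounded[of "(L_bcontfun ^^ n) X" 0] by (simp add: apply_L_bcontfun_pow aX)
      finally show ?thesis .
    qed
    show "norm ((L_bcontfun ^^ n) x) \<le> C * c ^ n * norm x" for n x
      by (rule norm_bound) (auto simp: apply_L_bcontfun_pow intro!: C norm_bounded)
  qed
qed

text \<open>A bound for the iterates on almost periodic functions gives the same bound for all continuous functions,
  as \<open>L^n f t\<close> depends only on the values of \<open>f\<close> on \<open>{t - n ap..t}\<close>, and the restriction of \<open>f\<close> to this interval
  extends to a periodic function with the same bound by reflection.\<close>

lemma spectral_radius_imp_iterate_bound: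
  assumes "spectral_radius_on AP_space L_bcontfun < q" "q > 0" shows "iterate_bound 0 q"
proof -
  obtain A where A: "\<And>n x. x \<in> AP_space \<Longrightarrow> norm ((L_bcontfun ^^ n) x) \<le> A * q ^ n * norm x"
    using renewal_operator.spectral_radius_less[OF assms] by blast
  show ?thesis
    unfolding iterate_bound_def
  proof (intro exI[of _ "max A 1"] allI impI)
    fix n t B and f :: "real \<Rightarrow> 'e"
    assume f: "continuous_on UNIV f" and b: "\<forall>s\<in>{t - real n * ap..t}. norm (f s) \<le> B * exp (0 * (s - t))"
    have b: "norm (f s) \<le> B" if "s \<in> {t - real n * ap..t}" for s using b that by simp
    have B: "B \<ge> 0" using b[of t] ap order_trans[OF norm_ge_zero] by auto
    show "norm ((L ^^ n) f t) \<le> max A 1 * q ^ n * B"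
    proof (cases n)
      \<comment> \<open>Treated separately: no \<open>L\<close> is applied that could absorb the
        projection of the values, and the periodic extension used below would have period 0. The 1
        in \<open>max A 1\<close> covers this case.\<close>
      case 0
      have "norm (f t) \<le> 1 * B" using b[of t] ap by simp
      also have "\<dots> \<le> max A 1 * B" using B by (intro mult_right_mono) auto
      finally show ?thesis using 0 by simp
    next
      case (Suc m)
      \<comment> \<open>\<open>arccos (cos x)\<close> is a triangular wave equal to \<open>x\<close>
        on \<open>{0..pi}\<close>. Rescaled by \<open>w\<close> it folds the line onto the window by
        reflections, with period \<open>2 * pi * w\<close>.\<close>
      define w where "w = real n * ap / pi"
      have w: "w > 0" "w * pi = real n * ap" using ap Suc by (auto simp: w_def)
      define a where "a = t - real n * ap"
      define \<theta> where "\<theta> s = a + w * arccos (cos ((s - a) / w))" for s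
      have \<theta>_range: "\<theta> s \<in> {t - real n * ap..t}" for s
      proof -
        have "arccos (cos ((s - a) / w)) \<in> {0..pi}" using arccos_bounded by simp
        then have "w * arccos (cos ((s - a) / w)) \<le> w * pi" "0 \<le> w * arccos (cos ((s - a) / w))"
          using w(1) by (auto intro: mult_left_mono)
        then show ?thesis unfolding \<theta>_def w(2) by (auto simp: a_def)
      qed
      have \<theta>_id: "\<theta> s = s" if "s \<in> {t - real n * ap..t}" for s
      proof -
        have "0 \<le> (s - a) / w" "(s - a) / w \<le> pi" using that w by (auto simp: a_def field_simps)
        then have "arccos (cos ((s - a) / w)) = (s - a) / w" by (rule arccos_cos)
        then show ?thesis using w(1) by (simp add: \<theta>_def)
      qed
      have \<theta>_cont: "continuous_on UNIV \<theta>"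
        unfolding \<theta>_def using w(1) by (intro continuous_intros continuous_on_arccos) auto
      have \<theta>_per: "\<theta> (s + 2 * pi * w) = \<theta> s" for s
      proof -
        have "(s + 2 * pi * w - a) / w = (s - a) / w + 2 * pi" using w(1) by (simp add: field_simps)
        then show ?thesis by (simp add: \<theta>_def)
      qed
      \<comment> \<open>Projecting the values puts the extension into \<open>AP_space\<close>. For
        \<open>n > 0\<close> this leaves the iterate unchanged, because \<open>L\<close> absorbs
        \<open>T 0\<close>.\<close>
      define g where "g s = T 0 (f (\<theta> s))" for s
      have g: "continuous_on UNIV g"
        unfolding g_def
        by (intro bounded_linear.continuous_on[OF T0_bounded_linear] continuous_on_compose2[OF f \<theta>_cont]) auto
      have iterate_bound: "norm (g s) \<le> B" for s
        using T0_norm[of "f (\<theta> s)"] b[OF \<theta>_range[of s]] by (simp add: g_def)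
      define \<psi> where "\<psi> = Bcontfun g"
      have a\<psi>: "apply_bcontfun \<psi> = g"
        unfolding \<psi>_def by (rule Bcontfun_inverse, rule bcontfun_normI[OF g iterate_bound])
      have "almost_periodic g"
        by (rule periodic_imp_almost_periodic[OF g, of "2 * pi * w"]) (use w in \<open>auto simp: g_def \<theta>_per\<close>)
      then have \<psi>: "\<psi> \<in> AP_space" by (simp add: AP_space_def a\<psi> g_def T_T0)
      have \<psi>n: "norm \<psi> \<le> B" by (rule norm_bound) (simp add: a\<psi> iterate_bound)
      have c0: "continuous_on UNIV (\<lambda>s. T 0 (f s))"
        by (intro bounded_linear.continuous_on[OF T0_bounded_linear] f)
      have "(L ^^ n) f = (L ^^ n) (\<lambda>s. T 0 (f s))"
        unfolding Suc funpow_Suc_right comp_def by (simp add: L_T0[abs_def])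
      then have "(L ^^ n) f t = (L ^^ n) (\<lambda>s. T 0 (f s)) t" by simp
      also have "\<dots> = (L ^^ n) g t"
        by (rule Lpow_local[OF c0 g]) (simp only: g_def \<theta>_id)
      also have "\<dots> = apply_bcontfun ((L_bcontfun ^^ n) \<psi>) t" by (simp add: apply_L_bcontfun_pow a\<psi>)
      finally have "norm ((L ^^ n) f t) \<le> norm ((L_bcontfun ^^ n) \<psi>)" by (simp only: norm_bounded)
      also have "\<dots> \<le> A * q ^ n * norm \<psi>" by (rule A[OF \<psi>])
      also have "\<dots> \<le> max A 1 * q ^ n * B"
        using \<psi>n assms(2) B by (intro mult_mono) auto
      finally show ?thesis .
    qed
  qed
qed

end

section \<open>Solutions along characteristics\<close>

lemma integrable_lebesgue_shift:
  fixes f :: "real \<Rightarrow> 'b::{banach, second_countable_topology}"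
  assumes "integrable lebesgue f"
  shows "integrable lebesgue (\<lambda>x. f (x - c))" "(LINT x|lebesgue. f (x - c)) = (LINT x|lebesgue. f x)"
proof -
  have m: "(\<lambda>x. - c + 1 * x) \<in> lebesgue \<rightarrow>\<^sub>M lebesgue"
    using lebesgue_affine_measurable[of "\<lambda>_::real. 1" "- c"] by simp
  have d: "lebesgue = distr lebesgue lebesgue (\<lambda>x. - c + 1 * x)"
    using lebesgue_real_affine[of 1 "- c"] by (simp add: density_1)
  have "integrable (distr lebesgue lebesgue (\<lambda>x. - c + 1 * x)) f" using assms d by simp
  then show "integrable lebesgue (\<lambda>x. f (x - c))"
    using integrable_distr[OF m] by (simp add: add.commute)
  have "(LINT x|lebesgue. f x) = (LINT x|distr lebesgue lebesgue (\<lambda>x. - c + 1 * x). f x)" using d by simp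
  also have "\<dots> = (LINT x|lebesgue. f (- c + 1 * x))"
    by (rule integral_distr[OF m]) (use assms in simp)
  finally show "(LINT x|lebesgue. f (x - c)) = (LINT x|lebesgue. f x)" by simp
qed

text \<open>The maximum argument of \<open>gronwall_bound\<close> with the integral replaced by an
  abstract step: a weighted bound on the past must reproduce itself with half the constant. Renewal
  inequalities have this form.\<close>

lemma weighted_maximum_bound:
  fixes \<phi> :: "real \<Rightarrow> real"
  assumes cont: "continuous_on {s..t} \<phi>" and st: "s \<le> t" and nn: "\<And>r. r \<in> {s..t} \<Longrightarrow> 0 \<le> \<phi> r"
    and A: "A \<ge> 0" and l: "l \<ge> 0"
    and step: "\<And>r Y. r \<in> {s..t} \<Longrightarrow> Y \<ge> 0 \<Longrightarrow> (\<And>x. x \<in> {s..r} \<Longrightarrow> \<phi> x \<le> Y * exp (l * (x - s))) \<Longrightarrow>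
      \<phi> r \<le> A + Y / 2 * exp (l * (r - s))"
  shows "\<phi> t \<le> 2 * A * exp (l * (t - s))"
proof -
  define y where "y r = exp (- (l * (r - s))) * \<phi> r" for r
  have "continuous_on {s..t} y"
    unfolding y_def by (intro continuous_intros cont)
  then obtain r0 where r0: "r0 \<in> {s..t}" "\<And>r. r \<in> {s..t} \<Longrightarrow> y r \<le> y r0"
    using continuous_attains_sup[of "{s..t}" y] st by auto
  have \<phi>: "\<phi> r = y r * exp (l * (r - s))" for r
    unfolding y_def by (simp add: mult_exp_exp)
  have Y: "y r0 \<ge> 0" unfolding y_def using nn[OF r0(1)] by simp
  have "\<phi> r0 \<le> A + y r0 / 2 * exp (l * (r0 - s))"
  proof (rule step[OF r0(1) Y])
    fix x assume x: "x \<in> {s..r0}"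
    then show "\<phi> x \<le> y r0 * exp (l * (x - s))"
      unfolding \<phi>[of x] using r0 by (intro mult_right_mono r0(2)) auto
  qed
  then have "y r0 * exp (l * (r0 - s)) \<le> 2 * A" using \<phi>[of r0] by simp
  moreover have "y r0 * 1 \<le> y r0 * exp (l * (r0 - s))" using r0 l Y by (intro mult_left_mono) auto
  ultimately have "y t \<le> 2 * A" using r0(2)[of t] st by auto
  then show ?thesis unfolding \<phi>[of t] by (intro mult_right_mono) auto
qed

context renewal
begin

text \<open>Individuals of age \<open>a \<le> t - s\<close> were born at time \<open>t - a\<close>, the others are
  survivors of the initial population \<open>p0\<close>.\<close>

definition char_value :: "real \<Rightarrow> (real \<Rightarrow> 'e) \<Rightarrow> (real \<Rightarrow> 'e) \<Rightarrow> real \<Rightarrow> real \<Rightarrow> 'e" where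
  "char_value s b p0 t a = (if a \<le> t - s then srv t a *\<^sub>R T (max 0 a) (b (t - a))
     else exp (H s - H t) *\<^sub>R T (max 0 (t - s)) (p0 (a - (t - s))))"

text \<open>The birth rate fed into \<open>char_value\<close> is that of \<open>P\<close> itself, so
  the renewal equation is built in as a fixed point; \<open>P t\<close> matters only up to null sets
  of ages.\<close>

definition char_solution :: "real \<Rightarrow> (real \<Rightarrow> 'e) \<Rightarrow> (real \<Rightarrow> real \<Rightarrow> 'e) \<Rightarrow> bool" where
  "char_solution s p0 P \<longleftrightarrow> integrable lebesgue p0 \<and> continuous_on {s..} (\<lambda>t. birth t (P t)) \<and>
     (\<forall>t\<ge>s. integrable M (P t) \<and> (AE a in M. P t a = char_value s (\<lambda>r. birth r (P r)) p0 t a))"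

lemma integrable_lebesgue_M:
  fixes f :: "real \<Rightarrow> 'b::{banach, second_countable_topology}"
  assumes f: "integrable lebesgue f" shows "integrable M f"
proof -
  have "integrable lebesgue (\<lambda>a. indicator {0<..<ap} a *\<^sub>R f a)"
    by (rule integrable_mult_indicator[OF _ f]) auto
  then show ?thesis by (subst integrable_restrict_space) auto
qed

lemma exp_H_le_1: "s \<le> t \<Longrightarrow> exp (H s - H t) \<le> 1"
  using H_diff[of s t] by simp

text \<open>After time \<open>ap\<close> every initial individual has left the age interval, hence
  the condition \<open>t - s < ap\<close> on the share of \<open>p0\<close>. Births are measured
  against the weight at their own time, which leaves the integral of
  \<open>exp (- l * a)\<close>.\<close>

lemma char_solution_norm:
  assumes P: "char_solution s p0 P" and t: "s \<le> t"
    and b: "\<And>r. r \<in> {s..t} \<Longrightarrow> norm (birth r (P r)) \<le> Y * exp (l * (r - s))" and Y: "Y \<ge> 0"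
  shows "(LINT a|M. norm (P t a)) \<le> (if t - s < ap then K * (LINT a|lebesgue. norm (p0 a)) else 0)
      + K * Y * exp (l * (t - s)) * (LINT a|M. exp (- l * a))"
proof -
  have p0: "integrable lebesgue p0" and iP: "integrable M (P t)"
    and AP: "AE a in M. P t a = char_value s (\<lambda>r. birth r (P r)) p0 t a"
    using P t by (auto simp: char_solution_def)
  define g where "g a = (if t - s < ap then K * norm (p0 (a - (t - s))) else 0)" for a
  have sh: "integrable lebesgue (\<lambda>a. norm (p0 (a - (t - s))))"
    "(LINT a|lebesgue. norm (p0 (a - (t - s)))) = (LINT a|lebesgue. norm (p0 a))"
    using integrable_lebesgue_shift[of "\<lambda>a. norm (p0 a)" "t - s"] p0 by auto
  have shM: "integrable M (\<lambda>a. norm (p0 (a - (t - s))))"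
    by (rule integrable_lebesgue_M[OF sh(1)])
  have gi: "integrable M g" using shM by (cases "t - s < ap") (simp_all add: g_def[abs_def])
  have "(LINT a|M. norm (p0 (a - (t - s)))) \<le> (LINT a|lebesgue. norm (p0 (a - (t - s))))"
  proof -
    have "(LINT a|M. norm (p0 (a - (t - s)))) = (LINT a|lebesgue. indicator {0<..<ap} a *\<^sub>R norm (p0 (a - (t - s))))"
      by (rule integral_restrict_space) auto
    also have "\<dots> \<le> (LINT a|lebesgue. norm (p0 (a - (t - s))))"
    proof (rule integral_mono_AE)
      show "integrable lebesgue (\<lambda>a. indicator {0<..<ap} a *\<^sub>R norm (p0 (a - (t - s))))"
        by (rule integrable_mult_indicator[OF _ sh(1)]) auto
    qed (use sh(1) in \<open>auto simp: indicator_def\<close>)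
    finally show ?thesis .
  qed
  then have gI: "(LINT a|M. g a) \<le> (if t - s < ap then K * (LINT a|lebesgue. norm (p0 a)) else 0)"
    using sh(2) K1 by (simp add: g_def mult_left_mono)
  have "(LINT a|M. norm (P t a)) \<le> (LINT a|M. g a + K * Y * exp (l * (t - s)) * exp (- l * a))"
  proof (rule integral_mono_AE)
    show "integrable M (\<lambda>a. g a + K * Y * exp (l * (t - s)) * exp (- l * a))"
      by (intro Bochner_Integration.integrable_add gi integrable_M_continuous continuous_intros)
    have "AE a in M. 0 < a \<and> a < ap" by (rule AE_M_I) simp
    then show "AE a in M. norm (P t a) \<le> g a + K * Y * exp (l * (t - s)) * exp (- l * a)"
      using AP
    proof eventually_elim
      case (elim a)
      have g0: "g a \<ge> 0" using K1 by (simp add: g_def)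
      have y0: "K * Y * exp (l * (t - s)) * exp (- l * a) \<ge> 0" using K1 Y by simp
      show ?case
      proof (cases "a \<le> t - s")
        case True
        have "norm (P t a) = srv t a * norm (T a (birth (t - a) (P (t - a))))"
          using elim True srv_pos[of t a] by (simp add: char_value_def)
        also have "\<dots> \<le> 1 * (K * (Y * exp (l * (t - a - s))))"
        proof (rule mult_mono)
          have "norm (T a (birth (t - a) (P (t - a)))) \<le> K * norm (birth (t - a) (P (t - a)))"
            using elim by (intro T_K) auto
          also have "\<dots> \<le> K * (Y * exp (l * (t - a - s)))"
            using elim True K1 by (intro mult_left_mono b) auto
          finally show "norm (T a (birth (t - a) (P (t - a)))) \<le> K * (Y * exp (l * (t - a - s)))" .
        qed (use elim srv_le_1 in auto)
        also have "exp (l * (t - a - s)) = exp (l * (t - s)) * exp (- l * a)"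
          unfolding mult_exp_exp by (rule arg_cong[where f = exp]) (simp add: algebra_simps)
        finally show ?thesis using g0 by (simp add: mult.assoc)
      next
        case False
        then have ts: "t - s < ap" using elim by auto
        have "norm (P t a) = exp (H s - H t) * norm (T (t - s) (p0 (a - (t - s))))"
          using elim False t by (simp add: char_value_def)
        also have "\<dots> \<le> 1 * (K * norm (p0 (a - (t - s))))"
          using t ts by (intro mult_mono T_K exp_H_le_1) auto
        also have "\<dots> = g a" using ts by (simp add: g_def)
        finally show ?thesis using y0 by simp
      qed
    qed
  qed (intro integrable_norm iP)
  also have "\<dots> = (LINT a|M. g a) + K * Y * exp (l * (t - s)) * (LINT a|M. exp (- l * a))"
    by (subst Bochner_Integration.integral_add[OF gi])
       (auto intro!: integrable_M_continuous continuous_intros)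
  finally show ?thesis using gI by linarith
qed

text \<open>An a priori bound with a far from optimal exponent: \<open>2 * \<beta>m * K\<close>
  makes past births reproduce at most half of their weighted maximum. It serves to control a bounded
  initial time interval.\<close>

lemma char_solution_births_crude:
  assumes P: "char_solution s p0 P" and t: "s \<le> t"
  shows "norm (birth t (P t)) \<le> 2 * (\<beta>m * K * (LINT a|lebesgue. norm (p0 a))) * exp (2 * \<beta>m * K * (t - s))"
proof (rule weighted_maximum_bound[OF _ t])
  show "continuous_on {s..t} (\<lambda>t. norm (birth t (P t)))"
    by (rule continuous_on_norm, rule continuous_on_subset[of "{s..}"]) (use P in \<open>auto simp: char_solution_def\<close>)
  show "0 \<le> \<beta>m * K * (LINT a|lebesgue. norm (p0 a))" using \<beta>m K1 by simp
  show "0 \<le> 2 * \<beta>m * K" using \<beta>m K1 by simp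
  fix r Y assume r: "r \<in> {s..t}" and Y: "Y \<ge> 0"
    and b: "\<And>x. x \<in> {s..r} \<Longrightarrow> norm (birth x (P x)) \<le> Y * exp (2 * \<beta>m * K * (x - s))"
  define l where "l = 2 * \<beta>m * K"
  have l: "l > 0" using \<beta>m K1 by (simp add: l_def)
  define N where "N = (LINT a|lebesgue. norm (p0 a))"
  have "norm (birth r (P r)) \<le> \<beta>m * (LINT a|M. norm (P r a))"
    using P r by (intro birth_norm) (auto simp: char_solution_def)
  also have "(LINT a|M. norm (P r a)) \<le> (if r - s < ap then K * N else 0) + K * Y * exp (l * (r - s)) * (LINT a|M. exp (- l * a))"
    unfolding N_def by (rule char_solution_norm[OF P]) (use r b Y in \<open>auto simp: l_def\<close>)
  also have "\<dots> \<le> K * N + K * Y * exp (l * (r - s)) * (1 / l)"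
    using K1 Y by (intro add_mono mult_left_mono integral_M_exp[OF l]) (auto simp: N_def)
  finally have "norm (birth r (P r)) \<le> \<beta>m * (K * N + K * Y * exp (l * (r - s)) * (1 / l))"
    using \<beta>m by simp
  also have "\<dots> = \<beta>m * K * N + Y / 2 * exp (l * (r - s))"
    using \<beta>m K1 by (simp add: l_def field_simps)
  finally show "norm (birth r (P r)) \<le> \<beta>m * K * N + Y / 2 * exp (2 * \<beta>m * K * (r - s))"
    by (simp add: l_def)
qed auto

lemma L_zero:
  assumes f: "continuous_on UNIV f" and "\<And>s. s \<in> {t - ap..t} \<Longrightarrow> f s = 0" shows "L f t = 0"
  using L_norm[OF f, of t 0] assms(2) by simp

text \<open>The birth rate of a solution started at time \<open>s\<close>, switched on gradually during \<open>{s..s + h}\<close> so as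
  to obtain a continuous function on the whole line.\<close>

definition ramped :: "real \<Rightarrow> real \<Rightarrow> (real \<Rightarrow> 'e) \<Rightarrow> real \<Rightarrow> 'e" where
  "ramped s h b t = max 0 (min 1 ((t - s) / h)) *\<^sub>R b (max s t)"

lemma ramped_cont:
  assumes b: "continuous_on {s..} b" shows "continuous_on UNIV (ramped s h b)"
proof -
  have "continuous_on UNIV (\<lambda>t. b (max s t))"
    by (rule continuous_on_compose2[OF b]) (auto intro!: continuous_intros)
  then show ?thesis
    unfolding ramped_def[abs_def] divide_inverse
    by (intro continuous_on_scaleR continuous_on_max continuous_on_min continuous_on_mult
        continuous_on_diff continuous_on_const continuous_on_id)
qed

lemma ramped_before: "h > 0 \<Longrightarrow> t \<le> s \<Longrightarrow> ramped s h b t = 0"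
  by (simp add: ramped_def divide_nonpos_pos)

lemma ramped_after: "h > 0 \<Longrightarrow> s + h \<le> t \<Longrightarrow> ramped s h b t = b t"
  by (simp add: ramped_def le_divide_eq)

lemma ramped_norm: "s \<le> t \<Longrightarrow> norm (ramped s h b t) \<le> norm (b t)"
  using mult_right_mono[of "max 0 (min 1 ((t - s) / h))" 1 "norm (b t)"] by (simp add: ramped_def)

text \<open>The ramped birth rate satisfies \<open>bx = g + L bx\<close>, where \<open>g\<close>
  vanishes before \<open>s\<close> and after \<open>s + 1 + ap\<close>: by then the ramp is complete
  for all parents and the initial population has left. So \<open>bx\<close> is the sum of the
  iterates of \<open>L\<close> on \<open>g\<close>, and the geometric bounds add up.\<close>

lemma iterate_bound_imp_char_solution_bound:
  assumes iterate_bound: "iterate_bound l q" and q: "0 \<le> q" "q < 1"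
  shows "\<exists>C\<ge>1. \<forall>s p0 P t. char_solution s p0 P \<longrightarrow> s \<le> t \<longrightarrow>
    (LINT a|M. norm (P t a)) \<le> C * exp (l * (t - s)) * (LINT a|lebesgue. norm (p0 a))"
proof -
  obtain C0 where C0: "\<And>n f t B. continuous_on UNIV f \<Longrightarrow>
     (\<And>s. s \<in> {t - real n * ap..t} \<Longrightarrow> norm (f s) \<le> B * exp (l * (s - t))) \<Longrightarrow>
     norm ((L ^^ n) f t) \<le> C0 * q ^ n * B"
    using iterate_bound unfolding iterate_bound_def by blast
  define C where "C = \<bar>C0\<bar>"
  have C: "norm ((L ^^ n) f t) \<le> C * q ^ n * B" if "continuous_on UNIV f" "B \<ge> 0"
    "\<And>s. s \<in> {t - real n * ap..t} \<Longrightarrow> norm (f s) \<le> B * exp (l * (s - t))" for n f t B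
    using C0[OF that(1,3)] mult_right_mono[of C0 C "q ^ n * B"] that(2) q by (fastforce simp: C_def mult.assoc)
  \<comment> \<open>\<open>1 + ap\<close> is the length of the ramp plus the maximal age, after
    which the renewal equation holds exactly. The factors
    \<open>exp (\<bar>l\<bar> * (1 + ap))\<close> turn bounds on this interval into weighted ones
    for either sign of \<open>l\<close>.\<close>
  define Y1 where "Y1 = 2 * (\<beta>m * K) * exp (2 * \<beta>m * K * (1 + ap))"
  define G1 where "G1 = (Y1 + \<beta>m * ap * K * Y1) * exp (\<bar>l\<bar> * (1 + ap))"
  define C2 where "C2 = C / (1 - q) * G1 + Y1 * exp (\<bar>l\<bar> * (1 + ap))"
  define C3 where "C3 = K * exp (\<bar>l\<bar> * ap) + K * C2 * (ap * exp (\<bar>l\<bar> * ap))"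
  have Y1: "Y1 \<ge> 0" using \<beta>m K1 by (simp add: Y1_def)
  have G1: "G1 \<ge> 0" using Y1 \<beta>m K1 ap by (simp add: G1_def)
  have C2: "C2 \<ge> 0" using Y1 G1 q by (simp add: C2_def C_def)
  have bound: "(LINT a|M. norm (P t a)) \<le> max C3 1 * exp (l * (t - s)) * (LINT a|lebesgue. norm (p0 a))"
    if P: "char_solution s p0 P" and st: "s \<le> t" for s p0 P t
  proof -
    define N where "N = (LINT a|lebesgue. norm (p0 a))"
    have N: "N \<ge> 0" by (simp add: N_def)
    define b where "b t = birth t (P t)" for t
    have bc: "continuous_on {s..} b" using P by (simp add: char_solution_def b_def[abs_def])
    have crude: "norm (b t) \<le> Y1 * N" if "s \<le> t" "t \<le> s + (1 + ap)" for t
    proof -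
      have "norm (b t) \<le> 2 * (\<beta>m * K * N) * exp (2 * \<beta>m * K * (t - s))"
        unfolding b_def N_def by (rule char_solution_births_crude[OF P that(1)])
      also have "\<dots> \<le> 2 * (\<beta>m * K * N) * exp (2 * \<beta>m * K * (1 + ap))"
        using that \<beta>m K1 N by (intro mult_left_mono) auto
      finally show ?thesis by (simp add: Y1_def mult_ac)
    qed
    have weight: "x \<le> x * exp (\<bar>l\<bar> * (1 + ap)) * exp (l * (t - s))" if "s \<le> t" "t \<le> s + (1 + ap)" "x \<ge> 0" for t x
    proof -
      have "\<bar>l\<bar> * (t - s) \<le> \<bar>l\<bar> * (1 + ap)" using that by (intro mult_left_mono) auto
      moreover have "- \<bar>l\<bar> * (t - s) \<le> l * (t - s)" using that by (intro mult_right_mono) auto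
      ultimately have "1 \<le> exp (\<bar>l\<bar> * (1 + ap)) * exp (l * (t - s))" unfolding mult_exp_exp by simp
      then have "x * 1 \<le> x * (exp (\<bar>l\<bar> * (1 + ap)) * exp (l * (t - s)))" using that by (intro mult_left_mono) auto
      then show ?thesis by (simp add: mult.assoc)
    qed
    define bx where "bx = ramped s 1 b"
    have bxc: "continuous_on UNIV bx" unfolding bx_def by (rule ramped_cont[OF bc])
    define g where "g t = bx t - L bx t" for t
    have gc: "continuous_on UNIV g" unfolding g_def by (intro continuous_intros bxc L_cont)
    have bx0: "bx t = 0" if "t \<le> s" for t unfolding bx_def using that by (intro ramped_before) auto
    have bx1: "norm (bx t) \<le> Y1 * N" if "t \<le> s + (1 + ap)" for t
    proof (cases "s \<le> t")
      case True
      then show ?thesis using ramped_norm[OF True, of 1 b] crude[OF True that] by (simp add: bx_def)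
    qed (use bx0[of t] Y1 N in simp)
    have iterate_bound: "norm (g t) \<le> G1 * N * exp (l * (t - s))" for t
    proof -
      consider "t < s" | "s \<le> t" "t \<le> s + (1 + ap)" | "s + (1 + ap) < t" by linarith
      then show ?thesis
      proof cases
        case 1
        then have "L bx t = 0" by (intro L_zero bxc bx0) auto
        then show ?thesis using 1 bx0[of t] G1 N by (simp add: g_def)
      next
        case 2
        have "norm (g t) \<le> norm (bx t) + norm (L bx t)" unfolding g_def by (rule norm_triangle_ineq4)
        also have "\<dots> \<le> Y1 * N + \<beta>m * ap * K * (Y1 * N)"
          using 2 by (intro add_mono bx1 L_norm bxc) auto
        also have "\<dots> = (Y1 + \<beta>m * ap * K * Y1) * N" by (simp add: algebra_simps)
        also have "\<dots> \<le> ((Y1 + \<beta>m * ap * K * Y1) * N) * exp (\<bar>l\<bar> * (1 + ap)) * exp (l * (t - s))"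
          using 2 Y1 N \<beta>m K1 ap by (intro weight) auto
        finally show ?thesis by (simp add: G1_def mult_ac)
      next
        case 3
        have "L bx t = birth t (P t)"
          unfolding L_def
        proof (rule birth_cong_AE)
          show "integrable M (kern bx t)" by (rule integrable_kern[OF bxc])
          show "integrable M (P t)" using P 3 ap by (auto simp: char_solution_def)
          have "AE a in M. P t a = char_value s b p0 t a" using P 3 ap by (simp add: char_solution_def b_def[abs_def])
          moreover have "AE a in M. 0 < a \<and> a < ap" by (rule AE_M_I) simp
          ultimately show "AE a in M. kern bx t a = P t a"
          proof eventually_elim
            case (elim a)
            have "bx (t - a) = b (t - a)" unfolding bx_def using elim 3 by (intro ramped_after) auto
            then show ?case using elim 3 by (simp add: kern_def char_value_def)
          qed
        qed
        moreover have "bx t = b t" unfolding bx_def using 3 ap by (intro ramped_after) auto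
        ultimately show ?thesis using G1 N by (simp add: g_def b_def)
      qed
    qed
    have expand: "bx r = (\<Sum>k<n. (L ^^ k) g r) + (L ^^ n) bx r" for n r
    proof (induction n)
      case (Suc n)
      have "(L ^^ n) bx = (L ^^ n) (\<lambda>t. g t + L bx t)" by (simp add: g_def)
      also have "\<dots> = (\<lambda>t. (L ^^ n) g t + (L ^^ n) (L bx) t)" by (rule Lpow_add[OF gc L_cont[OF bxc]])
      finally have "(L ^^ n) bx r = (L ^^ n) g r + (L ^^ n) (L bx) r" by (rule fun_cong)
      also have "(L ^^ n) (L bx) = (L ^^ Suc n) bx" by (simp only: funpow_Suc_right comp_apply)
      finally show ?case using Suc by (simp only: sum.lessThan_Suc add.assoc)
    qed simp
    have bxb: "norm (bx t) \<le> C / (1 - q) * (G1 * N) * exp (l * (t - s))" if st: "s \<le> t" for t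
    proof -
      define B where "B = G1 * N * exp (l * (t - s))"
      have B0: "B \<ge> 0" using G1 N by (simp add: B_def)
      have k: "norm ((L ^^ k) g t) \<le> C * q ^ k * B" for k
      proof (rule C[OF gc B0])
        fix r
        have "exp (l * (t - s)) * exp (l * (r - t)) = exp (l * (r - s))"
          unfolding mult_exp_exp by (rule arg_cong[where f = exp]) (simp add: algebra_simps)
        then show "norm (g r) \<le> B * exp (l * (r - t))" using iterate_bound[of r] by (simp add: B_def mult.assoc)
      qed
      obtain m where m: "m > 0" "\<And>r. r \<in> {s..t} \<Longrightarrow> norm (bx r) \<le> m"
        using compact_continuous_norm_bound[of "{s..t}" bx] continuous_on_subset[OF bxc] by (metis compact_Icc top_greatest)
      define B' where "B' = m * exp (\<bar>l\<bar> * (t - s))"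
      have B': "B' \<ge> 0" using m by (simp add: B'_def)
      \<comment> \<open>Since \<open>bx\<close> vanishes before \<open>s\<close>, its weighted size
        on the windows has a bound \<open>B'\<close> independent of \<open>n\<close>, and the
        remainder tends to 0.\<close>
      have tail: "norm ((L ^^ n) bx t) \<le> C * q ^ n * B'" for n
      proof (rule C[OF bxc B'])
        fix r assume r: "r \<in> {t - real n * ap..t}"
        show "norm (bx r) \<le> B' * exp (l * (r - t))"
        proof (cases "s \<le> r")
          case True
          have "l * (t - r) \<le> \<bar>l\<bar> * (t - r)" using r by (intro mult_right_mono) auto
          also have "\<dots> \<le> \<bar>l\<bar> * (t - s)" using True by (intro mult_left_mono) auto
          finally have "0 \<le> \<bar>l\<bar> * (t - s) + l * (r - t)" by (simp add: algebra_simps)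
          then have "1 \<le> exp (\<bar>l\<bar> * (t - s)) * exp (l * (r - t))" unfolding mult_exp_exp by simp
          then have "m * 1 \<le> m * (exp (\<bar>l\<bar> * (t - s)) * exp (l * (r - t)))" using m by (intro mult_left_mono) auto
          then show ?thesis using m(2)[of r] True r by (simp add: B'_def mult.assoc)
        qed (use bx0[of r] B' in simp)
      qed
      have "norm (bx t) \<le> C * B / (1 - q) + C * q ^ n * B'" for n
      proof -
        have "norm (bx t) \<le> norm (\<Sum>k<n. (L ^^ k) g t) + norm ((L ^^ n) bx t)"
          using expand[of t n] by (metis norm_triangle_ineq)
        also have "\<dots> \<le> (\<Sum>k<n. C * q ^ k * B) + C * q ^ n * B'"
          by (intro add_mono tail order_trans[OF norm_sum] sum_mono k)
        also have "(\<Sum>k<n. C * q ^ k * B) = C * B * (\<Sum>k<n. q ^ k)" by (simp add: sum_distrib_left mult_ac)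
        also have "\<dots> \<le> C * B * (1 / (1 - q))"
        proof (rule mult_left_mono)
          have "(\<Sum>k<n. q ^ k) = (1 - q ^ n) / (1 - q)" using q by (subst sum_gp_strict) auto
          also have "\<dots> \<le> 1 / (1 - q)" using q by (intro divide_right_mono) auto
          finally show "(\<Sum>k<n. q ^ k) \<le> 1 / (1 - q)" .
        qed (use B0 in \<open>simp add: C_def\<close>)
        finally show ?thesis by simp
      qed
      moreover have "(\<lambda>n. C * B / (1 - q) + C * q ^ n * B') \<longlonglongrightarrow> C * B / (1 - q) + C * 0 * B'"
        using q by (intro tendsto_intros LIMSEQ_power_zero) auto
      ultimately have "norm (bx t) \<le> C * B / (1 - q) + C * 0 * B'"
        by (intro LIMSEQ_le_const[of _ _ "norm (bx t)"]) auto
      then show ?thesis by (simp add: B_def mult_ac)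
    qed
    \<comment> \<open>Before the ramp is complete \<open>bx\<close> need not control
      \<open>b\<close>, so the crude bound covers the initial interval.\<close>
    have bb: "norm (b r) \<le> (C2 * N) * exp (l * (r - s))" if r: "s \<le> r" for r
    proof (cases "r \<le> s + (1 + ap)")
      case True
      have "norm (b r) \<le> (Y1 * N) * exp (\<bar>l\<bar> * (1 + ap)) * exp (l * (r - s))"
        using crude[OF r True] weight[OF r True, of "Y1 * N"] Y1 N by simp
      also have "\<dots> \<le> (C2 * N) * exp (l * (r - s))"
        using N G1 q by (intro mult_right_mono) (auto simp: C2_def C_def algebra_simps)
      finally show ?thesis .
    next
      case False
      have "bx r = b r" unfolding bx_def using False ap by (intro ramped_after) auto
      then have "norm (b r) \<le> C / (1 - q) * (G1 * N) * exp (l * (r - s))" using bxb[OF r] by simp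
      also have "\<dots> \<le> (C2 * N) * exp (l * (r - s))"
        using N Y1 by (intro mult_right_mono) (auto simp: C2_def algebra_simps)
      finally show ?thesis .
    qed
    have eM: "(LINT a|M. exp (- l * a)) \<le> ap * exp (\<bar>l\<bar> * ap)"
    proof -
      have "(LINT a|M. exp (- l * a)) \<le> (LINT a|M. exp (\<bar>l\<bar> * ap))"
      proof (rule integral_mono_AE)
        show "AE a in M. exp (- l * a) \<le> exp (\<bar>l\<bar> * ap)"
        proof (rule AE_M_I)
          fix a assume "0 < a" "a < ap"
          then have "- l * a \<le> \<bar>l\<bar> * ap" by (intro mult_mono) auto
          then show "exp (- l * a) \<le> exp (\<bar>l\<bar> * ap)" by simp
        qed
      qed (auto intro!: integrable_M_continuous continuous_intros)
      then show ?thesis by (simp only: integral_M_const real_scaleR_def)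
    qed
    have "(LINT a|M. norm (P t a)) \<le> (if t - s < ap then K * N else 0)
        + K * (C2 * N) * exp (l * (t - s)) * (LINT a|M. exp (- l * a))"
      unfolding N_def
      by (rule char_solution_norm[OF P st]) (use bb C2 N in \<open>auto simp: b_def N_def\<close>)
    also have "\<dots> \<le> K * N * exp (\<bar>l\<bar> * ap) * exp (l * (t - s)) + K * (C2 * N) * exp (l * (t - s)) * (ap * exp (\<bar>l\<bar> * ap))"
    proof (intro add_mono mult_left_mono eM)
      show "(if t - s < ap then K * N else 0) \<le> K * N * exp (\<bar>l\<bar> * ap) * exp (l * (t - s))"
      proof (cases "t - s < ap")
        case True
        have "- l * (t - s) \<le> \<bar>l\<bar> * ap" using True st by (intro mult_mono) auto
        then have "1 \<le> exp (\<bar>l\<bar> * ap) * exp (l * (t - s))" unfolding mult_exp_exp by simp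
        then have "K * N * 1 \<le> K * N * (exp (\<bar>l\<bar> * ap) * exp (l * (t - s)))"
          using K1 N by (intro mult_left_mono) auto
        then show ?thesis using True by (simp add: mult.assoc)
      qed (use K1 N in simp)
    qed (use K1 C2 N in simp)
    also have "\<dots> = C3 * exp (l * (t - s)) * N" by (simp add: C3_def algebra_simps)
    also have "\<dots> \<le> max C3 1 * exp (l * (t - s)) * N" using N by (intro mult_right_mono) auto
    finally show ?thesis by (simp add: N_def)
  qed
  show ?thesis
    by (rule exI[of _ "max C3 1"]) (use bound in auto)
qed

end

section \<open>From growth of solutions to bounds for the iterates\<close>

context renewal
begin

text \<open>Since \<open>L\<close> is monotone, iterating it from a supersolution only decreases the
  value.\<close>

lemma supersolution_bound:
  assumes F: "continuous_on UNIV F" and g: "continuous_on UNIV g"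
    and super: "\<And>r. r \<le> t \<Longrightarrow> L g r \<preceq> g r"
    and le: "\<And>r. r \<in> {t - real n * ap..t} \<Longrightarrow> F r \<preceq> g r"
  shows "(L ^^ n) F t \<preceq> g t"
proof -
  have "(L ^^ n) g r \<preceq> g r" if "r \<le> t" for n r
    using that
  proof (induction n)
    case (Suc n)
    have "(L ^^ n) (L g) r \<preceq> (L ^^ n) g r"
      by (rule Lpow_mono[OF L_cont[OF g] g]) (use super Suc in auto)
    then have "(L ^^ Suc n) g r \<preceq> (L ^^ n) g r" by (simp only: funpow_Suc_right comp_apply)
    then show ?case using Suc le_trans by blast
  qed (simp add: nn_0)
  then show ?thesis using Lpow_mono[OF F g le] le_trans by blast
qed

text \<open>The negative part \<open>f\<close> of the births satisfies
  \<open>- b t \<preceq> L f t\<close>. Minimality of the positive part turns this into a norm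
  inequality without source term, and the weighted maximum argument forces \<open>f = 0\<close>. As
  the births at time \<open>s\<close> are nonnegative, \<open>f\<close> extends by 0 into the
  past.\<close>

lemma char_solution_births_nn:
  assumes P: "char_solution s p0 P" and p0: "\<And>a. nn (p0 a)" and t: "s \<le> t"
  shows "nn (birth t (P t))"
proof -
  define b where "b t = birth t (P t)" for t
  have bc: "continuous_on {s..} b" using P by (simp add: char_solution_def b_def[abs_def])
  have iP: "integrable M (P t)" and AP: "AE a in M. P t a = char_value s b p0 t a" if "s \<le> t" for t
    using P that by (auto simp: char_solution_def b_def[abs_def])
  have pos: "AE a in M. 0 < a \<and> a < ap" by (rule AE_M_I) simp
  have bs: "nn (b s)"
    unfolding b_def
  proof (rule birth_nn[OF iP])
    show "AE a in M. nn (P s a)"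
      using AP[OF order_refl] pos by eventually_elim (simp add: char_value_def T_nn p0)
  qed simp
  define f where "f r = pp (- b (max s r))" for r
  have fc: "continuous_on UNIV f"
  proof -
    have "continuous_on UNIV (\<lambda>r. b (max s r))"
      by (rule continuous_on_compose2[OF bc]) (auto intro!: continuous_intros)
    then show ?thesis unfolding f_def by (intro continuous_on_pp continuous_on_minus)
  qed
  have f0: "f r = 0" if "r \<le> s" for r
    using bs that by (simp add: f_def max_absorb1 nn_iff_pp[symmetric])
  have le: "norm (pp (- b t)) \<le> norm (L f t)" if t: "s \<le> t" for t
  proof (rule nn_pp_minimal)
    show "nn (L f t)" using Lpow_nn[OF fc, of t 1] by (simp add: f_def pp_nn)
    have "L f t - - b t = birth t (\<lambda>a. kern f t a + P t a)"
      using iP[OF t] by (simp add: L_def b_def birth_add integrable_kern[OF fc])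
    also have "nn \<dots>"
    proof (rule birth_nn)
      show "integrable M (\<lambda>a. kern f t a + P t a)"
        using iP[OF t] integrable_kern[OF fc] by simp
      show "AE a in M. nn (kern f t a + P t a)"
        using AP[OF t] pos
      proof eventually_elim
        case (elim a)
        show ?case
        proof (cases "a \<le> t - s")
          case True
          have "pp (- b (t - a)) + b (t - a) = pp (b (t - a))"
            using pp_split[of "b (t - a)"] by (simp add: algebra_simps)
          then have "kern f t a + P t a = srv t a *\<^sub>R T a (pp (b (t - a)))"
            using elim True by (simp add: kern_def char_value_def f_def scaleR_add_right[symmetric] T_plus[symmetric])
          then show ?thesis using elim by (simp add: nn_scale T_nn pp_nn srv_pos less_imp_le)
        next
          case False
          have "nn (kern f t a)" using elim
            by (simp add: kern_def nn_scale T_nn f_def pp_nn srv_pos less_imp_le)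
          moreover have "nn (P t a)" using elim False t p0 by (simp add: char_value_def nn_scale T_nn)
          ultimately show ?thesis by (rule nn_add)
        qed
      qed
    qed
    finally show "- b t \<preceq> L f t" .
  qed
  have "norm (pp (- b t)) \<le> 2 * 0 * exp (2 * \<beta>m * K * (t - s))"
  proof (rule weighted_maximum_bound[OF _ t])
    show "continuous_on {s..t} (\<lambda>r. norm (pp (- b r)))"
      by (intro continuous_intros continuous_on_subset[OF bc]) auto
    show "0 \<le> 2 * \<beta>m * K" using \<beta>m K1 by simp
    fix r Y assume r: "r \<in> {s..t}" and Y: "Y \<ge> 0"
      and b: "\<And>x. x \<in> {s..r} \<Longrightarrow> norm (pp (- b x)) \<le> Y * exp (2 * \<beta>m * K * (x - s))"
    have "norm (L f r) \<le> (\<beta>m * K / (2 * \<beta>m * K)) * Y * exp (2 * \<beta>m * K * (r - s))"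
    proof (rule L_weighted[OF fc _ Y])
      show "0 < 2 * \<beta>m * K" using \<beta>m K1 by simp
      fix x assume x: "x \<in> {r - ap..r}"
      show "norm (f x) \<le> Y * exp (2 * \<beta>m * K * (x - s))"
      proof (cases "x \<le> s")
        case False
        then show ?thesis using b[of x] x by (simp add: f_def)
      qed (use f0[of x] Y in simp)
    qed
    then show "norm (pp (- b r)) \<le> 0 + Y / 2 * exp (2 * \<beta>m * K * (r - s))"
      using le[of r] r \<beta>m K1 by simp
  qed auto
  then show ?thesis by (simp add: nn_iff_pp b_def)
qed

text \<open>Births at \<open>t - a\<close> carry a ramp factor no larger than the one at
  \<open>t\<close>, and the contribution of the initial population is missing on the left; both
  effects make the left side smaller.\<close>

lemma ramped_supersolution:
  assumes P: "char_solution s p0 P" and p0: "\<And>a. nn (p0 a)" and h: "h > 0"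
  defines "b \<equiv> \<lambda>t. birth t (P t)"
  shows "L (ramped s h b) t \<preceq> ramped s h b t"
proof -
  have bc: "continuous_on {s..} b" using P by (simp add: char_solution_def b_def)
  note rc = ramped_cont[OF bc, of h]
  show ?thesis
  proof (cases "t < s")
    case True
    have "L (ramped s h b) t = 0" by (rule L_zero[OF rc]) (use True h in \<open>auto intro: ramped_before\<close>)
    then show ?thesis using True h by (simp add: ramped_before nn_0)
  next
    case False
    then have t: "s \<le> t" by simp
    have iP: "integrable M (P t)" and AP: "AE a in M. P t a = char_value s b p0 t a"
      using P t by (auto simp: char_solution_def b_def)
    have pos: "AE a in M. 0 < a \<and> a < ap" by (rule AE_M_I) simp
    define c where "c = max 0 (min 1 ((t - s) / h))"
    have c: "c \<ge> 0" by (simp add: c_def)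
    have "birth t (kern (ramped s h b) t) \<preceq> birth t (\<lambda>a. c *\<^sub>R P t a)"
    proof (rule birth_mono[OF integrable_kern[OF rc]])
      show "integrable M (\<lambda>a. c *\<^sub>R P t a)" using iP by simp
      show "AE a in M. kern (ramped s h b) t a \<preceq> c *\<^sub>R P t a"
        using AP pos
      proof eventually_elim
        case (elim a)
        show ?case
        proof (cases "a \<le> t - s")
          case True
          define c' where "c' = max 0 (min 1 ((t - a - s) / h))"
          have "(t - a - s) / h \<le> (t - s) / h" using elim h by (intro divide_right_mono) auto
          then have c': "c' \<le> c" unfolding c_def c'_def by (intro max.mono min.mono) auto
          have "kern (ramped s h b) t a = c' *\<^sub>R P t a"
            using elim True by (simp add: kern_def ramped_def c'_def char_value_def T_scaleR mult.commute)
          moreover have "nn (P t a)"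
            using elim True char_solution_births_nn[OF P p0, of "t - a"]
            by (simp add: char_value_def b_def nn_scale T_nn srv_pos less_imp_le)
          ultimately show ?thesis using le_scale_left[OF c'] by simp
        next
          case False
          have "kern (ramped s h b) t a = 0"
            using elim False h by (simp add: kern_def ramped_before T_zero)
          moreover have "nn (P t a)" using elim False t p0 by (simp add: char_value_def nn_scale T_nn)
          ultimately show ?thesis using c by (simp add: nn_scale)
        qed
      qed
    qed
    then show ?thesis using t by (simp add: L_def ramped_def birth_scale b_def c_def)
  qed
qed

text \<open>For the time \<open>ap / 2\<close> after the start, survivors of the initial population
  fill ages of total length at least \<open>ap / 2\<close>; the exponential is their worst-case
  density under mortality and diffusion.\<close>

definition young_const where "young_const = \<epsilon>0 * (ap / 2) * exp (- (\<mu>m + d) * ap)"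

lemma young_const_pos: "young_const > 0" using \<epsilon>0 ap by (simp add: young_const_def)

text \<open>Individuals born after \<open>s\<close> are only known to contribute nonnegatively. The
  bound counts the survivors of the initial profile, who occupy the ages
  \<open>{t - s<..<ap}\<close>.\<close>

lemma char_solution_births_lower:
  assumes P: "char_solution s (\<lambda>a. indicator {0<..<ap} a *\<^sub>R x) P" and x: "nn x" "T 0 x = x"
    and t: "s \<le> t" "t \<le> s + ap / 2"
  shows "young_const *\<^sub>R x \<preceq> birth t (P t)"
proof -
  let ?p0 = "\<lambda>a. indicator {0<..<ap} a *\<^sub>R x"
  define b where "b t = birth t (P t)" for t
  have p0: "nn (?p0 a)" for a using x by (simp add: nn_scale indicator_def nn_0)
  have iP: "integrable M (P t)" and AP: "AE a in M. P t a = char_value s b ?p0 t a"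
    using P t by (auto simp: char_solution_def b_def[abs_def])
  have pos: "AE a in M. 0 < a \<and> a < ap" by (rule AE_M_I) simp
  define y where "y = exp (- (\<mu>m + d) * ap) *\<^sub>R x"
  have y: "nn y" using x by (simp add: y_def nn_scale)
  define I where "I = {t - s<..<ap}"
  have I: "I \<in> sets M" using t by (auto simp: I_def sets_restrict_space_iff)
  have "measure M I = measure lebesgue I" by (rule measure_restrict_space) (use t in \<open>auto simp: I_def\<close>)
  then have mI: "measure M I = ap - (t - s)" using t ap by (simp add: I_def)
  have yt: "y \<preceq> exp (H s - H t) *\<^sub>R T (t - s) x"
  proof -
    have "exp (- (\<mu>m + d) * ap) = exp (- \<mu>m * ap) * exp (- d * ap)"
      unfolding mult_exp_exp by (rule arg_cong[where f = exp]) (simp add: algebra_simps)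
    also have "\<dots> \<le> exp (H s - H t) * exp (- d * (t - s))"
    proof (intro mult_mono)
      show "exp (- \<mu>m * ap) \<le> exp (H s - H t)" using srv_ge[of "t - s" t] t by (simp add: srv_def)
      have "d * (t - s) \<le> d * ap" using t d ap by (intro mult_left_mono) auto
      then show "exp (- d * ap) \<le> exp (- d * (t - s))" by simp
    qed auto
    finally have "y \<preceq> (exp (H s - H t) * exp (- d * (t - s))) *\<^sub>R x" unfolding y_def by (intro le_scale_left x)
    moreover have "exp (H s - H t) *\<^sub>R (exp (- d * (t - s)) *\<^sub>R T 0 x) \<preceq> exp (H s - H t) *\<^sub>R T (t - s) x"
      using t x by (intro le_scale T_ge) auto
    ultimately show ?thesis using x le_trans by simp
  qed
  have hb: "integrable M (\<lambda>a. indicator I a *\<^sub>R y)"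
    using I by (intro integrable_mult_indicator) (auto intro!: integrable_M_continuous continuous_intros)
  have "(\<epsilon>0 * measure M I) *\<^sub>R y \<preceq> birth t (\<lambda>a. indicator I a *\<^sub>R y)" by (rule birth_indicator_ge[OF y I])
  moreover have "birth t (\<lambda>a. indicator I a *\<^sub>R y) \<preceq> birth t (P t)"
  proof (rule birth_mono[OF hb iP])
    show "AE a in M. indicator I a *\<^sub>R y \<preceq> P t a"
      using AP pos
    proof eventually_elim
      case (elim a)
      show ?case
      proof (cases "a \<le> t - s")
        case True
        have "nn (P t a)"
          using elim True char_solution_births_nn[OF P p0, of "t - a"]
          by (simp add: char_value_def b_def nn_scale T_nn srv_pos less_imp_le)
        then show ?thesis using True by (simp add: I_def)
      next
        case False
        then show ?thesis using elim t yt by (simp add: char_value_def I_def)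
      qed
    qed
  qed
  moreover have "young_const *\<^sub>R x \<preceq> (\<epsilon>0 * measure M I) *\<^sub>R y"
  proof -
    have "(\<epsilon>0 * (ap / 2)) *\<^sub>R y \<preceq> (\<epsilon>0 * measure M I) *\<^sub>R y"
      using t \<epsilon>0 by (intro le_scale_left y mult_left_mono) (auto simp: mI)
    then show ?thesis by (simp add: young_const_def y_def)
  qed
  ultimately show ?thesis using le_trans by blast
qed

text \<open>\<open>T_ge\<close> read from right to left: a later semigroup value dominates an
  earlier one up to a constant. Pushing every age to \<open>ap\<close> removes the age from the
  operator in upper bounds for \<open>L\<close>.\<close>

lemma T_le_T_ap:
  assumes "nn u" "0 \<le> a" "a \<le> ap" shows "T a u \<preceq> exp (d * ap) *\<^sub>R T ap u"
proof -
  have "exp (- d * (ap - a)) *\<^sub>R T 0 (T a u) \<preceq> T (ap - a) (T a u)"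
    using assms by (intro T_ge T_nn) auto
  also have "T (ap - a) (T a u) = T ap u" using assms T_add[of "ap - a" a u] by simp
  finally have "exp (d * ap) *\<^sub>R (exp (- d * (ap - a)) *\<^sub>R T a u) \<preceq> exp (d * ap) *\<^sub>R T ap u"
    using assms by (intro le_scale) (auto simp: T0_T)
  moreover have "1 *\<^sub>R T a u \<preceq> (exp (d * ap) * exp (- d * (ap - a))) *\<^sub>R T a u"
  proof (rule le_scale_left)
    have "0 \<le> d * a" using d assms by simp
    then have "0 \<le> d * ap + - d * (ap - a)" by (simp add: algebra_simps)
    then show "1 \<le> exp (d * ap) * exp (- d * (ap - a))" unfolding mult_exp_exp by simp
  qed (use assms in \<open>auto intro: T_nn\<close>)
  ultimately show ?thesis using le_trans by simp
qed

text \<open>A single vector bounds \<open>L f\<close> at all times of a window: after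
  \<open>T_le_T_ap\<close> the age integral of \<open>f (r - a)\<close> becomes the integral of
  \<open>f\<close> over an interval of length \<open>ap\<close> ending at \<open>r\<close>, which is
  enlarged to the common interval \<open>{\<sigma> - ap..\<sigma>'}\<close>.\<close>

lemma L_le_window:
  assumes f: "continuous_on UNIV f" and fn: "\<And>s. nn (f s)"
    and r: "\<sigma> \<le> r" "r \<le> \<sigma>'"
  shows "L f r \<preceq> (\<beta>m * exp (d * ap)) *\<^sub>R T ap (LINT \<rho>|lborel. indicator {\<sigma> - ap..\<sigma>'} \<rho> *\<^sub>R f \<rho>)"
proof -
  define v where "v = (LINT \<rho>|lborel. indicator {\<sigma> - ap..\<sigma>'} \<rho> *\<^sub>R f \<rho>)"
  have iv: "integrable lborel (\<lambda>\<rho>. indicator {\<sigma> - ap..\<sigma>'} \<rho> *\<^sub>R f \<rho>)"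
    by (intro borel_integrable_compact continuous_on_subset[OF f]) auto
  define F where "F a = f (r - a)" for a
  have Fc: "continuous_on UNIV F"
    unfolding F_def by (rule continuous_on_compose2[OF f]) (auto intro!: continuous_intros)
  have iF: "integrable M F" by (rule integrable_M_continuous[OF Fc])
  have "(LINT a|M. F a) \<preceq> v"
  proof -
    have io: "integrable lborel (\<lambda>\<rho>. indicator {r - ap<..<r} \<rho> *\<^sub>R f \<rho>)"
    proof (rule Bochner_Integration.integrable_bound[OF iv])
      show "(\<lambda>\<rho>. indicator {r - ap<..<r} \<rho> *\<^sub>R f \<rho>) \<in> borel_measurable lborel"
        using borel_measurable_continuous_onI[OF f] by simp
      show "AE x in lborel. norm (indicator {r - ap<..<r} x *\<^sub>R f x) \<le> norm (indicator {\<sigma> - ap..\<sigma>'} x *\<^sub>R f x)"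
        using r by (intro AE_I2) (auto simp: indicator_def)
    qed
    have "(LINT a|M. F a) = (LINT a|lebesgue. indicator {0<..<ap} a *\<^sub>R F a)"
      by (rule integral_restrict_space) auto
    also have "\<dots> = (LINT a|lborel. indicator {0<..<ap} a *\<^sub>R F a)"
      by (rule integral_completion) (use borel_measurable_continuous_onI[OF Fc] in simp)
    also have "\<dots> = (LINT a|lborel. indicator {r - ap<..<r} (r + (- 1) * a) *\<^sub>R f (r + (- 1) * a))"
      by (rule Bochner_Integration.integral_cong) (auto simp: indicator_def F_def)
    also have "\<dots> = (LINT \<rho>|lborel. indicator {r - ap<..<r} \<rho> *\<^sub>R f \<rho>)"
      by (subst lborel_integral_real_affine[of "-1" _ r]) auto
    also have "\<dots> \<preceq> v"
      unfolding v_def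
      by (rule le_integral[OF io iv], rule AE_I2) (use r fn in \<open>auto simp: indicator_def nn_0\<close>)
    finally show ?thesis .
  qed
  then have Tv: "T ap (LINT a|M. F a) \<preceq> T ap v" using ap by (intro T_mono) auto
  have bT: "bounded_linear (T ap)" using ap by (intro T_lin) simp
  have iT: "integrable M (\<lambda>a. T ap (F a))" by (rule integrable_bounded_linear[OF bT iF])
  define c where "c = \<beta>m * exp (d * ap)"
  have c: "c \<ge> 0" using \<beta>m by (simp add: c_def)
  have "L f r \<preceq> (LINT a|M. c *\<^sub>R T ap (F a))"
    unfolding L_def birth_def
  proof (rule le_integral[OF integrable_Linf[OF integrable_kern[OF f]]])
    show "integrable M (\<lambda>a. c *\<^sub>R T ap (F a))" using iT by simp
    have "AE a in M. 0 < a \<and> a < ap" by (rule AE_M_I) simp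
    then show "AE a in M. rep_Linf (\<beta> r) a *\<^sub>R kern f r a \<preceq> c *\<^sub>R T ap (F a)"
      using \<beta>_M[of r]
    proof eventually_elim
      case (elim a)
      have k: "nn (T a (F a))" using elim fn by (simp add: T_nn F_def)
      have "(rep_Linf (\<beta> r) a * srv r a) *\<^sub>R T a (F a) \<preceq> \<beta>m *\<^sub>R T a (F a)"
      proof (rule le_scale_left[OF _ k])
        have "rep_Linf (\<beta> r) a * srv r a \<le> \<beta>m * 1"
          using elim srv_le_1[of a r] srv_pos[of r a] by (intro mult_mono) auto
        then show "rep_Linf (\<beta> r) a * srv r a \<le> \<beta>m" by simp
      qed
      moreover have "\<beta>m *\<^sub>R T a (F a) \<preceq> \<beta>m *\<^sub>R (exp (d * ap) *\<^sub>R T ap (F a))"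
        using elim fn \<beta>m by (intro le_scale T_le_T_ap) (auto simp: F_def)
      ultimately have "(rep_Linf (\<beta> r) a * srv r a) *\<^sub>R T a (F a) \<preceq> \<beta>m *\<^sub>R (exp (d * ap) *\<^sub>R T ap (F a))"
        by (rule le_trans)
      then show ?case using elim by (simp add: kern_def c_def F_def)
    qed
  qed
  also have "(LINT a|M. c *\<^sub>R T ap (F a)) = c *\<^sub>R T ap (LINT a|M. F a)"
    using integral_bounded_linear[OF bT iF] by simp
  finally have "L f r \<preceq> c *\<^sub>R T ap (LINT a|M. F a)" .
  then have "L f r \<preceq> c *\<^sub>R T ap v" using le_trans[OF _ le_scale[OF c Tv]] by blast
  then show ?thesis by (simp add: c_def v_def)
qed

lemma window_norm:
  fixes f :: "real \<Rightarrow> 'e"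
  assumes f: "continuous_on UNIV f" and B: "B \<ge> 0"
    and b: "\<And>s. s \<le> t \<Longrightarrow> norm (f s) \<le> B * exp (l * (s - t))"
    and s': "\<sigma> \<le> \<sigma>'" "\<sigma>' \<le> \<sigma> + ap" "\<sigma>' \<le> t"
  shows "norm (LINT \<rho>|lborel. indicator {\<sigma> - ap..\<sigma>'} \<rho> *\<^sub>R f \<rho>) \<le> 2 * ap * exp (\<bar>l\<bar> * ap) * B * exp (l * (\<sigma> - t))"
proof -
  define C where "C = exp (\<bar>l\<bar> * ap) * B * exp (l * (\<sigma> - t))"
  have C: "C \<ge> 0" using B by (simp add: C_def)
  have iv: "integrable lborel (\<lambda>\<rho>. indicator {\<sigma> - ap..\<sigma>'} \<rho> *\<^sub>R f \<rho>)"
    by (intro borel_integrable_compact continuous_on_subset[OF f]) auto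
  have hb: "has_bochner_integral lborel (\<lambda>\<rho>. indicator {\<sigma> - ap..\<sigma>'} \<rho> *\<^sub>R C) (measure lborel {\<sigma> - ap..\<sigma>'} *\<^sub>R C)"
    by (rule has_bochner_integral_indicator) (use s' ap in auto)
  have "norm (LINT \<rho>|lborel. indicator {\<sigma> - ap..\<sigma>'} \<rho> *\<^sub>R f \<rho>) \<le> (LINT \<rho>|lborel. norm (indicator {\<sigma> - ap..\<sigma>'} \<rho> *\<^sub>R f \<rho>))"
    by (rule integral_norm_bound)
  also have "\<dots> \<le> (LINT \<rho>|lborel. indicator {\<sigma> - ap..\<sigma>'} \<rho> *\<^sub>R C)"
  proof (rule integral_mono_AE[OF integrable_norm[OF iv] integrable.intros[OF hb]], rule AE_I2)
    fix \<rho>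
    show "norm (indicator {\<sigma> - ap..\<sigma>'} \<rho> *\<^sub>R f \<rho>) \<le> indicator {\<sigma> - ap..\<sigma>'} \<rho> *\<^sub>R C"
    proof (cases "\<rho> \<in> {\<sigma> - ap..\<sigma>'}")
      case True
      have "\<bar>\<rho> - \<sigma>\<bar> \<le> ap" using True s' by auto
      then have "\<bar>l * (\<rho> - \<sigma>)\<bar> \<le> \<bar>l\<bar> * ap" by (simp add: abs_mult mult_left_mono)
      then have "l * (\<rho> - \<sigma>) \<le> \<bar>l\<bar> * ap" by linarith
      then have "l * (\<rho> - t) \<le> \<bar>l\<bar> * ap + l * (\<sigma> - t)" by (simp add: algebra_simps)
      then have "exp (l * (\<rho> - t)) \<le> exp (\<bar>l\<bar> * ap) * exp (l * (\<sigma> - t))" unfolding mult_exp_exp by simp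
      from mult_left_mono[OF this B] have "B * exp (l * (\<rho> - t)) \<le> C" by (simp add: C_def mult_ac)
      then show ?thesis using b[of \<rho>] True s' by simp
    qed simp
  qed
  also have "\<dots> = measure lborel {\<sigma> - ap..\<sigma>'} *\<^sub>R C" by (rule has_bochner_integral_integral_eq[OF hb])
  also have "\<dots> = (\<sigma>' - \<sigma> + ap) * C" using s' ap by simp
  also have "\<dots> \<le> (2 * ap) * C" using s' C by (intro mult_right_mono) auto
  finally show ?thesis by (simp add: C_def mult_ac)
qed

text \<open>For a nonnegative \<open>f\<close>, in each of finitely many short time windows \<open>L f\<close> is dominated by the births of a
  solution started from a constant age distribution shortly before the window. The sum of these
  birth rates is a supersolution of the renewal equation, hence dominates all further iterates.\<close>

lemma evolution_bound_imp_iterate_bound: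
  assumes w: "w < l" and M0: "M0 \<ge> 0"
    and ex: "\<And>\<sigma> x. nn x \<Longrightarrow> T 0 x = x \<Longrightarrow> \<exists>P. char_solution \<sigma> (\<lambda>a. indicator {0<..<ap} a *\<^sub>R x) P \<and>
      (\<forall>t\<ge>\<sigma>. (LINT a|M. norm (P t a)) \<le> M0 * exp (w * (t - \<sigma>)) * norm x)"
  shows "iterate_bound l 1"
proof -
  \<comment> \<open>The window belonging to a start time \<sigma> is
    \<open>{\<sigma> + h..\<sigma> + 2 * h}\<close>: it begins when the ramp is complete, and
    \<open>2 * h = ap / 2\<close> is how long \<open>char_solution_births_lower\<close>
    applies.\<close>
  define h where "h = ap / 4"
  have h: "h > 0" using ap by (simp add: h_def)
  \<comment> \<open>Scales the initial vector so that the births guaranteed by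
    \<open>young_const\<close> equal the upper bound of \<open>L_le_window\<close>.\<close>
  define \<kappa>' where "\<kappa>' = \<beta>m * exp (d * ap) / young_const"
  have k': "\<kappa>' \<ge> 0" using \<beta>m young_const_pos by (simp add: \<kappa>'_def)
  \<comment> \<open>Each window further back costs a factor \<rho>: the started solution grows at
    most with exponent \<open>w\<close>, while the bound on \<open>f\<close> decreases into the past
    with exponent \<open>l\<close>. The gap \<open>w < l\<close> makes the sum over the windows
    bounded independently of \<open>n\<close>.\<close>
  define \<rho> where "\<rho> = exp (- (l - w) * h)"
  have \<rho>: "0 < \<rho>" "\<rho> < 1" using w h by (auto simp: \<rho>_def mult_neg_pos)
  define C1 where "C1 = \<beta>m * M0 * (\<kappa>' * K * (2 * ap * exp (\<bar>l\<bar> * ap)))"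
  have C1: "C1 \<ge> 0" unfolding C1_def using \<beta>m M0 k' K1 ap by (intro mult_nonneg_nonneg) auto
  define C where "C = max 1 (C1 / (1 - \<rho>))"
  show ?thesis
  proof (rule iterate_boundI_nn[where C = C])
    fix n t B and f :: "real \<Rightarrow> 'e"
    assume f0: "continuous_on UNIV f" and fn0: "\<And>s. nn (f s)" and B: "B \<ge> 0"
      and b0: "\<And>s. s \<in> {t - real n * ap..t} \<Longrightarrow> norm (f s) \<le> B * exp (l * (s - t))"
    show "norm ((L ^^ n) f t) \<le> C * 1 ^ n * B"
    proof (cases n)
      case 0
      have "norm (f t) \<le> 1 * B" using b0[of t] ap by simp
      also have "\<dots> \<le> C * B" using B by (intro mult_right_mono) (auto simp: C_def)
      finally show ?thesis using 0 by simp
    next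
      case (Suc m)
      define a0 where "a0 = t - real n * ap"
      \<comment> \<open>The windows reach further back than \<open>a0\<close>, where nothing is
        known about \<open>f\<close>. Freezing \<open>f\<close> at \<open>a0\<close> and continuing
        it by the pure weight keeps the bound valid for all \<open>s \<le> t\<close>.\<close>
      define F where "F s = exp (l * (s - max s a0)) *\<^sub>R f (max s a0)" for s
      have a0t: "a0 \<le> t" using ap by (simp add: a0_def)
      have Fc: "continuous_on UNIV F"
      proof -
        have "continuous_on UNIV (\<lambda>s. f (max s a0))"
          by (rule continuous_on_compose2[OF f0]) (auto intro!: continuous_intros)
        then show ?thesis unfolding F_def by (intro continuous_intros)
      qed
      have Fn: "nn (F s)" for s unfolding F_def by (intro nn_scale fn0) auto
      have Fb: "norm (F s) \<le> B * exp (l * (s - t))" if "s \<le> t" for s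
      proof -
        have "norm (f (max s a0)) \<le> B * exp (l * (max s a0 - t))"
          using that a0t by (intro b0) (auto simp: a0_def)
        then have "norm (F s) \<le> exp (l * (s - max s a0)) * (B * exp (l * (max s a0 - t)))"
          by (simp add: F_def)
        also have "\<dots> = B * (exp (l * (s - max s a0)) * exp (l * (max s a0 - t)))" by simp
        also have "exp (l * (s - max s a0)) * exp (l * (max s a0 - t)) = exp (l * (s - t))"
          unfolding mult_exp_exp by (rule arg_cong[where f = exp]) (simp add: algebra_simps)
        finally show ?thesis .
      qed
      have eq: "(L ^^ n) f t = (L ^^ m) (L F) t"
      proof -
        have "(L ^^ n) f t = (L ^^ n) F t"
          by (rule Lpow_local[OF f0 Fc]) (auto simp: F_def a0_def max_absorb1)
        then show ?thesis by (simp only: Suc funpow_Suc_right comp_apply)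
      qed
      define \<sigma> where "\<sigma> i = t - real (i + 2) * h" for i :: nat
      define v where "v i = (LINT r|lborel. indicator {\<sigma> i - ap..\<sigma> i + 2 * h} r *\<^sub>R F r)" for i
      define x where "x i = \<kappa>' *\<^sub>R T ap (v i)" for i
      have vn: "nn (v i)" for i
        unfolding v_def
        by (rule nn_integral[OF borel_integrable_compact[OF _ continuous_on_subset[OF Fc]]])
           (auto simp: nn_scale Fn)
      have xn: "nn (x i)" "T 0 (x i) = x i" for i
        unfolding x_def using k' ap by (simp_all add: nn_scale T_nn vn T_scaleR T0_T)
      have xnorm: "norm (x i) \<le> \<kappa>' * K * (2 * ap * exp (\<bar>l\<bar> * ap)) * B * exp (l * (\<sigma> i - t))" for i
      proof -
        have "norm (v i) \<le> 2 * ap * exp (\<bar>l\<bar> * ap) * B * exp (l * (\<sigma> i - t))"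
          unfolding v_def by (rule window_norm[OF Fc B Fb]) (use h in \<open>auto simp: \<sigma>_def h_def algebra_simps\<close>)
        then have "\<kappa>' * (K * norm (v i)) \<le> \<kappa>' * (K * (2 * ap * exp (\<bar>l\<bar> * ap) * B * exp (l * (\<sigma> i - t))))"
          using k' K1 by (intro mult_left_mono) auto
        moreover have "norm (x i) \<le> \<kappa>' * (K * norm (v i))"
          unfolding x_def using k' ap T_K[of ap "v i"] by (simp add: mult_left_mono)
        ultimately show ?thesis by (simp add: mult_ac)
      qed
      have "\<forall>i. \<exists>P. char_solution (\<sigma> i) (\<lambda>a. indicator {0<..<ap} a *\<^sub>R x i) P \<and>
          (\<forall>t\<ge>\<sigma> i. (LINT a|M. norm (P t a)) \<le> M0 * exp (w * (t - \<sigma> i)) * norm (x i))"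
        using ex xn by blast
      then obtain P where P: "\<And>i. char_solution (\<sigma> i) (\<lambda>a. indicator {0<..<ap} a *\<^sub>R x i) (P i)"
        and PN: "\<And>i t. t \<ge> \<sigma> i \<Longrightarrow> (LINT a|M. norm (P i t a)) \<le> M0 * exp (w * (t - \<sigma> i)) * norm (x i)" by metis
      define b where "b i r = birth r (P i r)" for i r
      have p0n: "nn (indicator {0<..<ap} a *\<^sub>R x i)" for a i using xn by (intro nn_scale) auto
      have bc: "continuous_on {\<sigma> i..} (b i)" for i using P[of i] by (simp add: char_solution_def b_def[abs_def])
      define R where "R i = ramped (\<sigma> i) h (b i)" for i
      have Rc: "continuous_on UNIV (R i)" for i unfolding R_def by (rule ramped_cont[OF bc])
      have Rsup: "L (R i) r \<preceq> R i r" for i r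
        unfolding R_def b_def[abs_def] by (rule ramped_supersolution[OF P p0n h])
      have Rn: "nn (R i r)" for i r
      proof (cases "r \<le> \<sigma> i")
        case True
        then show ?thesis by (simp add: R_def ramped_before[OF h] nn_0)
      next
        case False
        then have "nn (b i r)" unfolding b_def by (intro char_solution_births_nn[OF P p0n]) simp
        then show ?thesis using False by (simp add: R_def ramped_def nn_scale)
      qed
      have Rlow: "L F r \<preceq> R i r" if r: "\<sigma> i + h \<le> r" "r \<le> \<sigma> i + 2 * h" for i r
      proof -
        have "L F r \<preceq> (\<beta>m * exp (d * ap)) *\<^sub>R T ap (v i)"
          unfolding v_def using r h by (intro L_le_window[OF Fc Fn]) auto
        also have "(\<beta>m * exp (d * ap)) *\<^sub>R T ap (v i) = young_const *\<^sub>R x i"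
          using young_const_pos by (simp add: x_def \<kappa>'_def)
        finally have "L F r \<preceq> young_const *\<^sub>R x i" .
        moreover have "young_const *\<^sub>R x i \<preceq> b i r"
          unfolding b_def using r h by (intro char_solution_births_lower[OF P xn]) (auto simp: h_def)
        moreover have "R i r = b i r" unfolding R_def using r by (intro ramped_after h)
        ultimately show ?thesis using le_trans by simp
      qed
      \<comment> \<open>One application of \<open>L\<close> is spent on \<open>L F\<close>, so the
        windows of length \<open>ap / 4\<close> have to cover only \<open>{t - m * ap..t}\<close>,
        where the index is at most \<open>4 * m\<close>, which is below
        \<open>4 * n\<close>.\<close>
      define N where "N = 4 * n"
      define G where "G r = (\<Sum>i<N. R i r)" for r
      have Gc: "continuous_on UNIV G" unfolding G_def by (intro continuous_intros Rc)
      have LG: "L G r = (\<Sum>i<N. L (R i) r)" for r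
      proof -
        have "L (\<lambda>r. \<Sum>i<k. R i r) r = (\<Sum>i<k. L (R i) r)" for k
        proof (induction k)
          case 0
          then show ?case using L_zero[of "\<lambda>_. 0" r] by simp
        next
          case (Suc k)
          have "continuous_on UNIV (\<lambda>r. \<Sum>i<k. R i r)" by (intro continuous_intros Rc)
          then show ?case using Suc L_add[OF _ Rc[of k], of "\<lambda>r. \<Sum>i<k. R i r" r] by simp
        qed
        then show ?thesis by (simp add: G_def[abs_def])
      qed
      have "(L ^^ m) (L F) t \<preceq> G t"
      proof (rule supersolution_bound[OF L_cont[OF Fc] Gc])
        fix r show "L G r \<preceq> G r"
          unfolding LG unfolding G_def sum_subtractf[symmetric] by (intro nn_sum Rsup)
      next
        fix r assume r: "r \<in> {t - real m * ap..t}"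
        define i where "i = nat \<lfloor>(t - r) / h\<rfloor>"
        have q0: "0 \<le> (t - r) / h" using r h by simp
        have i: "real i \<le> (t - r) / h" "(t - r) / h \<le> real i + 1"
          using q0 unfolding i_def by linarith+
        have "(t - r) / h \<le> real m * ap / h" using r h by (intro divide_right_mono) auto
        also have "\<dots> = 4 * real m" using ap by (simp add: h_def)
        finally have "real i \<le> 4 * real m" using i(1) by linarith
        then have "real i < real N" unfolding N_def Suc by simp
        then have iN: "i < N" by (simp only: of_nat_less_iff)
        have ih: "real i * h \<le> t - r" "t - r \<le> (real i + 1) * h"
          using i h by (auto simp: field_simps)
        have "L F r \<preceq> R i r"
          by (rule Rlow) (use ih in \<open>auto simp: \<sigma>_def algebra_simps\<close>)
        moreover have "R i r \<preceq> G r"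
        proof -
          have "G r - R i r = (\<Sum>j\<in>{..<N} - {i}. R j r)"
            unfolding G_def using iN by (simp add: sum.remove)
          also have "nn \<dots>" by (intro nn_sum Rn)
          finally show ?thesis .
        qed
        ultimately show "L F r \<preceq> G r" by (rule le_trans)
      qed
      moreover have "nn ((L ^^ m) (L F) t)" using Lpow_nn[OF f0 fn0, of n t] by (simp only: eq)
      ultimately have "norm ((L ^^ n) f t) \<le> norm (G t)" unfolding eq by (intro nn_mono_norm)
      also have "\<dots> \<le> (\<Sum>i<N. norm (R i t))" unfolding G_def by (rule norm_sum)
      also have "\<dots> \<le> (\<Sum>i<N. C1 * B * \<rho> ^ i)"
      proof (rule sum_mono)
        fix i
        have st: "\<sigma> i \<le> t" using h by (simp add: \<sigma>_def)
        have "norm (R i t) \<le> norm (b i t)" unfolding R_def by (rule ramped_norm[OF st])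
        also have "\<dots> \<le> \<beta>m * (LINT a|M. norm (P i t a))"
          unfolding b_def using P[of i] st by (intro birth_norm) (auto simp: char_solution_def)
        also have "\<dots> \<le> \<beta>m * (M0 * exp (w * (t - \<sigma> i)) * norm (x i))"
          using \<beta>m st by (intro mult_left_mono PN) auto
        also have "\<dots> \<le> \<beta>m * (M0 * exp (w * (t - \<sigma> i)) * (\<kappa>' * K * (2 * ap * exp (\<bar>l\<bar> * ap)) * B * exp (l * (\<sigma> i - t))))"
          using \<beta>m M0 by (intro mult_left_mono xnorm) auto
        also have "\<dots> = C1 * B * (exp (w * (t - \<sigma> i)) * exp (l * (\<sigma> i - t)))"
          by (simp add: C1_def)
        also have "exp (w * (t - \<sigma> i)) * exp (l * (\<sigma> i - t)) = \<rho> ^ (i + 2)"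
          unfolding mult_exp_exp \<rho>_def exp_of_nat_mult[symmetric]
          by (rule arg_cong[where f = exp]) (simp add: \<sigma>_def algebra_simps)
        also have "C1 * B * \<rho> ^ (i + 2) \<le> C1 * B * \<rho> ^ i"
          using C1 B \<rho> by (intro mult_left_mono power_decreasing) auto
        finally show "norm (R i t) \<le> C1 * B * \<rho> ^ i" .
      qed
      also have "\<dots> = C1 * B * ((1 - \<rho> ^ N) / (1 - \<rho>))"
        using \<rho> by (subst sum_distrib_left[symmetric], subst sum_gp_strict) auto
      also have "\<dots> \<le> C1 * B * (1 / (1 - \<rho>))"
        using \<rho> C1 B by (intro mult_left_mono divide_right_mono) auto
      also have "\<dots> = C1 / (1 - \<rho>) * B" by simp
      also have "\<dots> \<le> C * B" using B by (intro mult_right_mono) (auto simp: C_def)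
      finally show ?thesis by simp
    qed
  qed
qed

end

section \<open>Characteristics of the integrated transport equation\<close>

text \<open>A Lipschitz bound uniform in the parameter upgrades separate to joint continuity, as
  required below by the differentiability criterion with partial derivatives.\<close>

lemma joint_continuity_of_lipschitz_family:
  fixes \<Phi> :: "'i::metric_space \<Rightarrow> 'x::real_normed_vector \<Rightarrow> 'y::real_normed_vector" and P :: "'j::metric_space \<Rightarrow> 'x"
  assumes lip: "\<And>\<xi> \<eta> \<eta>'. \<xi> \<in> I \<Longrightarrow> norm (\<Phi> \<xi> \<eta> - \<Phi> \<xi> \<eta>') \<le> C * norm (\<eta> - \<eta>')"
    and cont: "\<And>\<eta>. continuous_on I (\<lambda>\<xi>. \<Phi> \<xi> \<eta>)" and P: "continuous_on J P"
  shows "continuous_on (J \<times> I) (\<lambda>p. \<Phi> (snd p) (P (fst p)))"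
proof (subst continuous_on_def, intro ballI)
  fix p assume p: "p \<in> J \<times> I"
  let ?F = "at p within J \<times> I"
  have c1: "((\<lambda>q. P (fst q)) \<longlongrightarrow> P (fst p)) ?F"
  proof -
    have "continuous_on (J \<times> I) (\<lambda>q. P (fst q))"
      by (rule continuous_on_compose2[OF P]) (auto intro!: continuous_intros)
    then show ?thesis using p by (auto simp: continuous_on_def)
  qed
  have c2: "((\<lambda>q. \<Phi> (snd q) (P (fst p))) \<longlongrightarrow> \<Phi> (snd p) (P (fst p))) ?F"
  proof -
    have "continuous_on (J \<times> I) (\<lambda>q. \<Phi> (snd q) (P (fst p)))"
      by (rule continuous_on_compose2[OF cont]) (auto intro!: continuous_intros)
    then show ?thesis using p unfolding continuous_on_def by blast
  qed
  have "((\<lambda>q. \<Phi> (snd q) (P (fst q)) - \<Phi> (snd p) (P (fst p))) \<longlongrightarrow> 0) ?F"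
  proof (rule Lim_null_comparison)
    show "\<forall>\<^sub>F q in ?F. norm (\<Phi> (snd q) (P (fst q)) - \<Phi> (snd p) (P (fst p)))
        \<le> C * norm (P (fst q) - P (fst p)) + norm (\<Phi> (snd q) (P (fst p)) - \<Phi> (snd p) (P (fst p)))"
      unfolding eventually_at_filter
    proof (rule always_eventually, intro allI impI)
      fix q assume "q \<in> J \<times> I"
      then have "snd q \<in> I" by auto
      from lip[OF this, of "P (fst q)" "P (fst p)"]
      show "norm (\<Phi> (snd q) (P (fst q)) - \<Phi> (snd p) (P (fst p)))
        \<le> C * norm (P (fst q) - P (fst p)) + norm (\<Phi> (snd q) (P (fst p)) - \<Phi> (snd p) (P (fst p)))"
        using norm_triangle_ineq[of "\<Phi> (snd q) (P (fst q)) - \<Phi> (snd q) (P (fst p))" "\<Phi> (snd q) (P (fst p)) - \<Phi> (snd p) (P (fst p))"]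
        by simp
    qed
    have "((\<lambda>q. C * norm (P (fst q) - P (fst p)) + norm (\<Phi> (snd q) (P (fst p)) - \<Phi> (snd p) (P (fst p))))
        \<longlongrightarrow> C * norm (P (fst p) - P (fst p)) + norm (\<Phi> (snd p) (P (fst p)) - \<Phi> (snd p) (P (fst p)))) ?F"
      by (intro tendsto_intros c1 c2)
    then show "((\<lambda>q. C * norm (P (fst q) - P (fst p)) + norm (\<Phi> (snd q) (P (fst p)) - \<Phi> (snd p) (P (fst p)))) \<longlongrightarrow> 0) ?F"
      by simp
  qed
  then show "((\<lambda>q. \<Phi> (snd q) (P (fst q))) \<longlongrightarrow> \<Phi> (snd p) (P (fst p))) ?F"
    by (simp add: LIM_zero_iff)
qed

text \<open>The integrated transport equation, solved along characteristics: with \<open>X t x\<close> the antiderivative of \<open>\<phi> t\<close>,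
  the function \<open>exp (H t) X t x\<close> has derivative \<open>exp (H t) x b t\<close> in the direction \<open>(1, 1)\<close>.\<close>

lemma transport_characteristics:
  fixes \<phi> :: "real \<Rightarrow> real \<Rightarrow> real" and b \<mu> H :: "real \<Rightarrow> real"
  defines "X \<equiv> \<lambda>t x. integral {0..x} (\<phi> t)"
  assumes \<phi>: "continuous_on ({s..} \<times> {0..c}) (\<lambda>p. \<phi> (fst p) (snd p))"
    and b: "continuous_on {s..} b" and \<mu>: "continuous_on UNIV \<mu>"
    and Xc: "\<And>x. x \<in> {0..c} \<Longrightarrow> continuous_on {s..} (\<lambda>t. X t x)"
    and H: "\<And>t. (H has_real_derivative \<mu> t) (at t)"
    and eq: "\<And>t x. s \<le> t \<Longrightarrow> x \<in> {0..c} \<Longrightarrow>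
      integral {s..t} (\<lambda>r. \<phi> r x) = x * integral {s..t} b + X s x - X t x - integral {s..t} (\<lambda>r. \<mu> r * X r x)"
    and t: "s \<le> t"
  shows "0 < x \<Longrightarrow> x < c \<Longrightarrow> x < t - s \<Longrightarrow>
      exp (H t) * \<phi> t x = integral {0..x} (\<lambda>\<sigma>. exp (H (t - \<sigma>)) * b (t - \<sigma>))"
    and "t - s < x \<Longrightarrow> x < c \<Longrightarrow>
      exp (H t) * \<phi> t x = exp (H s) * \<phi> s (x - (t - s)) + integral {0..t - s} (\<lambda>\<sigma>. exp (H (t - \<sigma>)) * b (t - \<sigma>))"
proof -
  have Hc: "continuous_on S H" for S using H by (meson DERIV_isCont continuous_at_imp_continuous_on)
  have \<phi>x: "continuous_on {0..c} (\<phi> r)" if "s \<le> r" for r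
  proof -
    have "continuous_on {0..c} (\<lambda>x. (\<lambda>p. \<phi> (fst p) (snd p)) (r, x))"
      by (rule continuous_on_compose2[OF \<phi>]) (use that in \<open>auto intro!: continuous_intros\<close>)
    then show ?thesis by simp
  qed
  have \<phi>t: "continuous_on {s..} (\<lambda>r. \<phi> r x)" if "x \<in> {0..c}" for x
  proof -
    have "continuous_on {s..} (\<lambda>r. (\<lambda>p. \<phi> (fst p) (snd p)) (r, x))"
      by (rule continuous_on_compose2[OF \<phi>]) (use that in \<open>auto intro!: continuous_intros\<close>)
    then show ?thesis by simp
  qed
  define k where "k \<sigma> = exp (H (t - \<sigma>)) * b (t - \<sigma>)" for \<sigma>
  have kc: "continuous_on {0..t - s} k"
  proof -
    have "continuous_on {0..t - s} (\<lambda>\<sigma>. H (t - \<sigma>))"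
      by (rule continuous_on_compose2[OF Hc[of UNIV]]) (auto intro!: continuous_intros)
    moreover have "continuous_on {0..t - s} (\<lambda>\<sigma>. b (t - \<sigma>))"
      by (rule continuous_on_compose2[OF b]) (auto intro!: continuous_intros)
    ultimately show ?thesis unfolding k_def by (intro continuous_intros)
  qed
  \<comment> \<open>\<phi> is merely continuous. Its antiderivative \<open>X\<close> has \<phi> as
    derivative in age, and the integrated equation supplies the derivative in time, so
    \<open>X\<close> can be differentiated along a characteristic.\<close>
  have X\<tau>: "((\<lambda>\<tau>. X \<tau> \<xi>) has_real_derivative (\<xi> * b \<tau> - \<phi> \<tau> \<xi> - \<mu> \<tau> * X \<tau> \<xi>)) (at \<tau> within {s..t})"
    if \<tau>: "\<tau> \<in> {s..t}" and \<xi>: "\<xi> \<in> {0..c}" for \<tau> \<xi>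
  proof -
    define g where "g r = \<xi> * b r - \<phi> r \<xi> - \<mu> r * X r \<xi>" for r
    have c: "continuous_on {s..t} b" "continuous_on {s..t} (\<lambda>r. \<phi> r \<xi>)" "continuous_on {s..t} (\<lambda>r. \<mu> r * X r \<xi>)"
      by (rule continuous_on_subset[OF b] continuous_on_subset[OF \<phi>t[OF \<xi>]], force)+
         (intro continuous_intros continuous_on_subset[OF \<mu>] continuous_on_subset[OF Xc[OF \<xi>]]; force)
    have gc: "continuous_on {s..t} g" unfolding g_def by (intro continuous_intros c)
    have Xe: "X r \<xi> = X s \<xi> + integral {s..r} g" if r: "r \<in> {s..t}" for r
    proof -
      have i: "b integrable_on {s..r}" "(\<lambda>r. \<phi> r \<xi>) integrable_on {s..r}" "(\<lambda>r. \<mu> r * X r \<xi>) integrable_on {s..r}"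
        using r by (auto intro!: integrable_continuous_interval intro: continuous_on_subset[OF c(1)] continuous_on_subset[OF c(2)] continuous_on_subset[OF c(3)])
      have "integral {s..r} g = \<xi> * integral {s..r} b - integral {s..r} (\<lambda>r. \<phi> r \<xi>) - integral {s..r} (\<lambda>r. \<mu> r * X r \<xi>)"
      proof -
        have i1: "(\<lambda>r. \<xi> * b r) integrable_on {s..r}" by (rule integrable_cmul[OF i(1), of \<xi>, unfolded real_scaleR_def])
        have i2: "(\<lambda>r. \<xi> * b r - \<phi> r \<xi>) integrable_on {s..r}"
          by (rule Henstock_Kurzweil_Integration.integrable_diff[OF i1 i(2)])
        show ?thesis
          unfolding g_def Henstock_Kurzweil_Integration.integral_diff[OF i2 i(3)]
            Henstock_Kurzweil_Integration.integral_diff[OF i1 i(2)] by simp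
      qed
      then show ?thesis using eq[of r \<xi>] r \<xi> by simp
    qed
    have "((\<lambda>\<tau>. X s \<xi> + integral {s..\<tau>} g) has_real_derivative (0 + g \<tau>)) (at \<tau> within {s..t})"
      by (intro DERIV_add DERIV_const integral_has_real_derivative gc \<tau>)
    then have "((\<lambda>\<tau>. X \<tau> \<xi>) has_real_derivative (0 + g \<tau>)) (at \<tau> within {s..t})"
      by (rule has_field_derivative_transform_within[where d = 1]) (simp, rule \<tau>, rule Xe[symmetric])
    then show ?thesis by (simp add: g_def)
  qed
  have X\<xi>: "((\<lambda>\<xi>. X \<tau> \<xi>) has_real_derivative \<phi> \<tau> \<xi>) (at \<xi> within {0..x})"
    if "s \<le> \<tau>" "\<xi> \<in> {0..x}" "x \<le> c" for \<tau> \<xi> x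
    unfolding X_def
    by (rule integral_has_real_derivative) (use that continuous_on_subset[OF \<phi>x[of \<tau>], of "{0..x}"] in auto)
  have char: "exp (H t) * X t x = exp (H (t - m)) * X (t - m) (x - m) + integral {0..m} (\<lambda>\<sigma>. k \<sigma> * (x - \<sigma>))"
    if m: "0 \<le> m" "m \<le> t - s" "m \<le> x" and x: "x \<le> c" for m x
  proof -
    define G where "G \<tau> \<xi> = exp (H \<tau>) * X \<tau> \<xi>" for \<tau> \<xi>
    have der: "((\<lambda>\<sigma>. G (t - \<sigma>) (x - \<sigma>)) has_vector_derivative (- (k \<sigma> * (x - \<sigma>)))) (at \<sigma> within {0..m})"
      if \<sigma>: "\<sigma> \<in> {0..m}" for \<sigma>
    proof -
      define \<tau> where "\<tau> = t - \<sigma>"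
      define \<xi> where "\<xi> = x - \<sigma>"
      have \<tau>: "\<tau> \<in> {s..t}" and \<xi>: "\<xi> \<in> {0..x}" using \<sigma> m by (auto simp: \<tau>_def \<xi>_def)
      have fx: "((\<lambda>\<tau>. G \<tau> \<xi>) has_derivative (\<lambda>h. exp (H \<tau>) * (\<xi> * b \<tau> - \<phi> \<tau> \<xi>) * h)) (at \<tau> within {s..t})"
      proof -
        have "((\<lambda>\<tau>. exp (H \<tau>) * X \<tau> \<xi>) has_real_derivative
            exp (H \<tau>) * \<mu> \<tau> * X \<tau> \<xi> + (\<xi> * b \<tau> - \<phi> \<tau> \<xi> - \<mu> \<tau> * X \<tau> \<xi>) * exp (H \<tau>)) (at \<tau> within {s..t})"
          using X\<tau>[OF \<tau>, of \<xi>] \<xi> x has_field_derivative_at_within[OF H[of \<tau>]]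
          by (auto intro!: derivative_eq_intros)
        moreover have "exp (H \<tau>) * \<mu> \<tau> * X \<tau> \<xi> + (\<xi> * b \<tau> - \<phi> \<tau> \<xi> - \<mu> \<tau> * X \<tau> \<xi>) * exp (H \<tau>) = exp (H \<tau>) * (\<xi> * b \<tau> - \<phi> \<tau> \<xi>)"
          by (simp add: algebra_simps)
        ultimately show ?thesis unfolding G_def has_field_derivative_def by simp
      qed
      \<comment> \<open>\<open>has_derivative_partialsI\<close> asks for the second partial
        derivative as a continuous family of bounded linear maps, while the first has to exist only
        at the point itself.\<close>
      define fy where "fy \<tau> \<xi> = (exp (H \<tau>) * \<phi> \<tau> \<xi>) *\<^sub>R (id_blinfun :: real \<Rightarrow>\<^sub>L real)" for \<tau> \<xi>
      have fyd: "((\<lambda>\<xi>. G \<tau> \<xi>) has_derivative blinfun_apply (fy \<tau> \<xi>)) (at \<xi> within {0..x})"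
        if "\<tau> \<in> {s..t}" "\<xi> \<in> {0..x}" for \<tau> \<xi>
      proof -
        have "((\<lambda>\<xi>. exp (H \<tau>) * X \<tau> \<xi>) has_real_derivative exp (H \<tau>) * \<phi> \<tau> \<xi>) (at \<xi> within {0..x})"
          using X\<xi>[of \<tau> \<xi> x] that x by (intro DERIV_cmult) auto
        then show ?thesis unfolding G_def has_field_derivative_def
          by (simp add: fy_def scaleR_blinfun.rep_eq)
      qed
      have fyc: "continuous_on ({s..t} \<times> {0..x}) (\<lambda>(\<tau>, \<xi>). fy \<tau> \<xi>)"
      proof -
        have "continuous_on ({s..t} \<times> {0..x}) (\<lambda>p. \<phi> (fst p) (snd p))"
          by (rule continuous_on_subset[OF \<phi>]) (use x in auto)
        moreover have "continuous_on ({s..t} \<times> {0..x}) (\<lambda>p::real \<times> real. H (fst p))"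
          by (rule continuous_on_compose2[OF Hc[of UNIV]]) (auto intro!: continuous_intros)
        ultimately have "continuous_on ({s..t} \<times> {0..x}) (\<lambda>p. fy (fst p) (snd p))"
          unfolding fy_def by (intro continuous_intros)
        then show ?thesis by (simp add: split_beta)
      qed
      have D: "((\<lambda>(\<tau>, \<xi>). G \<tau> \<xi>) has_derivative (\<lambda>(tx, ty). exp (H \<tau>) * (\<xi> * b \<tau> - \<phi> \<tau> \<xi>) * tx + blinfun_apply (fy \<tau> \<xi>) ty))
          (at (\<tau>, \<xi>) within {s..t} \<times> {0..x})"
      proof (rule has_derivative_partialsI[OF fx fyd])
        show "continuous (at (\<tau>, \<xi>) within {s..t} \<times> {0..x}) (\<lambda>(x, y). fy x y)"
          using fyc \<tau> \<xi> by (simp add: continuous_on_eq_continuous_within)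
      qed (use \<xi> in auto)
      have p: "((\<lambda>\<sigma>. (t - \<sigma>, x - \<sigma>)) has_derivative (\<lambda>h. (- h, - h))) (at \<sigma> within {0..m})"
        by (auto intro!: derivative_eq_intros)
      have "((\<lambda>\<sigma>. (\<lambda>(\<tau>, \<xi>). G \<tau> \<xi>) (t - \<sigma>, x - \<sigma>)) has_derivative
          (\<lambda>h. (\<lambda>(tx, ty). exp (H \<tau>) * (\<xi> * b \<tau> - \<phi> \<tau> \<xi>) * tx + blinfun_apply (fy \<tau> \<xi>) ty) (- h, - h))) (at \<sigma> within {0..m})"
      proof (rule has_derivative_in_compose[OF p])
        have sub: "(\<lambda>\<sigma>. (t - \<sigma>, x - \<sigma>)) ` {0..m} \<subseteq> {s..t} \<times> {0..x}" using m by auto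
        show "((\<lambda>(\<tau>, \<xi>). G \<tau> \<xi>) has_derivative (\<lambda>(tx, ty). exp (H \<tau>) * (\<xi> * b \<tau> - \<phi> \<tau> \<xi>) * tx + blinfun_apply (fy \<tau> \<xi>) ty))
          (at (t - \<sigma>, x - \<sigma>) within (\<lambda>\<sigma>. (t - \<sigma>, x - \<sigma>)) ` {0..m})"
          unfolding \<tau>_def[symmetric] \<xi>_def[symmetric] by (rule has_derivative_subset[OF D sub])
      qed
      moreover have "(\<lambda>h. (\<lambda>(tx, ty). exp (H \<tau>) * (\<xi> * b \<tau> - \<phi> \<tau> \<xi>) * tx + blinfun_apply (fy \<tau> \<xi>) ty) (- h, - h))
          = (\<lambda>h. h *\<^sub>R (- (k \<sigma> * (x - \<sigma>))))"
        by (rule ext) (simp add: fy_def scaleR_blinfun.rep_eq k_def \<tau>_def \<xi>_def algebra_simps)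
      ultimately show ?thesis unfolding has_vector_derivative_def by simp
    qed
    have "((\<lambda>\<sigma>. - (k \<sigma> * (x - \<sigma>))) has_integral (G (t - m) (x - m) - G (t - 0) (x - 0))) {0..m}"
      by (rule fundamental_theorem_of_calculus[OF m(1) der])
    from integral_unique[OF this] show ?thesis by (simp add: G_def)
  qed
  \<comment> \<open>Separating the factor \<open>x\<close> from the integral makes the right side
    easy to differentiate in \<open>x\<close>; the derivative of \<open>X\<close> on the left then
    returns \<phi>.\<close>
  have lin: "integral {0..m} (\<lambda>\<sigma>. k \<sigma> * (x - \<sigma>)) = x * integral {0..m} k - integral {0..m} (\<lambda>\<sigma>. \<sigma> * k \<sigma>)"
    if "0 \<le> m" "m \<le> t - s" for m x
  proof -
    have "continuous_on {0..m} k" by (rule continuous_on_subset[OF kc]) (use that in auto)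
    then have i: "k integrable_on {0..m}" "(\<lambda>\<sigma>. \<sigma> * k \<sigma>) integrable_on {0..m}"
      by (auto intro!: integrable_continuous_interval continuous_intros)
    have "integral {0..m} (\<lambda>\<sigma>. k \<sigma> * (x - \<sigma>)) = integral {0..m} (\<lambda>\<sigma>. x * k \<sigma> - \<sigma> * k \<sigma>)"
      by (rule integral_cong) (simp add: algebra_simps)
    then show ?thesis
      using i integrable_cmul[OF i(1), of x] by (simp add: Henstock_Kurzweil_Integration.integral_diff)
  qed
  have Xat: "((\<lambda>\<xi>. exp (H \<tau>) * X \<tau> \<xi>) has_real_derivative exp (H \<tau>) * \<phi> \<tau> \<xi>) (at \<xi>)" if "s \<le> \<tau>" "0 < \<xi>" "\<xi> < c" for \<tau> \<xi>
  proof -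
    have "((\<lambda>\<xi>. X \<tau> \<xi>) has_real_derivative \<phi> \<tau> \<xi>) (at \<xi> within {0..c})" by (rule X\<xi>) (use that in auto)
    then have "((\<lambda>\<xi>. X \<tau> \<xi>) has_real_derivative \<phi> \<tau> \<xi>) (at \<xi>)"
      using at_within_interior[of \<xi> "{0..c}"] that by (simp add: interior_atLeastAtMost_real)
    then show ?thesis by (rule DERIV_cmult)
  qed
  \<comment> \<open>Here the characteristic is followed back to age 0 (\<open>m = x\<close>), where
    \<open>X\<close> vanishes; in the second case it is followed back to the initial time
    (\<open>m = t - s\<close>).\<close>
  show "exp (H t) * \<phi> t x = integral {0..x} (\<lambda>\<sigma>. exp (H (t - \<sigma>)) * b (t - \<sigma>))" if x: "0 < x" "x < c" "x < t - s"
  proof -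
    have kx: "((\<lambda>\<xi>. integral {0..\<xi>} g) has_real_derivative g x) (at x)" if g: "continuous_on {0..t - s} g" for g
    proof -
      have "((\<lambda>\<xi>. integral {0..\<xi>} g) has_real_derivative g x) (at x within {0..t - s})"
        by (rule integral_has_real_derivative[OF g]) (use x in auto)
      then show ?thesis using at_within_interior[of x "{0..t - s}"] x by (simp add: interior_atLeastAtMost_real)
    qed
    have "((\<lambda>\<xi>. \<xi> * integral {0..\<xi>} k - integral {0..\<xi>} (\<lambda>\<sigma>. \<sigma> * k \<sigma>)) has_real_derivative
        (1 * integral {0..x} k + k x * x - x * k x)) (at x)"
      by (intro DERIV_diff DERIV_mult DERIV_ident kx kc continuous_intros)
    then have R: "((\<lambda>\<xi>. \<xi> * integral {0..\<xi>} k - integral {0..\<xi>} (\<lambda>\<sigma>. \<sigma> * k \<sigma>)) has_real_derivative integral {0..x} k) (at x)"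
      by (simp add: mult.commute)
    have "((\<lambda>\<xi>. \<xi> * integral {0..\<xi>} k - integral {0..\<xi>} (\<lambda>\<sigma>. \<sigma> * k \<sigma>)) has_real_derivative exp (H t) * \<phi> t x) (at x)"
    proof (rule has_field_derivative_transform_within_open[OF Xat[OF t x(1,2)], of "{0<..<min c (t - s)}"])
      fix \<xi> assume "\<xi> \<in> {0<..<min c (t - s)}"
      then show "exp (H t) * X t \<xi> = \<xi> * integral {0..\<xi>} k - integral {0..\<xi>} (\<lambda>\<sigma>. \<sigma> * k \<sigma>)"
        using char[of \<xi> \<xi>] lin[of \<xi> \<xi>] by (simp add: X_def)
    qed (use x in auto)
    then have "exp (H t) * \<phi> t x = integral {0..x} k" using R by (rule DERIV_unique)
    then show ?thesis by (simp add: k_def[abs_def])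
  qed
  show "exp (H t) * \<phi> t x = exp (H s) * \<phi> s (x - (t - s)) + integral {0..t - s} (\<lambda>\<sigma>. exp (H (t - \<sigma>)) * b (t - \<sigma>))"
    if x: "t - s < x" "x < c"
  proof -
    have sh: "((\<lambda>\<xi>. exp (H s) * X s (\<xi> - (t - s))) has_real_derivative exp (H s) * \<phi> s (x - (t - s))) (at x)"
    proof -
      have "((\<lambda>\<xi>. exp (H s) * X s (\<xi> - (t - s))) has_real_derivative exp (H s) * \<phi> s (x - (t - s)) * 1) (at x)"
        by (rule DERIV_chain2[OF Xat]) (use x t in \<open>auto intro!: derivative_eq_intros\<close>)
      then show ?thesis by simp
    qed
    have R: "((\<lambda>\<xi>. exp (H s) * X s (\<xi> - (t - s)) + (\<xi> * integral {0..t - s} k - integral {0..t - s} (\<lambda>\<sigma>. \<sigma> * k \<sigma>)))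
        has_real_derivative (exp (H s) * \<phi> s (x - (t - s)) + (1 * integral {0..t - s} k - 0))) (at x)"
      by (intro DERIV_add DERIV_diff sh DERIV_cmult_right DERIV_ident DERIV_const)
    have x0: "0 < x" using x t by simp
    have "((\<lambda>\<xi>. exp (H s) * X s (\<xi> - (t - s)) + (\<xi> * integral {0..t - s} k - integral {0..t - s} (\<lambda>\<sigma>. \<sigma> * k \<sigma>)))
        has_real_derivative exp (H t) * \<phi> t x) (at x)"
    proof (rule has_field_derivative_transform_within_open[OF Xat[OF t x0 x(2)], of "{t - s<..<c}"])
      fix \<xi> assume "\<xi> \<in> {t - s<..<c}"
      then show "exp (H t) * X t \<xi> = exp (H s) * X s (\<xi> - (t - s)) + (\<xi> * integral {0..t - s} k - integral {0..t - s} (\<lambda>\<sigma>. \<sigma> * k \<sigma>))"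
        using char[of "t - s" \<xi>] lin[of "t - s" \<xi>] t by simp
    qed (use x in auto)
    then have "exp (H t) * \<phi> t x = exp (H s) * \<phi> s (x - (t - s)) + (1 * integral {0..t - s} k - 0)"
      using R by (rule DERIV_unique)
    then show ?thesis by (simp add: k_def[abs_def])
  qed
qed

text \<open>Half-lines generate the Borel sets and are stable under intersection, so vanishing
  integrals over them extend to all Borel sets. The Borel representative \<open>g'\<close> is
  introduced because this argument runs on the Borel sets rather than on their completion.\<close>

lemma AE_zero_of_indefinite_integral:
  fixes f :: "real \<Rightarrow> real"
  assumes int: "set_integrable lebesgue {p..q} f"
    and zero: "\<And>x. p \<le> x \<Longrightarrow> x \<le> q \<Longrightarrow> (LINT a:{p..x}|lebesgue. f a) = 0"
  shows "AE a in lebesgue. a \<in> {p..q} \<longrightarrow> f a = 0"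
proof -
  define g where "g a = indicator {p..q} a * f a" for a
  have g: "integrable lebesgue g"
    using int by (simp add: set_integrable_def g_def[abs_def])
  then have "g \<in> borel_measurable lebesgue" by simp
  then obtain g' where g'[measurable]: "g' \<in> borel_measurable lborel" and AEg': "AE x in lborel. g x = g' x"
    using completion_ex_borel_measurable_real by blast
  have AEl: "AE x in lebesgue. g x = g' x"
    using AEg' by (rule AE_completion)
  have g'm: "g' \<in> borel_measurable lebesgue" using g' by (rule measurable_completion)
  have g'i: "integrable lebesgue g'"
    using integrable_cong_AE[THEN iffD1, OF _ _ AEl g] g'm g by auto
  then have g'l: "integrable lborel g'"
    by (simp add: integrable_completion)
  have si: "set_integrable lborel A g'" if "A \<in> sets lborel" for A
    unfolding set_integrable_def using g'l that integrable_mult_indicator by blast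
  have eq: "(LINT a:A|lborel. g' a) = (LINT a:A|lebesgue. g a)" if A: "A \<in> sets lborel" for A
  proof -
    have "(LINT a:A|lborel. g' a) = (LINT a:A|lebesgue. g' a)"
      unfolding set_lebesgue_integral_def using A by (subst integral_completion) auto
    also have "\<dots> = (LINT a:A|lebesgue. g a)"
      by (rule set_lebesgue_integral_cong_AE) (use A g'm g AEl in \<open>auto simp: eq_commute borel_measurable_integrable\<close>)
    finally show ?thesis .
  qed
  have base: "(LINT a:{..x}|lebesgue. g a) = 0" for x
  proof (cases "p \<le> x \<and> p \<le> q")
    case True
    have "(LINT a:{..x}|lebesgue. g a) = (LINT a:{p..min x q}|lebesgue. f a)"
      unfolding set_lebesgue_integral_def g_def
      by (rule Bochner_Integration.integral_cong) (auto simp: indicator_def)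
    also have "\<dots> = 0" using True by (intro zero) auto
    finally show ?thesis .
  next
    case False
    have "(LINT a:{..x}|lebesgue. g a) = (LINT a|(lebesgue :: real measure). (0::real))"
      unfolding set_lebesgue_integral_def g_def
      by (rule Bochner_Integration.integral_cong) (use False in \<open>auto simp: indicator_def\<close>)
    then show ?thesis by simp
  qed
  have all: "(LINT a:A|lborel. g' a) = 0" if "A \<in> sets borel" for A
  proof -
    have b: "sets (borel :: real measure) = sigma_sets UNIV (range atMost)"
      by (simp add: borel_eq_atMost image_def)
    have "Int_stable (range atMost :: real set set)" by (auto simp: Int_stable_def)
    moreover have "range atMost \<subseteq> Pow (UNIV :: real set)" by simp
    moreover have "A \<in> sigma_sets UNIV (range atMost)" using that by (simp add: b)
    ultimately show ?thesis
    proof (induction rule: sigma_sets_induct_disjoint)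
      case (union A)
      have sA: "A i \<in> sets lborel" for i using union by (auto simp: b)
      have "(LINT a:(\<Union>i. A i)|lborel. g' a) = (\<Sum>i. LINT a:A i|lborel. g' a)"
        by (rule lebesgue_integral_countable_add)
           (use union sA in \<open>auto simp: disjoint_family_on_def intro!: si\<close>)
      moreover have "(LINT a:A i|lborel. g' a) = 0" for i
        using union by (auto simp: image_subset_iff)
      ultimately show ?case by simp
    next
      case (compl A)
      have A: "A \<in> sets lborel" using compl by (simp add: b)
      have "(LINT a:(UNIV :: real set)|lborel. g' a) = (LINT a:(A \<union> (UNIV - A))|lborel. g' a)"
        by simp
      also have "\<dots> = (LINT a:A|lborel. g' a) + (LINT a:(UNIV - A)|lborel. g' a)"
        by (rule set_integral_Un) (use A in \<open>auto intro!: si\<close>)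
      finally have "(LINT a:(UNIV - A)|lborel. g' a) = (LINT a:(UNIV :: real set)|lborel. g' a)"
        using compl by simp
      also have "\<dots> = LINT a|lebesgue. g a"
        using eq[of UNIV] by (simp add: set_lebesgue_integral_def)
      also have "\<dots> = (LINT a:{..q}|lebesgue. g a)"
        unfolding set_lebesgue_integral_def g_def
        by (rule Bochner_Integration.integral_cong) (auto simp: indicator_def)
      finally show ?case using base by simp
    next
      case (basic A)
      then show ?case using eq base by auto
    next
      case empty
      then show ?case by (simp add: set_lebesgue_integral_def)
    qed
  qed
  have "AE x in lborel. g' x = 0"
    by (rule density_unique_real) (use g'l all in auto)
  then have "AE x in lebesgue. g' x = 0" by (rule AE_completion)
  with AEl show ?thesis
    by eventually_elim (auto simp: g_def)
qed

text \<open>Integrals starting at the end points are not covered by the hypothesis, so the open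
  interval is exhausted by closed intervals at distance \<open>1 / (n + 1)\<close> from its
  ends.\<close>

lemma AE_zero_of_interval_integrals:
  fixes f :: "real \<Rightarrow> real"
  assumes int: "set_integrable lebesgue {p..q} f"
    and zero: "\<And>x y. p < x \<Longrightarrow> x \<le> y \<Longrightarrow> y < q \<Longrightarrow> (LINT a:{x..y}|lebesgue. f a) = 0"
  shows "AE a in lebesgue. p < a \<and> a < q \<longrightarrow> f a = 0"
proof -
  have "AE a in lebesgue. a \<in> {p + 1 / real (Suc n)..q - 1 / real (Suc n)} \<longrightarrow> f a = 0" for n
  proof (rule AE_zero_of_indefinite_integral)
    have sub: "{p + 1 / real (Suc n)..q - 1 / real (Suc n)} \<subseteq> {p..q}"
    proof
      fix x assume x: "x \<in> {p + 1 / real (Suc n)..q - 1 / real (Suc n)}"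
      have "0 \<le> 1 / real (Suc n)" by simp
      then show "x \<in> {p..q}" using x unfolding atLeastAtMost_iff by linarith
    qed
    show "set_integrable lebesgue {p + 1 / real (Suc n)..q - 1 / real (Suc n)} f"
      by (rule set_integrable_subset[OF int _ sub]) simp
    fix x assume x: "p + 1 / real (Suc n) \<le> x" "x \<le> q - 1 / real (Suc n)"
    have "0 < 1 / real (Suc n)" by simp
    then show "(LINT a:{p + 1 / real (Suc n)..x}|lebesgue. f a) = 0"
      using x by (intro zero) linarith+
  qed
  then have "AE a in lebesgue. \<forall>n. a \<in> {p + 1 / real (Suc n)..q - 1 / real (Suc n)} \<longrightarrow> f a = 0"
    by (simp only: AE_all_countable) simp
  then show ?thesis
  proof eventually_elim
    case (elim a)
    show ?case
    proof
      assume a: "p < a \<and> a < q"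
      then have "0 < min (a - p) (q - a)" by simp
      then obtain n where "1 / real (Suc n) < min (a - p) (q - a)" using nat_approx_posE by blast
      then have "a \<in> {p + 1 / real (Suc n)..q - 1 / real (Suc n)}" unfolding atLeastAtMost_iff by linarith
      then show "f a = 0" using elim by blast
    qed
  qed
qed

lemma rep_L1_add: "AE a in lebesgue. rep_L1 (u + v) a = rep_L1 u a + rep_L1 v a"
proof -
  have "u + v = abs_L1 (\<lambda>a. rep_L1 u a + rep_L1 v a)"
    using plus_L1.abs_eq[of "rep_L1 u" "rep_L1 v"] by simp
  then show ?thesis using rep_abs_L1[of "\<lambda>a. rep_L1 u a + rep_L1 v a"] by simp
qed

lemma rep_L1_scaleR: "AE a in lebesgue. rep_L1 (c *\<^sub>R u) a = c *\<^sub>R rep_L1 u a"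
proof -
  have "c *\<^sub>R u = abs_L1 (\<lambda>a. c *\<^sub>R rep_L1 u a)"
    using scaleR_L1.abs_eq[of "rep_L1 u" c] by simp
  then show ?thesis using rep_abs_L1[of "\<lambda>a. c *\<^sub>R rep_L1 u a"] by simp
qed

lemma norm_rep_L1: "norm u = (LINT a|lebesgue. norm (rep_L1 u a))"
  using norm_abs_L1[OF integrable_rep[of u]] by simp

section \<open>The resolvent identity as the parameter vanishes\<close>

context renewal
begin

text \<open>\<open>T (c - r)\<close> transports all ages \<open>r \<le> c\<close> to the common age
  \<open>c\<close>. Along a characteristic the semigroup then disappears, because
  \<open>T (c - a) (T a y) = T c y\<close>, and pairing with \<open>z\<close> leaves a scalar
  transport equation.\<close>

definition test_integrand :: "'e \<Rightarrow> real \<Rightarrow> (real, 'e) L1 \<Rightarrow> real \<Rightarrow> real" where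
  "test_integrand z c \<eta> r = inner z (T (max 0 (c - r)) (rep_L1 \<eta> r))"

text \<open>\<open>Phi\<close> and \<open>Psi\<close> are the first and second antiderivatives in
  age of the tested density; they take the roles of \<phi> and \<open>X\<close> in
  \<open>transport_characteristics\<close>.\<close>

definition Phi :: "'e \<Rightarrow> real \<Rightarrow> real \<Rightarrow> (real, 'e) L1 \<Rightarrow> real" where
  "Phi z c x \<eta> = (LINT r:{0..x}|lebesgue. test_integrand z c \<eta> r)"

definition Psi :: "'e \<Rightarrow> real \<Rightarrow> real \<Rightarrow> (real, 'e) L1 \<Rightarrow> real" where
  "Psi z c x \<eta> = integral {0..x} (\<lambda>a. Phi z c a \<eta>)"

lemma test_integrand_measurable: "test_integrand z c \<eta> \<in> borel_measurable lebesgue"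
proof -
  have m: "(\<lambda>r::real. c - r) \<in> borel_measurable lebesgue" by (rule measurable_completion) simp
  have "(\<lambda>r. T (max 0 (c - r)) (rep_L1 \<eta> r)) \<in> borel_measurable lebesgue"
    by (rule measurable_Tmax[OF m borel_measurable_integrable[OF integrable_rep]])
  then show ?thesis unfolding test_integrand_def[abs_def] by (intro borel_measurable_inner borel_measurable_const)
qed

lemma test_integrand_bound: "0 \<le> r \<Longrightarrow> 0 \<le> c \<Longrightarrow> \<bar>test_integrand z c \<eta> r\<bar> \<le> norm z * exp (\<kappa> * c) * norm (rep_L1 \<eta> r)"
proof -
  assume r: "0 \<le> r" "0 \<le> c"
  have "\<bar>test_integrand z c \<eta> r\<bar> \<le> norm z * norm (T (max 0 (c - r)) (rep_L1 \<eta> r))"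
    unfolding test_integrand_def by (rule Cauchy_Schwarz_ineq2)
  also have "\<dots> \<le> norm z * (exp (\<kappa> * max 0 (c - r)) * norm (rep_L1 \<eta> r))"
    by (intro mult_left_mono T_norm) auto
  also have "\<dots> \<le> norm z * (exp (\<kappa> * c) * norm (rep_L1 \<eta> r))"
    using r \<kappa> by (intro mult_left_mono mult_right_mono) (auto intro!: mult_left_mono)
  finally show ?thesis by (simp add: mult.assoc)
qed

lemma test_integrand_integrable:
  assumes "0 \<le> p" "0 \<le> c" shows "set_integrable lebesgue {p..q} (test_integrand z c \<eta>)"
proof (rule set_integrable_bound)
  show "set_integrable lebesgue {p..q} (\<lambda>r. norm z * exp (\<kappa> * c) * norm (rep_L1 \<eta> r))"
    unfolding set_integrable_def
    by (intro integrable_mult_indicator integrable_mult_right integrable_norm integrable_rep) auto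
  show "set_borel_measurable lebesgue {p..q} (test_integrand z c \<eta>)"
    unfolding set_borel_measurable_def
    by (intro borel_measurable_scaleR borel_measurable_indicator test_integrand_measurable) auto
  show "AE r in lebesgue. r \<in> {p..q} \<longrightarrow> norm (test_integrand z c \<eta> r) \<le> norm (norm z * exp (\<kappa> * c) * norm (rep_L1 \<eta> r))"
    using test_integrand_bound[of _ c z \<eta>] assms by (intro AE_I2) (auto simp: abs_mult)
qed

lemma Phi_eq_integral: "0 \<le> c \<Longrightarrow> Phi z c x \<eta> = integral {0..x} (test_integrand z c \<eta>)"
  unfolding Phi_def by (rule set_lebesgue_integral_eq_integral(2)[OF test_integrand_integrable]) auto

lemma test_integrand_integrable_on: "0 \<le> p \<Longrightarrow> 0 \<le> c \<Longrightarrow> test_integrand z c \<eta> integrable_on {p..q}"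
  by (rule set_lebesgue_integral_eq_integral(1)[OF test_integrand_integrable])

lemma Phi_cont: "0 \<le> c \<Longrightarrow> continuous_on {0..q} (\<lambda>x. Phi z c x \<eta>)"
  unfolding Phi_eq_integral by (intro indefinite_integral_continuous_1 test_integrand_integrable_on) auto

lemma Phi_bounded_linear:
  assumes c: "0 \<le> c" shows "bounded_linear (Phi z c x)"
proof (rule bounded_linear_intro)
  have si: "integrable lebesgue (\<lambda>r. indicator {0..x} r *\<^sub>R test_integrand z c \<eta> r)" for \<eta>
    using test_integrand_integrable[of 0 c x z \<eta>] c by (simp add: set_integrable_def)
  have m: "(\<lambda>r. indicator {0..x} r *\<^sub>R test_integrand z c \<eta> r) \<in> borel_measurable lebesgue" for \<eta>
    by (rule borel_measurable_integrable[OF si])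
  fix u v :: "(real, 'e) L1" and k :: real
  have "Phi z c x (u + v) = (LINT r|lebesgue. indicator {0..x} r *\<^sub>R test_integrand z c u r + indicator {0..x} r *\<^sub>R test_integrand z c v r)"
    unfolding Phi_def set_lebesgue_integral_def
  proof (rule integral_cong_AE[OF m])
    show "AE r in lebesgue. indicator {0..x} r *\<^sub>R test_integrand z c (u + v) r =
        indicator {0..x} r *\<^sub>R test_integrand z c u r + indicator {0..x} r *\<^sub>R test_integrand z c v r"
      using rep_L1_add[of u v]
      by eventually_elim (simp add: test_integrand_def T_plus inner_add_right distrib_left)
  qed (intro borel_measurable_add m)
  then show "Phi z c x (u + v) = Phi z c x u + Phi z c x v"
    unfolding Phi_def set_lebesgue_integral_def using Bochner_Integration.integral_add[OF si si] by simp
  have "Phi z c x (k *\<^sub>R u) = (LINT r|lebesgue. k * (indicator {0..x} r *\<^sub>R test_integrand z c u r))"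
    unfolding Phi_def set_lebesgue_integral_def
  proof (rule integral_cong_AE[OF m])
    show "AE r in lebesgue. indicator {0..x} r *\<^sub>R test_integrand z c (k *\<^sub>R u) r = k * (indicator {0..x} r *\<^sub>R test_integrand z c u r)"
      using rep_L1_scaleR[of k u]
      by eventually_elim (simp add: test_integrand_def T_scaleR)
  qed (intro borel_measurable_times borel_measurable_const m)
  then show "Phi z c x (k *\<^sub>R u) = k *\<^sub>R Phi z c x u"
    unfolding Phi_def set_lebesgue_integral_def by simp
  have "\<bar>Phi z c x u\<bar> \<le> (LINT r|lebesgue. \<bar>indicator {0..x} r *\<^sub>R test_integrand z c u r\<bar>)"
    unfolding Phi_def set_lebesgue_integral_def by (rule integral_abs_bound)
  also have "\<dots> \<le> (LINT r|lebesgue. norm z * exp (\<kappa> * c) * norm (rep_L1 u r))"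
  proof (rule integral_mono_AE)
    show "AE r in lebesgue. \<bar>indicator {0..x} r *\<^sub>R test_integrand z c u r\<bar> \<le> norm z * exp (\<kappa> * c) * norm (rep_L1 u r)"
      using test_integrand_bound[of _ c z u] c by (intro AE_I2) (auto simp: indicator_def)
  qed (use si in auto)
  also have "\<dots> = norm u * (norm z * exp (\<kappa> * c))" by (simp add: norm_rep_L1)
  finally show "norm (Phi z c x u) \<le> norm u * (norm z * exp (\<kappa> * c))" by simp
qed

lemma Phi_lipschitz:
  assumes c: "0 \<le> c" shows "norm (Phi z c x u - Phi z c x v) \<le> (norm z * exp (\<kappa> * c)) * norm (u - v)"
proof -
  have "\<bar>Phi z c x (u - v)\<bar> \<le> (LINT r|lebesgue. \<bar>indicator {0..x} r *\<^sub>R test_integrand z c (u - v) r\<bar>)"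
    unfolding Phi_def set_lebesgue_integral_def by (rule integral_abs_bound)
  also have "\<dots> \<le> (LINT r|lebesgue. norm z * exp (\<kappa> * c) * norm (rep_L1 (u - v) r))"
  proof (rule integral_mono_AE)
    show "AE r in lebesgue. \<bar>indicator {0..x} r *\<^sub>R test_integrand z c (u - v) r\<bar> \<le> norm z * exp (\<kappa> * c) * norm (rep_L1 (u - v) r)"
      using test_integrand_bound[of _ c z "u - v"] c by (intro AE_I2) (auto simp: indicator_def)
    show "integrable lebesgue (\<lambda>r. \<bar>indicator {0..x} r *\<^sub>R test_integrand z c (u - v) r\<bar>)"
      using test_integrand_integrable[of 0 c x z "u - v"] c unfolding set_integrable_def by (intro integrable_abs) simp
  qed auto
  also have "\<dots> = (norm z * exp (\<kappa> * c)) * norm (u - v)" by (simp add: norm_rep_L1)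
  finally show ?thesis by (simp add: linear_diff[OF bounded_linear.linear[OF Phi_bounded_linear[OF c]], symmetric])
qed

lemma Psi_bounded_linear:
  assumes c: "0 \<le> c" and x: "0 \<le> x" shows "bounded_linear (Psi z c x)"
proof (rule bounded_linear_intro)
  have i: "(\<lambda>a. Phi z c a \<eta>) integrable_on {0..x}" for \<eta>
    by (intro integrable_continuous_interval Phi_cont c)
  note lin = bounded_linear.linear[OF Phi_bounded_linear[OF c]]
  fix u v :: "(real, 'e) L1" and k :: real
  show "Psi z c x (u + v) = Psi z c x u + Psi z c x v"
    unfolding Psi_def linear_add[OF lin] by (rule Henstock_Kurzweil_Integration.integral_add[OF i i])
  show "Psi z c x (k *\<^sub>R u) = k *\<^sub>R Psi z c x u"
    unfolding Psi_def linear_scale[OF lin] by (rule integral_cmul)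
  have "norm (Phi z c a u) \<le> (norm z * exp (\<kappa> * c)) * norm u" for a
    using Phi_lipschitz[OF c, of z a u 0] by (simp add: linear_0[OF lin])
  then have "norm (Psi z c x u) \<le> (norm z * exp (\<kappa> * c)) * norm u * (x - 0)"
    unfolding Psi_def by (intro integral_bound x Phi_cont c) auto
  then show "norm (Psi z c x u) \<le> norm u * (norm z * exp (\<kappa> * c) * x)" by (simp add: mult_ac)
qed

text \<open>The resolvent identity for \<open>l > 0\<close> has a fixed left-hand side, so one may let \<open>l\<close> tend to zero in it.\<close>

lemma resolvent_limit:
  fixes W Z :: "(real, 'e) L1" and B :: 'e
  assumes res: "\<And>l. l > 0 \<Longrightarrow> AE a in lebesgue. a \<in> {0<..<ap} \<longrightarrow> rep_L1 W a = exp (- l * a) *\<^sub>R T a B +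
      (LINT r:{0..a}|lebesgue. exp (- l * (a - r)) *\<^sub>R T (a - r) (rep_L1 (l *\<^sub>R W + Z) r))"
  shows "AE a in lebesgue. a \<in> {0<..<ap} \<longrightarrow> rep_L1 W a = T a B + (LINT r:{0..a}|lebesgue. T (a - r) (rep_L1 Z r))"
proof -
  \<comment> \<open>Countably many parameters share one null set of ages, and the upper bound 1
    provides an integrable majorant.\<close>
  define l where "l n = 1 / real (Suc n)" for n
  have l: "l n > 0" "l n \<le> 1" for n by (auto simp: l_def)
  have l0: "l \<longlonglongrightarrow> 0" unfolding l_def using LIMSEQ_inverse_real_of_nat by (simp add: inverse_eq_divide)
  have R: "AE a in lebesgue. \<forall>n. a \<in> {0<..<ap} \<longrightarrow> rep_L1 W a = exp (- l n * a) *\<^sub>R T a B +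
      (LINT r:{0..a}|lebesgue. exp (- l n * (a - r)) *\<^sub>R T (a - r) (rep_L1 (l n *\<^sub>R W + Z) r))"
    unfolding AE_all_countable using res l by blast
  have E: "AE r in lebesgue. \<forall>n. rep_L1 (l n *\<^sub>R W + Z) r = l n *\<^sub>R rep_L1 W r + rep_L1 Z r"
    unfolding AE_all_countable
  proof
    fix n
    show "AE r in lebesgue. rep_L1 (l n *\<^sub>R W + Z) r = l n *\<^sub>R rep_L1 W r + rep_L1 Z r"
      using rep_L1_add[of "l n *\<^sub>R W" Z] rep_L1_scaleR[of "l n" W] by eventually_elim simp
  qed
  have mT: "(\<lambda>r. T (max 0 (a - r)) (rep_L1 \<eta> r)) \<in> borel_measurable lebesgue" for a and \<eta> :: "(real, 'e) L1"
  proof -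
    have m: "(\<lambda>r::real. a - r) \<in> borel_measurable lebesgue" by (rule measurable_completion) simp
    show ?thesis by (rule measurable_Tmax[OF m borel_measurable_integrable[OF integrable_rep]])
  qed
  have lim: "(\<lambda>n. LINT r:{0..a}|lebesgue. exp (- l n * (a - r)) *\<^sub>R T (a - r) (rep_L1 (l n *\<^sub>R W + Z) r))
      \<longlonglongrightarrow> (LINT r:{0..a}|lebesgue. T (a - r) (rep_L1 Z r))" if a: "0 < a" "a < ap" for a
  proof -
    define f where "f n r = indicator {0..a} r *\<^sub>R (exp (- l n * (a - r)) *\<^sub>R T (max 0 (a - r)) (rep_L1 (l n *\<^sub>R W + Z) r))" for n r
    define g where "g r = indicator {0..a} r *\<^sub>R T (max 0 (a - r)) (rep_L1 Z r)" for r
    define w where "w r = K * (norm (rep_L1 W r) + norm (rep_L1 Z r))" for r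
    have me: "(\<lambda>r::real. exp (- l n * (a - r))) \<in> borel_measurable lebesgue" for n by (rule measurable_completion) simp
    have "(\<lambda>n. LINT r|lebesgue. f n r) \<longlonglongrightarrow> (LINT r|lebesgue. g r)"
    proof (rule integral_dominated_convergence[where w = w])
      show "g \<in> borel_measurable lebesgue"
        unfolding g_def by (intro borel_measurable_scaleR borel_measurable_indicator mT) auto
      show "f n \<in> borel_measurable lebesgue" for n
        unfolding f_def by (intro borel_measurable_scaleR borel_measurable_indicator mT me) auto
      show "integrable lebesgue w" unfolding w_def by auto
      show "AE r in lebesgue. (\<lambda>n. f n r) \<longlonglongrightarrow> g r"
        using E
      proof eventually_elim
        case (elim r)
        have "(\<lambda>n. indicator {0..a} r *\<^sub>R (exp (- l n * (a - r)) *\<^sub>R (l n *\<^sub>R T (max 0 (a - r)) (rep_L1 W r) + T (max 0 (a - r)) (rep_L1 Z r))))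
            \<longlonglongrightarrow> indicator {0..a} r *\<^sub>R (exp (- 0 * (a - r)) *\<^sub>R (0 *\<^sub>R T (max 0 (a - r)) (rep_L1 W r) + T (max 0 (a - r)) (rep_L1 Z r)))"
          by (intro tendsto_intros l0)
        then show ?case using elim by (simp add: f_def g_def T_plus T_scaleR)
      qed
      show "AE r in lebesgue. norm (f n r) \<le> w r" for n
        using E
      proof eventually_elim
        case (elim r)
        show ?case
        proof (cases "r \<in> {0..a}")
          case True
          have e: "rep_L1 (l n *\<^sub>R W + Z) r = l n *\<^sub>R rep_L1 W r + rep_L1 Z r" using elim by blast
          have "norm (f n r) = exp (- l n * (a - r)) * norm (T (max 0 (a - r)) (l n *\<^sub>R rep_L1 W r + rep_L1 Z r))"
            using True e by (simp add: f_def)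
          also have "\<dots> \<le> 1 * (K * (norm (rep_L1 W r) + norm (rep_L1 Z r)))"
          proof (rule mult_mono)
            have "0 \<le> l n * (a - r)" using l(1)[of n] True by simp
            then show "exp (- l n * (a - r)) \<le> 1" by simp
            have "norm (T (max 0 (a - r)) (l n *\<^sub>R rep_L1 W r + rep_L1 Z r)) \<le> K * norm (l n *\<^sub>R rep_L1 W r + rep_L1 Z r)"
              using True a by (intro T_K) auto
            also have "norm (l n *\<^sub>R rep_L1 W r + rep_L1 Z r) \<le> l n * norm (rep_L1 W r) + norm (rep_L1 Z r)"
              using l(1)[of n] by (intro order_trans[OF norm_triangle_ineq]) simp
            also have "l n * norm (rep_L1 W r) \<le> 1 * norm (rep_L1 W r)" by (intro mult_right_mono l) auto
            finally show "norm (T (max 0 (a - r)) (l n *\<^sub>R rep_L1 W r + rep_L1 Z r)) \<le> K * (norm (rep_L1 W r) + norm (rep_L1 Z r))"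
              using K1 by simp
          qed auto
          finally show ?thesis by (simp add: w_def)
        next
          case False
          then show ?thesis using K1 by (simp add: f_def w_def)
        qed
      qed
    qed
    moreover have "(LINT r|lebesgue. f n r) = (LINT r:{0..a}|lebesgue. exp (- l n * (a - r)) *\<^sub>R T (a - r) (rep_L1 (l n *\<^sub>R W + Z) r))" for n
      unfolding set_lebesgue_integral_def f_def by (rule Bochner_Integration.integral_cong) (auto simp: indicator_def)
    moreover have "(LINT r|lebesgue. g r) = (LINT r:{0..a}|lebesgue. T (a - r) (rep_L1 Z r))"
      unfolding set_lebesgue_integral_def g_def by (rule Bochner_Integration.integral_cong) (auto simp: indicator_def)
    ultimately show ?thesis by simp
  qed
  show ?thesis
    using R
  proof eventually_elim
    case (elim a)
    show ?case
    proof
      assume a: "a \<in> {0<..<ap}"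
      have "(\<lambda>n. exp (- l n * a) *\<^sub>R T a B + (LINT r:{0..a}|lebesgue. exp (- l n * (a - r)) *\<^sub>R T (a - r) (rep_L1 (l n *\<^sub>R W + Z) r)))
          \<longlonglongrightarrow> exp (- 0 * a) *\<^sub>R T a B + (LINT r:{0..a}|lebesgue. T (a - r) (rep_L1 Z r))"
        using a by (intro tendsto_intros l0 lim) auto
      moreover have "(\<lambda>n. exp (- l n * a) *\<^sub>R T a B + (LINT r:{0..a}|lebesgue. exp (- l n * (a - r)) *\<^sub>R T (a - r) (rep_L1 (l n *\<^sub>R W + Z) r)))
          = (\<lambda>n. rep_L1 W a)" using elim a by auto
      ultimately show "rep_L1 W a = T a B + (LINT r:{0..a}|lebesgue. T (a - r) (rep_L1 Z r))"
        using LIMSEQ_unique[OF tendsto_const] by fastforce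
    qed
  qed
qed

text \<open>\<open>inner z\<close> after \<open>T (c - a)\<close> turns \<open>T a B\<close> into
  the constant \<open>inner z (T c B)\<close> and the convolution into \<open>Phi z c a Z\<close>.
  Integrating once in age gives the tested equation.\<close>

lemma Phi_of_resolvent_limit:
  fixes W Z :: "(real, 'e) L1" and B :: 'e
  assumes lim: "AE a in lebesgue. a \<in> {0<..<ap} \<longrightarrow> rep_L1 W a = T a B + (LINT r:{0..a}|lebesgue. T (a - r) (rep_L1 Z r))"
    and c: "0 < c" "c \<le> ap" and x: "0 \<le> x" "x \<le> c"
  shows "Phi z c x W = x * inner z (T c B) + Psi z c x Z"
proof -
  have key: "AE a in lebesgue. a \<in> {0..x} \<longrightarrow> test_integrand z c W a = inner z (T c B) + Phi z c a Z"
    \<comment> \<open>Discarding the ages 0 and \<open>c\<close> as null sets leaves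
      \<open>0 < a < c\<close>, where the limit identity is available and \<open>c - a\<close> is
      positive.\<close>
    using lim AE_completion[OF AE_lborel_singleton[of 0]] AE_completion[OF AE_lborel_singleton[of c]]
  proof eventually_elim
    case (elim a)
    show ?case
    proof
      assume "a \<in> {0..x}"
      then have a: "0 < a" "a < c" using elim x by auto
      have bl: "bounded_linear (T (c - a))" using a by (intro T_lin) simp
      have iT: "integrable lebesgue (\<lambda>r. indicator {0..a} r *\<^sub>R T (a - r) (rep_L1 Z r))"
      proof -
        have m: "(\<lambda>r::real. a - r) \<in> borel_measurable lebesgue" by (rule measurable_completion) simp
        have "integrable lebesgue (\<lambda>r. indicator {0..a} r *\<^sub>R T (max 0 (a - r)) (rep_L1 Z r))"
        proof (rule Bochner_Integration.integrable_bound)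
          show "integrable lebesgue (\<lambda>r. K * norm (rep_L1 Z r))" by auto
          show "(\<lambda>r. indicator {0..a} r *\<^sub>R T (max 0 (a - r)) (rep_L1 Z r)) \<in> borel_measurable lebesgue"
            by (intro borel_measurable_scaleR borel_measurable_indicator measurable_Tmax[OF m borel_measurable_integrable[OF integrable_rep]]) auto
          show "AE r in lebesgue. norm (indicator {0..a} r *\<^sub>R T (max 0 (a - r)) (rep_L1 Z r)) \<le> norm (K * norm (rep_L1 Z r))"
          proof (rule AE_I2)
            fix r
            show "norm (indicator {0..a} r *\<^sub>R T (max 0 (a - r)) (rep_L1 Z r)) \<le> norm (K * norm (rep_L1 Z r))"
              using T_K[of "a - r" "rep_L1 Z r"] a c K1 by (cases "r \<in> {0..a}") auto
          qed
        qed
        then show ?thesis by (rule Bochner_Integration.integrable_cong[THEN iffD1, rotated -1]) (auto simp: indicator_def)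
      qed
      have "T (c - a) (LINT r:{0..a}|lebesgue. T (a - r) (rep_L1 Z r)) = (LINT r|lebesgue. T (c - a) (indicator {0..a} r *\<^sub>R T (a - r) (rep_L1 Z r)))"
        unfolding set_lebesgue_integral_def by (rule integral_bounded_linear[OF bl iT, symmetric])
      then have "inner z (T (c - a) (LINT r:{0..a}|lebesgue. T (a - r) (rep_L1 Z r))) = (LINT r|lebesgue. inner z (T (c - a) (indicator {0..a} r *\<^sub>R T (a - r) (rep_L1 Z r))))"
        using integral_bounded_linear[OF bounded_linear_inner_right[of z] integrable_bounded_linear[OF bl iT]] by simp
      also have "\<dots> = Phi z c a Z"
        unfolding Phi_def set_lebesgue_integral_def
      proof (rule Bochner_Integration.integral_cong)
        fix r
        have "T (c - a) (T (a - r) y) = T (c - r) y" if "r \<in> {0..a}" for y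
          using T_add[of "c - a" "a - r" y] a that by simp
        then show "inner z (T (c - a) (indicator {0..a} r *\<^sub>R T (a - r) (rep_L1 Z r))) = indicator {0..a} r *\<^sub>R test_integrand z c Z r"
          using a by (auto simp: indicator_def test_integrand_def T_zero)
      qed simp
      finally have 1: "inner z (T (c - a) (LINT r:{0..a}|lebesgue. T (a - r) (rep_L1 Z r))) = Phi z c a Z" .
      have 2: "T (c - a) (T a B) = T c B" using T_add[of "c - a" a B] a by simp
      have "rep_L1 W a = T a B + (LINT r:{0..a}|lebesgue. T (a - r) (rep_L1 Z r))" using elim a c by simp
      then have "test_integrand z c W a = inner z (T (c - a) (T a B + (LINT r:{0..a}|lebesgue. T (a - r) (rep_L1 Z r))))"
        using a by (simp add: test_integrand_def)
      then show "test_integrand z c W a = inner z (T c B) + Phi z c a Z"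
        using a 1 2 by (simp add: T_plus inner_add_right)
    qed
  qed
  have cont: "continuous_on {0..x} (\<lambda>a. inner z (T c B) + Phi z c a Z)"
    using c by (intro continuous_intros Phi_cont) auto
  have si: "set_integrable lebesgue {0..x} (\<lambda>a. inner z (T c B) + Phi z c a Z)"
    using absolutely_integrable_continuous_real[OF cont] .
  have "Phi z c x W = (LINT a|lebesgue. indicator {0..x} a *\<^sub>R test_integrand z c W a)"
    by (simp only: Phi_def set_lebesgue_integral_def)
  also have "\<dots> = (LINT a|lebesgue. indicator {0..x} a *\<^sub>R (inner z (T c B) + Phi z c a Z))"
  proof (rule integral_cong_AE)
    show "(\<lambda>a. indicator {0..x} a *\<^sub>R test_integrand z c W a) \<in> borel_measurable lebesgue"
      by (intro borel_measurable_scaleR borel_measurable_indicator test_integrand_measurable) auto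
    show "(\<lambda>a. indicator {0..x} a *\<^sub>R (inner z (T c B) + Phi z c a Z)) \<in> borel_measurable lebesgue"
      using si unfolding set_integrable_def by (rule borel_measurable_integrable)
    show "AE a in lebesgue. indicator {0..x} a *\<^sub>R test_integrand z c W a = indicator {0..x} a *\<^sub>R (inner z (T c B) + Phi z c a Z)"
      using key by eventually_elim (auto simp: indicator_def)
  qed
  also have "\<dots> = (LINT a:{0..x}|lebesgue. inner z (T c B) + Phi z c a Z)"
    by (simp only: set_lebesgue_integral_def)
  also have "\<dots> = integral {0..x} (\<lambda>a. inner z (T c B) + Phi z c a Z)"
    by (rule set_lebesgue_integral_eq_integral(2)[OF si])
  also have "\<dots> = integral {0..x} (\<lambda>a. inner z (T c B)) + integral {0..x} (\<lambda>a. Phi z c a Z)"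
    using c by (intro Henstock_Kurzweil_Integration.integral_add integrable_continuous_interval Phi_cont continuous_intros) auto
  finally show ?thesis using x by (simp add: Psi_def)
qed

lemma birth_L1_lipschitz:
  "norm (birth t (rep_L1 u) - birth s (rep_L1 v)) \<le> norm (\<beta> t - \<beta> s) * norm u + \<beta>m * norm (u - v)"
proof -
  have i: "integrable M (rep_L1 u)" for u :: "(real, 'e) L1" by (rule integrable_lebesgue_M) simp
  have n: "(LINT a|M. norm (rep_L1 u a)) \<le> norm u" for u :: "(real, 'e) L1"
  proof -
    have "(LINT a|M. norm (rep_L1 u a)) = (LINT a|lebesgue. indicator {0<..<ap} a *\<^sub>R norm (rep_L1 u a))"
      by (rule integral_restrict_space) auto
    also have "\<dots> \<le> (LINT a|lebesgue. norm (rep_L1 u a))"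
    proof (rule integral_mono_AE)
      show "integrable lebesgue (\<lambda>a. indicator {0<..<ap} a *\<^sub>R norm (rep_L1 u a))"
        by (rule integrable_mult_indicator) auto
    qed (auto simp: indicator_def)
    finally show ?thesis by (simp add: norm_rep_L1)
  qed
  have d: "birth s (rep_L1 u) - birth s (rep_L1 v) = birth s (rep_L1 (u - v))"
  proof -
    have "birth s (rep_L1 (u - v)) = birth s (\<lambda>a. rep_L1 u a - rep_L1 v a)"
    proof (rule birth_cong_AE[OF i])
      have "AE a in lebesgue. rep_L1 (u + (-1) *\<^sub>R v) a = rep_L1 u a + (-1) *\<^sub>R rep_L1 v a"
        using rep_L1_add[of u "(-1) *\<^sub>R v"] rep_L1_scaleR[of "-1" v] by eventually_elim simp
      then show "AE a in M. rep_L1 (u - v) a = rep_L1 u a - rep_L1 v a"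
        by (intro AE_M') simp
    qed (use i in auto)
    then show ?thesis using birth_diff[OF i i] by simp
  qed
  have "birth t (rep_L1 u) - birth s (rep_L1 v) = (birth t (rep_L1 u) - birth s (rep_L1 u)) + birth s (rep_L1 (u - v))"
    using d by (simp add: algebra_simps)
  then have "norm (birth t (rep_L1 u) - birth s (rep_L1 v)) \<le> norm (birth t (rep_L1 u) - birth s (rep_L1 u)) + norm (birth s (rep_L1 (u - v)))"
    by (simp only: norm_triangle_ineq)
  also have "\<dots> \<le> norm (\<beta> t - \<beta> s) * (LINT a|M. norm (rep_L1 u a)) + \<beta>m * (LINT a|M. norm (rep_L1 (u - v) a))"
    by (intro add_mono birth_diff_time birth_norm i)
  also have "\<dots> \<le> norm (\<beta> t - \<beta> s) * norm u + \<beta>m * norm (u - v)"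
    using \<beta>m by (intro add_mono mult_left_mono n) auto
  finally show ?thesis .
qed

lemma continuous_on_birth_L1:
  fixes P :: "real \<Rightarrow> (real, 'e) L1"
  assumes P: "continuous_on S P" shows "continuous_on S (\<lambda>t. birth t (rep_L1 (P t)))"
proof (subst continuous_on_def, intro ballI)
  fix t assume t: "t \<in> S"
  have cP: "(P \<longlongrightarrow> P t) (at t within S)" using P t by (auto simp: continuous_on_def)
  have c\<beta>: "(\<beta> \<longlongrightarrow> \<beta> t) (at t within S)"
    using continuous_on_subset[OF continuous_on_\<beta>, of S] t by (auto simp: continuous_on_def)
  have "((\<lambda>r. birth r (rep_L1 (P r)) - birth t (rep_L1 (P t))) \<longlongrightarrow> 0) (at t within S)"
  proof (rule Lim_null_comparison)
    show "\<forall>\<^sub>F r in at t within S. norm (birth r (rep_L1 (P r)) - birth t (rep_L1 (P t))) \<le> norm (\<beta> r - \<beta> t) * norm (P r) + \<beta>m * norm (P r - P t)"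
      using birth_L1_lipschitz by (intro always_eventually allI)
    have "((\<lambda>r. norm (\<beta> r - \<beta> t) * norm (P r) + \<beta>m * norm (P r - P t)) \<longlongrightarrow> norm (\<beta> t - \<beta> t) * norm (P t) + \<beta>m * norm (P t - P t)) (at t within S)"
      by (intro tendsto_intros cP c\<beta>)
    then show "((\<lambda>r. norm (\<beta> r - \<beta> t) * norm (P r) + \<beta>m * norm (P r - P t)) \<longlongrightarrow> 0) (at t within S)" by simp
  qed
  then show "((\<lambda>r. birth r (rep_L1 (P r))) \<longlongrightarrow> birth t (rep_L1 (P t))) (at t within S)" by (simp add: LIM_zero_iff)
qed

end

lemma (in renewal) continuous_on_\<mu>: "continuous_on S \<mu>"
  using \<mu>_AP continuous_on_subset by (auto simp: almost_periodic_def)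

context renewal
begin

text \<open>The functionals \<open>Phi z c x\<close> and \<open>Psi z c x\<close> are bounded, so
  they pass under the time integrals; the identity for the primitives \<open>W\<close> and
  \<open>Z\<close> becomes the scalar hypothesis of
  \<open>transport_characteristics\<close>.\<close>

lemma Phi_transport:
  fixes P :: "real \<Rightarrow> (real, 'e) L1" and s :: real
  defines "b \<equiv> \<lambda>t. birth t (rep_L1 (P t))"
  defines "W \<equiv> \<lambda>t. integral {s..t} P"
    and "Z \<equiv> \<lambda>t. P s - P t - integral {s..t} (\<lambda>r. \<mu> r *\<^sub>R P r)"
  assumes P: "continuous_on {s..} P"
    and res: "\<And>t l. s \<le> t \<Longrightarrow> l > 0 \<Longrightarrow> AE a in lebesgue. a \<in> {0<..<ap} \<longrightarrow>
      rep_L1 (W t) a = exp (- l * a) *\<^sub>R T a (integral {s..t} b) +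
      (LINT r:{0..a}|lebesgue. exp (- l * (a - r)) *\<^sub>R T (a - r) (rep_L1 (l *\<^sub>R W t + Z t) r))"
    and c: "0 < c" "c \<le> ap" and t: "s \<le> t"
  shows "0 < x \<Longrightarrow> x < c \<Longrightarrow> x < t - s \<Longrightarrow>
      exp (H t) * Phi z c x (P t) = integral {0..x} (\<lambda>\<sigma>. exp (H (t - \<sigma>)) * inner z (T c (b (t - \<sigma>))))"
    and "t - s < x \<Longrightarrow> x < c \<Longrightarrow>
      exp (H t) * Phi z c x (P t) = exp (H s) * Phi z c (x - (t - s)) (P s)
        + integral {0..t - s} (\<lambda>\<sigma>. exp (H (t - \<sigma>)) * inner z (T c (b (t - \<sigma>))))"
proof -
  have c0: "0 \<le> c" using c by simp
  have bc: "continuous_on {s..} b" unfolding b_def by (rule continuous_on_birth_L1[OF P])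
  have blT: "bounded_linear (\<lambda>y. inner z (T c y))"
    using bounded_linear_compose[OF bounded_linear_inner_right T_lin[OF c0]] .
  have b'c: "continuous_on {s..} (\<lambda>t. inner z (T c (b t)))"
    by (rule bounded_linear.continuous_on[OF blT bc])
  have \<phi>c: "continuous_on ({s..} \<times> {0..c}) (\<lambda>p. Phi z c (snd p) (P (fst p)))"
    by (rule joint_continuity_of_lipschitz_family[OF Phi_lipschitz[OF c0] Phi_cont[OF c0] P])
  have X: "integral {0..x} (\<lambda>x. Phi z c x (P t)) = Psi z c x (P t)" for x t
    by (simp add: Psi_def)
  have blPhi: "bounded_linear (Phi z c x)" for x by (rule Phi_bounded_linear[OF c0])
  have blPsi: "bounded_linear (Psi z c x)" if "x \<in> {0..c}" for x
    using that by (intro Psi_bounded_linear c0) auto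
  have Xc: "continuous_on {s..} (\<lambda>t. integral {0..x} (\<lambda>x. Phi z c x (P t)))" if "x \<in> {0..c}" for x
    unfolding X by (rule bounded_linear.continuous_on[OF blPsi[OF that] P])
  have eq: "integral {s..t} (\<lambda>r. Phi z c x (P r)) = x * integral {s..t} (\<lambda>t. inner z (T c (b t)))
      + integral {0..x} (\<lambda>x. Phi z c x (P s)) - integral {0..x} (\<lambda>x. Phi z c x (P t))
      - integral {s..t} (\<lambda>r. \<mu> r * integral {0..x} (\<lambda>x. Phi z c x (P r)))" if t: "s \<le> t" and x: "x \<in> {0..c}" for t x
  proof -
    have iP: "P integrable_on {s..t}" by (rule integrable_continuous_interval[OF continuous_on_subset[OF P]]) auto
    have ib: "b integrable_on {s..t}" by (rule integrable_continuous_interval[OF continuous_on_subset[OF bc]]) auto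
    have i\<mu>: "(\<lambda>r. \<mu> r *\<^sub>R P r) integrable_on {s..t}"
      by (intro integrable_continuous_interval continuous_on_scaleR continuous_on_\<mu> continuous_on_subset[OF P]) auto
    have "Phi z c x (W t) = x * inner z (T c (integral {s..t} b)) + Psi z c x (Z t)"
      using x by (intro Phi_of_resolvent_limit[OF resolvent_limit[OF res[OF t]] c]) auto
    moreover have "integral {s..t} (\<lambda>r. Phi z c x (P r)) = Phi z c x (W t)"
      unfolding W_def using integral_linear[OF iP blPhi[of x]] by (simp add: comp_def)
    moreover have "integral {s..t} (\<lambda>t. inner z (T c (b t))) = inner z (T c (integral {s..t} b))"
      using integral_linear[OF ib blT] by (simp add: comp_def)
    moreover have "Psi z c x (Z t) = Psi z c x (P s) - Psi z c x (P t) - integral {s..t} (\<lambda>r. \<mu> r * Psi z c x (P r))"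
    proof -
      note lin = bounded_linear.linear[OF blPsi[OF x]]
      have "Psi z c x (integral {s..t} (\<lambda>r. \<mu> r *\<^sub>R P r)) = integral {s..t} (\<lambda>r. \<mu> r * Psi z c x (P r))"
        using integral_linear[OF i\<mu> blPsi[OF x]] by (simp add: comp_def linear_scale[OF lin])
      then show ?thesis unfolding Z_def by (simp add: linear_diff[OF lin])
    qed
    ultimately show ?thesis unfolding X by simp
  qed
  note tr = transport_characteristics[of s c "\<lambda>t x. Phi z c x (P t)" "\<lambda>t. inner z (T c (b t))" \<mu> H t x,
      OF \<phi>c b'c continuous_on_\<mu> Xc H eq t]
  show "0 < x \<Longrightarrow> x < c \<Longrightarrow> x < t - s \<Longrightarrow>
      exp (H t) * Phi z c x (P t) = integral {0..x} (\<lambda>\<sigma>. exp (H (t - \<sigma>)) * inner z (T c (b (t - \<sigma>))))"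
    by (rule tr(1))
  show "t - s < x \<Longrightarrow> x < c \<Longrightarrow>
      exp (H t) * Phi z c x (P t) = exp (H s) * Phi z c (x - (t - s)) (P s)
        + integral {0..t - s} (\<lambda>\<sigma>. exp (H (t - \<sigma>)) * inner z (T c (b (t - \<sigma>))))"
    by (rule tr(2))
qed

lemma Phi_interval:
  assumes "0 \<le> x" "x \<le> y" "0 \<le> c"
  shows "(LINT r:{x..y}|lebesgue. test_integrand z c \<eta> r) = Phi z c y \<eta> - Phi z c x \<eta>"
proof -
  have "integral {0..x} (test_integrand z c \<eta>) + integral {x..y} (test_integrand z c \<eta>) = integral {0..y} (test_integrand z c \<eta>)"
    using assms by (intro Henstock_Kurzweil_Integration.integral_combine test_integrand_integrable_on) auto
  moreover have "(LINT r:{x..y}|lebesgue. test_integrand z c \<eta> r) = integral {x..y} (test_integrand z c \<eta>)"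
    by (rule set_lebesgue_integral_eq_integral(2)[OF test_integrand_integrable]) (use assms in auto)
  ultimately show ?thesis using assms by (simp add: Phi_eq_integral)
qed

text \<open>Differences of \<open>Phi\<close> are integrals of the tested density over age
  intervals, so the identities for \<open>Phi\<close> determine the density almost everywhere. Ages
  below and above \<open>t - s\<close> are treated separately; the age \<open>t - s\<close> itself
  is a null set.\<close>

lemma test_AE_char_value:
  fixes P :: "real \<Rightarrow> (real, 'e) L1" and s :: real
  defines "b \<equiv> \<lambda>t. birth t (rep_L1 (P t))"
  assumes P: "continuous_on {s..} P"
    and res: "\<And>t l. s \<le> t \<Longrightarrow> l > 0 \<Longrightarrow> AE a in lebesgue. a \<in> {0<..<ap} \<longrightarrow>
      rep_L1 (integral {s..t} P) a = exp (- l * a) *\<^sub>R T a (integral {s..t} b) +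
      (LINT r:{0..a}|lebesgue. exp (- l * (a - r)) *\<^sub>R T (a - r) (rep_L1 (l *\<^sub>R integral {s..t} P
        + (P s - P t - integral {s..t} (\<lambda>r. \<mu> r *\<^sub>R P r))) r))"
    and c: "0 < c" "c \<le> ap" and t: "s \<le> t"
  shows "AE a in lebesgue. 0 < a \<and> a < c \<longrightarrow> inner z (T (max 0 (c - a)) (rep_L1 (P t) a - char_value s b (rep_L1 (P s)) t a)) = 0"
proof -
  have bc: "continuous_on {s..} b" unfolding b_def by (rule continuous_on_birth_L1[OF P])
  have c0: "0 \<le> c" using c by simp
  define \<delta> where "\<delta> = t - s"
  have \<delta>: "\<delta> \<ge> 0" using t by (simp add: \<delta>_def)
  define k where "k \<sigma> = exp (H (t - \<sigma>)) * inner z (T c (b (t - \<sigma>)))" for \<sigma>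
  note tr = Phi_transport[of s P, folded b_def, OF P res c t]
  have tr1: "exp (H t) * Phi z c x (P t) = integral {0..x} k" if "0 < x" "x < c" "x < \<delta>" for x
    using tr(1)[of x z] that by (simp add: k_def[abs_def] \<delta>_def b_def)
  have tr2: "exp (H t) * Phi z c x (P t) = exp (H s) * Phi z c (x - \<delta>) (P s) + integral {0..\<delta>} k" if "\<delta> < x" "x < c" for x
    using tr(2)[of x z] that by (simp add: k_def[abs_def] \<delta>_def b_def)
  have kc: "continuous_on {0..\<delta>} k"
  proof -
    have "continuous_on {0..\<delta>} (\<lambda>\<sigma>. H (t - \<sigma>))"
      by (rule continuous_on_H') (auto intro!: continuous_intros)
    moreover have "continuous_on {0..\<delta>} (\<lambda>\<sigma>. b (t - \<sigma>))"
      by (rule continuous_on_compose2[OF bc]) (auto simp: \<delta>_def intro!: continuous_intros)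
    ultimately show ?thesis unfolding k_def
      using c0 by (intro continuous_intros continuous_on_T) auto
  qed
  define p where "p = rep_L1 (P t)"
  define p0 where "p0 = rep_L1 (P s)"
  have ig: "set_integrable lebesgue {q..r} (\<lambda>a. v * test_integrand z c \<eta> a)" if "0 \<le> q" for q r v \<eta>
    using test_integrand_integrable[OF that c0] by simp
  have A1: "AE a in lebesgue. 0 < a \<and> a < min c \<delta> \<longrightarrow> exp (H t) * test_integrand z c (P t) a - k a = 0"
  proof (rule AE_zero_of_interval_integrals)
    have "set_integrable lebesgue {0..min c \<delta>} k"
      by (intro absolutely_integrable_continuous_real continuous_on_subset[OF kc]) auto
    then have ik: "set_integrable lebesgue {x..y} k" if "0 \<le> x" "y \<le> min c \<delta>" for x y
      by (rule set_integrable_subset) (use that in auto)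
    show "set_integrable lebesgue {0..min c \<delta>} (\<lambda>a. exp (H t) * test_integrand z c (P t) a - k a)"
      by (intro set_integral_diff(1) ig ik) auto
    fix x y assume xy: "0 < x" "x \<le> y" "y < min c \<delta>"
    have "(LINT a:{x..y}|lebesgue. exp (H t) * test_integrand z c (P t) a - k a)
        = exp (H t) * (LINT a:{x..y}|lebesgue. test_integrand z c (P t) a) - (LINT a:{x..y}|lebesgue. k a)"
      using xy by (subst set_integral_diff(2)[OF ig ik]) auto
    also have "(LINT a:{x..y}|lebesgue. k a) = integral {x..y} k"
      by (rule set_lebesgue_integral_eq_integral(2)[OF ik]) (use xy in auto)
    also have "integral {x..y} k = integral {0..y} k - integral {0..x} k"
    proof -
      have "k integrable_on {0..y}" by (rule integrable_continuous_interval, rule continuous_on_subset[OF kc]) (use xy in auto)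
      then show ?thesis using Henstock_Kurzweil_Integration.integral_combine[of 0 x y k] xy by simp
    qed
    also have "(LINT a:{x..y}|lebesgue. test_integrand z c (P t) a) = Phi z c y (P t) - Phi z c x (P t)"
      using xy c0 by (intro Phi_interval) auto
    finally show "(LINT a:{x..y}|lebesgue. exp (H t) * test_integrand z c (P t) a - k a) = 0"
      using tr1[of x] tr1[of y] xy by (simp add: right_diff_distrib)
  qed
  have A2: "AE a in lebesgue. \<delta> < a \<and> a < c \<longrightarrow> exp (H t) * test_integrand z c (P t) a - exp (H s) * test_integrand z c (P s) (a - \<delta>) = 0"
  proof (rule AE_zero_of_interval_integrals)
    have sh: "set_integrable lebesgue {x..y} (\<lambda>a. exp (H s) * test_integrand z c (P s) (a - \<delta>))"
      "(LINT a:{x..y}|lebesgue. test_integrand z c (P s) (a - \<delta>)) = (LINT a:{x - \<delta>..y - \<delta>}|lebesgue. test_integrand z c (P s) a)"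
      if "\<delta> \<le> x" for x y
    proof -
      have i: "integrable lebesgue (\<lambda>a. indicator {x - \<delta>..y - \<delta>} a *\<^sub>R test_integrand z c (P s) a)"
        using test_integrand_integrable[of "x - \<delta>" c "y - \<delta>" z "P s"] that c0 by (simp add: set_integrable_def)
      have e: "indicator {x - \<delta>..y - \<delta>} (a - \<delta>) = (indicator {x..y} a :: real)" for a by (auto simp: indicator_def)
      have "set_integrable lebesgue {x..y} (\<lambda>a. test_integrand z c (P s) (a - \<delta>))"
        using integrable_lebesgue_shift(1)[OF i, of \<delta>] unfolding set_integrable_def e .
      then show "set_integrable lebesgue {x..y} (\<lambda>a. exp (H s) * test_integrand z c (P s) (a - \<delta>))" by simp
      show "(LINT a:{x..y}|lebesgue. test_integrand z c (P s) (a - \<delta>)) = (LINT a:{x - \<delta>..y - \<delta>}|lebesgue. test_integrand z c (P s) a)"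
        using integrable_lebesgue_shift(2)[OF i, of \<delta>] unfolding set_lebesgue_integral_def e .
    qed
    show "set_integrable lebesgue {\<delta>..c} (\<lambda>a. exp (H t) * test_integrand z c (P t) a - exp (H s) * test_integrand z c (P s) (a - \<delta>))"
      by (intro set_integral_diff(1) ig sh \<delta>) auto
    fix x y assume xy: "\<delta> < x" "x \<le> y" "y < c"
    have "(LINT a:{x..y}|lebesgue. exp (H t) * test_integrand z c (P t) a - exp (H s) * test_integrand z c (P s) (a - \<delta>))
        = exp (H t) * (LINT a:{x..y}|lebesgue. test_integrand z c (P t) a) - exp (H s) * (LINT a:{x..y}|lebesgue. test_integrand z c (P s) (a - \<delta>))"
      using xy \<delta> by (subst set_integral_diff(2)[OF ig sh(1)]) auto
    also have "(LINT a:{x..y}|lebesgue. test_integrand z c (P t) a) = Phi z c y (P t) - Phi z c x (P t)"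
      using xy c0 \<delta> by (intro Phi_interval) auto
    also have "(LINT a:{x..y}|lebesgue. test_integrand z c (P s) (a - \<delta>)) = Phi z c (y - \<delta>) (P s) - Phi z c (x - \<delta>) (P s)"
      using xy c0 by (subst sh(2)) (auto intro!: Phi_interval)
    finally show "(LINT a:{x..y}|lebesgue. exp (H t) * test_integrand z c (P t) a - exp (H s) * test_integrand z c (P s) (a - \<delta>)) = 0"
      using tr2[of x] tr2[of y] xy by (simp add: right_diff_distrib)
  qed
  show ?thesis
    using A1 A2 AE_completion[OF AE_lborel_singleton[of \<delta>]]
  proof eventually_elim
    case (elim a)
    show ?case
    proof
      assume a: "0 < a \<and> a < c"
      have Hpos: "exp (H t) \<noteq> 0" by simp
      show "inner z (T (max 0 (c - a)) (rep_L1 (P t) a - char_value s b (rep_L1 (P s)) t a)) = 0"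
      proof (cases "a < \<delta>")
        case True
        have ca: "T (c - a) (T a y) = T c y" for y using T_add[of "c - a" a y] a by simp
        have "exp (H t) * inner z (T (c - a) (rep_L1 (P t) a)) = exp (H (t - a)) * inner z (T c (b (t - a)))"
          using elim(1) True a by (simp add: test_integrand_def k_def)
        moreover have "exp (H t) * inner z (T (c - a) (char_value s b (rep_L1 (P s)) t a)) = exp (H (t - a)) * inner z (T c (b (t - a)))"
          using True a by (simp add: char_value_def \<delta>_def srv_def T_scaleR ca exp_diff)
        ultimately have "exp (H t) * inner z (T (c - a) (rep_L1 (P t) a - char_value s b (rep_L1 (P s)) t a)) = 0"
          using a by (simp add: T_diff inner_diff_right right_diff_distrib)
        then show ?thesis using a Hpos by simp
      next
        case False
        then have ad: "\<delta> < a" using elim(3) by simp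
        have ca: "T (c - a) (T \<delta> y) = T (c - (a - \<delta>)) y" for y
          using T_add[of "c - a" \<delta> y] a \<delta> by (simp add: algebra_simps)
        have "exp (H t) * inner z (T (c - a) (rep_L1 (P t) a)) = exp (H s) * inner z (T (c - (a - \<delta>)) (rep_L1 (P s) (a - \<delta>)))"
          using elim(2) ad a \<delta> by (simp add: test_integrand_def)
        moreover have "exp (H t) * inner z (T (c - a) (char_value s b (rep_L1 (P s)) t a)) = exp (H s) * inner z (T (c - (a - \<delta>)) (rep_L1 (P s) (a - \<delta>)))"
          using ad a \<delta> by (simp add: char_value_def \<delta>_def[symmetric] T_scaleR ca exp_diff)
        ultimately have "exp (H t) * inner z (T (c - a) (rep_L1 (P t) a - char_value s b (rep_L1 (P s)) t a)) = 0"
          using a by (simp add: T_diff inner_diff_right right_diff_distrib)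
        then show ?thesis using a Hpos by simp
      qed
    qed
  qed
qed

text \<open>Testing with \<open>inner z (T (c - a) _)\<close> for countably many \<open>z\<close> and \<open>c\<close> and letting \<open>c\<close> decrease to \<open>a\<close>
  recovers the values themselves although \<open>T\<close> need not be injective.\<close>

lemma char_solution_of_resolvent_identity:
  fixes P :: "real \<Rightarrow> (real, 'e) L1" and s :: real
  defines "b \<equiv> \<lambda>t. birth t (rep_L1 (P t))"
  assumes P: "continuous_on {s..} P"
    and T0: "\<And>t. s \<le> t \<Longrightarrow> AE a in lebesgue. T 0 (rep_L1 (P t) a) = rep_L1 (P t) a"
    and res: "\<And>t l. s \<le> t \<Longrightarrow> l > 0 \<Longrightarrow> AE a in lebesgue. a \<in> {0<..<ap} \<longrightarrow>
      rep_L1 (integral {s..t} P) a = exp (- l * a) *\<^sub>R T a (integral {s..t} b) +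
      (LINT r:{0..a}|lebesgue. exp (- l * (a - r)) *\<^sub>R T (a - r) (rep_L1 (l *\<^sub>R integral {s..t} P
        + (P s - P t - integral {s..t} (\<lambda>r. \<mu> r *\<^sub>R P r))) r))"
  shows "char_solution s (rep_L1 (P s)) (\<lambda>t. rep_L1 (P t))"
  unfolding char_solution_def
proof (intro conjI allI impI)
  show "integrable lebesgue (rep_L1 (P s))" by simp
  show "continuous_on {s..} (\<lambda>t. birth t (rep_L1 (P t)))" by (rule continuous_on_birth_L1[OF P])
  fix t assume t: "s \<le> t"
  show "integrable M (rep_L1 (P t))" by (rule integrable_lebesgue_M) simp
  obtain D :: "'e set" where D: "countable D" "\<And>U. open U \<Longrightarrow> U \<noteq> {} \<Longrightarrow> \<exists>d\<in>D. d \<in> U"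
    using countable_dense_setE by (metis (no_types, lifting))
  define Q where "Q a = char_value s b (rep_L1 (P s)) t a" for a
  define C where "C = {c \<in> \<rat>. 0 < c \<and> c \<le> ap}"
  have C: "countable C" unfolding C_def by (rule countable_subset[OF _ countable_rat]) auto
  have "AE a in lebesgue. \<forall>z\<in>D. \<forall>c\<in>C. 0 < a \<and> a < c \<longrightarrow> inner z (T (max 0 (c - a)) (rep_L1 (P t) a - Q a)) = 0"
    unfolding AE_ball_countable[OF D(1)] AE_ball_countable[OF C] Q_def b_def
    by (intro ballI test_AE_char_value[OF P res[unfolded b_def] _ _ t]) (auto simp: C_def)
  then have "AE a in lebesgue. a \<in> {0<..<ap} \<longrightarrow> rep_L1 (P t) a = Q a"
    using T0[OF t]
  proof eventually_elim
    case (elim a)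
    show ?case
    proof
      assume a: "a \<in> {0<..<ap}"
      define y where "y = rep_L1 (P t) a - Q a"
      have z0: "T (max 0 (c - a)) y = 0" if c: "c \<in> C" "a < c" for c
      proof (rule ccontr)
        \<comment> \<open>A nonzero vector has an element of the dense set strictly closer to it
          than its norm, but by Pythagoras no vector orthogonal to it is that close.\<close>
        assume n: "T (max 0 (c - a)) y \<noteq> 0"
        define v where "v = T (max 0 (c - a)) y"
        have "ball v (norm v) \<noteq> {}" using n by (simp add: v_def)
        then obtain z where z: "z \<in> D" "z \<in> ball v (norm v)" using D(2)[of "ball v (norm v)"] by auto
        have "inner z v = 0" using elim(1) z(1) c a by (simp add: v_def y_def)
        then have "(norm (v - z))\<^sup>2 = (norm v)\<^sup>2 + (norm z)\<^sup>2"
          by (simp add: power2_norm_eq_inner inner_diff_left inner_diff_right inner_commute)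
        moreover have "(norm (v - z))\<^sup>2 < (norm v)\<^sup>2"
          using z(2) by (intro power_strict_mono) (auto simp: dist_norm)
        ultimately show False by (simp add: not_sum_power2_lt_zero)
      qed
      have "\<exists>c. c \<in> C \<and> a < c \<and> c < a + inverse (real (Suc n))" for n
      proof -
        have "a < min ap (a + inverse (real (Suc n)))" using a by simp
        then obtain q where "q \<in> \<rat>" "a < q" "q < min ap (a + inverse (real (Suc n)))"
          using Rats_dense_in_real by blast
        then show ?thesis using a by (intro exI[of _ q]) (auto simp: C_def)
      qed
      then obtain cs where cs: "\<And>n. cs n \<in> C" "\<And>n. a < cs n" "\<And>n. cs n < a + inverse (real (Suc n))" by metis
      have lim: "cs \<longlonglongrightarrow> a"
      proof (rule tendsto_sandwich[of "\<lambda>_. a" _ _ "\<lambda>n. a + inverse (real (Suc n))"])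
        show "(\<lambda>n. a + inverse (real (Suc n))) \<longlonglongrightarrow> a"
          using tendsto_add[OF tendsto_const LIMSEQ_inverse_real_of_nat, of a] by simp
      qed (intro always_eventually allI less_imp_le cs tendsto_const)+
      have "continuous_on UNIV (\<lambda>c. T (max 0 (c - a)) y)" by (intro continuous_on_Tmax continuous_intros)
      then have "(\<lambda>n. T (max 0 (cs n - a)) y) \<longlonglongrightarrow> T (max 0 (a - a)) y"
        using lim by (rule continuous_on_tendsto_compose) auto
      then have "(\<lambda>n. 0 :: 'e) \<longlonglongrightarrow> T 0 y" using z0 cs by simp
      then have "T 0 y = 0" using LIMSEQ_unique[OF tendsto_const] by metis
      \<comment> \<open>In the limit only the projection \<open>T 0\<close> remains, and it fixes
        both \<open>rep_L1 (P t) a\<close> and \<open>Q a\<close>.\<close>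
      moreover have "T 0 (Q a) = Q a"
        unfolding Q_def char_value_def by (simp add: T_scaleR T0_T)
      ultimately show "rep_L1 (P t) a = Q a" using elim(2) by (simp add: y_def T_diff)
    qed
  qed
  then show "AE a in M. rep_L1 (P t) a = char_value s (\<lambda>r. birth r (rep_L1 (P r))) (rep_L1 (P s)) t a"
    unfolding Q_def b_def by (rule AE_M)
qed

end

section \<open>The Hilbert lattice of square-integrable functions\<close>

lemma rep_L2_measurable [measurable]: "rep_L2 u \<in> borel_measurable lebesgue"
  using sq_integrable_rep[of u] by (simp add: sq_integrable_def)

lemma rep_L2_add: "AE x in lebesgue. rep_L2 (u + v) x = rep_L2 u x + rep_L2 v x"
  using rep_abs_L2[OF sq_integrable_add[OF sq_integrable_rep[of u] sq_integrable_rep[of v]]]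
    abs_L2_add[OF sq_integrable_rep[of u] sq_integrable_rep[of v]] by simp

lemma rep_L2_scaleR: "AE x in lebesgue. rep_L2 (c *\<^sub>R u) x = c * rep_L2 u x"
  using rep_abs_L2[OF sq_integrable_scale[OF sq_integrable_rep[of u], of c]]
    abs_L2_scaleR[OF sq_integrable_rep[of u], of c] by simp

lemma rep_L2_minus: "AE x in lebesgue. rep_L2 (- u) x = - rep_L2 u x"
proof -
  have "- u = (-1) *\<^sub>R u" by simp
  then show ?thesis using rep_L2_scaleR[of "-1" u] by simp
qed

lemma rep_L2_zero: "AE x in lebesgue. rep_L2 0 x = 0"
  using rep_L2_scaleR[of 0 0] by simp

lemma inner_L2_rep: "inner u v = (LINT x|lebesgue. rep_L2 u x * rep_L2 v x)"
  using inner_L2.abs_eq[of "rep_L2 u" "rep_L2 v"] by simp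

lemma L2_eqI: "AE x in lebesgue. rep_L2 u x = rep_L2 v x \<Longrightarrow> u = v"
  using abs_L2_eqI[of "rep_L2 u" "rep_L2 v"] by simp

definition L2_pos_part :: "'a::euclidean_space L2 \<Rightarrow> 'a L2" where
  "L2_pos_part u = abs_L2 (\<lambda>x. max 0 (rep_L2 u x))"

lemma rep_L2_pos_part: "AE x in lebesgue. rep_L2 (L2_pos_part u) x = max 0 (rep_L2 u x)"
proof -
  have "sq_integrable (\<lambda>x. max 0 (rep_L2 u x))"
    by (rule sq_integrable_dominated[OF sq_integrable_rep[of u]]) auto
  then show ?thesis unfolding L2_pos_part_def by (rule rep_abs_L2)
qed

text \<open>For the converse half of self-duality, a vector whose inner products with the cone are
  nonnegative is tested with its own negative part, which must then vanish.\<close>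

lemma L2_self_dual_cone: "self_dual_cone (L2_nonneg :: 'a::euclidean_space L2 \<Rightarrow> bool) L2_pos_part"
proof
  fix x :: "'a L2"
  note [simp] = sq_integrable_rep
  have pm: "AE a in lebesgue. rep_L2 (L2_pos_part (- x)) a = max 0 (- rep_L2 x a)"
    using rep_L2_pos_part[of "- x"] rep_L2_minus[of x] by eventually_elim simp
  show nn: "L2_nonneg (L2_pos_part x)" for x :: "'a L2"
    unfolding L2_nonneg_def using rep_L2_pos_part[of x] by eventually_elim simp
  show "L2_pos_part x - L2_pos_part (- x) = x"
  proof (rule L2_eqI)
    have "L2_pos_part x - L2_pos_part (- x) = L2_pos_part x + (-1) *\<^sub>R L2_pos_part (- x)" by simp
    moreover have "AE a in lebesgue. rep_L2 (L2_pos_part x + (-1) *\<^sub>R L2_pos_part (- x)) a = rep_L2 x a"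
      using rep_L2_add[of "L2_pos_part x" "(-1) *\<^sub>R L2_pos_part (- x)"] rep_L2_scaleR[of "-1" "L2_pos_part (- x)"]
        rep_L2_pos_part[of x] pm by eventually_elim (simp add: max_def)
    ultimately show "AE a in lebesgue. rep_L2 (L2_pos_part x - L2_pos_part (- x)) a = rep_L2 x a" by simp
  qed
  show "inner (L2_pos_part x) (L2_pos_part (- x)) = 0"
  proof -
    have "AE a in lebesgue. rep_L2 (L2_pos_part x) a * rep_L2 (L2_pos_part (- x)) a = 0"
      using rep_L2_pos_part[of x] pm by eventually_elim (simp add: max_def)
    then have "(LINT a|lebesgue. rep_L2 (L2_pos_part x) a * rep_L2 (L2_pos_part (- x)) a) = (LINT a|(lebesgue :: 'a measure). 0)"
      by (intro integral_cong_AE) auto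
    then show ?thesis by (simp add: inner_L2_rep)
  qed
  show "L2_nonneg x \<longleftrightarrow> (\<forall>z. L2_nonneg z \<longrightarrow> 0 \<le> inner x z)"
  proof (intro iffI allI impI)
    fix z :: "'a L2" assume "L2_nonneg x" "L2_nonneg z"
    then have "AE a in lebesgue. 0 \<le> rep_L2 x a * rep_L2 z a"
      unfolding L2_nonneg_def by eventually_elim simp
    then show "0 \<le> inner x z" unfolding inner_L2_rep by (rule integral_nonneg_AE)
  next
    assume *: "\<forall>z. L2_nonneg z \<longrightarrow> 0 \<le> inner x z"
    have "AE a in lebesgue. rep_L2 x a * rep_L2 (L2_pos_part (- x)) a = - (rep_L2 (L2_pos_part (- x)) a * rep_L2 (L2_pos_part (- x)) a)"
      using pm by eventually_elim (simp add: max_def)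
    then have "inner x (L2_pos_part (- x)) = (LINT a|lebesgue. - (rep_L2 (L2_pos_part (- x)) a * rep_L2 (L2_pos_part (- x)) a))"
      unfolding inner_L2_rep by (intro integral_cong_AE) auto
    also have "\<dots> = - inner (L2_pos_part (- x)) (L2_pos_part (- x))" by (simp add: inner_L2_rep)
    finally have "inner (L2_pos_part (- x)) (L2_pos_part (- x)) \<le> 0" using *[rule_format, OF nn[of "- x"]] by linarith
    then have "L2_pos_part (- x) = 0" by (metis inner_ge_zero inner_eq_zero_iff antisym)
    then have "AE a in lebesgue. rep_L2 (L2_pos_part (- x)) a = 0" using rep_L2_zero by simp
    then show "L2_nonneg x" unfolding L2_nonneg_def using pm by eventually_elim (simp add: max_def split: if_splits)
  qed
qed

text \<open>Multiplication by the indicator is the orthogonal projection onto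
  \<open>L2_on \<Omega>\<close>; it is the projection with which the semigroup gets
  composed.\<close>

definition L2_restrict :: "'a::euclidean_space set \<Rightarrow> 'a L2 \<Rightarrow> 'a L2" where
  "L2_restrict \<Omega> u = abs_L2 (\<lambda>x. indicator \<Omega> x * rep_L2 u x)"

context
  fixes \<Omega> :: "'a::euclidean_space set"
  assumes \<Omega>: "\<Omega> \<in> sets lebesgue"
begin

lemma indicator_mult_sq_integrable: "sq_integrable f \<Longrightarrow> sq_integrable (\<lambda>x. indicator \<Omega> x * f x)"
  by (rule sq_integrable_dominated[of f])
     (use \<Omega> in \<open>auto simp: sq_integrable_def indicator_def intro!: borel_measurable_times\<close>)

lemma rep_L2_restrict: "AE x in lebesgue. rep_L2 (L2_restrict \<Omega> u) x = indicator \<Omega> x * rep_L2 u x"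
  unfolding L2_restrict_def by (rule rep_abs_L2[OF indicator_mult_sq_integrable[OF sq_integrable_rep]])

lemma L2_restrict_bounded_linear: "bounded_linear (L2_restrict \<Omega>)"
  and norm_L2_restrict: "norm (L2_restrict \<Omega> u) \<le> norm u"
proof -
  show n: "norm (L2_restrict \<Omega> u) \<le> norm u" for u
  proof -
    have "inner (L2_restrict \<Omega> u) (L2_restrict \<Omega> u) \<le> inner u u"
      unfolding inner_L2_rep
    proof (rule integral_mono_AE)
      show "AE x in lebesgue. rep_L2 (L2_restrict \<Omega> u) x * rep_L2 (L2_restrict \<Omega> u) x \<le> rep_L2 u x * rep_L2 u x"
        using rep_L2_restrict[of u] by eventually_elim (simp add: indicator_def)
    qed (auto intro!: sq_integrable_mult)
    then show ?thesis by (simp add: norm_le)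
  qed
  show "bounded_linear (L2_restrict \<Omega>)"
  proof (rule bounded_linear_intro)
    fix u v :: "'a L2" and c :: real
    show "L2_restrict \<Omega> (u + v) = L2_restrict \<Omega> u + L2_restrict \<Omega> v"
    proof (rule L2_eqI)
      show "AE x in lebesgue. rep_L2 (L2_restrict \<Omega> (u + v)) x = rep_L2 (L2_restrict \<Omega> u + L2_restrict \<Omega> v) x"
        using rep_L2_restrict[of "u + v"] rep_L2_restrict[of u] rep_L2_restrict[of v] rep_L2_add[of u v]
          rep_L2_add[of "L2_restrict \<Omega> u" "L2_restrict \<Omega> v"]
        by eventually_elim (simp only: distrib_left)
    qed
    show "L2_restrict \<Omega> (c *\<^sub>R u) = c *\<^sub>R L2_restrict \<Omega> u"
    proof (rule L2_eqI)
      show "AE x in lebesgue. rep_L2 (L2_restrict \<Omega> (c *\<^sub>R u)) x = rep_L2 (c *\<^sub>R L2_restrict \<Omega> u) x"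
        using rep_L2_restrict[of "c *\<^sub>R u"] rep_L2_restrict[of u] rep_L2_scaleR[of c u]
          rep_L2_scaleR[of c "L2_restrict \<Omega> u"]
        by eventually_elim (simp only: mult.left_commute)
    qed
    show "norm (L2_restrict \<Omega> u) \<le> norm u * 1" using n by simp
  qed
qed

lemma L2_on_iff: "u \<in> L2_on \<Omega> \<longleftrightarrow> L2_restrict \<Omega> u = u"
proof
  assume "u \<in> L2_on \<Omega>"
  then have "AE x in lebesgue. x \<notin> \<Omega> \<longrightarrow> rep_L2 u x = 0" by (simp add: L2_on_def)
  then have "AE x in lebesgue. rep_L2 (L2_restrict \<Omega> u) x = rep_L2 u x"
    using rep_L2_restrict[of u] by eventually_elim (auto simp: indicator_def)
  then show "L2_restrict \<Omega> u = u" by (rule L2_eqI)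
next
  assume e: "L2_restrict \<Omega> u = u"
  have "AE x in lebesgue. rep_L2 u x = indicator \<Omega> x * rep_L2 u x"
    using rep_L2_restrict[of u] unfolding e .
  then show "u \<in> L2_on \<Omega>" unfolding L2_on_def mem_Collect_eq by eventually_elim (auto simp: indicator_def)
qed

lemma L2_restrict_in: "L2_restrict \<Omega> u \<in> L2_on \<Omega>"
  unfolding L2_on_def mem_Collect_eq using rep_L2_restrict[of u] by eventually_elim auto

lemma L2_on_closed_subspace: "closed (L2_on \<Omega>)" "subspace (L2_on \<Omega>)"
proof -
  have e: "L2_on \<Omega> = {u. L2_restrict \<Omega> u = u}" using L2_on_iff by blast
  show "closed (L2_on \<Omega>)"
    unfolding e by (intro closed_Collect_eq bounded_linear.continuous_on[OF L2_restrict_bounded_linear] continuous_intros)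
  interpret bounded_linear "L2_restrict \<Omega>" by (rule L2_restrict_bounded_linear)
  show "subspace (L2_on \<Omega>)"
    unfolding e subspace_def by (simp add: zero add scaleR)
qed

lemma L2_restrict_nonneg:
  assumes "L2_nonneg u" shows "L2_nonneg (L2_restrict \<Omega> u)"
  using assms rep_L2_restrict[of u] unfolding L2_nonneg_def by eventually_elim simp

lemma L2_restrict_pos_part: "L2_restrict \<Omega> u = u \<Longrightarrow> L2_restrict \<Omega> (L2_pos_part u) = L2_pos_part u"
proof -
  assume "L2_restrict \<Omega> u = u"
  then have "AE x in lebesgue. x \<notin> \<Omega> \<longrightarrow> rep_L2 u x = 0" using L2_on_iff by (simp add: L2_on_def)
  then have "L2_pos_part u \<in> L2_on \<Omega>"
    unfolding L2_on_def mem_Collect_eq using rep_L2_pos_part[of u] by eventually_elim auto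
  then show ?thesis by (simp add: L2_on_iff)
qed

end

text \<open>The nonlocal term is bounded by Cauchy-Schwarz on the bounded domain, since the kernel is bounded.\<close>

lemma nonlocal_diffusion_properties:
  fixes J :: "'a::euclidean_space \<Rightarrow> real" and \<Omega> :: "'a set"
  assumes \<Omega>: "open \<Omega>" "bounded \<Omega>" and d: "d \<ge> 0"
    and J: "continuous_on UNIV J" "compact (closure {x. J x \<noteq> 0})" "\<And>x. J x \<ge> 0"
  shows "\<exists>C\<ge>0. \<forall>u\<in>L2_on \<Omega>. nonlocal_diffusion d J \<Omega> u \<in> L2_on \<Omega> \<and>
      norm (nonlocal_diffusion d J \<Omega> u) \<le> C * norm u \<and>
      (L2_nonneg u \<longrightarrow> L2_nonneg (nonlocal_diffusion d J \<Omega> u + d *\<^sub>R u))"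
proof -
  have \<Omega>m: "\<Omega> \<in> sets lebesgue" using \<Omega> by auto
  have \<Omega>f: "emeasure lebesgue \<Omega> < \<infinity>"
    using emeasure_bounded_finite[OF \<Omega>(2)] \<Omega>(1) by simp
  define I where "I = (indicator \<Omega> :: 'a \<Rightarrow> real)"
  have sI: "sq_integrable I" unfolding I_def by (rule sq_integrable_indicator[OF \<Omega>m \<Omega>f])
  obtain Jm where Jm0: "Jm > 0" and Jm1: "\<And>x. x \<in> closure {x. J x \<noteq> 0} \<Longrightarrow> norm (J x) \<le> Jm"
  proof (rule compact_continuous_norm_bound[OF J(2) continuous_on_subset[OF J(1) subset_UNIV]])
    fix B assume "B > 0" and B: "\<And>x. x \<in> closure {x. J x \<noteq> 0} \<Longrightarrow> norm (J x) \<le> B"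
    show thesis by (rule that[OF \<open>B > 0\<close>]) (rule B)
  qed
  have Jm: "J x \<le> Jm" for x
  proof (cases "J x = 0")
    case False
    then have "x \<in> closure {x. J x \<noteq> 0}" using closure_subset[of "{x. J x \<noteq> 0}"] by (intro subsetD[OF closure_subset]) simp
    from Jm1[OF this] show ?thesis by simp
  qed (use Jm0 in simp)
  have Jmeas: "(\<lambda>y. J (x - y)) \<in> borel_measurable lebesgue" for x
  proof -
    have "continuous_on UNIV (\<lambda>y. J (x - y))"
      by (rule continuous_on_compose2[OF J(1)]) (auto intro!: continuous_intros)
    then have "(\<lambda>y. J (x - y)) \<in> borel_measurable borel" by (rule borel_measurable_continuous_onI)
    then show ?thesis by (intro measurable_completion) simp
  qed
  define C1 where "C1 = Jm * norm (abs_L2 I)"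
  have C1: "C1 \<ge> 0" using Jm0 by (simp add: C1_def)
  define C where "C = d * (C1 * norm (abs_L2 I) + 1)"
  have "nonlocal_diffusion d J \<Omega> u \<in> L2_on \<Omega> \<and> norm (nonlocal_diffusion d J \<Omega> u) \<le> C * norm u \<and>
      (L2_nonneg u \<longrightarrow> L2_nonneg (nonlocal_diffusion d J \<Omega> u + d *\<^sub>R u))" if u: "u \<in> L2_on \<Omega>" for u
  proof -
    let ?u = "rep_L2 u"
    have u0: "AE x in lebesgue. x \<notin> \<Omega> \<longrightarrow> ?u x = 0" using u by (simp add: L2_on_def)
    have iIu: "integrable lebesgue (\<lambda>y. I y * \<bar>?u y\<bar>)"
    proof -
      have "sq_integrable (\<lambda>y. \<bar>?u y\<bar>)"
        by (rule sq_integrable_dominated[OF sq_integrable_rep[of u]]) auto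
      then show ?thesis by (rule sq_integrable_mult[OF sI])
    qed
    have dom: "AE y in lebesgue. norm (J (x - y) * ?u y) \<le> Jm * (I y * \<bar>?u y\<bar>)" for x
      using u0
    proof eventually_elim
      case (elim y)
      have "J (x - y) * \<bar>?u y\<bar> \<le> Jm * \<bar>?u y\<bar>" by (rule mult_right_mono[OF Jm]) simp
      then show ?case using elim J(3)[of "x - y"] by (cases "y \<in> \<Omega>") (auto simp: I_def abs_mult)
    qed
    have Jum: "(\<lambda>y. J (x - y) * ?u y) \<in> borel_measurable lebesgue" for x
      by (intro borel_measurable_times Jmeas rep_L2_measurable)
    \<comment> \<open>The convolution is continuous by dominated convergence, which settles its
      measurability without a product measure.\<close>
    define g where "g x = (LINT y|lebesgue. J (x - y) * ?u y)" for x
    have gc: "continuous_on UNIV g"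
    proof (subst continuous_on_sequentially, intro allI ballI impI)
      fix xs :: "nat \<Rightarrow> 'a" and x assume "(\<forall>n. xs n \<in> UNIV) \<and> xs \<longlonglongrightarrow> x"
      then have xs: "xs \<longlonglongrightarrow> x" by simp
      have "(\<lambda>n. LINT y|lebesgue. J (xs n - y) * ?u y) \<longlonglongrightarrow> (LINT y|lebesgue. J (x - y) * ?u y)"
      proof (rule integral_dominated_convergence[where w = "\<lambda>y. Jm * (I y * \<bar>?u y\<bar>)"])
        show "integrable lebesgue (\<lambda>y. Jm * (I y * \<bar>?u y\<bar>))" using iIu by simp
        show "AE y in lebesgue. (\<lambda>n. J (xs n - y) * ?u y) \<longlonglongrightarrow> J (x - y) * ?u y"
        proof (rule AE_I2)
          fix y
          have "(\<lambda>n. xs n - y) \<longlonglongrightarrow> x - y" by (intro tendsto_intros xs)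
          then have "(\<lambda>n. J (xs n - y)) \<longlonglongrightarrow> J (x - y)"
            by (rule continuous_on_tendsto_compose[OF J(1)]) auto
          then show "(\<lambda>n. J (xs n - y) * ?u y) \<longlonglongrightarrow> J (x - y) * ?u y" by (intro tendsto_intros)
        qed
      qed (use dom Jum in auto)
      then show "(g \<circ> xs) \<longlonglongrightarrow> g x" by (simp add: g_def comp_def)
    qed
    have gm: "g \<in> borel_measurable lebesgue"
      using borel_measurable_continuous_onI[OF gc] by (intro measurable_completion) simp
    have g_bound: "\<bar>g x\<bar> \<le> C1 * norm u" for x
    proof -
      have "\<bar>g x\<bar> \<le> (LINT y|lebesgue. norm (J (x - y) * ?u y))"
        unfolding g_def real_norm_def by (rule integral_abs_bound)
      also have "\<dots> \<le> (LINT y|lebesgue. Jm * (I y * \<bar>?u y\<bar>))"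
      proof (rule integral_mono_AE[OF _ _ dom])
        show "integrable lebesgue (\<lambda>y. Jm * (I y * \<bar>?u y\<bar>))" using iIu by simp
        show "integrable lebesgue (\<lambda>y. norm (J (x - y) * ?u y))"
        proof (rule Bochner_Integration.integrable_bound[of _ "\<lambda>y. Jm * (I y * \<bar>?u y\<bar>)"])
          show "AE y in lebesgue. norm (norm (J (x - y) * ?u y)) \<le> norm (Jm * (I y * \<bar>?u y\<bar>))"
            using dom[of x] by eventually_elim (simp only: real_norm_def abs_abs order_trans[OF _ abs_ge_self])
        qed (use iIu Jum in auto)
      qed
      also have "\<dots> = Jm * (LINT y|lebesgue. I y * \<bar>?u y\<bar>)" by simp
      also have "(LINT y|lebesgue. I y * \<bar>?u y\<bar>) \<le> norm (abs_L2 I) * norm u"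
      proof -
        have sa: "sq_integrable (\<lambda>y. \<bar>?u y\<bar>)"
          by (rule sq_integrable_dominated[OF sq_integrable_rep[of u]]) auto
        have "(LINT y|lebesgue. I y * \<bar>?u y\<bar>) = inner (abs_L2 I) (abs_L2 (\<lambda>y. \<bar>?u y\<bar>))"
          using sI sa by (simp add: inner_L2.abs_eq)
        also have "\<dots> \<le> norm (abs_L2 I) * norm (abs_L2 (\<lambda>y. \<bar>?u y\<bar>))" by (rule norm_cauchy_schwarz)
        also have "norm (abs_L2 (\<lambda>y. \<bar>?u y\<bar>)) = norm u"
          using norm_abs_L2[OF sa] norm_abs_L2[OF sq_integrable_rep[of u]] by simp
        finally show ?thesis .
      qed
      finally show ?thesis using Jm0 by (simp add: C1_def mult.assoc)
    qed
    define f where "f x = I x * (d * (g x - ?u x))" for x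
    have fe: "nonlocal_diffusion d J \<Omega> u = abs_L2 f"
      by (simp add: nonlocal_diffusion_def f_def[abs_def] g_def I_def)
    have sg: "sq_integrable (\<lambda>x. I x * g x)"
    proof (rule sq_integrable_dominated[OF sq_integrable_scale[OF sI, of "C1 * norm u"]])
      show "(\<lambda>x. I x * g x) \<in> borel_measurable lebesgue" using sI gm by (auto simp: sq_integrable_def)
      show "AE x in lebesgue. \<bar>I x * g x\<bar> \<le> \<bar>C1 * norm u * I x\<bar>"
        using g_bound C1 by (intro AE_I2) (auto simp: I_def indicator_def abs_mult)
    qed
    have su: "sq_integrable (\<lambda>x. I x * ?u x)"
      unfolding I_def by (rule indicator_mult_sq_integrable[OF \<Omega>m sq_integrable_rep])
    have fsplit: "f = (\<lambda>x. d * (I x * g x) + (- d) * (I x * ?u x))" by (auto simp: f_def algebra_simps)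
    have sf: "sq_integrable f" unfolding fsplit by (intro sq_integrable_add sq_integrable_scale sg su)
    have repf: "AE x in lebesgue. rep_L2 (abs_L2 f) x = f x" by (rule rep_abs_L2[OF sf])
    have 1: "abs_L2 f \<in> L2_on \<Omega>"
      unfolding L2_on_def mem_Collect_eq using repf by eventually_elim (simp add: f_def I_def)
    have uI: "abs_L2 (\<lambda>x. I x * ?u x) = u"
      using u L2_on_iff[OF \<Omega>m, of u] by (simp add: L2_restrict_def I_def)
    have 2: "norm (abs_L2 f) \<le> C * norm u"
    proof -
      have "abs_L2 f = d *\<^sub>R abs_L2 (\<lambda>x. I x * g x) + (- d) *\<^sub>R abs_L2 (\<lambda>x. I x * ?u x)"
        unfolding fsplit abs_L2_scaleR[OF sg] abs_L2_scaleR[OF su]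
        by (rule abs_L2_add[symmetric]) (intro sq_integrable_scale sg su)+
      then have "norm (abs_L2 f) \<le> norm (d *\<^sub>R abs_L2 (\<lambda>x. I x * g x)) + norm ((- d) *\<^sub>R u)"
        unfolding uI by (simp only: norm_triangle_ineq)
      also have "\<dots> = d * norm (abs_L2 (\<lambda>x. I x * g x)) + d * norm u" using d by simp
      finally have n1: "norm (abs_L2 f) \<le> d * norm (abs_L2 (\<lambda>x. I x * g x)) + d * norm u" .
      have n2: "norm (abs_L2 (\<lambda>x. I x * g x)) \<le> C1 * norm u * norm (abs_L2 I)"
      proof -
        have "(norm (abs_L2 (\<lambda>x. I x * g x)))\<^sup>2 \<le> (C1 * norm u * norm (abs_L2 I))\<^sup>2"
        proof -
          have "(LINT x|lebesgue. (I x * g x)\<^sup>2) \<le> (LINT x|lebesgue. (C1 * norm u)\<^sup>2 * (I x)\<^sup>2)"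
          proof (rule integral_mono_AE)
            show "integrable lebesgue (\<lambda>x. (I x * g x)\<^sup>2)" using sg by (simp add: sq_integrable_def)
            show "integrable lebesgue (\<lambda>x. (C1 * norm u)\<^sup>2 * (I x)\<^sup>2)" using sI by (simp add: sq_integrable_def)
            show "AE x in lebesgue. (I x * g x)\<^sup>2 \<le> (C1 * norm u)\<^sup>2 * (I x)\<^sup>2"
            proof (rule AE_I2)
              fix x
              have "(g x)\<^sup>2 \<le> (C1 * norm u)\<^sup>2" using g_bound[of x] by (rule abs_le_square_iff[THEN iffD1, OF order_trans[OF _ abs_ge_self]])
              then show "(I x * g x)\<^sup>2 \<le> (C1 * norm u)\<^sup>2 * (I x)\<^sup>2" by (auto simp: I_def indicator_def)
            qed
          qed
          also have "\<dots> = (C1 * norm u)\<^sup>2 * (norm (abs_L2 I))\<^sup>2"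
            using sI by (simp add: norm_abs_L2 sq_integrable_def)
          finally show ?thesis
            using sg by (simp add: norm_abs_L2 sq_integrable_def power_mult_distrib)
        qed
        then show ?thesis by (rule power2_le_imp_le) (use C1 in auto)
      qed
      have "d * norm (abs_L2 (\<lambda>x. I x * g x)) \<le> d * (C1 * norm u * norm (abs_L2 I))"
        using n2 d by (rule mult_left_mono)
      with n1 show ?thesis by (simp add: C_def algebra_simps)
    qed
    have 3: "L2_nonneg (abs_L2 f + d *\<^sub>R u)" if "L2_nonneg u"
    proof -
      have un: "AE y in lebesgue. 0 \<le> ?u y" using that by (simp add: L2_nonneg_def)
      have g0: "0 \<le> g x" for x
        unfolding g_def by (rule integral_nonneg_AE) (use un J(3) in \<open>auto elim!: eventually_mono\<close>)
      show ?thesis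
        unfolding L2_nonneg_def
        using repf rep_L2_add[of "abs_L2 f" "d *\<^sub>R u"] rep_L2_scaleR[of d u] u0
      proof eventually_elim
        case (elim x)
        then have "rep_L2 (abs_L2 f + d *\<^sub>R u) x = I x * (d * (g x - ?u x)) + d * ?u x" by (simp add: f_def)
        also have "\<dots> = d * (I x * g x)" using elim by (cases "x \<in> \<Omega>") (auto simp: I_def algebra_simps)
        also have "\<dots> \<ge> 0" using d g0 by (simp add: I_def)
        finally show ?case .
      qed
    qed
    show ?thesis using 1 2 3 by (simp add: fe)
  qed
  moreover have "C \<ge> 0" using d C1 by (simp add: C_def)
  ultimately show ?thesis by blast
qed

section \<open>Semigroups generated by bounded quasi-positive operators\<close>

text \<open>A semigroup on a subspace is studied through its composition with a projection.\<close>

locale projected_semigroup =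
  fixes S :: "'e::{real_inner, banach} set" and T :: "real \<Rightarrow> 'e \<Rightarrow> 'e" and B Q :: "'e \<Rightarrow> 'e" and C :: real
  assumes semigroup: "C0_semigroup_on S T"
    and generator: "generator_graph_on S T = {(u, B u) |u. u \<in> S}"
    and S: "closed S" "subspace S"
    and Q_lin: "bounded_linear Q" and Q_in: "\<And>u. Q u \<in> S" and Q_eq: "\<And>u. u \<in> S \<Longrightarrow> Q u = u"
    and B_bound: "\<And>u. u \<in> S \<Longrightarrow> norm (B u) \<le> C * norm u" and C0: "C \<ge> 0"
    and Q_norm: "\<And>u. norm (Q u) \<le> norm u"
begin

definition TQ :: "real \<Rightarrow> 'e \<Rightarrow> 'e" where "TQ t u = T t (Q u)"

lemma T_eq_TQ: "u \<in> S \<Longrightarrow> T t u = TQ t u" by (simp add: TQ_def Q_eq)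

lemma TQ_0: "TQ 0 u = Q u"
  using semigroup Q_in[of u] by (simp add: TQ_def C0_semigroup_on_def)

lemma TQ_in: "t \<ge> 0 \<Longrightarrow> TQ t u \<in> S"
  using semigroup Q_in[of u] by (auto simp: TQ_def C0_semigroup_on_def)

lemma B_in: "u \<in> S \<Longrightarrow> B u \<in> S"
proof -
  assume "u \<in> S"
  then have "(u, B u) \<in> generator_graph_on S T" unfolding generator by blast
  then show ?thesis by (simp add: generator_graph_on_def)
qed

lemma B_limit: "u \<in> S \<Longrightarrow> ((\<lambda>h. (TQ h u - u) /\<^sub>R h) \<longlongrightarrow> B u) (at_right 0)"
proof -
  assume u: "u \<in> S"
  then have "(u, B u) \<in> generator_graph_on S T" unfolding generator by blast
  then show ?thesis using u by (simp add: generator_graph_on_def T_eq_TQ)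
qed

lemma B_unique: "u \<in> S \<Longrightarrow> v \<in> S \<Longrightarrow> ((\<lambda>h. (TQ h u - u) /\<^sub>R h) \<longlongrightarrow> v) (at_right 0) \<Longrightarrow> B u = v"
  by (rule tendsto_unique[OF _ B_limit]) auto

lemma TQ_linear: assumes "t \<ge> 0" shows "linear (TQ t)"
proof -
  have l: "linear_map_on S (T t)" using semigroup assms by (auto simp: C0_semigroup_on_def)
  interpret Q: bounded_linear Q by (rule Q_lin)
  show ?thesis
    using l Q_in by (intro linearI) (simp_all add: TQ_def Q.add Q.scaleR linear_map_on_def)
qed

lemma TQ_bounded_linear: assumes "t \<ge> 0" shows "bounded_linear (TQ t)"
proof -
  have "\<exists>K. \<forall>x\<in>S. norm (T t x) \<le> K * norm x"
    using semigroup assms by (simp add: C0_semigroup_on_def)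
  then obtain K0 where K0: "\<And>x. x \<in> S \<Longrightarrow> norm (T t x) \<le> K0 * norm x" by blast
  have "norm (TQ t x) \<le> norm x * max K0 0" for x
  proof -
    have "norm (TQ t x) \<le> K0 * norm (Q x)" unfolding TQ_def by (rule K0[OF Q_in])
    also have "\<dots> \<le> max K0 0 * norm (Q x)" by (rule mult_right_mono) auto
    also have "\<dots> \<le> max K0 0 * norm x" by (rule mult_left_mono[OF Q_norm]) auto
    finally show ?thesis by (simp add: mult.commute)
  qed
  then show ?thesis
    using TQ_linear[OF assms] by (auto simp: bounded_linear_def bounded_linear_axioms_def)
qed

lemma TQ_Q: "TQ t (Q u) = TQ t u" by (simp add: TQ_def Q_eq Q_in)

lemma TQ_add: "s \<ge> 0 \<Longrightarrow> t \<ge> 0 \<Longrightarrow> TQ (s + t) u = TQ s (TQ t u)"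
  using semigroup Q_in[of u] TQ_in[of t u] unfolding TQ_def by (simp add: C0_semigroup_on_def Q_eq)

lemma TQ_right: "((\<lambda>h. TQ h u) \<longlongrightarrow> Q u) (at_right 0)"
  using semigroup Q_in[of u] unfolding TQ_def by (simp add: C0_semigroup_on_def)

lemma TQ_near_0: "e > 0 \<Longrightarrow> \<exists>\<delta>>0. \<forall>h. 0 \<le> h \<and> h < \<delta> \<longrightarrow> norm (TQ h u - Q u) < e"
proof -
  assume e: "e > 0"
  have "\<forall>\<^sub>F h in at_right 0. dist (TQ h u) (Q u) < e" using TQ_right e by (rule tendstoD)
  then obtain b where b: "b > 0" "\<And>h. 0 < h \<Longrightarrow> h < b \<Longrightarrow> dist (TQ h u) (Q u) < e"
    unfolding eventually_at_right_field by auto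
  have "norm (TQ h u - Q u) < e" if "0 \<le> h" "h < b" for h
    using b(2)[of h] that e by (cases "h = 0") (auto simp: dist_norm TQ_0)
  then show ?thesis using b(1) by blast
qed

text \<open>Without a bound near 0 there would be times tending to 0 along which the operator norms
  are unbounded, although strong continuity makes every orbit converge along them; uniform
  boundedness excludes this.\<close>

lemma TQ_bounded_near_0: "\<exists>\<delta>>0. \<exists>K\<ge>1. \<forall>t u. 0 \<le> t \<and> t \<le> \<delta> \<longrightarrow> norm (TQ t u) \<le> K * norm u"
proof (rule ccontr)
  assume n: "\<not> ?thesis"
  have "\<exists>t u. 0 \<le> t \<and> t \<le> inverse (real (Suc i)) \<and> real (Suc i) * norm u < norm (TQ t u)" for i
  proof (rule ccontr)
    assume "\<not> ?thesis"
    then have "\<forall>t u. 0 \<le> t \<and> t \<le> inverse (real (Suc i)) \<longrightarrow> norm (TQ t u) \<le> real (Suc i) * norm u"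
      by (meson not_le)
    moreover have "inverse (real (Suc i)) > 0" "real (Suc i) \<ge> 1" by simp_all
    ultimately show False using n by blast
  qed
  then obtain t u where t: "\<And>i. 0 \<le> t i" "\<And>i. t i \<le> inverse (real (Suc i))"
    and big: "\<And>i. real (Suc i) * norm (u i) < norm (TQ (t i) (u i))" by metis
  have "\<exists>K. \<forall>i. \<forall>x\<in>UNIV. norm (TQ (t i) x) \<le> K * norm x"
  proof (rule uniform_boundedness_on)
    show "linear_map_on UNIV (TQ (t i))" for i
      using TQ_linear[OF t(1)] by (simp add: linear_map_on_def linear_add linear_scale)
    show "\<exists>K. \<forall>x\<in>UNIV. norm (TQ (t i) x) \<le> K * norm x" for i
      using bounded_linear.bounded[OF TQ_bounded_linear[OF t(1)]] by (metis mult.commute)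
    show "\<exists>K. \<forall>i. norm (TQ (t i) x) \<le> K" for x
    proof -
      have t0: "t \<longlonglongrightarrow> 0"
        by (rule tendsto_sandwich[OF _ _ tendsto_const LIMSEQ_inverse_real_of_nat]) (use t in auto)
      have "(\<lambda>i. TQ (t i) x) \<longlonglongrightarrow> Q x"
      proof (rule LIMSEQ_I)
        fix e :: real assume "e > 0"
        then obtain \<delta> where \<delta>: "\<delta> > 0" "\<forall>h. 0 \<le> h \<and> h < \<delta> \<longrightarrow> norm (TQ h x - Q x) < e" using TQ_near_0 by blast
        from LIMSEQ_D[OF t0 \<delta>(1)] obtain N where "\<forall>n\<ge>N. norm (t n - 0) < \<delta>" by blast
        then have "\<forall>n\<ge>N. norm (TQ (t n) x - Q x) < e" using \<delta>(2) t(1) by simp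
        then show "\<exists>no. \<forall>n\<ge>no. norm (TQ (t n) x - Q x) < e" by blast
      qed
      then have "Bseq (\<lambda>i. TQ (t i) x)" by (intro convergent_imp_Bseq convergentI)
      then show ?thesis unfolding Bseq_def by blast
    qed
  qed auto
  then obtain K where K: "\<And>i x. norm (TQ (t i) x) \<le> K * norm x" by auto
  obtain i :: nat where i: "K < real i" using reals_Archimedean2 by blast
  have "K * norm (u i) \<le> real (Suc i) * norm (u i)" using i by (intro mult_right_mono) auto
  with K[of i "u i"] big[of i] show False by linarith
qed

lemma TQ_locally_bounded: "\<exists>K\<ge>1. \<forall>t u. 0 \<le> t \<and> t \<le> b \<longrightarrow> norm (TQ t u) \<le> K * norm u"
proof -
  obtain \<delta> K where \<delta>: "\<delta> > 0" and K: "K \<ge> 1" "\<And>t u. 0 \<le> t \<Longrightarrow> t \<le> \<delta> \<Longrightarrow> norm (TQ t u) \<le> K * norm u"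
    using TQ_bounded_near_0 by blast
  have *: "norm (TQ t u) \<le> K ^ Suc n * norm u" if "0 \<le> t" "t \<le> real (Suc n) * \<delta>" for t u n
    using that
  proof (induction n arbitrary: t)
    case 0
    then show ?case using K(2)[of t u] by simp
  next
    case (Suc n)
    show ?case
    proof (cases "t \<le> \<delta>")
      case True
      have "norm (TQ t u) \<le> K * norm u" using K(2) Suc.prems True by blast
      also have "\<dots> \<le> K ^ Suc (Suc n) * norm u"
        using K(1) by (intro mult_right_mono) (simp_all add: self_le_power flip: power_Suc)
      finally show ?thesis .
    next
      case False
      have "TQ t u = TQ \<delta> (TQ (t - \<delta>) u)" using TQ_add[of \<delta> "t - \<delta>" u] \<delta> False by simp
      then have "norm (TQ t u) \<le> K * norm (TQ (t - \<delta>) u)" using K(2)[of \<delta> "TQ (t - \<delta>) u"] \<delta> by simp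
      also have "norm (TQ (t - \<delta>) u) \<le> K ^ Suc n * norm u"
        using Suc.prems False by (intro Suc.IH) (auto simp: algebra_simps)
      finally show ?thesis using K(1) by (simp add: mult.assoc)
    qed
  qed
  obtain n :: nat where n: "b / \<delta> < real n" using reals_Archimedean2 by blast
  then have "b \<le> real (Suc n) * \<delta>" using \<delta> by (simp add: divide_less_eq distrib_right)
  then have "\<forall>t u. 0 \<le> t \<and> t \<le> b \<longrightarrow> norm (TQ t u) \<le> K ^ Suc n * norm u" using * by force
  moreover have "K ^ Suc n \<ge> 1" using K(1) by (rule one_le_power)
  ultimately show ?thesis by blast
qed

text \<open>Both one-sided limits follow from the identity \<open>TQ t u - TQ s u = TQ s (TQ (t - s) u - Q u)\<close>
  for \<open>s \<le> t\<close> and the local bound.\<close>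

lemma TQ_diff_eq: "0 \<le> s \<Longrightarrow> s \<le> t \<Longrightarrow> TQ t u - TQ s u = TQ s (TQ (t - s) u - Q u)"
  using TQ_add[of s "t - s" u] by (simp add: linear_diff[OF TQ_linear] TQ_Q)

lemma TQ_continuous: "continuous_on {0..} (\<lambda>t. TQ t u)"
  unfolding continuous_on_iff
proof (intro ballI allI impI)
  fix t e :: real assume t: "t \<in> {0..}" and e: "e > 0"
  obtain K where K: "K \<ge> 1" "\<And>r x. 0 \<le> r \<Longrightarrow> r \<le> t + 1 \<Longrightarrow> norm (TQ r x) \<le> K * norm x"
    using TQ_locally_bounded[of "t + 1"] by blast
  obtain \<delta> where \<delta>: "\<delta> > 0" "\<forall>h. 0 \<le> h \<and> h < \<delta> \<longrightarrow> norm (TQ h u - Q u) < e / K"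
    using TQ_near_0[of "e / K" u] e K(1) by auto
  have *: "norm (TQ b u - TQ a u) < e" if "0 \<le> a" "a \<le> b" "a \<le> t + 1" "b - a < \<delta>" for a b
  proof -
    have "norm (TQ b u - TQ a u) \<le> K * norm (TQ (b - a) u - Q u)"
      unfolding TQ_diff_eq[OF that(1,2)] using that by (intro K) auto
    also have "\<dots> < K * (e / K)" using \<delta>(2) that K(1) by (intro mult_strict_left_mono) auto
    finally show ?thesis using K(1) by simp
  qed
  show "\<exists>\<delta>>0. \<forall>x'\<in>{0..}. dist x' t < \<delta> \<longrightarrow> dist (TQ x' u) (TQ t u) < e"
  proof (intro exI conjI ballI impI)
    show "min \<delta> 1 > 0" using \<delta>(1) by simp
    fix s :: real assume s: "s \<in> {0..}" "dist s t < min \<delta> 1"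
    show "dist (TQ s u) (TQ t u) < e"
      using *[of s t] *[of t s] s t by (cases "s \<le> t") (auto simp: dist_norm norm_minus_commute)
  qed
qed

text \<open>The generator is given by right limits at 0 only. Writing a difference quotient as
  \<open>TQ a\<close> applied to a quotient at 0, with \<open>a\<close> the smaller of the two
  times, treats left and right derivatives at once; the local bound and the continuity of
  \<open>TQ a (B u)\<close> in \<open>a\<close> give the limit.\<close>

lemma TQ_derivative:
  assumes u: "u \<in> S" and t: "t \<ge> 0"
  shows "((\<lambda>t. TQ t u) has_vector_derivative TQ t (B u)) (at t within {0..})"
proof -
  have BuS: "B u \<in> S" using B_in[OF u] .
  obtain K where K: "K \<ge> 1" "\<And>r x. 0 \<le> r \<Longrightarrow> r \<le> t + 1 \<Longrightarrow> norm (TQ r x) \<le> K * norm x"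
    using TQ_locally_bounded[of "t + 1"] by blast
  have lim: "((\<lambda>s. (1 / (s - t)) *\<^sub>R (TQ s u - TQ t u)) \<longlongrightarrow> TQ t (B u)) (at t within {0..})"
    unfolding Lim_within
  proof (intro allI impI)
    fix e :: real assume e: "e > 0"
    define e' where "e' = e / (2 * K)"
    have e': "e' > 0" using e K(1) by (simp add: e'_def)
    have "\<forall>\<^sub>F h in at_right 0. dist ((TQ h u - u) /\<^sub>R h) (B u) < e'"
      using B_limit[OF u] e' by (rule tendstoD)
    then obtain \<delta>1 where \<delta>1: "\<delta>1 > 0" "\<And>h. 0 < h \<Longrightarrow> h < \<delta>1 \<Longrightarrow> norm ((TQ h u - u) /\<^sub>R h - B u) < e'"
      unfolding eventually_at_right_field dist_norm by auto
    obtain \<delta>2 where \<delta>2: "\<delta>2 > 0" "\<forall>s\<in>{0..}. dist s t < \<delta>2 \<longrightarrow> dist (TQ s (B u)) (TQ t (B u)) < e / 2"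
      using TQ_continuous[of "B u", unfolded continuous_on_iff, rule_format, of t "e / 2"] t e by auto
    show "\<exists>\<delta>>0. \<forall>s\<in>{0..}. 0 < dist s t \<and> dist s t < \<delta> \<longrightarrow>
        dist ((1 / (s - t)) *\<^sub>R (TQ s u - TQ t u)) (TQ t (B u)) < e"
    proof (intro exI conjI ballI impI)
      show "min 1 (min \<delta>1 \<delta>2) > 0" using \<delta>1 \<delta>2 by simp
      fix s assume s: "s \<in> {0..}" "0 < dist s t \<and> dist s t < min 1 (min \<delta>1 \<delta>2)"
      define a b where "a = min s t" and "b = max s t"
      have ab: "0 \<le> a" "a < b" "a \<le> t + 1" "b - a < \<delta>1" "dist a t < \<delta>2" and bs: "b - a = \<bar>s - t\<bar>"
        using s t \<delta>2(1) by (auto simp: a_def b_def dist_real_def min_def max_def split: if_splits)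
      have q: "(1 / (s - t)) *\<^sub>R (TQ s u - TQ t u) = (TQ b u - TQ a u) /\<^sub>R (b - a)"
      proof (cases "s \<le> t")
        case True
        have "(1 / (s - t)) *\<^sub>R (TQ s u - TQ t u) = (1 / (- (s - t))) *\<^sub>R (- (TQ s u - TQ t u))"
          by (simp only: scaleR_minus_right divide_minus_right scaleR_minus_left minus_minus)
        then show ?thesis using True by (simp add: a_def b_def min_def max_def inverse_eq_divide)
      qed (simp add: a_def b_def min_def max_def inverse_eq_divide)
      have "(TQ b u - TQ a u) /\<^sub>R (b - a) = TQ a ((TQ (b - a) u - u) /\<^sub>R (b - a))"
        using TQ_diff_eq[of a b u] ab by (simp add: linear_scale[OF TQ_linear] Q_eq[OF u])
      then have "(TQ b u - TQ a u) /\<^sub>R (b - a) - TQ a (B u) = TQ a ((TQ (b - a) u - u) /\<^sub>R (b - a) - B u)"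
        using ab by (simp add: linear_diff[OF TQ_linear])
      then have "norm ((TQ b u - TQ a u) /\<^sub>R (b - a) - TQ a (B u)) \<le> K * norm ((TQ (b - a) u - u) /\<^sub>R (b - a) - B u)"
        using K(2)[of a "(TQ (b - a) u - u) /\<^sub>R (b - a) - B u"] ab by simp
      also have "\<dots> < K * e'" using \<delta>1(2)[of "b - a"] ab K(1) by (intro mult_strict_left_mono) auto
      finally have 1: "dist ((TQ b u - TQ a u) /\<^sub>R (b - a)) (TQ a (B u)) < e / 2"
        using K(1) by (simp add: dist_norm e'_def)
      have 2: "dist (TQ a (B u)) (TQ t (B u)) < e / 2" using \<delta>2(2) ab by simp
      show "dist ((1 / (s - t)) *\<^sub>R (TQ s u - TQ t u)) (TQ t (B u)) < e"
        unfolding q using dist_triangle_half_l[OF 1, of "TQ t (B u)"] 2 by (simp add: dist_commute)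
    qed
  qed
  have "((\<lambda>s. norm ((TQ s u - TQ t u) - (s - t) *\<^sub>R TQ t (B u)) / norm (s - t)) \<longlongrightarrow> 0) (at t within {0..})"
  proof (rule Lim_transform_eventually)
    show "((\<lambda>s. norm ((1 / (s - t)) *\<^sub>R (TQ s u - TQ t u) - TQ t (B u))) \<longlongrightarrow> 0) (at t within {0..})"
      using tendsto_norm[OF LIM_zero[OF lim]] by simp
    have e: "norm ((1 / (s - t)) *\<^sub>R x - y) = norm (x - (s - t) *\<^sub>R y) / norm (s - t)" if "s \<noteq> t" for s and x y :: 'e
    proof -
      have "(1 / (s - t)) *\<^sub>R (x - (s - t) *\<^sub>R y) = (1 / (s - t)) *\<^sub>R x - y"
        using that by (simp add: scaleR_diff_right)
      then have "norm ((1 / (s - t)) *\<^sub>R x - y) = \<bar>1 / (s - t)\<bar> * norm (x - (s - t) *\<^sub>R y)"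
        by (metis norm_scaleR)
      then show ?thesis by (simp add: divide_inverse)
    qed
    show "\<forall>\<^sub>F s in at t within {0..}. norm ((1 / (s - t)) *\<^sub>R (TQ s u - TQ t u) - TQ t (B u)) =
        norm ((TQ s u - TQ t u) - (s - t) *\<^sub>R TQ t (B u)) / norm (s - t)"
      by (rule eventually_at_filter[THEN iffD2, OF always_eventually]) (auto simp: e)
  qed
  then show ?thesis
    unfolding has_vector_derivative_def has_derivative_iff_norm by (simp add: bounded_linear_scaleR_left)
qed

lemma TQ_B: assumes u: "u \<in> S" and t: "t \<ge> 0" shows "TQ t (B u) = B (TQ t u)"
proof (rule B_unique[symmetric])
  show "TQ t u \<in> S" "TQ t (B u) \<in> S" by (rule TQ_in[OF t])+
  have "((\<lambda>h. TQ t ((TQ h u - u) /\<^sub>R h)) \<longlongrightarrow> TQ t (B u)) (at_right 0)"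
    by (rule bounded_linear.tendsto[OF TQ_bounded_linear[OF t] B_limit[OF u]])
  moreover have "\<forall>\<^sub>F h in at_right 0. TQ t ((TQ h u - u) /\<^sub>R h) = (TQ h (TQ t u) - TQ t u) /\<^sub>R h"
    unfolding eventually_at_right_field
  proof (intro exI[of _ 1] conjI allI impI)
    fix h :: real assume "0 < h" "h < 1"
    then show "TQ t ((TQ h u - u) /\<^sub>R h) = (TQ h (TQ t u) - TQ t u) /\<^sub>R h"
      using t TQ_add[of t h u] TQ_add[of h t u] TQ_linear[OF t]
      by (simp add: linear_scale linear_diff add.commute)
  qed simp
  ultimately show "((\<lambda>h. (TQ h (TQ t u) - TQ t u) /\<^sub>R h) \<longlongrightarrow> TQ t (B u)) (at_right 0)"
    by (rule Lim_transform_eventually)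
qed

text \<open>\<open>B\<close> is known only through the graph of the generator, so its linearity is
  read off from the uniqueness of the defining limits.\<close>

lemma BQ_bounded_linear: "bounded_linear (\<lambda>u. B (Q u))"
proof (rule bounded_linear_intro)
  interpret Q: bounded_linear Q by (rule Q_lin)
  fix u v :: 'e and c :: real
  have lin: "linear (TQ h)" if "0 < h" for h using TQ_linear that by simp
  show "B (Q (u + v)) = B (Q u) + B (Q v)"
  proof (rule B_unique)
    show "Q (u + v) \<in> S" "B (Q u) + B (Q v) \<in> S" by (simp_all add: Q_in B_in S subspace_add)
    have "((\<lambda>h. (TQ h (Q u) - Q u) /\<^sub>R h + (TQ h (Q v) - Q v) /\<^sub>R h) \<longlongrightarrow> B (Q u) + B (Q v)) (at_right 0)"
      by (intro tendsto_add B_limit Q_in)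
    moreover have "\<forall>\<^sub>F h in at_right 0. (TQ h (Q u) - Q u) /\<^sub>R h + (TQ h (Q v) - Q v) /\<^sub>R h
        = (TQ h (Q (u + v)) - Q (u + v)) /\<^sub>R h"
      using eventually_at_right_less[of 0]
      by eventually_elim (simp add: Q.add linear_add[OF lin] algebra_simps)
    ultimately show "((\<lambda>h. (TQ h (Q (u + v)) - Q (u + v)) /\<^sub>R h) \<longlongrightarrow> B (Q u) + B (Q v)) (at_right 0)"
      by (rule Lim_transform_eventually)
  qed
  show "B (Q (c *\<^sub>R u)) = c *\<^sub>R B (Q u)"
  proof (rule B_unique)
    show "Q (c *\<^sub>R u) \<in> S" "c *\<^sub>R B (Q u) \<in> S" by (simp_all add: Q_in B_in S subspace_scale)
    have "((\<lambda>h. c *\<^sub>R ((TQ h (Q u) - Q u) /\<^sub>R h)) \<longlongrightarrow> c *\<^sub>R B (Q u)) (at_right 0)"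
      by (intro tendsto_scaleR tendsto_const B_limit Q_in)
    moreover have "\<forall>\<^sub>F h in at_right 0. c *\<^sub>R ((TQ h (Q u) - Q u) /\<^sub>R h)
        = (TQ h (Q (c *\<^sub>R u)) - Q (c *\<^sub>R u)) /\<^sub>R h"
      using eventually_at_right_less[of 0]
      by eventually_elim (simp add: Q.scaleR linear_scale[OF lin] algebra_simps)
    ultimately show "((\<lambda>h. (TQ h (Q (c *\<^sub>R u)) - Q (c *\<^sub>R u)) /\<^sub>R h) \<longlongrightarrow> c *\<^sub>R B (Q u)) (at_right 0)"
      by (rule Lim_transform_eventually)
  qed
  have "norm (B (Q u)) \<le> C * norm (Q u)" by (rule B_bound[OF Q_in])
  also have "\<dots> \<le> C * norm u" by (rule mult_left_mono[OF Q_norm C0])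
  finally show "norm (B (Q u)) \<le> norm u * C" by (simp add: mult.commute)
qed

lemma TQ_ode:
  assumes "t \<ge> 0" shows "((\<lambda>t. TQ t u) has_vector_derivative B (TQ t u)) (at t within {0..})"
  using TQ_derivative[OF Q_in assms, of u] TQ_B[OF Q_in assms, of u] by (simp add: TQ_Q)

text \<open>The squared norm has derivative at most \<open>2 * C\<close> times itself. This gives an
  exponential bound with constant 1, the form of \<open>T_norm\<close> in \<open>renewal\<close>,
  which local boundedness alone would not provide.\<close>

lemma TQ_norm:
  assumes t: "t \<ge> 0" shows "norm (TQ t u) \<le> exp (C * t) * norm u"
proof (cases "t = 0")
  case True
  then show ?thesis using Q_norm[of u] by (simp add: TQ_0)
next
  case False
  define f where "f r = exp (- 2 * C * r) * inner (TQ r u) (TQ r u)" for r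
  have "f t \<le> f 0"
  proof (rule DERIV_nonpos_imp_decreasing_open[of 0 t f])
    show "0 \<le> t" by fact
    show "continuous_on {0..t} f"
      unfolding f_def by (intro continuous_intros continuous_on_subset[OF TQ_continuous]) auto
    fix r assume r: "0 < r" "r < t"
    have "at r within {0..} = at r" using r by (intro at_within_interior) (simp add: interior_real_atLeast)
    then have d: "((\<lambda>t. TQ t u) has_vector_derivative B (TQ r u)) (at r)"
      using TQ_ode[of r u] r by simp
    have "((\<lambda>r. inner (TQ r u) (TQ r u)) has_vector_derivative inner (TQ r u) (B (TQ r u)) + inner (B (TQ r u)) (TQ r u)) (at r)"
      by (rule bounded_bilinear.has_vector_derivative[OF bounded_bilinear_inner d d])
    then have "((\<lambda>r. inner (TQ r u) (TQ r u)) has_real_derivative 2 * inner (TQ r u) (B (TQ r u))) (at r)"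
      by (simp add: has_real_derivative_iff_has_vector_derivative inner_commute)
    then have "(f has_real_derivative exp (- 2 * C * r) * (2 * inner (TQ r u) (B (TQ r u)) - 2 * C * inner (TQ r u) (TQ r u))) (at r)"
      unfolding f_def by (auto intro!: derivative_eq_intros simp: algebra_simps)
    moreover have "inner (TQ r u) (B (TQ r u)) \<le> C * inner (TQ r u) (TQ r u)"
    proof -
      have "inner (TQ r u) (B (TQ r u)) \<le> norm (TQ r u) * norm (B (TQ r u))" by (rule norm_cauchy_schwarz)
      also have "\<dots> \<le> norm (TQ r u) * (C * norm (TQ r u))"
        using r by (intro mult_left_mono B_bound TQ_in) auto
      finally show ?thesis by (simp add: dot_square_norm power2_eq_square mult.left_commute)
    qed
    ultimately show "\<exists>y. DERIV f r :> y \<and> y \<le> 0"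
      by (intro exI conjI) (auto intro!: mult_nonneg_nonpos)
  qed
  then have "exp (- 2 * C * t) * (norm (TQ t u))\<^sup>2 \<le> (norm (Q u))\<^sup>2"
    by (simp add: f_def TQ_0 power2_norm_eq_inner)
  also have "\<dots> \<le> (norm u)\<^sup>2" by (rule power_mono[OF Q_norm]) simp
  finally have *: "exp (- 2 * C * t) * (norm (TQ t u))\<^sup>2 \<le> (norm u)\<^sup>2" .
  have "(norm (TQ t u))\<^sup>2 = exp (2 * C * t) * (exp (- 2 * C * t) * (norm (TQ t u))\<^sup>2)"
    by (simp add: mult.assoc[symmetric] mult_exp_exp)
  also have "\<dots> \<le> exp (2 * C * t) * (norm u)\<^sup>2" using * by (rule mult_left_mono) simp
  also have "exp (2 * C * t) = (exp (C * t))\<^sup>2" by (simp add: power2_eq_square mult_exp_exp)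
  finally have "(norm (TQ t u))\<^sup>2 \<le> (exp (C * t) * norm u)\<^sup>2" by (simp add: power_mult_distrib)
  then show ?thesis by (rule power2_le_imp_le) simp
qed

end

locale positive_projected_semigroup = projected_semigroup S T B Q C + self_dual_cone nn pp
  for S :: "'e::{real_inner, banach, second_countable_topology} set" and T B Q C and nn :: "'e \<Rightarrow> bool" and pp +
  fixes d :: real
  assumes d0: "d \<ge> 0"
    and B_nn: "\<And>u. u \<in> S \<Longrightarrow> nn u \<Longrightarrow> nn (B u + d *\<^sub>R u)"
    and Q_nn: "\<And>u. nn u \<Longrightarrow> nn (Q u)"
    and pp_in: "\<And>u. u \<in> S \<Longrightarrow> pp u \<in> S"
begin

lemma nn_has_integral:
  assumes "(f has_integral I) {a..b}" "\<And>r. r \<in> {a..b} \<Longrightarrow> nn (f r)" shows "nn I"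
proof (subst self_dual, intro allI impI)
  fix z assume "nn z"
  have "((\<lambda>r. inner (f r) z) has_integral inner I z) {a..b}"
    using has_integral_linear[OF assms(1) bounded_linear_inner_left] by (simp add: comp_def)
  then show "0 \<le> inner I z"
    by (rule has_integral_nonneg) (use assms(2) \<open>nn z\<close> nn_inner in auto)
qed

text \<open>Quasi-monotonicity: \<open>y t = exp (d t) TQ t u\<close> solves \<open>y' = G y\<close> with \<open>G = B + d I\<close> positive, and the
  negative part of \<open>y\<close> satisfies a Gronwall inequality.\<close>

lemma exp_TQ_nn:
  assumes u: "nn u" and t: "t \<ge> 0"
  shows "nn (exp (d * t) *\<^sub>R TQ t u)" "nn (exp (d * t) *\<^sub>R TQ t u - Q u)"
proof -
  define G where "G v = B (Q v) + d *\<^sub>R Q v" for v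
  have Gl: "bounded_linear G"
    unfolding G_def by (intro bounded_linear_add BQ_bounded_linear bounded_linear_const_scaleR Q_lin)
  have G_nn: "nn (G v)" if "nn v" for v using B_nn[OF Q_in Q_nn[OF that]] by (simp add: G_def)
  \<comment> \<open>The summand 1 makes the Gronwall constant strictly positive.\<close>
  define c where "c = C + d + 1"
  have c: "c > 0" using C0 d0 by (simp add: c_def)
  have G_norm: "norm (G v) \<le> c * norm v" for v
  proof -
    have "norm (G v) \<le> C * norm (Q v) + d * norm (Q v)"
      unfolding G_def using norm_triangle_ineq[of "B (Q v)" "d *\<^sub>R Q v"] B_bound[OF Q_in, of v] d0 by simp
    also have "\<dots> \<le> c * norm (Q v)" by (simp add: c_def algebra_simps)
    also have "\<dots> \<le> c * norm v" using c by (intro mult_left_mono Q_norm) simp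
    finally show ?thesis .
  qed
  define y where "y r = exp (d * r) *\<^sub>R TQ r u" for r
  have y': "(y has_vector_derivative G (y r)) (at r within {0..})" if "r \<ge> 0" for r
  proof -
    have "Q (y r) = y r" unfolding y_def using that by (intro Q_eq subspace_scale S TQ_in)
    moreover have "B (exp (d * r) *\<^sub>R TQ r u) = exp (d * r) *\<^sub>R B (TQ r u)"
      using linear_scale[OF bounded_linear.linear[OF BQ_bounded_linear], of "exp (d * r)" "TQ r u"]
        Q_eq[OF TQ_in[OF that, of u]] Q_eq[OF subspace_scale[OF S(2) TQ_in[OF that, of u], of "exp (d * r)"]] by simp
    ultimately have e: "G (y r) = exp (d * r) *\<^sub>R B (TQ r u) + (d * exp (d * r)) *\<^sub>R TQ r u"
      by (simp add: G_def y_def)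
    have "((\<lambda>r. exp (d * r)) has_real_derivative d * exp (d * r)) (at r within {0..})"
      by (auto intro!: derivative_eq_intros)
    then show ?thesis unfolding y_def[abs_def] e[unfolded y_def]
      by (rule has_vector_derivative_scaleR[OF _ TQ_ode[OF that]])
  qed
  have yc: "continuous_on {0..} y"
    unfolding y_def by (intro continuous_intros TQ_continuous)
  have yi: "((\<lambda>r. G (y r)) has_integral (y s - Q u)) {0..s}" if "s \<ge> 0" for s
  proof -
    have "((\<lambda>r. G (y r)) has_integral (y s - y 0)) {0..s}"
      by (rule fundamental_theorem_of_calculus[OF that])
         (auto intro: has_vector_derivative_within_subset[OF y'])
    then show ?thesis by (simp add: y_def TQ_0)
  qed
  have cG: "continuous_on X (\<lambda>r. G (f r))" if "continuous_on X f" for X and f :: "real \<Rightarrow> 'e"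
    by (rule bounded_linear.continuous_on[OF Gl that])
  define n where "n r = pp (- y r)" for r
  have nc: "continuous_on {0..} n" unfolding n_def by (intro continuous_intros yc)
  have pc: "continuous_on {0..} (\<lambda>r. pp (y r))" by (intro continuous_intros yc)
  \<comment> \<open>As \<open>y = pp y - n\<close> and \<open>G\<close> preserves the cone, the
    integral equation shows that \<open>- y s\<close> lies below the integral of
    \<open>G (n r)\<close>; minimality of the positive part turns this into a norm bound.\<close>
  have nb: "norm (n s) \<le> 0 + c * integral {0..s} (\<lambda>r. norm (n r))" if "s \<ge> 0" for s
  proof -
    have ni: "(\<lambda>r. G (n r)) integrable_on {0..s}" "(\<lambda>r. norm (n r)) integrable_on {0..s}"
      by (auto intro!: integrable_continuous_interval cG continuous_intros continuous_on_subset[OF nc])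
    have pi: "((\<lambda>r. G (pp (y r))) has_integral (y s - Q u + integral {0..s} (\<lambda>r. G (n r)))) {0..s}"
    proof -
      have "((\<lambda>r. G (y r) + G (n r)) has_integral (y s - Q u + integral {0..s} (\<lambda>r. G (n r)))) {0..s}"
        by (intro has_integral_add yi that integrable_integral ni)
      moreover have "G (y r) + G (n r) = G (pp (y r))" for r
        using linear_add[OF bounded_linear.linear[OF Gl], of "y r" "n r"] pp_split[of "y r"]
        by (simp add: n_def) (metis diff_add_cancel)
      ultimately show ?thesis by simp
    qed
    have "nn (Q u + (y s - Q u + integral {0..s} (\<lambda>r. G (n r))))"
      by (intro nn_add Q_nn u nn_has_integral[OF pi] G_nn pp_nn)
    moreover have "Q u + (y s - Q u + integral {0..s} (\<lambda>r. G (n r))) = integral {0..s} (\<lambda>r. G (n r)) - (- y s)"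
      by simp
    ultimately have le: "- y s \<preceq> integral {0..s} (\<lambda>r. G (n r))" by simp
    have "nn (integral {0..s} (\<lambda>r. G (n r)))"
      by (rule nn_has_integral[OF integrable_integral[OF ni(1)]]) (simp add: n_def G_nn pp_nn)
    then have "norm (n s) \<le> norm (integral {0..s} (\<lambda>r. G (n r)))"
      unfolding n_def[of s] by (rule nn_pp_minimal[OF _ le])
    also have "\<dots> \<le> integral {0..s} (\<lambda>r. c * norm (n r))"
      by (rule integral_norm_bound_integral) (use ni G_norm in \<open>auto intro: integrable_on_mult_right\<close>)
    finally show ?thesis by simp
  qed
  have n0: "n s = 0" if "s \<ge> 0" for s
  proof -
    have "norm (n s) \<le> 2 * 0 * exp (2 * c * (s - 0))"
      by (rule gronwall_bound[of 0 s "\<lambda>r. norm (n r)"])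
         (use that c nb in \<open>auto intro!: continuous_intros continuous_on_subset[OF nc]\<close>)
    then show ?thesis by simp
  qed
  have y_nn: "nn (y s)" if "s \<ge> 0" for s using n0[OF that] nn_iff_pp by (simp add: n_def)
  show "nn (exp (d * t) *\<^sub>R TQ t u)" using y_nn[OF t] by (simp add: y_def)
  \<comment> \<open>Once \<open>y\<close> is nonnegative, so is its increment, which is the integral
    of \<open>G (y r)\<close>.\<close>
  show "nn (exp (d * t) *\<^sub>R TQ t u - Q u)"
    using nn_has_integral[OF yi[OF t]] y_nn G_nn by (simp add: y_def)
qed

lemma TQ_nn: "nn u \<Longrightarrow> t \<ge> 0 \<Longrightarrow> nn (TQ t u)"
  using nn_scale[of "exp (- (d * t))" "exp (d * t) *\<^sub>R TQ t u"] exp_TQ_nn(1)[of u t] by (simp add: mult_exp_exp)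

lemma TQ_ge: "nn u \<Longrightarrow> t \<ge> 0 \<Longrightarrow> exp (- d * t) *\<^sub>R Q u \<preceq> TQ t u"
  using nn_scale[of "exp (- (d * t))" "exp (d * t) *\<^sub>R TQ t u - Q u"] exp_TQ_nn(2)[of u t]
  by (simp add: mult_exp_exp scaleR_diff_right)

end

section \<open>Mild solutions of the age-structured model\<close>

lemma AE_lebesgue_shift:
  fixes c :: real
  assumes "AE x in lebesgue. P x" shows "AE x in lebesgue. P (x - c)"
proof -
  have m: "(\<lambda>x. - c + 1 * x) \<in> lebesgue \<rightarrow>\<^sub>M lebesgue"
    using lebesgue_affine_measurable[of "\<lambda>_::real. 1" "- c"] by simp
  have d: "lebesgue = distr lebesgue lebesgue (\<lambda>x. - c + 1 * x)"
    using lebesgue_real_affine[of 1 "- c"] by (simp add: density_1)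
  have "AE x in distr lebesgue lebesgue (\<lambda>x. - c + 1 * x). P x" using assms unfolding d[symmetric] .
  from AE_distrD[OF m this] show ?thesis by simp
qed

lemma borel_measurable_lebesgue_AE:
  fixes f g :: "'a::euclidean_space \<Rightarrow> 'b::topological_space"
  assumes g: "g \<in> borel_measurable lebesgue" and ae: "AE x in lebesgue. f x = g x"
  shows "f \<in> borel_measurable lebesgue"
proof (rule borel_measurableI)
  fix U :: "'b set" assume "open U"
  then have gU: "g -` U \<in> sets lebesgue" using measurable_sets[OF g, of U] by simp
  from ae obtain N where N: "{x. f x \<noteq> g x} \<subseteq> N" "N \<in> null_sets lebesgue"
    by (auto simp: eventually_ae_filter)
  have "f -` U \<inter> N \<in> null_sets lebesgue" by (rule null_sets_completion_subset[OF _ N(2)]) auto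
  then have "(g -` U - N) \<union> (f -` U \<inter> N) \<in> sets lebesgue" using gU N(2) by auto
  moreover have "(g -` U - N) \<union> (f -` U \<inter> N) = f -` U" using N(1) by auto
  ultimately show "f -` U \<inter> space lebesgue \<in> sets lebesgue" by simp
qed

text \<open>No measurability is assumed: on the complete measure either both functions are
  measurable or neither is, and in the latter case both integrals have the default value 0. This
  allows \<open>T\<close> to be replaced by \<open>TQ\<close> inside an integral before
  measurability is discussed.\<close>

lemma integral_lebesgue_cong_AE:
  fixes f g :: "'a::euclidean_space \<Rightarrow> 'b::{banach, second_countable_topology}"
  assumes ae: "AE x in lebesgue. f x = g x"
  shows "(LINT x|lebesgue. f x) = (LINT x|lebesgue. g x)"
proof (cases "g \<in> borel_measurable lebesgue")
  case True
  then show ?thesis using borel_measurable_lebesgue_AE[OF True ae] ae by (intro integral_cong_AE)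
next
  case False
  have "f \<notin> borel_measurable lebesgue"
  proof
    assume "f \<in> borel_measurable lebesgue"
    then have "g \<in> borel_measurable lebesgue"
      by (rule borel_measurable_lebesgue_AE) (use ae in \<open>auto elim!: eventually_mono\<close>)
    with False show False by simp
  qed
  then have "\<not> integrable lebesgue f" "\<not> integrable lebesgue g" using False by auto
  then show ?thesis by (simp add: not_integrable_integral_eq)
qed

lemma spectral_radius_on_cong:
  assumes "\<And>x. x \<in> S \<Longrightarrow> L x = L' x" shows "spectral_radius_on S L = spectral_radius_on S L'"
proof -
  have e: "complex_shift z L p = complex_shift z L' p" if "p \<in> S \<times> S" for z p
    using that assms by (auto simp: complex_shift_def)
  have "resolvent_set_on S L = resolvent_set_on S L'"
    unfolding resolvent_set_on_def using e by (simp cong: bij_betw_cong)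
  then show ?thesis by (simp add: spectral_radius_on_def spectrum_on_def)
qed

lemma antiderivative_exists:
  fixes f :: "real \<Rightarrow> real"
  assumes "continuous_on UNIV f" shows "\<exists>F. \<forall>x. (F has_real_derivative f x) (at x)"
proof -
  have "\<exists>F. \<forall>x::real. -\<infinity> < ereal x \<longrightarrow> ereal x < \<infinity> \<longrightarrow> (F has_vector_derivative f x) (at x)"
    by (rule einterval_antiderivative) (use assms in \<open>auto simp: continuous_on_eq_continuous_at\<close>)
  then show ?thesis by (simp add: has_real_derivative_iff_has_vector_derivative)
qed

context renewal
begin

lemma srv_eq_integral:
  assumes "a \<ge> 0" shows "srv t a = exp (- integral {0..a} (\<lambda>s. \<mu> (t + s - a)))"
proof -
  have "((\<lambda>s. \<mu> (t + s - a)) has_integral (H (t + a - a) - H (t + 0 - a))) {0..a}"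
  proof (rule fundamental_theorem_of_calculus[OF assms])
    fix s assume "s \<in> {0..a}"
    have "((\<lambda>s. H (t + s - a)) has_real_derivative \<mu> (t + s - a) * 1) (at s within {0..a})"
      by (rule DERIV_chain2[OF H]) (auto intro!: derivative_eq_intros)
    then show "((\<lambda>s. H (t + s - a)) has_vector_derivative \<mu> (t + s - a)) (at s within {0..a})"
      by (simp add: has_real_derivative_iff_has_vector_derivative)
  qed
  then have "integral {0..a} (\<lambda>s. \<mu> (t + s - a)) = H t - H (t - a)" by (simp add: integral_unique)
  then show ?thesis by (simp add: srv_def)
qed

text \<open>Lets the chosen representative of an initial class be replaced by an explicit function,
  such as a constant age profile.\<close>

lemma char_solution_cong_AE:
  assumes c: "char_solution s p0 P" and ae: "AE a in lebesgue. p0 a = p0' a" and i: "integrable lebesgue p0'"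
  shows "char_solution s p0' P"
  unfolding char_solution_def
proof (intro conjI allI impI)
  show "integrable lebesgue p0'" by fact
  show "continuous_on {s..} (\<lambda>t. birth t (P t))" using c by (simp add: char_solution_def)
  fix t assume t: "s \<le> t"
  show "integrable M (P t)" using c t by (simp add: char_solution_def)
  have "AE a in M. P t a = char_value s (\<lambda>r. birth r (P r)) p0 t a" using c t by (simp add: char_solution_def)
  then show "AE a in M. P t a = char_value s (\<lambda>r. birth r (P r)) p0' t a"
    using AE_M'[OF AE_lebesgue_shift[OF ae, of "t - s"]]
    by eventually_elim (simp add: char_value_def)
qed

section \<open>The resolvent formula as an integrable age profile\<close>

definition age_convolution :: "real \<Rightarrow> (real, 'e) L1 \<Rightarrow> real \<Rightarrow> 'e" where
  "age_convolution l \<eta> a = (LINT r:{0..a}|lebesgue. exp (- l * (a - r)) *\<^sub>R T (a - r) (rep_L1 \<eta> r))"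

lemma age_convolution_eq:
  "age_convolution l \<eta> a = (LINT r|lebesgue. indicator {0..a} r *\<^sub>R (exp (- l * (a - r)) *\<^sub>R T (max 0 (a - r)) (rep_L1 \<eta> r)))"
  unfolding age_convolution_def set_lebesgue_integral_def
  by (rule Bochner_Integration.integral_cong) (auto simp: indicator_def max_def)

text \<open>Continuity in the age makes the resolvent formula integrable; only then does a
  representative of the class built by \<open>abs_L1\<close> agree with the formula almost
  everywhere.\<close>

lemma age_convolution_continuous:
  assumes l: "l \<ge> 0" shows "continuous_on UNIV (\<lambda>a. age_convolution l \<eta> (max 0 a))"
proof -
  have "continuous_on {0..} (age_convolution l \<eta>)"
  proof (subst continuous_on_sequentially, intro ballI allI impI)
    fix x :: "nat \<Rightarrow> real" and a assume a: "a \<in> {0..}" and x: "(\<forall>n. x n \<in> {0..}) \<and> x \<longlonglongrightarrow> a"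
    then have x0: "\<And>n. x n \<ge> 0" and lim: "x \<longlonglongrightarrow> a" by auto
    obtain c where c: "\<And>n. norm (x n) \<le> c" using convergent_imp_Bseq[OF convergentI[OF lim]] unfolding Bseq_def by blast
    have c0: "c \<ge> 0" using c[of 0] by (meson norm_ge_zero order_trans)
    let ?f = "\<lambda>y r. indicator {0..y} r *\<^sub>R (exp (- l * (y - r)) *\<^sub>R T (max 0 (y - r)) (rep_L1 \<eta> r))"
    have m: "?f y \<in> borel_measurable lebesgue" for y
    proof -
      have "(\<lambda>r. exp (- l * (y - r))) \<in> borel_measurable lebesgue" "(\<lambda>r. y - r) \<in> borel_measurable lebesgue"
        by (intro measurable_completion; simp)+
      moreover have "rep_L1 \<eta> \<in> borel_measurable lebesgue" by (rule borel_measurable_integrable) simp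
      ultimately show ?thesis
        by (intro borel_measurable_scaleR borel_measurable_indicator measurable_Tmax) auto
    qed
    have "(\<lambda>n. LINT r|lebesgue. ?f (x n) r) \<longlonglongrightarrow> (LINT r|lebesgue. ?f a r)"
    proof (rule integral_dominated_convergence[where w = "\<lambda>r. exp (\<kappa> * c) * norm (rep_L1 \<eta> r)"])
      show "integrable lebesgue (\<lambda>r. exp (\<kappa> * c) * norm (rep_L1 \<eta> r))" by simp
      show "AE r in lebesgue. (\<lambda>n. ?f (x n) r) \<longlonglongrightarrow> ?f a r"
      \<comment> \<open>The indicators of \<open>{0..x n}\<close> may fail to converge at
        \<open>r = a\<close>, a null set.\<close>
      proof (rule AE_mp[OF AE_lborel_singleton[of a, THEN AE_completion] AE_I2], intro impI)
        fix r assume ra: "r \<noteq> a"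
        have "(\<lambda>n. indicator {0..x n} r :: real) \<longlonglongrightarrow> indicator {0..a} r"
        proof (rule tendsto_eventually)
          show "\<forall>\<^sub>F n in sequentially. (indicator {0..x n} r :: real) = indicator {0..a} r"
          proof (cases "r < a")
            case True
            then have "\<forall>\<^sub>F n in sequentially. r < x n" using order_tendstoD(1)[OF lim] by blast
            then show ?thesis by eventually_elim (use True in \<open>auto simp: indicator_def\<close>)
          next
            case False
            then have "\<forall>\<^sub>F n in sequentially. x n < r" using order_tendstoD(2)[OF lim, of r] ra by auto
            then show ?thesis by eventually_elim (use False ra in \<open>auto simp: indicator_def\<close>)
          qed
        qed
        moreover have "(\<lambda>n. exp (- l * (x n - r)) *\<^sub>R T (max 0 (x n - r)) (rep_L1 \<eta> r)) \<longlonglongrightarrow> exp (- l * (a - r)) *\<^sub>R T (max 0 (a - r)) (rep_L1 \<eta> r)"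
        proof -
          have "continuous_on UNIV (\<lambda>y. exp (- l * (y - r)) *\<^sub>R T (max 0 (y - r)) (rep_L1 \<eta> r))"
            by (intro continuous_intros continuous_on_Tmax)
          from continuous_on_tendsto_compose[OF this lim] show ?thesis by simp
        qed
        ultimately show "(\<lambda>n. ?f (x n) r) \<longlonglongrightarrow> ?f a r" by (rule tendsto_scaleR)
      qed
      show "AE r in lebesgue. norm (?f (x n) r) \<le> exp (\<kappa> * c) * norm (rep_L1 \<eta> r)" for n
      proof (rule AE_I2)
        fix r
        show "norm (?f (x n) r) \<le> exp (\<kappa> * c) * norm (rep_L1 \<eta> r)"
        proof (cases "r \<in> {0..x n}")
          case True
          have "\<kappa> * (x n - r) \<le> \<kappa> * c" using True c[of n] \<kappa> by (intro mult_left_mono) auto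
          then have "norm (T (max 0 (x n - r)) (rep_L1 \<eta> r)) \<le> exp (\<kappa> * c) * norm (rep_L1 \<eta> r)"
            using True T_norm[of "max 0 (x n - r)" "rep_L1 \<eta> r"]
            by (intro order_trans[OF T_norm mult_right_mono]) (auto simp: max_def)
          moreover have "exp (- l * (x n - r)) \<le> 1" using True l by simp
          ultimately have "exp (- l * (x n - r)) * norm (T (max 0 (x n - r)) (rep_L1 \<eta> r)) \<le> 1 * (exp (\<kappa> * c) * norm (rep_L1 \<eta> r))"
            by (intro mult_mono) auto
          then show ?thesis using True by simp
        qed simp
      qed
    qed (use m in auto)
    then show "(age_convolution l \<eta> \<circ> x) \<longlonglongrightarrow> age_convolution l \<eta> a"
      unfolding comp_def age_convolution_eq .
  qed
  then show ?thesis by (rule continuous_on_compose2) (auto intro!: continuous_intros)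
qed

lemma resolvent_integrable:
  assumes l: "l \<ge> 0"
  shows "integrable lebesgue (\<lambda>a. indicator {0<..<ap} a *\<^sub>R (exp (- l * a) *\<^sub>R T a \<phi> + age_convolution l \<eta> a))"
proof -
  have "continuous_on UNIV (\<lambda>a. exp (- l * a) *\<^sub>R T (max 0 a) \<phi> + age_convolution l \<eta> (max 0 a))"
    by (intro continuous_intros continuous_on_Tmax age_convolution_continuous l)
  from integrable_M_continuous[OF this]
  have "integrable lebesgue (\<lambda>a. indicator {0<..<ap} a *\<^sub>R (exp (- l * a) *\<^sub>R T (max 0 a) \<phi> + age_convolution l \<eta> (max 0 a)))"
    by (subst (asm) integrable_restrict_space) auto
  moreover have "(\<lambda>a. indicator {0<..<ap} a *\<^sub>R (exp (- l * a) *\<^sub>R T (max 0 a) \<phi> + age_convolution l \<eta> (max 0 a)))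
      = (\<lambda>a. indicator {0<..<ap} a *\<^sub>R (exp (- l * a) *\<^sub>R T a \<phi> + age_convolution l \<eta> a))"
    by (auto simp: indicator_def max_def fun_eq_iff)
  ultimately show ?thesis by simp
qed

end

lemma (in renewal) iterate_bound_mono:
  assumes iterate_bound: "iterate_bound l c" and c: "0 \<le> c" "c \<le> c'" shows "iterate_bound l c'"
proof -
  obtain C where C: "\<And>n f t B. continuous_on UNIV f \<Longrightarrow>
     (\<And>s. s \<in> {t - real n * ap..t} \<Longrightarrow> norm (f s) \<le> B * exp (l * (s - t))) \<Longrightarrow>
     norm ((L ^^ n) f t) \<le> C * c ^ n * B"
    using iterate_bound unfolding iterate_bound_def by blast
  show ?thesis
    unfolding iterate_bound_def
  proof (intro exI[of _ "\<bar>C\<bar>"] allI impI)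
    fix n t B and f :: "real \<Rightarrow> 'e"
    assume f: "continuous_on UNIV f" and b: "\<forall>s\<in>{t - real n * ap..t}. norm (f s) \<le> B * exp (l * (s - t))"
    have "t \<in> {t - real n * ap..t}" using ap by simp
    with b have "norm (f t) \<le> B * exp (l * (t - t))" by blast
    then have B: "B \<ge> 0" by simp (meson norm_ge_zero order_trans)
    have 1: "norm ((L ^^ n) f t) \<le> C * c ^ n * B" using C[OF f] b by blast
    have 2: "C * c ^ n * B \<le> \<bar>C\<bar> * c' ^ n * B"
      using c B by (intro mult_right_mono mult_mono power_mono) auto
    show "norm ((L ^^ n) f t) \<le> \<bar>C\<bar> * c' ^ n * B" by (rule order_trans[OF 1 2])
  qed
qed

text \<open>Couples the abstract setting, applied to the projected family \<open>TQ\<close>, with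
  the operators of the model, which are formulated with the original \<open>T\<close>.\<close>

locale age_model = renewal L2_nonneg L2_pos_part TQ \<beta> \<mu> H ap d \<kappa> \<epsilon>0 \<beta>m \<mu>m x0
  for TQ :: "real \<Rightarrow> 'a::euclidean_space L2 \<Rightarrow> 'a L2" and \<beta> \<mu> H ap d \<kappa> \<epsilon>0 \<beta>m \<mu>m x0 +
  fixes \<Omega> :: "'a set" and T :: "real \<Rightarrow> 'a L2 \<Rightarrow> 'a L2" and D :: "'a state set" and A :: "'a state \<Rightarrow> 'a state"
  assumes L2_on_fixed: "u \<in> L2_on \<Omega> \<longleftrightarrow> TQ 0 u = u"
    and T_eq: "u \<in> L2_on \<Omega> \<Longrightarrow> T a u = TQ a u"
    and A: "closed_operator_with_resolvent (state_space ap \<Omega>) (state_space0 ap \<Omega>) (age_resolvent ap T) D A"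
begin

lemma subspace_L2_on: "subspace (L2_on \<Omega>)"
  using T_plus[of 0] T_scaleR[of 0] T_zero[of 0] by (auto simp: subspace_def L2_on_fixed)

lemma rep_age_resolvent:
  assumes \<phi>: "\<phi> \<in> L2_on \<Omega>" and \<eta>: "AE a in lebesgue. rep_L1 \<eta> a \<in> L2_on \<Omega>" and l: "l > 0"
  shows "AE a in lebesgue. a \<in> {0<..<ap} \<longrightarrow>
    rep_L1 (snd (age_resolvent ap T l (\<phi>, \<eta>))) a = exp (- l * a) *\<^sub>R TQ a \<phi> + age_convolution l \<eta> a"
proof -
  have c: "(LINT s:{0..a}|lebesgue. exp (- l * (a - s)) *\<^sub>R T (a - s) (rep_L1 \<eta> s)) = age_convolution l \<eta> a" for a
    unfolding age_convolution_def set_lebesgue_integral_def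
    by (rule integral_lebesgue_cong_AE) (use \<eta> in \<open>eventually_elim, simp add: T_eq\<close>)
  have i: "integrable lebesgue (\<lambda>a. indicator {0<..<ap} a *\<^sub>R (exp (- l * a) *\<^sub>R TQ a \<phi> + age_convolution l \<eta> a))"
    by (rule resolvent_integrable) (use l in simp)
  have e: "snd (age_resolvent ap T l (\<phi>, \<eta>)) = abs_L1 (\<lambda>a. indicator {0<..<ap} a *\<^sub>R (exp (- l * a) *\<^sub>R TQ a \<phi> + age_convolution l \<eta> a))"
    by (simp only: age_resolvent_def prod.case snd_conv c T_eq[OF \<phi>])
  show ?thesis unfolding e using rep_abs_L1[OF i] by eventually_elim simp
qed

text \<open>For \<open>v = integral {s..t} u\<close> the mild equation expresses \<open>A v\<close>
  through \<open>u t\<close>, \<open>u0\<close> and the time integrals of births and deaths. The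
  resolvent recovers \<open>v\<close> from \<open>l *\<^sub>R v - A v\<close> for every
  \<open>l > 0\<close>, and this is the identity required by
  \<open>char_solution_of_resolvent_identity\<close>.\<close>

lemma mild_solution_char_solution:
  assumes sol: "mild_solution ap \<Omega> \<beta> \<mu> D A s u0 u" and u0: "u0 \<in> state_space0 ap \<Omega>"
  shows "char_solution s (rep_L1 (snd u0)) (\<lambda>t. rep_L1 (snd (u t)))"
proof -
  define P where "P t = snd (u t)" for t
  define b where "b t = birth t (rep_L1 (P t))" for t
  have uc: "continuous_on {s..} u" and u0t: "\<And>t. s \<le> t \<Longrightarrow> u t \<in> state_space0 ap \<Omega>"
    and uD: "\<And>t. s \<le> t \<Longrightarrow> integral {s..t} u \<in> D"
    and ueq: "\<And>t. s \<le> t \<Longrightarrow> u t = u0 + A (integral {s..t} u) +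
        integral {s..t} (\<lambda>r. birth_op ap \<beta> r (u r) - mortality_op \<mu> r (u r))"
    using sol by (auto simp: mild_solution_def)
  have Pc: "continuous_on {s..} P" unfolding P_def by (intro continuous_on_snd uc)
  have bc: "continuous_on {s..} b" unfolding b_def by (rule continuous_on_birth_L1[OF Pc])
  have uP: "u t = (0, P t)" if "s \<le> t" for t
    using u0t[OF that] by (auto simp: state_space0_def P_def)
  have D0: "0 \<in> D" "\<And>v. v \<in> D \<Longrightarrow> A v \<in> state_space ap \<Omega>"
    and lin: "linear_map_on D A"
    and R: "\<And>l v. l > 0 \<Longrightarrow> v \<in> D \<Longrightarrow> age_resolvent ap T l (l *\<^sub>R v - A v) = v"
    using A by (auto simp: closed_operator_with_resolvent_def subspace_0)
  have A0: "A 0 = 0"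
    using lin D0(1) unfolding linear_map_on_def by (metis scaleR_zero_left)
  have us: "u s = u0" using ueq[of s] A0 by simp
  have Ps: "P s = snd u0" by (simp add: P_def us)
  have fP: "AE a in lebesgue. rep_L1 (P t) a \<in> L2_on \<Omega>" if "s \<le> t" for t
    using u0t[OF that] by (auto simp: state_space0_def age_space_def P_def)
  have "char_solution s (rep_L1 (P s)) (\<lambda>t. rep_L1 (P t))"
  proof (rule char_solution_of_resolvent_identity[OF Pc])
    show "AE a in lebesgue. TQ 0 (rep_L1 (P t) a) = rep_L1 (P t) a" if "s \<le> t" for t
      using fP[OF that] by (simp add: L2_on_fixed)
    fix t l :: real assume t: "s \<le> t" and l: "l > 0"
    define v where "v = integral {s..t} u"
    define w where "w = integral {s..t} (\<lambda>r. birth_op ap \<beta> r (u r) - mortality_op \<mu> r (u r))"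
    have iu: "u integrable_on {s..t}"
      by (rule integrable_continuous_interval[OF continuous_on_subset[OF uc]]) auto
    have sv: "snd v = integral {s..t} P"
      using integral_linear[OF iu bounded_linear_snd] by (simp add: v_def P_def[abs_def] comp_def)
    have fv: "fst v = 0"
    proof -
      have "fst v = integral {s..t} (\<lambda>r. fst (u r))"
        using integral_linear[OF iu bounded_linear_fst] by (simp add: v_def comp_def)
      also have "\<dots> = integral {s..t} (\<lambda>r. 0)" by (rule integral_cong) (simp add: uP)
      finally show ?thesis by simp
    qed
    define g where "g r = (b r, - (\<mu> r *\<^sub>R P r))" for r
    have gc: "continuous_on {s..t} g"
      unfolding g_def by (intro continuous_intros continuous_on_\<mu> continuous_on_subset[OF bc] continuous_on_subset[OF Pc]) auto
    have ig: "g integrable_on {s..t}" by (rule integrable_continuous_interval[OF gc])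
    have wg: "w = integral {s..t} g"
      unfolding w_def
    proof (rule integral_cong)
      fix r assume "r \<in> {s..t}"
      then have "u r = (0, P r)" by (simp add: uP)
      moreover have "birth r f = (LINT a:{0<..<ap}|lebesgue. rep_Linf (\<beta> r) a *\<^sub>R f a)" for f
        unfolding birth_def set_lebesgue_integral_def by (rule integral_restrict_space) simp
      ultimately show "birth_op ap \<beta> r (u r) - mortality_op \<mu> r (u r) = g r"
        by (simp add: birth_op_def mortality_op_def g_def b_def)
    qed
    have fw: "fst w = integral {s..t} b"
      using integral_linear[OF ig bounded_linear_fst] by (simp add: wg g_def comp_def)
    have sw: "snd w = - integral {s..t} (\<lambda>r. \<mu> r *\<^sub>R P r)"
      using integral_linear[OF ig bounded_linear_snd] by (simp add: wg g_def comp_def)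
    have Av: "A v = u t - u0 - w" using ueq[OF t] by (simp add: v_def w_def)
    define \<eta> where "\<eta> = l *\<^sub>R integral {s..t} P + (P s - P t - integral {s..t} (\<lambda>r. \<mu> r *\<^sub>R P r))"
    have fu0: "fst u0 = 0" using u0 by (auto simp: state_space0_def)
    have lv: "l *\<^sub>R v - A v = (integral {s..t} b, \<eta>)"
    proof (rule prod_eqI)
      show "fst (l *\<^sub>R v - A v) = fst (integral {s..t} b, \<eta>)"
        by (simp add: Av fv fw fu0 uP[OF t])
      show "snd (l *\<^sub>R v - A v) = snd (integral {s..t} b, \<eta>)"
        by (simp add: Av sv sw \<eta>_def Ps uP[OF t])
    qed
    have vX: "v \<in> state_space ap \<Omega>" and AvX: "A v \<in> state_space ap \<Omega>"
      using A uD[OF t] by (auto simp: closed_operator_with_resolvent_def v_def)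
    have \<phi>: "integral {s..t} b \<in> L2_on \<Omega>"
    proof -
      have "integral {s..t} b = - fst (A v)" using arg_cong[OF lv, of fst] fv by simp
      then show ?thesis using AvX subspace_neg[OF subspace_L2_on] by (auto simp: state_space_def)
    qed
    have \<eta>': "AE a in lebesgue. rep_L1 \<eta> a \<in> L2_on \<Omega>"
    proof -
      have e: "\<eta> = l *\<^sub>R snd v + (-1) *\<^sub>R snd (A v)" using arg_cong[OF lv, of snd] by simp
      have 1: "AE a in lebesgue. rep_L1 (snd v) a \<in> L2_on \<Omega>" "AE a in lebesgue. rep_L1 (snd (A v)) a \<in> L2_on \<Omega>"
        using vX AvX by (auto simp: state_space_def age_space_def)
      show ?thesis
        unfolding e using 1 rep_L1_add[of "l *\<^sub>R snd v" "(-1) *\<^sub>R snd (A v)"] rep_L1_scaleR[of l "snd v"] rep_L1_scaleR[of "-1" "snd (A v)"]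
      proof eventually_elim
        case (elim a)
        then show ?case
          by (simp only:) (intro subspace_add subspace_scale subspace_L2_on)
      qed
    qed
    have vR: "v = age_resolvent ap T l (integral {s..t} b, \<eta>)"
      using R[OF l, of v] uD[OF t] unfolding lv by (simp add: v_def)
    have "AE a in lebesgue. a \<in> {0<..<ap} \<longrightarrow>
       rep_L1 (snd v) a = exp (- l * a) *\<^sub>R TQ a (integral {s..t} b) + age_convolution l \<eta> a"
      by (subst vR) (rule rep_age_resolvent[OF \<phi> \<eta>' l])
    then show "AE a in lebesgue. a \<in> {0<..<ap} \<longrightarrow>
      rep_L1 (integral {s..t} P) a = exp (- l * a) *\<^sub>R TQ a (integral {s..t} (\<lambda>t. birth t (rep_L1 (P t)))) +
      (LINT r:{0..a}|lebesgue. exp (- l * (a - r)) *\<^sub>R TQ (a - r) (rep_L1 (l *\<^sub>R integral {s..t} P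
        + (P s - P t - integral {s..t} (\<lambda>r. \<mu> r *\<^sub>R P r))) r))"
      unfolding sv b_def[abs_def, symmetric] age_convolution_def \<eta>_def .
  qed
  then show ?thesis unfolding Ps by (simp add: P_def)
qed

lemma norm_age_space:
  assumes "\<psi> \<in> age_space ap \<Omega>" shows "norm \<psi> = (LINT a|M. norm (rep_L1 \<psi> a))"
proof -
  have "(LINT a|M. norm (rep_L1 \<psi> a)) = (LINT a|lebesgue. indicator {0<..<ap} a *\<^sub>R norm (rep_L1 \<psi> a))"
    by (rule integral_restrict_space) simp
  also have "\<dots> = (LINT a|lebesgue. norm (rep_L1 \<psi> a))"
  proof (rule integral_lebesgue_cong_AE)
    have "AE a in lebesgue. a \<notin> {0<..<ap} \<longrightarrow> rep_L1 \<psi> a = 0" using assms by (simp add: age_space_def)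
    then show "AE a in lebesgue. indicator {0<..<ap} a *\<^sub>R norm (rep_L1 \<psi> a) = norm (rep_L1 \<psi> a)"
      by eventually_elim (auto simp: indicator_def)
  qed
  finally show ?thesis by (simp add: norm_rep_L1)
qed

lemma constant_age_profile:
  assumes x: "TQ 0 x = x"
  defines "\<psi> \<equiv> abs_L1 (\<lambda>a. indicator {0<..<ap} a *\<^sub>R x)"
  shows "(0, \<psi>) \<in> state_space0 ap \<Omega>" "norm \<psi> = ap * norm x"
    "AE a in lebesgue. rep_L1 \<psi> a = indicator {0<..<ap} a *\<^sub>R x"
    "integrable lebesgue (\<lambda>a. indicator {0<..<ap} a *\<^sub>R x)"
proof -
  have "integrable M (\<lambda>a. x)" by simp
  then show i: "integrable lebesgue (\<lambda>a. indicator {0<..<ap} a *\<^sub>R x)"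
    by (subst (asm) integrable_restrict_space) auto
  show r: "AE a in lebesgue. rep_L1 \<psi> a = indicator {0<..<ap} a *\<^sub>R x"
    unfolding \<psi>_def by (rule rep_abs_L1[OF i])
  have x': "x \<in> L2_on \<Omega>" using x by (simp add: L2_on_fixed)
  have "AE a in lebesgue. a \<notin> {0<..<ap} \<longrightarrow> rep_L1 \<psi> a = 0" using r by eventually_elim simp
  moreover have "AE a in lebesgue. rep_L1 \<psi> a \<in> L2_on \<Omega>"
    using r by eventually_elim (use x' subspace_0[OF subspace_L2_on] in \<open>auto simp: indicator_def\<close>)
  ultimately have \<psi>: "\<psi> \<in> age_space ap \<Omega>" by (simp add: age_space_def)
  then show "(0, \<psi>) \<in> state_space0 ap \<Omega>" by (simp add: state_space0_def)
  have "norm \<psi> = (LINT a|lebesgue. norm (indicator {0<..<ap} a *\<^sub>R x))" unfolding \<psi>_def by (rule norm_abs_L1[OF i])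
  also have "\<dots> = (LINT a|lebesgue. indicator {0<..<ap} a *\<^sub>R norm x)"
    by (rule Bochner_Integration.integral_cong) (auto simp: indicator_def)
  also have "\<dots> = (LINT a|M. norm x)" by (rule integral_restrict_space[symmetric]) simp
  also have "\<dots> = ap * norm x" using integral_M_const[of "norm x"] by simp
  finally show "norm \<psi> = ap * norm x" .
qed

lemma AP_L2_eq: "AP_L2 \<Omega> = AP_space"
  by (simp add: AP_L2_def AP_space_def L2_on_fixed)

lemma renewal_op_eq: "\<psi> \<in> AP_space \<Longrightarrow> renewal_op ap \<beta> \<mu> T \<psi> = L_bcontfun \<psi>"
proof -
  assume \<psi>: "\<psi> \<in> AP_space"
  have "(LINT a:{0<..<ap}|lebesgue. (rep_Linf (\<beta> t) a * exp (- integral {0..a} (\<lambda>s. \<mu> (t + s - a)))) *\<^sub>R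
       T a (apply_bcontfun \<psi> (t - a))) = L (apply_bcontfun \<psi>) t" for t
  proof -
    have "L (apply_bcontfun \<psi>) t = (LINT a|lebesgue. indicator {0<..<ap} a *\<^sub>R (rep_Linf (\<beta> t) a *\<^sub>R kern (apply_bcontfun \<psi>) t a))"
      unfolding L_def birth_def by (rule integral_restrict_space) simp
    also have "\<dots> = (LINT a|lebesgue. indicator {0<..<ap} a *\<^sub>R ((rep_Linf (\<beta> t) a * exp (- integral {0..a} (\<lambda>s. \<mu> (t + s - a)))) *\<^sub>R
       T a (apply_bcontfun \<psi> (t - a))))"
    proof (rule Bochner_Integration.integral_cong[OF refl])
      fix a
      have "T a (apply_bcontfun \<psi> (t - a)) = TQ a (apply_bcontfun \<psi> (t - a))"
        using \<psi> by (intro T_eq) (simp add: AP_space_def L2_on_fixed)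
      then show "indicator {0<..<ap} a *\<^sub>R (rep_Linf (\<beta> t) a *\<^sub>R kern (apply_bcontfun \<psi>) t a) =
         indicator {0<..<ap} a *\<^sub>R ((rep_Linf (\<beta> t) a * exp (- integral {0..a} (\<lambda>s. \<mu> (t + s - a)))) *\<^sub>R T a (apply_bcontfun \<psi> (t - a)))"
        by (cases "a \<in> {0<..<ap}") (simp_all add: kern_def srv_eq_integral)
    qed
    finally show ?thesis by (simp add: set_lebesgue_integral_def)
  qed
  then show ?thesis by (simp add: renewal_op_def L_bcontfun_def)
qed

lemma spectral_radius_eq: "spectral_radius_on (AP_L2 \<Omega>) (renewal_op ap \<beta> \<mu> T) = spectral_radius_on AP_space L_bcontfun"
  unfolding AP_L2_eq by (rule spectral_radius_on_cong[OF renewal_op_eq])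

lemma iterate_bound_imp_mild_solution_bound:
  assumes iterate_bound: "iterate_bound l q" and q: "0 \<le> q" "q < 1"
  shows "\<exists>C\<ge>1. \<forall>s u0 u t. u0 \<in> state_space0 ap \<Omega> \<longrightarrow> mild_solution ap \<Omega> \<beta> \<mu> D A s u0 u \<longrightarrow> s \<le> t \<longrightarrow>
    norm (u t) \<le> C * exp (l * (t - s)) * norm u0"
proof -
  obtain C where C: "C \<ge> 1" "\<And>s p0 P t. char_solution s p0 P \<Longrightarrow> s \<le> t \<Longrightarrow>
    (LINT a|M. norm (P t a)) \<le> C * exp (l * (t - s)) * (LINT a|lebesgue. norm (p0 a))"
    using iterate_bound_imp_char_solution_bound[OF iterate_bound q] by blast
  have "norm (u t) \<le> C * exp (l * (t - s)) * norm u0"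
    if "u0 \<in> state_space0 ap \<Omega>" "mild_solution ap \<Omega> \<beta> \<mu> D A s u0 u" "s \<le> t" for s u0 u t
  proof -
    have "u t \<in> state_space0 ap \<Omega>" using that(2,3) unfolding mild_solution_def by blast
    then have "norm (u t) = (LINT a|M. norm (rep_L1 (snd (u t)) a))"
      using norm_age_space[of "snd (u t)"] by (auto simp: state_space0_def norm_Pair)
    also have "\<dots> \<le> C * exp (l * (t - s)) * (LINT a|lebesgue. norm (rep_L1 (snd u0) a))"
      by (rule C(2)[OF mild_solution_char_solution[OF that(2,1)] that(3)])
    also have "(LINT a|lebesgue. norm (rep_L1 (snd u0) a)) = norm u0"
      using that(1) by (auto simp: state_space0_def norm_rep_L1 norm_Pair)
    finally show ?thesis .
  qed
  then show ?thesis using C(1) by blast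
qed

lemma iterate_bound_imp_growth_bound:
  assumes iterate_bound: "iterate_bound l q" and q: "0 \<le> q" "q < 1" and U: "model_evolution_family ap \<Omega> \<beta> \<mu> D A U"
  shows "growth_bound_on (state_space0 ap \<Omega>) U \<le> ereal l"
proof -
  obtain C where C: "C \<ge> 1" "\<And>s u0 u t. u0 \<in> state_space0 ap \<Omega> \<Longrightarrow> mild_solution ap \<Omega> \<beta> \<mu> D A s u0 u \<Longrightarrow> s \<le> t \<Longrightarrow>
    norm (u t) \<le> C * exp (l * (t - s)) * norm u0"
    using iterate_bound_imp_mild_solution_bound[OF iterate_bound q] by blast
  have "norm (U t s x) \<le> C * exp (l * (t - s)) * norm x" if "s \<le> t" "x \<in> state_space0 ap \<Omega>" for s t x
    using C(2)[OF that(2) _ that(1), of "\<lambda>t. U t s x"] U that(2) by (simp add: model_evolution_family_def)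
  then show ?thesis
    unfolding growth_bound_on_def using C(1) by (intro Inf_lower imageI) blast
qed

text \<open>\<open>l0\<close> separates an admissible exponent \<open>w0\<close> from
  \<open>l\<close>: the gap below \<open>l0\<close> gives bounded iterates for the weight
  \<open>l0\<close>, the gap above it a rate below 1 for \<open>l\<close>.\<close>

lemma growth_bound_imp_iterate_bound:
  assumes U: "model_evolution_family ap \<Omega> \<beta> \<mu> D A U"
    and w: "growth_bound_on (state_space0 ap \<Omega>) U < ereal l"
  shows "\<exists>q. 0 < q \<and> q < 1 \<and> iterate_bound l q"
proof -
  from w obtain w0 C where wl: "w0 < l" and C: "C \<ge> 1" "\<And>s t x. s \<le> t \<Longrightarrow> x \<in> state_space0 ap \<Omega> \<Longrightarrow>
      norm (U t s x) \<le> C * exp (w0 * (t - s)) * norm x"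
    unfolding growth_bound_on_def Inf_less_iff by auto
  define l0 where "l0 = (w0 + l) / 2"
  have l0: "w0 < l0" "l0 < l" using wl by (auto simp: l0_def)
  have "iterate_bound l0 1"
  proof (rule evolution_bound_imp_iterate_bound[OF l0(1)])
    show "0 \<le> C * ap" using C(1) ap by simp
    fix \<sigma> and x :: "'a L2" assume x: "TQ 0 x = x"
    define \<psi> where "\<psi> = abs_L1 (\<lambda>a. indicator {0<..<ap} a *\<^sub>R x)"
    note p = constant_age_profile[OF x, folded \<psi>_def]
    have sol: "mild_solution ap \<Omega> \<beta> \<mu> D A \<sigma> (0, \<psi>) (\<lambda>t. U t \<sigma> (0, \<psi>))"
      using U p(1) by (simp add: model_evolution_family_def)
    have "char_solution \<sigma> (\<lambda>a. indicator {0<..<ap} a *\<^sub>R x) (\<lambda>t. rep_L1 (snd (U t \<sigma> (0, \<psi>))))"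
      using mild_solution_char_solution[OF sol p(1), unfolded snd_conv] p(3,4) by (rule char_solution_cong_AE)
    moreover have "(LINT a|M. norm (rep_L1 (snd (U t \<sigma> (0, \<psi>))) a)) \<le> C * ap * exp (w0 * (t - \<sigma>)) * norm x"
      if "t \<ge> \<sigma>" for t
    proof -
      have "U t \<sigma> (0, \<psi>) \<in> state_space0 ap \<Omega>" using sol that unfolding mild_solution_def by blast
      then have "(LINT a|M. norm (rep_L1 (snd (U t \<sigma> (0, \<psi>))) a)) = norm (U t \<sigma> (0, \<psi>))"
        using norm_age_space[of "snd (U t \<sigma> (0, \<psi>))"] by (auto simp: state_space0_def norm_Pair)
      also have "\<dots> \<le> C * exp (w0 * (t - \<sigma>)) * norm (0 :: 'a L2, \<psi>)" by (rule C(2)[OF that p(1)])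
      also have "\<dots> = C * ap * exp (w0 * (t - \<sigma>)) * norm x" using ap by (simp add: norm_Pair p(2))
      finally show ?thesis .
    qed
    ultimately show "\<exists>P. char_solution \<sigma> (\<lambda>a. indicator {0<..<ap} a *\<^sub>R x) P \<and>
        (\<forall>t\<ge>\<sigma>. (LINT a|M. norm (P t a)) \<le> C * ap * exp (w0 * (t - \<sigma>)) * norm x)" by blast
  qed
  then have "iterate_bound l0 c" if "c > 1" for c by (rule iterate_bound_mono) (use that in auto)
  then show ?thesis by (rule iterate_bound_strict[OF _ l0(2)])
qed

end

context age_model
begin

text \<open>The non-strict implications approach the weight 0 from above: if
  \<open>r \<le> 1\<close>, every \<open>l > 0\<close> admits a rate below 1, and if
  \<open>w \<le> 0\<close>, every \<open>l > 0\<close> gives \<open>r \<le> exp (l * ap)\<close>.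
  Combined with the strict ones they settle the case \<open>r = 1\<close>.\<close>

lemma growth_bound_trichotomy:
  assumes U: "model_evolution_family ap \<Omega> \<beta> \<mu> D A U"
  defines "r \<equiv> spectral_radius_on (AP_L2 \<Omega>) (renewal_op ap \<beta> \<mu> T)"
    and "w \<equiv> growth_bound_on (state_space0 ap \<Omega>) U"
  shows "r < 1 \<Longrightarrow> w < 0" "r \<le> 1 \<Longrightarrow> w \<le> 0" "w < 0 \<Longrightarrow> r < 1" "w \<le> 0 \<Longrightarrow> r \<le> 1"
    and "r < 1 \<Longrightarrow> u0 \<in> state_space0 ap \<Omega> \<Longrightarrow> mild_solution ap \<Omega> \<beta> \<mu> D A s u0 u \<Longrightarrow> (u \<longlongrightarrow> 0) at_top"
proof -
  have r: "r = spectral_radius_on AP_space L_bcontfun" by (simp add: r_def spectral_radius_eq)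
  have decay: "\<exists>l q. l < 0 \<and> 0 \<le> q \<and> q < 1 \<and> iterate_bound l q" if "r < 1"
  proof -
    define q where "q = (max r 0 + 1) / 2"
    have q: "r < q" "0 < q" "q < 1" using that by (auto simp: q_def)
    have g: "iterate_bound 0 q" by (rule spectral_radius_imp_iterate_bound) (use q r in auto)
    \<comment> \<open>Changing the weight from 0 to \<open>l\<close> multiplies the rate by
      \<open>exp (- l * ap) = exp (- ln q / 2)\<close>. The new rate is the square root of
      \<open>q\<close>, still below 1.\<close>
    define l where "l = ln q / (2 * ap)"
    have l: "l < 0" using q ap by (simp add: l_def divide_neg_pos)
    have "q * exp (max 0 (0 - l) * ap) = exp (ln q) * exp (- ln q / 2)"
      using l ap q by (simp add: l_def max_def)
    also have "\<dots> = exp (ln q / 2)" unfolding mult_exp_exp by simp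
    also have "\<dots> < 1" using q by simp
    finally have "q * exp (max 0 (0 - l) * ap) < 1" .
    with iterate_bound_weaken[OF g, of l] l q show ?thesis
      by (intro exI[of _ l] exI[of _ "q * exp (max 0 (0 - l) * ap)"]) simp
  qed
  show "w < 0" if "r < 1"
  proof -
    from decay[OF that] obtain l q where l: "l < 0" and g: "iterate_bound l q" "0 \<le> q" "q < 1" by blast
    have "w \<le> ereal l" unfolding w_def by (rule iterate_bound_imp_growth_bound[OF g U])
    also have "\<dots> < 0" using l by simp
    finally show ?thesis .
  qed
  show "(u \<longlongrightarrow> 0) at_top" if r1: "r < 1" and sol: "u0 \<in> state_space0 ap \<Omega>" "mild_solution ap \<Omega> \<beta> \<mu> D A s u0 u"
  proof -
    from decay[OF r1] obtain l q where l: "l < 0" and g: "iterate_bound l q" "0 \<le> q" "q < 1" by blast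
    obtain C where C: "\<And>t. s \<le> t \<Longrightarrow> norm (u t) \<le> C * exp (l * (t - s)) * norm u0"
      using iterate_bound_imp_mild_solution_bound[OF g] sol by blast
    show ?thesis
    proof (rule Lim_null_comparison)
      show "\<forall>\<^sub>F t in at_top. norm (u t) \<le> C * exp (l * (t - s)) * norm u0"
        using eventually_ge_at_top[of s] by eventually_elim (rule C)
      have "filterlim (\<lambda>t. l * (t - s)) at_bot at_top"
      proof (rule filterlim_tendsto_neg_mult_at_bot[OF tendsto_const l], unfold filterlim_at_top, rule allI)
        fix Z
        show "\<forall>\<^sub>F t in at_top. Z \<le> t - s"
          using eventually_ge_at_top[of "Z + s"] by eventually_elim simp
      qed
      then have "((\<lambda>t. exp (l * (t - s))) \<longlongrightarrow> 0) at_top" by (rule filterlim_compose[OF exp_at_bot])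
      then have "((\<lambda>t. C * exp (l * (t - s)) * norm u0) \<longlongrightarrow> C * 0 * norm u0) at_top"
        by (intro tendsto_intros)
      then show "((\<lambda>t. C * exp (l * (t - s)) * norm u0) \<longlongrightarrow> 0) at_top" by simp
    qed
  qed
  show "w \<le> 0" if "r \<le> 1"
  proof (rule ccontr)
    assume "\<not> w \<le> 0"
    then have "0 < w" by simp
    from ereal_dense2[OF this] obtain l where l: "0 < ereal l" "ereal l < w" by blast
    have g: "iterate_bound 0 c" if "c > 1" for c
      by (rule spectral_radius_imp_iterate_bound) (use that \<open>r \<le> 1\<close> r in auto)
    obtain q where q: "0 < q" "q < 1" "iterate_bound l q" using iterate_bound_strict[OF g, of l] l(1) by auto
    have "w \<le> ereal l" unfolding w_def by (rule iterate_bound_imp_growth_bound[OF q(3) _ q(2) U]) (use q in simp)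
    then show False using l(2) by simp
  qed
  show "r < 1" if "w < 0"
  proof -
    have "w < ereal 0" using that by (simp add: zero_ereal_def)
    from growth_bound_imp_iterate_bound[OF U this[unfolded w_def]] obtain q where q: "0 < q" "q < 1" "iterate_bound 0 q" by blast
    have "r \<le> q" unfolding r by (rule iterate_bound_imp_spectral_radius) (use q in auto)
    then show ?thesis using q by simp
  qed
  show "r \<le> 1" if "w \<le> 0"
  proof -
    have le: "r \<le> exp (l * ap)" if l: "l > 0" for l
    proof -
      have "w < ereal l" by (rule order.strict_trans1[OF \<open>w \<le> 0\<close>]) (use l in simp)
      from growth_bound_imp_iterate_bound[OF U this[unfolded w_def]] obtain q where q: "0 < q" "q < 1" "iterate_bound l q" by blast
      have "r \<le> q * exp (max 0 (l - 0) * ap)" unfolding r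
        by (rule iterate_bound_imp_spectral_radius[OF iterate_bound_weaken[OF q(3)]]) (use q in auto)
      also have "\<dots> \<le> 1 * exp (l * ap)" using q l by (intro mult_mono) auto
      finally show ?thesis by simp
    qed
    show ?thesis
    proof (rule ccontr)
      assume "\<not> r \<le> 1"
      then have r1: "r > 1" by simp
      \<comment> \<open>With this choice of \<open>l\<close> the bound says that \<open>r\<close> is
        at most its own square root, impossible for \<open>r > 1\<close>.\<close>
      then have "r \<le> exp (ln r / (2 * ap) * ap)" using ap by (intro le) simp
      also have "\<dots> = exp (ln r / 2)" using ap by simp
      also have "\<dots> < exp (ln r)" unfolding exp_less_cancel_iff using r1 by simp
      also have "\<dots> = r" using r1 by (intro exp_ln) simp
      finally show False by simp
    qed
  qed
qed

end

theorem theorem4p7: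
  fixes \<Omega> :: "(real ^ 'n) set"
    and d ap \<epsilon>0 :: real
    and J :: "real ^ 'n \<Rightarrow> real"
    and \<beta> :: "real \<Rightarrow> real Linf"
    and \<mu> :: "real \<Rightarrow> real"
    and T :: "real \<Rightarrow> (real ^ 'n) L2 \<Rightarrow> (real ^ 'n) L2"
    and D :: "(real ^ 'n) state set"
    and A :: "(real ^ 'n) state \<Rightarrow> (real ^ 'n) state"
    and U :: "real \<Rightarrow> real \<Rightarrow> (real ^ 'n) state \<Rightarrow> (real ^ 'n) state"
  assumes domain: "open \<Omega>" "connected \<Omega>" "bounded \<Omega>" "\<Omega> \<noteq> {}"
    and pos: "d > 0" "ap > 0"
    and kernel: "continuous_on UNIV J" "compact (closure {x. J x \<noteq> 0})" "\<And>x. J x \<ge> 0"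
      "(LINT x|lebesgue. J x) = 1"
    and \<beta>_AP: "almost_periodic \<beta>"
    and \<beta>_space: "\<And>t. \<beta> t \<in> Linf_on {0<..<ap}" "\<And>t. Linf_nonneg (\<beta> t)"
    and \<mu>_AP: "almost_periodic \<mu>" "\<And>t. \<mu> t \<ge> 0"
    and \<epsilon>0: "\<epsilon>0 > 0" "\<And>t. \<mu> t > \<epsilon>0"
      "\<And>t. AE a in lebesgue. a \<in> {0<..<ap} \<longrightarrow> rep_Linf (\<beta> t) a \<ge> \<epsilon>0"
    and semigroup: "C0_semigroup_on (L2_on \<Omega>) T"
      "generator_graph_on (L2_on \<Omega>) T = {(u, nonlocal_diffusion d J \<Omega> u) |u. u \<in> L2_on \<Omega>}"
    and A: "closed_operator_with_resolvent (state_space ap \<Omega>) (state_space0 ap \<Omega>)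
              (age_resolvent ap T) D A"
    and U: "model_evolution_family ap \<Omega> \<beta> \<mu> D A U"
  shows "(spectral_radius_on (AP_L2 \<Omega>) (renewal_op ap \<beta> \<mu> T) < 1 \<longrightarrow>
            growth_bound_on (state_space0 ap \<Omega>) U < 0 \<and>
            (\<forall>t0 p0 u. p0 \<in> age_space ap \<Omega> \<and> age_nonneg p0 \<and>
                mild_solution ap \<Omega> \<beta> \<mu> D A t0 (0, p0) u \<longrightarrow>
                ((\<lambda>t. norm (snd (u t))) \<longlongrightarrow> 0) at_top)) \<and>
         (spectral_radius_on (AP_L2 \<Omega>) (renewal_op ap \<beta> \<mu> T) = 1 \<longrightarrow>
            growth_bound_on (state_space0 ap \<Omega>) U = 0) \<and>
         (spectral_radius_on (AP_L2 \<Omega>) (renewal_op ap \<beta> \<mu> T) > 1 \<longrightarrow>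
            growth_bound_on (state_space0 ap \<Omega>) U > 0)"
proof -
  have \<Omega>m: "\<Omega> \<in> sets lebesgue" using domain by auto
  obtain C where C: "C \<ge> 0" "\<And>u. u \<in> L2_on \<Omega> \<Longrightarrow> norm (nonlocal_diffusion d J \<Omega> u) \<le> C * norm u"
    "\<And>u. u \<in> L2_on \<Omega> \<Longrightarrow> L2_nonneg u \<Longrightarrow> L2_nonneg (nonlocal_diffusion d J \<Omega> u + d *\<^sub>R u)"
    using nonlocal_diffusion_properties[OF domain(1,3) less_imp_le[OF pos(1)] kernel(1,2,3)] by blast
  interpret cone: self_dual_cone L2_nonneg "L2_pos_part :: (real ^ 'n) L2 \<Rightarrow> _" by (rule L2_self_dual_cone)
  interpret Q: bounded_linear "L2_restrict \<Omega>" by (rule L2_restrict_bounded_linear[OF \<Omega>m])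
  interpret S: positive_projected_semigroup "L2_on \<Omega>" T "nonlocal_diffusion d J \<Omega>" "L2_restrict \<Omega>" C L2_nonneg L2_pos_part d
  proof
    show "L2_pos_part u \<in> L2_on \<Omega>" if "u \<in> L2_on \<Omega>" for u
      using that L2_restrict_pos_part[OF \<Omega>m] by (simp add: L2_on_iff[OF \<Omega>m])
  qed (use semigroup C pos L2_on_closed_subspace[OF \<Omega>m] L2_restrict_in[OF \<Omega>m]
      norm_L2_restrict[OF \<Omega>m] L2_restrict_nonneg[OF \<Omega>m] L2_on_iff[OF \<Omega>m] in auto)
  obtain \<beta>m where \<beta>m: "\<beta>m > 0" "\<And>t. norm (\<beta> t) \<le> \<beta>m" using almost_periodic_bounded[OF \<beta>_AP] by metis
  obtain \<mu>m where \<mu>m: "\<And>t. norm (\<mu> t) \<le> \<mu>m" using almost_periodic_bounded[OF \<mu>_AP(1)] by metis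
  obtain H where H: "\<And>t. (H has_real_derivative \<mu> t) (at t)"
    using antiderivative_exists[of \<mu>] \<mu>_AP(1) by (auto simp: almost_periodic_def)
  \<comment> \<open>A nonnegative vector supported in the domain, nonzero because a nonempty open
    set is not negligible.\<close>
  define x0 where "x0 = abs_L2 (indicator \<Omega> :: real ^ 'n \<Rightarrow> real)"
  have sq: "sq_integrable (indicator \<Omega> :: real ^ 'n \<Rightarrow> real)"
    using emeasure_bounded_finite[OF domain(3)] domain(1) by (intro sq_integrable_indicator[OF \<Omega>m]) simp
  have rx: "AE x in lebesgue. rep_L2 x0 x = indicator \<Omega> x" unfolding x0_def by (rule rep_abs_L2[OF sq])
  have x0_in: "x0 \<in> L2_on \<Omega>"
    unfolding L2_on_def mem_Collect_eq using rx by eventually_elim simp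
  have x0_nn: "L2_nonneg x0" unfolding L2_nonneg_def using rx by eventually_elim simp
  have x0_nz: "x0 \<noteq> 0"
  proof
    assume "x0 = 0"
    then have "AE x in lebesgue. x \<notin> \<Omega>"
      using rx rep_L2_zero by (auto simp: indicator_def elim!: eventually_elim2 split: if_splits)
    then have "negligible \<Omega>"
      unfolding negligible_iff_null_sets using \<Omega>m by (simp add: AE_iff_null_sets)
    then show False using open_not_negligible[OF domain(1,4)] by blast
  qed
  \<comment> \<open>The operator bound \<open>C\<close> of the nonlocal diffusion serves as the
    growth exponent \<kappa> of the projected semigroup.\<close>
  interpret m: age_model S.TQ \<beta> \<mu> H ap d C \<epsilon>0 \<beta>m \<mu>m x0 \<Omega> T D A
  proof (intro age_model.intro renewal.intro age_model_axioms.intro renewal_axioms.intro L2_self_dual_cone)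
    show "norm (\<beta> t) \<le> \<beta>m" "\<mu> t \<le> \<mu>m" for t using \<beta>m \<mu>m[of t] by auto
    show "AE a in lebesgue. 0 \<le> rep_Linf (\<beta> t) a" for t using \<beta>_space(2) by (simp add: Linf_nonneg_def)
    show "S.TQ 0 (L2_pos_part x) = L2_pos_part x" if "S.TQ 0 x = x" for x
      using that L2_restrict_pos_part[OF \<Omega>m] by (simp add: S.TQ_0)
    show "L2_nonneg (S.TQ a x - exp (- d * a) *\<^sub>R S.TQ 0 x)" if "a \<ge> 0" "L2_nonneg x" for a x
      using S.TQ_ge[OF that(2,1)] by (simp add: S.TQ_0)
    show "u \<in> L2_on \<Omega> \<longleftrightarrow> S.TQ 0 u = u" for u by (simp add: S.TQ_0 L2_on_iff[OF \<Omega>m])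
    show "S.TQ 0 x0 = x0" using x0_in by (simp add: S.TQ_0 L2_on_iff[OF \<Omega>m])
  qed (use pos C(1) \<beta>_AP \<beta>m \<mu>_AP \<epsilon>0 H A x0_nn x0_nz in
      \<open>auto intro: S.TQ_bounded_linear S.TQ_norm S.TQ_continuous S.TQ_add S.TQ_nn S.T_eq_TQ\<close>)
  note t = m.growth_bound_trichotomy[OF U]
  let ?r = "spectral_radius_on (AP_L2 \<Omega>) (renewal_op ap \<beta> \<mu> T)" and ?w = "growth_bound_on (state_space0 ap \<Omega>) U"
  show ?thesis
  proof (intro conjI impI allI)
    assume r: "?r < 1"
    show "?w < 0" by (rule t(1)[OF r])
    fix t0 p0 u assume *: "p0 \<in> age_space ap \<Omega> \<and> age_nonneg p0 \<and> mild_solution ap \<Omega> \<beta> \<mu> D A t0 (0, p0) u"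
    then have "(0, p0) \<in> state_space0 ap \<Omega>" by (simp add: state_space0_def)
    with * have "(u \<longlongrightarrow> 0) at_top" by (intro t(5)[OF r]) auto
    then have "((\<lambda>t. snd (u t)) \<longlongrightarrow> snd (0 :: (real ^ 'n) state)) at_top" by (rule tendsto_snd)
    then show "((\<lambda>t. norm (snd (u t))) \<longlongrightarrow> 0) at_top" using tendsto_norm_zero by auto
  next
    assume r: "?r = 1"
    have "?w \<le> 0" by (rule t(2)) (use r in simp)
    moreover have "\<not> ?w < 0" using t(3) r by auto
    ultimately show "?w = 0" by (simp add: order_class.order.order_iff_strict)
  next
    assume r: "?r > 1"
    show "?w > 0" using t(4) r by (meson not_less)
  qed
qed

end
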